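(* Let $\lambda,\mu$ be partitions, let $n\ge 1$, let $\ell\ge \ell(\lambda),\ell(\mu)$ and $\ell'\ge\lambda_1,\mu_1$, and put \[ C=\prod_{i=1}^{\ell}\prod_{j=1}^{n}(1-\beta_i x_j),\qquad C'=\prod_{i=1}^{\ell'}\prod_{j=1}^{n}(1+\alpha_i x_j)^{-1}. \] Then \begin{align*} {}^{[[\boldsymbol\alpha,\boldsymbol\beta]]}\langle\mu|\, e^{H(\mathbf{x}_n)}\,|\lambda\rangle^{[\boldsymbol\alpha,\boldsymbol\beta]} &= C\det\bigl[h_{\lambda_i-\mu_j-i+j}\bigl(\mathbf{x}_n\ominus(A_{(\mu_j,\lambda_i]}+B_{[i,j]})\bigr)\bigr]_{i,j=1}^{\ell} = C'\det\bigl[e_{\lambda'_i-\mu'_j-i+j}\bigl(\mathbf{x}_n\ominus(A_{(j,i)}+B_{(\lambda'_i,\mu'_j]})\bigr)\bigr]_{i,j=1}^{\ell'},\\ {}^{[\boldsymbol\alpha,\boldsymbol\beta]}\langle\mu|\, e^{H(\mathbf{x}_n)}\,|\lambda\rangle^{[\boldsymbol\alpha,\boldsymbol\beta]} &= C\det\bigl[h_{\lambda_i-\mu_j-i+j}\bigl(\mathbf{x}_n\ominus(A_{[\mu_j,\lambda_i]}+B_{[i,j)})\bigr)\bigr]_{i,j=1}^{\ell} = C'\det\bigl[e_{\lambda'_i-\mu'_j-i+j}\bigl(\mathbf{x}_n\ominus(A_{[j,i)}+B_{(\lambda'_i,\mu'_j)})\bigr)\bigr]_{i,j=1}^{\ell'},\\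 {}_{[\boldsymbol\alpha,\boldsymbol\beta]}\langle\mu|\, e^{H(\mathbf{x}_n)}\,|\lambda\rangle_{[\boldsymbol\alpha,\boldsymbol\beta]} &= \det\bigl[h_{\lambda_i-\mu_j-i+j}(\mathbf{x}_n+A_{[\lambda_i,\mu_j]}+B_{[j,i)})\bigr]_{i,j=1}^{\ell} = \det\bigl[e_{\lambda'_i-\mu'_j-i+j}(\mathbf{x}_n+A_{[i,j)}+B_{(\mu'_j,\lambda'_i)})\bigr]_{i,j=1}^{\ell'}. \end{align*} Here $\lambda'$ denotes the conjugate partition, and partitions are padded with zeros.
   Context: Alphabets: an alphabet is a formal $\mathbb{Z}$-linear combination $Z=\sum_i c_iz_i$ of variables; $X+Y$, $X-Y$ are sum and difference. Set $p_k(Z)=\sum_i c_iz_i^k$, and define $h_m(Z),e_m(Z)$ by $\sum_{m\ge0}h_m(Z)t^m=\prod_i(1-z_it)^{-c_i}$, $\sum_{m\ge0}e_m(Z)t^m=\prod_i(1+z_it)^{c_i}$, with $h_m=e_m=0$ for $m<0$. Write $\mathbf{x}_n=x_1+\dots+x_n$. For an alphabet $Y$, $h_m(\mathbf{x}_n\ominus Y):=\sum_{a,b\ge0,\ a-b=m}h_a(\mathbf{x}_n)h_b(Y)$ and $e_m(\mathbf{x}_n\ominus Y):=\sum_{a,b\ge0,\ a-b=m}e_a(\mathbf{x}_n)e_b(Y)$ (for all $m\in\mathbb{Z}$; formal power series). Parameters $\boldsymbol\alpha=(\alpha_1,\alpha_2,\dots)$, $\boldsymbol\beta=(\beta_1,\beta_2,\dots)$.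 Let $A_k=(-\alpha_1)+\dots+(-\alpha_k)$ and $B_k=\beta_1+\dots+\beta_k$ for $k\ge1$, $A_k=B_k=0$ for $k\le0$; for integers $i,j$ let $A_{[i,j]}=A_j-A_{i-1}$, $A_{[i,j)}=A_{[i,j-1]}$, $A_{(i,j]}=A_{[i+1,j]}$, $A_{(i,j)}=A_{[i+1,j-1]}$, and similarly for $B$. Free fermions: $\mathcal{A}$ is the unital associative algebra generated by $\psi_n,\psi_n^*$ ($n\in\mathbb{Z}$) with $\psi_m\psi_n+\psi_n\psi_m=\psi^*_m\psi^*_n+\psi^*_n\psi^*_m=0$ and $\psi_m\psi_n^*+\psi_n^*\psi_m=\delta_{m,n}$; $*$ is the anti-algebra involution with $\psi_n\leftrightarrow\psi_n^*$. Fock space $\mathcal{F}=\mathcal{A}|0\rangle$ is the left module generated by $|0\rangle$ with $\psi_n|0\rangle=\psi_m^*|0\rangle=0$ for $n<0\le m$; the dual $\mathcal{F}^*=\langle0|\mathcal{A}$ is the right module with $\langle0|\psi_m=\langle0|\psi_n^*=0$ for $n<0\le m$; $\langle w|v\rangle$ is the unique bilinear pairing with $\langle0|0\rangle=1$ and $(\langle w|X)|v\rangle=\langle w|(X|v\rangle)$; the map $*:\mathcal{F}\to\mathcal{F}^*$ sends $X|0\rangle\mapsto\langle0|X^*$. Shifted vacua: $|m\rangle=\psi_{m-1}\cdots\psi_0|0\rangle$ ($m\ge0$), $|m\rangle=\psi_m^*\cdots\psi_{-1}^*|0\rangle$ ($m<0$); $\langle m|=\langle0|\psi_0^*\cdots\psi_{m-1}^*$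 ($m\ge0$), $\langle m|=\langle 0|\psi_{-1}\cdots\psi_m$ ($m<0$). Currents $a_k=\sum_{i\in\mathbb{Z}}{:}\psi_i\psi_{i+k}^*{:}$ where ${:}\psi_i\psi^*_{i+k}{:}=\psi_i\psi^*_{i+k}$ if $i\le0$ and $=-\psi^*_{i+k}\psi_i$ if $i>0$; $a_k^*=a_{-k}$. For an alphabet $X$: $H(X)=\sum_{k>0}\frac{p_k(X)}{k}a_k$, $H^*(X)=\sum_{k>0}\frac{p_k(X)}{k}a_{-k}$; exponentials and matrix elements are formal power series in the variables and parameters. $H(\beta_i)$ means the alphabet consisting of the single variable $\beta_i$. Vectors (for a partition $\lambda$ and $\ell\ge\ell(\lambda)$; independent of $\ell$), with $\prod^{\rightarrow}_{1\le i\le\ell}\Phi_i=\Phi_1\cdots\Phi_\ell$ and $\prod^{\leftarrow}_{1\le i\le\ell}\Phi_i=\Phi_\ell\cdots\Phi_1$: $|\lambda\rangle_{[\boldsymbol\alpha,\boldsymbol\beta]}=\prod^{\rightarrow}_{1\le i\le\ell}\bigl(e^{-H(A_{\lambda_i-1})}\psi_{\lambda_i-i}e^{H(\beta_i)}e^{H(A_{\lambda_i-1})}\bigr)|-\ell\rangle$; $|\lambda\rangle^{[\boldsymbol\alpha,\boldsymbol\beta]}=\prod^{\rightarrow}_{1\le i\le\ell}\bigl(e^{H^*(A_{\lambda_i})}\psi_{\lambda_i-i}e^{-H^*(\beta_i)}e^{-H^*(A_{\lambda_i})}\bigr)e^{H^*(A_{\lambda_\ell})}|-\ell\rangle$; ${}^{[\boldsymbol\alpha,\boldsymbol\beta]}\langle\mu|=(|\mu\rangle_{[\boldsymbol\alpha,\boldsymbol\beta]})^*$,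 ${}_{[\boldsymbol\alpha,\boldsymbol\beta]}\langle\mu|=(|\mu\rangle^{[\boldsymbol\alpha,\boldsymbol\beta]})^*$; ${}^{[[\boldsymbol\alpha,\boldsymbol\beta]]}\langle\mu|=\langle-\ell|\prod^{\leftarrow}_{1\le i\le\ell}\bigl(e^{-H^*(B_i-A_{\mu_i})}\psi^*_{\mu_i-i}e^{H^*(B_i-A_{\mu_i})}\bigr)$.
   Formalization: In the second line, columns with μ_j=0 (resp. μ'_j=0) use the first line's alphabet, as the printed one fails for λ=μ=∅, ℓ=1; |λ⟩^{[α,β]} and its dual are taken with product length greater than ℓ(λ), resp. ℓ(μ), since the printed product changes at equality. *)

theory Defs
  imports
    "HOL-Library.Poly_Mapping"
    "HOL-Library.Nat_Bijection"
    "HOL-Computational_Algebra.Formal_Power_Series"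
    "Jordan_Normal_Form.Determinant"
begin

section \<open>Formal power series in the variables and parameters\<close>

datatype var = Xvar nat | Alpha nat | Beta nat

type_synonym monom = "var \<Rightarrow>\<^sub>0 nat"

typedef 'a series = "UNIV :: (monom \<Rightarrow> 'a) set"
  morphisms scoeff Series
  by simp

lemma scoeff_Series [simp]: "scoeff (Series f) = f"
  by (simp add: Series_inverse)

lemma series_eqI: "(\<And>m. scoeff f m = scoeff g m) \<Longrightarrow> f = g"
  by (metis ext scoeff_inject)

definition splits :: "monom \<Rightarrow> (monom \<times> monom) set" where
  "splits m = {(a, b). a + b = m}"

definition conv :: "('a \<Rightarrow> 'b \<Rightarrow> 'c::comm_monoid_add) \<Rightarrow> 'a series \<Rightarrow> 'b series \<Rightarrow> 'c series" where
  "conv f s t = Series (\<lambda>m. \<Sum>(a, b)\<in>splits m. f (scoeff s a) (scoeff t b))"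

definition map_series :: "('a \<Rightarrow> 'b) \<Rightarrow> 'a series \<Rightarrow> 'b series" where
  "map_series f s = Series (\<lambda>m. f (scoeff s m))"

definition const_series :: "'a::zero \<Rightarrow> 'a series" where
  "const_series c = Series (\<lambda>m. if m = 0 then c else 0)"

text \<open>Coefficientwise sum of a family of series; meaningful when every monomial
  occurs in only finitely many members of the family.\<close>

definition series_sum :: "('i \<Rightarrow> 'a::comm_monoid_add series) \<Rightarrow> 'i set \<Rightarrow> 'a series" where
  "series_sum f I = Series (\<lambda>m. \<Sum>i | i \<in> I \<and> scoeff (f i) m \<noteq> 0. scoeff (f i) m)"

lemma finite_splits [simp]: "finite (splits m)"
proof -
  let ?S = "{a :: monom. \<exists>b. a + b = m}"
  let ?f = "\<lambda>a :: monom. restrict (Poly_Mapping.lookup a) (Poly_Mapping.keys m)"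
  have keys: "Poly_Mapping.keys a \<subseteq> Poly_Mapping.keys m" if "a \<in> ?S" for a
    using that by (auto simp: Poly_Mapping.in_keys_iff Poly_Mapping.lookup_add)
  have "inj_on ?f ?S"
  proof (rule inj_onI, rule poly_mapping_eqI)
    fix a b k assume "a \<in> ?S" "b \<in> ?S" and eq: "?f a = ?f b"
    show "Poly_Mapping.lookup a k = Poly_Mapping.lookup b k"
    proof (cases "k \<in> Poly_Mapping.keys m")
      case True
      then show ?thesis using fun_cong[OF eq, of k] by simp
    next
      case False
      with keys[OF \<open>a \<in> ?S\<close>] keys[OF \<open>b \<in> ?S\<close>]
      have "k \<notin> Poly_Mapping.keys a" "k \<notin> Poly_Mapping.keys b" by blast+
      then show ?thesis by (simp add: Poly_Mapping.in_keys_iff)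
    qed
  qed
  moreover have "?f ` ?S \<subseteq> (\<Pi>\<^sub>E k\<in>Poly_Mapping.keys m. {..Poly_Mapping.lookup m k})"
    by (auto simp: Poly_Mapping.lookup_add)
  moreover have "finite (\<Pi>\<^sub>E k\<in>Poly_Mapping.keys m. {..Poly_Mapping.lookup m k})"
    by (intro finite_PiE) auto
  ultimately have "finite ?S"
    by (rule inj_on_finite)
  then have "finite ((\<lambda>a. (a, m - a)) ` ?S)"
    by (rule finite_imageI)
  moreover have "splits m \<subseteq> (\<lambda>a. (a, m - a)) ` ?S"
  proof
    fix x assume "x \<in> splits m"
    then obtain a b where "x = (a, b)" "m = a + b" by (auto simp: splits_def)
    then show "x \<in> (\<lambda>a. (a, m - a)) ` ?S" by (intro image_eqI[of _ _ a]) auto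
  qed
  ultimately show ?thesis
    by (rule rev_finite_subset)
qed

lemma splits_zero_left: "(\<Sum>(a, b)\<in>splits m. if a = 0 then f a b else 0) = (f 0 m :: 'a::comm_monoid_add)"
proof -
  have "(\<Sum>(a, b)\<in>splits m. if a = 0 then f a b else 0) = (\<Sum>(a, b)\<in>{(0, m)}. if a = 0 then f a b else 0)"
    by (rule sum.mono_neutral_right, rule finite_splits) (auto simp: splits_def split: if_splits)
  then show ?thesis by simp
qed

lemma splits_swap: "(\<Sum>(a, b)\<in>splits m. f a b) = (\<Sum>(a, b)\<in>splits m. f b a :: 'a::comm_monoid_add)"
  by (rule sum.reindex_bij_witness[of _ prod.swap prod.swap]) (auto simp: splits_def add.commute)

lemma splits_assoc:
  "(\<Sum>(p, c)\<in>splits m. \<Sum>(a, b)\<in>splits p. f a b c) =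
   (\<Sum>(a, q)\<in>splits m. \<Sum>(b, c)\<in>splits q. f a b c :: 'a::comm_monoid_add)"
proof -
  have "(\<Sum>(p, c)\<in>splits m. \<Sum>(a, b)\<in>splits p. f a b c) =
        (\<Sum>((p, c), (a, b))\<in>Sigma (splits m) (\<lambda>(p, c). splits p). f a b c)"
    by (subst sum.Sigma[symmetric]) (auto simp: case_prod_beta)
  also have "\<dots> = (\<Sum>((a, q), (b, c))\<in>Sigma (splits m) (\<lambda>(a, q). splits q). f a b c)"
    by (rule sum.reindex_bij_witness[where
          i = "\<lambda>((a, q), (b, c)). ((a + b, c), (a, b))" and
          j = "\<lambda>((p, c), (a, b)). ((a, b + c), (b, c))"])
       (auto simp: splits_def add.assoc)
  also have "\<dots> = (\<Sum>(a, q)\<in>splits m. \<Sum>(b, c)\<in>splits q. f a b c)"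
    by (subst sum.Sigma[symmetric]) (auto simp: case_prod_beta)
  finally show ?thesis .
qed

instantiation series :: (ab_group_add) ab_group_add
begin
definition zero_series :: "'a series" where
  "zero_series = Series (\<lambda>m. 0)"
definition plus_series :: "'a series \<Rightarrow> 'a series \<Rightarrow> 'a series" where
  "plus_series f g = Series (\<lambda>m. scoeff f m + scoeff g m)"
definition minus_series :: "'a series \<Rightarrow> 'a series \<Rightarrow> 'a series" where
  "minus_series f g = Series (\<lambda>m. scoeff f m - scoeff g m)"
definition uminus_series :: "'a series \<Rightarrow> 'a series" where
  "uminus_series f = Series (\<lambda>m. - scoeff f m)"
instance
  by standard
     (auto intro!: series_eqI simp: zero_series_def plus_series_def minus_series_def uminus_series_def add_ac)
end

instantiation series :: (comm_ring_1) comm_ring_1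
begin
definition one_series :: "'a series" where
  "one_series = const_series 1"
definition times_series :: "'a series \<Rightarrow> 'a series \<Rightarrow> 'a series" where
  "times_series = conv (*)"
instance
proof
  fix a b c :: "'a series"
  show "a * b * c = a * (b * c)"
  proof (rule series_eqI)
    fix m
    have "scoeff (a * b * c) m =
      (\<Sum>(p, z)\<in>splits m. \<Sum>(x, y)\<in>splits p. scoeff a x * scoeff b y * scoeff c z)"
      by (simp add: times_series_def conv_def sum_distrib_right case_prod_beta)
    also have "\<dots> = (\<Sum>(x, q)\<in>splits m. \<Sum>(y, z)\<in>splits q. scoeff a x * scoeff b y * scoeff c z)"
      by (rule splits_assoc)
    also have "\<dots> = scoeff (a * (b * c)) m"
      by (simp add: times_series_def conv_def sum_distrib_left case_prod_beta mult.assoc)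
    finally show "scoeff (a * b * c) m = scoeff (a * (b * c)) m" .
  qed
  show "a * b = b * a"
    by (rule series_eqI, simp add: times_series_def conv_def, subst splits_swap) (simp add: mult.commute)
  show "1 * a = a"
  proof (rule series_eqI)
    fix m
    have "scoeff (1 * a) m = (\<Sum>(x, y)\<in>splits m. if x = 0 then scoeff a y else 0)"
      by (auto simp: times_series_def conv_def one_series_def const_series_def intro!: sum.cong)
    then show "scoeff (1 * a) m = scoeff a m"
      by (simp add: splits_zero_left)
  qed
  show "(a + b) * c = a * c + b * c"
    by (rule series_eqI)
       (simp add: times_series_def conv_def plus_series_def distrib_right sum.distrib case_prod_beta)
  show "(0 :: 'a series) \<noteq> 1"
  proof
    assume "(0 :: 'a series) = 1"
    then have "scoeff (0 :: 'a series) 0 = scoeff 1 0" by simp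
    then show False by (simp add: zero_series_def one_series_def const_series_def)
  qed
qed
end

definition var_series :: "var \<Rightarrow> 'k::comm_ring_1 series" where
  "var_series v = Series (\<lambda>m. if m = Poly_Mapping.single v 1 then 1 else 0)"

abbreviation xv :: "nat \<Rightarrow> 'k::comm_ring_1 series" where "xv j \<equiv> var_series (Xvar j)"
abbreviation av :: "nat \<Rightarrow> 'k::comm_ring_1 series" where "av i \<equiv> var_series (Alpha i)"
abbreviation bv :: "nat \<Rightarrow> 'k::comm_ring_1 series" where "bv i \<equiv> var_series (Beta i)"

definition unit_inv :: "'a::comm_monoid_mult \<Rightarrow> 'a" where
  "unit_inv u = (THE v. u * v = 1)"

lemma unit_inv_eqI:
  assumes "u * v = 1"
  shows "unit_inv u = v"
  unfolding unit_inv_def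
proof (rule the_equality)
  fix w assume "u * w = 1"
  then have "v = v * (u * w)" by simp
  also have "\<dots> = w" using assms by (metis mult.assoc mult.commute mult_1_left)
  finally show "w = v" by simp
qed (rule assms)

definition unit_powi :: "'a::comm_monoid_mult \<Rightarrow> int \<Rightarrow> 'a" where
  "unit_powi u c = (if c \<ge> 0 then u ^ nat c else unit_inv u ^ nat (- c))"


section \<open>Alphabets and symmetric functions\<close>

text \<open>The letters of an alphabet are series, so that \<open>- av i\<close> can be used as a letter
  (and is different from the letter \<open>av i\<close> with multiplicity \<open>-1\<close>).\<close>

type_synonym 'k alphabet = "'k series \<Rightarrow>\<^sub>0 int"

abbreviation letter :: "'k::comm_ring_1 series \<Rightarrow> 'k alphabet" where
  "letter z \<equiv> Poly_Mapping.single z 1"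

definition psum :: "nat \<Rightarrow> 'k::comm_ring_1 alphabet \<Rightarrow> 'k series" where
  "psum k Z = (\<Sum>z\<in>Poly_Mapping.keys Z. of_int (Poly_Mapping.lookup Z z) * z ^ k)"

definition hgen :: "'k::comm_ring_1 alphabet \<Rightarrow> 'k series fps" where
  "hgen Z = (\<Prod>z\<in>Poly_Mapping.keys Z. unit_powi (1 - fps_const z * fps_X) (- Poly_Mapping.lookup Z z))"

definition egen :: "'k::comm_ring_1 alphabet \<Rightarrow> 'k series fps" where
  "egen Z = (\<Prod>z\<in>Poly_Mapping.keys Z. unit_powi (1 + fps_const z * fps_X) (Poly_Mapping.lookup Z z))"

lemma unit_inv_one_minus: 
  "unit_inv (1 - fps_const z * fps_X) = Abs_fps (\<lambda>n. z ^ n :: 'a::comm_ring_1)"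
proof (rule unit_inv_eqI, rule fps_ext)
  fix n
  have "fps_nth ((1 - fps_const z * fps_X) * Abs_fps (\<lambda>n. z ^ n)) n
      = z ^ n - z * fps_nth (fps_X * Abs_fps (\<lambda>n. z ^ n)) n"
    by (simp add: left_diff_distrib mult.assoc fps_mult_left_const_nth del: fps_X_mult_nth)
  then show "fps_nth ((1 - fps_const z * fps_X) * Abs_fps (\<lambda>n. z ^ n)) n = fps_nth 1 n"
    by (cases n) auto
qed

definition hfun :: "int \<Rightarrow> 'k::comm_ring_1 alphabet \<Rightarrow> 'k series" where
  "hfun m Z = (if m < 0 then 0 else fps_nth (hgen Z) (nat m))"

definition efun :: "int \<Rightarrow> 'k::comm_ring_1 alphabet \<Rightarrow> 'k series" where
  "efun m Z = (if m < 0 then 0 else fps_nth (egen Z) (nat m))"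

definition h_ominus :: "int \<Rightarrow> 'k::comm_ring_1 alphabet \<Rightarrow> 'k alphabet \<Rightarrow> 'k series" where
  "h_ominus m X Y =
     series_sum (\<lambda>(a, b). hfun (int a) X * hfun (int b) Y) {(a, b). int a - int b = m}"

definition e_ominus :: "int \<Rightarrow> 'k::comm_ring_1 alphabet \<Rightarrow> 'k alphabet \<Rightarrow> 'k series" where
  "e_ominus m X Y =
     series_sum (\<lambda>(a, b). efun (int a) X * efun (int b) Y) {(a, b). int a - int b = m}"

definition xs_alph :: "nat \<Rightarrow> 'k::comm_ring_1 alphabet" where
  "xs_alph n = (\<Sum>j=1..n. letter (xv j))"

definition A_alph :: "int \<Rightarrow> 'k::comm_ring_1 alphabet" where
  "A_alph k = (\<Sum>i=1..nat k. letter (- av i))"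

definition B_alph :: "int \<Rightarrow> 'k::comm_ring_1 alphabet" where
  "B_alph k = (\<Sum>i=1..nat k. letter (bv i))"

text \<open>Closed, half-open and open index intervals \<open>[i,j]\<close>, \<open>[i,j)\<close>, \<open>(i,j]\<close>, \<open>(i,j)\<close>;
  the differences may have negative multiplicities.\<close>

definition seg_cc :: "(int \<Rightarrow> 'k::comm_ring_1 alphabet) \<Rightarrow> int \<Rightarrow> int \<Rightarrow> 'k alphabet" where
  "seg_cc F i j = F j - F (i - 1)"
definition seg_co :: "(int \<Rightarrow> 'k::comm_ring_1 alphabet) \<Rightarrow> int \<Rightarrow> int \<Rightarrow> 'k alphabet" where
  "seg_co F i j = seg_cc F i (j - 1)"
definition seg_oc :: "(int \<Rightarrow> 'k::comm_ring_1 alphabet) \<Rightarrow> int \<Rightarrow> int \<Rightarrow> 'k alphabet" where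
  "seg_oc F i j = seg_cc F (i + 1) j"
definition seg_oo :: "(int \<Rightarrow> 'k::comm_ring_1 alphabet) \<Rightarrow> int \<Rightarrow> int \<Rightarrow> 'k alphabet" where
  "seg_oo F i j = seg_cc F (i + 1) (j - 1)"


section \<open>Partitions\<close>

definition is_partition :: "nat list \<Rightarrow> bool" where
  "is_partition lam \<longleftrightarrow> sorted_wrt (\<ge>) lam \<and> 0 \<notin> set lam"

text \<open>Parts are numbered from 1.\<close>

definition part :: "nat list \<Rightarrow> nat \<Rightarrow> nat" where
  "part lam i = (if 1 \<le> i \<and> i \<le> length lam then lam ! (i - 1) else 0)"

definition conj_part :: "nat list \<Rightarrow> nat \<Rightarrow> nat" where
  "conj_part lam j = card {i. 1 \<le> i \<and> i \<le> length lam \<and> j \<le> part lam i}"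


abbreviation ipart :: "nat list \<Rightarrow> nat \<Rightarrow> int" where
  "ipart lam i \<equiv> int (part lam i)"

abbreviation iconj :: "nat list \<Rightarrow> nat \<Rightarrow> int" where
  "iconj lam j \<equiv> int (conj_part lam j)"


section \<open>Free fermions\<close>

lemma diff_diff_swap: "(a - c) - (b - d) = (a - b) - (c - d)" for a b c d :: "'a::ab_group_add"
  by simp

datatype gen = Psi int | PsiS int

datatype word = Word "gen list"

instantiation word :: monoid_add
begin
definition zero_word :: word where "zero_word = Word []"
fun plus_word :: "word \<Rightarrow> word \<Rightarrow> word" where
  "plus_word (Word u) (Word v) = Word (u @ v)"
instance
proof
  fix a b c :: word
  show "a + b + c = a + (b + c)" by (cases a; cases b; cases c) simp
  show "0 + a = a" "a + 0 = a" by (cases a; simp add: zero_word_def)+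
qed
end

text \<open>The free algebra on the generators is the monoid algebra of words.\<close>

type_synonym 'k free_alg = "word \<Rightarrow>\<^sub>0 'k"

definition fgen :: "gen \<Rightarrow> 'k::field free_alg" where
  "fgen g = Poly_Mapping.single (Word [g]) 1"

inductive_set car_rels :: "'k::field free_alg set" where
  "fgen (Psi m) * fgen (Psi n) + fgen (Psi n) * fgen (Psi m) \<in> car_rels"
| "fgen (PsiS m) * fgen (PsiS n) + fgen (PsiS n) * fgen (PsiS m) \<in> car_rels"
| "fgen (Psi m) * fgen (PsiS n) + fgen (PsiS n) * fgen (Psi m) - (if m = n then 1 else 0) \<in> car_rels"

inductive_set car_ideal :: "'k::field free_alg set" where
  zero: "0 \<in> car_ideal"
| gen: "r \<in> car_rels \<Longrightarrow> a * r * b \<in> car_ideal"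
| add: "x \<in> car_ideal \<Longrightarrow> y \<in> car_ideal \<Longrightarrow> x + y \<in> car_ideal"

lemma car_ideal_mult_left: "x \<in> car_ideal \<Longrightarrow> c * x \<in> car_ideal"
proof (induction rule: car_ideal.induct)
  case (gen r a b)
  then show ?case using car_ideal.gen[of r "c * a" b] by (simp add: mult.assoc)
qed (auto simp: distrib_left intro: car_ideal.intros)

lemma car_ideal_mult_right: "x \<in> car_ideal \<Longrightarrow> x * c \<in> car_ideal"
proof (induction rule: car_ideal.induct)
  case (gen r a b)
  then show ?case using car_ideal.gen[of r a "b * c"] by (simp add: mult.assoc)
qed (auto simp: distrib_right intro: car_ideal.intros)

lemma car_ideal_uminus: "x \<in> car_ideal \<Longrightarrow> - x \<in> car_ideal"
  using car_ideal_mult_left[of x "-1"] by simp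

lemma car_ideal_diff: "x \<in> car_ideal \<Longrightarrow> y \<in> car_ideal \<Longrightarrow> x - y \<in> car_ideal"
  using car_ideal.add[of x "- y"] car_ideal_uminus[of y] by simp

definition car_eq :: "'k::field free_alg \<Rightarrow> 'k free_alg \<Rightarrow> bool" where
  "car_eq x y \<longleftrightarrow> x - y \<in> car_ideal"

lemma equivp_car_eq: "equivp (car_eq :: 'a::field free_alg \<Rightarrow> _)"
proof (rule equivpI)
  show "reflp (car_eq :: 'a free_alg \<Rightarrow> _)" by (auto simp: reflp_def car_eq_def intro: car_ideal.zero)
  show "symp (car_eq :: 'a free_alg \<Rightarrow> _)"
    by (auto simp: symp_def car_eq_def) (metis car_ideal_uminus minus_diff_eq)
  show "transp (car_eq :: 'a free_alg \<Rightarrow> _)"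
  proof (rule transpI)
    fix x y z :: "'a free_alg"
    assume "car_eq x y" "car_eq y z"
    then show "car_eq x z"
      using car_ideal.add[of "x - y" "y - z"] by (simp add: car_eq_def)
  qed
qed

quotient_type (overloaded) 'k cliff = "'k::field free_alg" / car_eq
  by (rule equivp_car_eq)

instantiation cliff :: (field) "{ring, monoid_mult}"
begin
lift_definition zero_cliff :: "'a cliff" is 0 .
lift_definition one_cliff :: "'a cliff" is 1 .
lift_definition plus_cliff :: "'a cliff \<Rightarrow> 'a cliff \<Rightarrow> 'a cliff" is "(+)"
  unfolding car_eq_def by (metis add_diff_add car_ideal.add)
lift_definition uminus_cliff :: "'a cliff \<Rightarrow> 'a cliff" is uminus
  unfolding car_eq_def by (metis car_ideal_uminus minus_diff_minus)
lift_definition minus_cliff :: "'a cliff \<Rightarrow> 'a cliff \<Rightarrow> 'a cliff" is "(-)"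
  unfolding car_eq_def by (subst diff_diff_swap) (rule car_ideal_diff)
lift_definition times_cliff :: "'a cliff \<Rightarrow> 'a cliff \<Rightarrow> 'a cliff" is "(*)"
proof -
  fix a b c d :: "'a free_alg"
  assume "car_eq a b" "car_eq c d"
  then have "(a - b) * c + b * (c - d) \<in> car_ideal"
    unfolding car_eq_def by (intro car_ideal.add car_ideal_mult_left car_ideal_mult_right)
  then show "car_eq (a * c) (b * d)"
    by (simp add: car_eq_def algebra_simps)
qed
instance
  by standard (transfer; simp add: car_eq_def car_ideal.zero algebra_simps; fail)+
end

lift_definition scal :: "'k::field \<Rightarrow> 'k cliff" is "Poly_Mapping.single 0" .
lift_definition psi :: "int \<Rightarrow> 'k::field cliff" is "\<lambda>n. fgen (Psi n)" .
lift_definition psi_st :: "int \<Rightarrow> 'k::field cliff" is "\<lambda>n. fgen (PsiS n)" .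


subsection \<open>The anti-involution\<close>

fun gen_star :: "gen \<Rightarrow> gen" where
  "gen_star (Psi n) = PsiS n"
| "gen_star (PsiS n) = Psi n"

fun word_star :: "word \<Rightarrow> word" where
  "word_star (Word w) = Word (rev (map gen_star w))"

definition free_star :: "'k::field free_alg \<Rightarrow> 'k free_alg" where
  "free_star p = (\<Sum>w\<in>Poly_Mapping.keys p. Poly_Mapping.single (word_star w) (Poly_Mapping.lookup p w))"

lemma word_star_add: "word_star (u + v) = word_star v + word_star u"
  by (cases u; cases v) simp

lemma poly_mapping_sum_single:
  "p = (\<Sum>w\<in>Poly_Mapping.keys p. Poly_Mapping.single w (Poly_Mapping.lookup p w))"
  by (rule poly_mapping_eqI)
     (simp add: lookup_sum lookup_single when_def sum.delta in_keys_iff)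

lemma free_alg_induct [case_names zero single add]:
  fixes p :: "'a \<Rightarrow>\<^sub>0 'b::ab_group_add"
  assumes "P 0" "\<And>w c. P (Poly_Mapping.single w c)" "\<And>p q. P p \<Longrightarrow> P q \<Longrightarrow> P (p + q)"
  shows "P p"
proof -
  have "P (\<Sum>w\<in>S. Poly_Mapping.single w (Poly_Mapping.lookup p w))" if "finite S" for S
    using that by induction (auto intro: assms)
  from this[of "Poly_Mapping.keys p"] show ?thesis
    using poly_mapping_sum_single[of p] by simp
qed

lemma sum_keys_add:
  fixes f :: "'a \<Rightarrow> 'b::ab_group_add \<Rightarrow> 'c::ab_group_add"
  assumes "\<And>w x y. f w (x + y) = f w x + f w y"
  shows "(\<Sum>w\<in>Poly_Mapping.keys (p + q). f w (Poly_Mapping.lookup (p + q) w)) =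
    (\<Sum>w\<in>Poly_Mapping.keys p. f w (Poly_Mapping.lookup p w)) +
    (\<Sum>w\<in>Poly_Mapping.keys q. f w (Poly_Mapping.lookup q w))"
proof -
  let ?K = "Poly_Mapping.keys p \<union> Poly_Mapping.keys q"
  have 0: "f w 0 = 0" for w using assms[of w 0 0] by simp
  have ext: "(\<Sum>w\<in>Poly_Mapping.keys r. f w (Poly_Mapping.lookup r w)) = (\<Sum>w\<in>?K. f w (Poly_Mapping.lookup r w))"
    if "Poly_Mapping.keys r \<subseteq> ?K" for r :: "'a \<Rightarrow>\<^sub>0 'b"
    using that by (intro sum.mono_neutral_left) (auto simp: 0 in_keys_iff)
  show ?thesis
    by (subst (1 2 3) ext) (use Poly_Mapping.keys_add[of p q] in \<open>auto simp: lookup_add assms sum.distrib\<close>)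
qed

lemma free_star_zero [simp]: "free_star 0 = 0"
  by (simp add: free_star_def)

lemma free_star_add: "free_star (p + q) = free_star p + free_star q"
  unfolding free_star_def by (rule sum_keys_add) (rule single_add)

lemma free_star_single [simp]: "free_star (Poly_Mapping.single w c) = Poly_Mapping.single (word_star w) c"
  by (cases "c = 0") (auto simp: free_star_def)

lemma free_star_uminus: "free_star (- p) = - free_star p"
  using free_star_add[of p "- p"] by (simp add: eq_neg_iff_add_eq_0 add.commute)

lemma free_star_diff: "free_star (p - q) = free_star p - free_star q"
  using free_star_add[of p "- q"] by (simp add: free_star_uminus)

lemma free_star_one [simp]: "free_star 1 = 1"
  by (simp add: zero_word_def flip: single_one)

lemma free_star_mult: "free_star (p * q) = free_star q * free_star p"
proof (induction p rule: free_alg_induct)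
  case (single u c)
  then show ?case
  proof (induction q rule: free_alg_induct)
    case (single v d)
    then show ?case by (simp add: mult_single word_star_add mult.commute)
  qed (simp_all add: distrib_left distrib_right free_star_add)
qed (simp_all add: distrib_left distrib_right free_star_add)

lemma free_star_fgen [simp]: "free_star (fgen g) = fgen (gen_star g)"
  by (simp add: fgen_def)

lemma free_star_ideal: "x \<in> car_ideal \<Longrightarrow> free_star x \<in> car_ideal"
proof (induction rule: car_ideal.induct)
  case (gen r a b)
  then have "free_star r \<in> car_rels"
  proof (cases rule: car_rels.cases)
    case (3 m n)
    show ?thesis
      using car_rels.intros(3)[of n m] unfolding 3
      by (simp add: free_star_add free_star_diff free_star_mult eq_commute[of m n] split: if_splits)
  qed (auto simp: free_star_add free_star_mult intro: car_rels.intros)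
  then show ?case
    using car_ideal.gen by (simp add: free_star_mult flip: mult.assoc)
qed (auto simp: free_star_add intro: car_ideal.intros)

lift_definition cstar :: "'k::field cliff \<Rightarrow> 'k cliff" is free_star
  unfolding car_eq_def by (metis free_star_diff free_star_ideal)

lemma cstar_add: "cstar (x + y) = cstar x + cstar y"
  by transfer (simp add: free_star_add car_eq_def car_ideal.zero)
lemma cstar_diff: "cstar (x - y) = cstar x - cstar y"
  by transfer (simp add: free_star_diff car_eq_def car_ideal.zero)
lemma cstar_zero: "cstar 0 = 0"
  by transfer (simp add: car_eq_def car_ideal.zero)
lemma cstar_mult: "cstar (x * y) = cstar y * cstar x"
  by transfer (simp add: free_star_mult car_eq_def car_ideal.zero)
lemma cstar_psi: "cstar (psi n) = psi_st n"
  by transfer (simp add: car_eq_def car_ideal.zero)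
lemma cstar_psi_st: "cstar (psi_st n) = psi n"
  by transfer (simp add: car_eq_def car_ideal.zero)


subsection \<open>A representation\<close>

text \<open>The action of the generators on functions of the set of excitations of the vacuum. It is
  only used to show that the vacuum pairing below exists.\<close>

definition ex_sign :: "nat \<Rightarrow> nat set \<Rightarrow> 'k::field" where
  "ex_sign a D = (-1) ^ card (D \<inter> {..<a})"

definition ex_cr :: "nat \<Rightarrow> (nat set \<Rightarrow> 'k::field) \<Rightarrow> nat set \<Rightarrow> 'k" where
  "ex_cr a v D = (if a \<in> D then ex_sign a D * v (D - {a}) else 0)"

definition ex_an :: "nat \<Rightarrow> (nat set \<Rightarrow> 'k::field) \<Rightarrow> nat set \<Rightarrow> 'k" where
  "ex_an a v D = (if a \<in> D then 0 else ex_sign a D * v (insert a D))"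

fun gact :: "gen \<Rightarrow> (nat set \<Rightarrow> 'k::field) \<Rightarrow> nat set \<Rightarrow> 'k" where
  "gact (Psi n) = (if 0 \<le> n then ex_cr else ex_an) (int_encode n)"
| "gact (PsiS n) = (if 0 \<le> n then ex_an else ex_cr) (int_encode n)"

fun wact :: "word \<Rightarrow> (nat set \<Rightarrow> 'k::field) \<Rightarrow> nat set \<Rightarrow> 'k" where
  "wact (Word gs) v = foldr gact gs v"

definition free_act :: "'k::field free_alg \<Rightarrow> (nat set \<Rightarrow> 'k) \<Rightarrow> nat set \<Rightarrow> 'k" where
  "free_act p v D = (\<Sum>w\<in>Poly_Mapping.keys p. Poly_Mapping.lookup p w * wact w v D)"

lemma ex_sign_remove: "b \<in> D \<Longrightarrow> (ex_sign a (D - {b}) :: 'k::field) = (if b < a then - ex_sign a D else ex_sign a D)"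
proof (cases "b < a")
  case True
  assume "b \<in> D"
  then have "D \<inter> {..<a} = insert b ((D - {b}) \<inter> {..<a})" using True by auto
  then have "card (D \<inter> {..<a}) = Suc (card ((D - {b}) \<inter> {..<a}))" by simp
  then show ?thesis using True by (simp add: ex_sign_def)
next
  case False
  then have "(D - {b}) \<inter> {..<a} = D \<inter> {..<a}" by auto
  then show ?thesis using False by (simp add: ex_sign_def)
qed

lemma ex_sign_insert: "b \<notin> D \<Longrightarrow> (ex_sign a (insert b D) :: 'k::field) = (if b < a then - ex_sign a D else ex_sign a D)"
proof -
  assume "b \<notin> D"
  then have "insert b D - {b} = D" by simp
  with ex_sign_remove[of b "insert b D" a, where 'k = 'k] show ?thesis
    by (cases "b < a") simp_all
qed

lemma ex_sign_sq: "ex_sign a D * ex_sign a D = 1"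
  by (simp add: ex_sign_def flip: power_mult_distrib)

lemma ex_sign_sq': "ex_sign a D * (ex_sign a D * x) = x"
  by (simp add: ex_sign_sq flip: mult.assoc)

lemma ex_cr_cr: "ex_cr a (ex_cr b v) D + ex_cr b (ex_cr a v) D = 0"
proof -
  have "D - {a} - {b} = D - {b} - {a}" by auto
  then show ?thesis
    by (cases "a = b") (auto simp: ex_cr_def ex_sign_remove)
qed

lemma ex_an_an: "ex_an a (ex_an b v) D + ex_an b (ex_an a v) D = 0"
  by (cases "a = b") (auto simp: ex_an_def ex_sign_insert insert_commute)

lemma ex_cr_an: "ex_cr a (ex_an b v) D + ex_an b (ex_cr a v) D = (if a = b then v D else 0)"
proof (cases "a = b")
  case True
  then show ?thesis
    by (auto simp: ex_cr_def ex_an_def ex_sign_remove ex_sign_insert ex_sign_sq' insert_absorb)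
next
  case False
  then have "insert b (D - {a}) = insert b D - {a}" by auto
  with False show ?thesis
    by (auto simp: ex_cr_def ex_an_def ex_sign_remove ex_sign_insert)
qed

lemma ex_an_cr: "ex_an a (ex_cr b v) D + ex_cr b (ex_an a v) D = (if a = b then v D else 0)"
  using ex_cr_an[of b a v D] by (auto simp: add.commute)

lemma gact_add: "gact g (\<lambda>D. u D + v D) = (\<lambda>D. gact g u D + gact g v D)"
  by (cases g) (auto simp: ex_cr_def ex_an_def distrib_left fun_eq_iff)

lemma gact_scale: "gact g (\<lambda>D. c * v D) = (\<lambda>D. c * gact g v D)"
  by (cases g) (auto simp: ex_cr_def ex_an_def fun_eq_iff)

lemma wact_add: "wact w (\<lambda>D. u D + v D) = (\<lambda>D. wact w u D + wact w v D)"
proof (cases w)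
  case (Word gs)
  have "foldr gact gs (\<lambda>D. u D + v D) = (\<lambda>D. foldr gact gs u D + foldr gact gs v D)"
    by (induction gs) (simp_all add: gact_add)
  with Word show ?thesis by simp
qed

lemma wact_scale: "wact w (\<lambda>D. c * v D) = (\<lambda>D. c * wact w v D)"
proof (cases w)
  case (Word gs)
  have "foldr gact gs (\<lambda>D. c * v D) = (\<lambda>D. c * foldr gact gs v D)"
    by (induction gs) (simp_all add: gact_scale)
  with Word show ?thesis by simp
qed

lemma wact_plus: "wact (u + w) v = wact u (wact w v)"
  by (cases u; cases w) simp

lemma wact_zero_word [simp]: "wact 0 v = v"
  by (simp add: zero_word_def)

lemma free_act_zero [simp]: "free_act 0 v = (\<lambda>D. 0)"
  by (simp add: free_act_def fun_eq_iff)

lemma free_act_single: "free_act (Poly_Mapping.single w c) v = (\<lambda>D. c * wact w v D)"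
  by (cases "c = 0") (auto simp: free_act_def fun_eq_iff)

lemma free_act_plus: "free_act (p + q) v = (\<lambda>D. free_act p v D + free_act q v D)"
  unfolding free_act_def by (rule ext, rule sum_keys_add) (simp add: distrib_right)

lemma free_act_uminus: "free_act (- p) v = (\<lambda>D. - free_act p v D)"
proof
  fix D
  have "free_act (p + - p) v D = 0" by simp
  then have "free_act p v D + free_act (- p) v D = 0" by (simp only: free_act_plus)
  then show "free_act (- p) v D = - free_act p v D" by (simp add: eq_neg_iff_add_eq_0 add.commute)
qed

lemma free_act_diff: "free_act (p - q) v = (\<lambda>D. free_act p v D - free_act q v D)"
  using free_act_plus[of p "- q" v] by (simp add: free_act_uminus)

lemma free_act_add: "free_act p (\<lambda>D. u D + v D) = (\<lambda>D. free_act p u D + free_act p v D)"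
  by (rule ext) (simp add: free_act_def wact_add distrib_left sum.distrib)

lemma free_act_scale: "free_act p (\<lambda>D. c * v D) = (\<lambda>D. c * free_act p v D)"
  by (rule ext) (simp add: free_act_def wact_scale sum_distrib_left mult_ac)

lemma free_act_zero_vec [simp]: "free_act p (\<lambda>D. 0) = (\<lambda>D. 0)"
  using free_act_scale[of p 0 "\<lambda>D. 0"] by simp

lemma free_act_mult: "free_act (p * q) v = free_act p (free_act q v)"
proof (induction p rule: free_alg_induct)
  case (single u c)
  then show ?case
  proof (induction q rule: free_alg_induct)
    case (single w d)
    then show ?case by (simp add: mult_single free_act_single wact_plus wact_scale mult.assoc)
  qed (simp_all add: distrib_left free_act_plus free_act_add)
qed (simp_all add: distrib_right free_act_plus)

lemma free_act_one [simp]: "free_act 1 v = v"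
  by (simp add: free_act_single flip: single_one)

lemma free_act_fgen [simp]: "free_act (fgen g) v = gact g v"
  by (simp add: fgen_def free_act_single)

lemma free_act_car_rels: "r \<in> car_rels \<Longrightarrow> free_act r v = (\<lambda>D. 0)"
proof (induction rule: car_rels.induct)
  case (3 m n)
  then show ?case
    by (cases "m = n")
       (auto simp: free_act_plus free_act_diff free_act_mult ex_cr_cr ex_an_an ex_cr_an ex_an_cr int_encode_eq fun_eq_iff)
qed (auto simp: free_act_plus free_act_mult ex_cr_cr ex_an_an ex_cr_an ex_an_cr int_encode_eq fun_eq_iff)

lemma free_act_car_ideal: "x \<in> car_ideal \<Longrightarrow> free_act x v = (\<lambda>D. 0)"
  by (induction arbitrary: v rule: car_ideal.induct) (simp_all add: free_act_mult free_act_plus free_act_car_rels)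

lift_definition cact :: "'k::field cliff \<Rightarrow> (nat set \<Rightarrow> 'k) \<Rightarrow> nat set \<Rightarrow> 'k" is free_act
proof
  fix p q :: "'k free_alg" and v
  assume "car_eq p q"
  then have "free_act (p - q) v = (\<lambda>D. 0)" by (simp add: car_eq_def free_act_car_ideal)
  then show "free_act p v = free_act q v" by (simp add: free_act_diff fun_eq_iff)
qed

lemma cact_mult: "cact (X * Y) v = cact X (cact Y v)"
  by transfer (rule free_act_mult)
lemma cact_add: "cact (X + Y) v = (\<lambda>D. cact X v D + cact Y v D)"
  by transfer (rule free_act_plus)
lemma cact_diff: "cact (X - Y) v = (\<lambda>D. cact X v D - cact Y v D)"
  by transfer (rule free_act_diff)
lemma cact_zero: "cact 0 v = (\<lambda>D. 0)"
  by transfer simp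
lemma cact_zero_vec: "cact X (\<lambda>D. 0) = (\<lambda>D. 0)"
  by transfer simp
lemma cact_one: "cact 1 v = v"
  by transfer simp
lemma cact_scale: "cact X (\<lambda>D. c * v D) = (\<lambda>D. c * cact X v D)"
  by transfer (rule free_act_scale)
lemma cact_scal: "cact (scal c) v = (\<lambda>D. c * v D)"
  by transfer (simp add: free_act_single)
lemma cact_psi: "cact (psi n) = gact (Psi n)"
  by transfer (simp add: fun_eq_iff)
lemma cact_psi_st: "cact (psi_st n) = gact (PsiS n)"
  by transfer (simp add: fun_eq_iff)

lemma cliff_induct [case_names zero word add]:
  assumes "P 0" "\<And>w c. P (abs_cliff (Poly_Mapping.single w c))" "\<And>x y. P x \<Longrightarrow> P y \<Longrightarrow> P (x + y)"
  shows "P (X :: 'k::field cliff)"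
proof -
  have "P (abs_cliff p)" for p :: "'k free_alg"
    by (induction p rule: free_alg_induct)
       (use assms in \<open>auto simp: zero_cliff_def simp flip: plus_cliff.abs_eq\<close>)
  then show ?thesis by (metis Quotient_cliff Quotient_abs_rep)
qed

lemma scal_commute: "scal c * X = X * scal c"
proof (induction X rule: cliff_induct)
  case (word w d)
  then show ?case
    by (simp add: scal.abs_eq times_cliff.abs_eq mult_single mult.commute)
qed (simp_all add: distrib_left distrib_right)

lemma psi_psi: "psi m * psi n + psi n * psi m = 0"
  by transfer (use car_ideal.gen[OF car_rels.intros(1), of 1 _ _ 1] in \<open>simp add: car_eq_def\<close>)
lemma psi_st_psi_st: "psi_st m * psi_st n + psi_st n * psi_st m = 0"
  by transfer (use car_ideal.gen[OF car_rels.intros(2), of 1 _ _ 1] in \<open>simp add: car_eq_def\<close>)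
lemma psi_psi_st: "psi m * psi_st n + psi_st n * psi m = (if m = n then 1 else 0 :: 'k::field cliff)"
proof (cases "m = n")
  case True
  have "psi n * psi_st n + psi_st n * psi n = (1 :: 'k cliff)"
    by transfer (use car_ideal.gen[OF car_rels.intros(3)[of n n for n], of 1 _ 1] in \<open>simp add: car_eq_def\<close>)
  with True show ?thesis by simp
next
  case False
  have "m \<noteq> n \<Longrightarrow> psi m * psi_st n + psi_st n * psi m = (0 :: 'k cliff)"
  proof transfer
    fix m n :: int assume "m \<noteq> n"
    then show "car_eq (fgen (Psi m) * fgen (PsiS n) + fgen (PsiS n) * fgen (Psi m)) (0 :: 'k free_alg)"
      using car_ideal.gen[OF car_rels.intros(3)[of m n], of 1 1] by (simp add: car_eq_def)
  qed
  with False show ?thesis by simp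
qed

lemma scal_zero: "scal 0 = 0"
  by transfer (simp add: car_eq_def car_ideal.zero)
lemma scal_one: "scal 1 = 1"
  by transfer (simp add: car_eq_def car_ideal.zero)


subsection \<open>Fock space and its dual\<close>

text \<open>\<open>\<F> = \<A> / \<A>\<langle>\<psi>\<^sub>n, \<psi>\<^sub>m\<^sup>*\<rangle>\<close> and \<open>\<F>\<^sup>* = \<A> / \<langle>\<psi>\<^sub>m, \<psi>\<^sub>n\<^sup>*\<rangle>\<A>\<close> with \<open>n < 0 \<le> m\<close>.\<close>

inductive_set ket_ideal :: "'k::field cliff set" where
  zero: "0 \<in> ket_ideal"
| psi: "n < 0 \<Longrightarrow> a * psi n \<in> ket_ideal"
| psi_st: "0 \<le> m \<Longrightarrow> a * psi_st m \<in> ket_ideal"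
| add: "x \<in> ket_ideal \<Longrightarrow> y \<in> ket_ideal \<Longrightarrow> x + y \<in> ket_ideal"

inductive_set bra_ideal :: "'k::field cliff set" where
  zero: "0 \<in> bra_ideal"
| psi: "0 \<le> m \<Longrightarrow> psi m * a \<in> bra_ideal"
| psi_st: "n < 0 \<Longrightarrow> psi_st n * a \<in> bra_ideal"
| add: "x \<in> bra_ideal \<Longrightarrow> y \<in> bra_ideal \<Longrightarrow> x + y \<in> bra_ideal"

lemma ket_ideal_mult: "x \<in> ket_ideal \<Longrightarrow> c * x \<in> ket_ideal"
proof (induction rule: ket_ideal.induct)
  case (psi n a)
  then show ?case using ket_ideal.psi[of n "c * a"] by (simp add: mult.assoc)
next
  case (psi_st n a)
  then show ?case using ket_ideal.psi_st[of n "c * a"] by (simp add: mult.assoc)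
qed (auto simp: distrib_left intro: ket_ideal.intros)

lemma bra_ideal_mult: "x \<in> bra_ideal \<Longrightarrow> x * c \<in> bra_ideal"
proof (induction rule: bra_ideal.induct)
  case (psi n a)
  then show ?case using bra_ideal.psi[of n "a * c"] by (simp add: mult.assoc)
next
  case (psi_st n a)
  then show ?case using bra_ideal.psi_st[of n "a * c"] by (simp add: mult.assoc)
qed (auto simp: distrib_right intro: bra_ideal.intros)

lemma ket_ideal_uminus: "x \<in> ket_ideal \<Longrightarrow> - x \<in> ket_ideal"
  using ket_ideal_mult[of x "- 1"] by simp
lemma bra_ideal_uminus: "x \<in> bra_ideal \<Longrightarrow> - x \<in> bra_ideal"
  using bra_ideal_mult[of x "- 1"] by simp
lemma ket_ideal_diff: "x \<in> ket_ideal \<Longrightarrow> y \<in> ket_ideal \<Longrightarrow> x - y \<in> ket_ideal"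
  using ket_ideal.add[of x "- y"] ket_ideal_uminus[of y] by simp
lemma bra_ideal_diff: "x \<in> bra_ideal \<Longrightarrow> y \<in> bra_ideal \<Longrightarrow> x - y \<in> bra_ideal"
  using bra_ideal.add[of x "- y"] bra_ideal_uminus[of y] by simp

definition ket_eq :: "'k::field cliff \<Rightarrow> 'k cliff \<Rightarrow> bool" where
  "ket_eq x y \<longleftrightarrow> x - y \<in> ket_ideal"
definition bra_eq :: "'k::field cliff \<Rightarrow> 'k cliff \<Rightarrow> bool" where
  "bra_eq x y \<longleftrightarrow> x - y \<in> bra_ideal"

lemma equivp_ket_eq: "equivp (ket_eq :: 'a::field cliff \<Rightarrow> _)"
proof (rule equivpI)
  show "reflp (ket_eq :: 'a cliff \<Rightarrow> _)" by (auto simp: reflp_def ket_eq_def intro: ket_ideal.zero)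
  show "symp (ket_eq :: 'a cliff \<Rightarrow> _)"
    by (auto simp: symp_def ket_eq_def) (metis ket_ideal_uminus minus_diff_eq)
  show "transp (ket_eq :: 'a cliff \<Rightarrow> _)"
  proof (rule transpI)
    fix x y z :: "'a cliff"
    assume "ket_eq x y" "ket_eq y z"
    then show "ket_eq x z"
      using ket_ideal.add[of "x - y" "y - z"] by (simp add: ket_eq_def)
  qed
qed

lemma equivp_bra_eq: "equivp (bra_eq :: 'a::field cliff \<Rightarrow> _)"
proof (rule equivpI)
  show "reflp (bra_eq :: 'a cliff \<Rightarrow> _)" by (auto simp: reflp_def bra_eq_def intro: bra_ideal.zero)
  show "symp (bra_eq :: 'a cliff \<Rightarrow> _)"
    by (auto simp: symp_def bra_eq_def) (metis bra_ideal_uminus minus_diff_eq)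
  show "transp (bra_eq :: 'a cliff \<Rightarrow> _)"
  proof (rule transpI)
    fix x y z :: "'a cliff"
    assume "bra_eq x y" "bra_eq y z"
    then show "bra_eq x z"
      using bra_ideal.add[of "x - y" "y - z"] by (simp add: bra_eq_def)
  qed
qed

lifting_forget cliff.lifting

quotient_type (overloaded) 'k fock = "'k::field cliff" / ket_eq
  by (rule equivp_ket_eq)
quotient_type (overloaded) 'k dfock = "'k::field cliff" / bra_eq
  by (rule equivp_bra_eq)

instantiation fock :: (field) ab_group_add
begin
lift_definition zero_fock :: "'a fock" is 0 .
lift_definition plus_fock :: "'a fock \<Rightarrow> 'a fock \<Rightarrow> 'a fock" is "(+)"
  unfolding ket_eq_def by (metis add_diff_add ket_ideal.add)
lift_definition uminus_fock :: "'a fock \<Rightarrow> 'a fock" is uminus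
  unfolding ket_eq_def by (metis ket_ideal_uminus minus_diff_minus)
lift_definition minus_fock :: "'a fock \<Rightarrow> 'a fock \<Rightarrow> 'a fock" is "(-)"
  unfolding ket_eq_def by (subst diff_diff_swap) (rule ket_ideal_diff)
instance
  by standard (transfer; simp add: ket_eq_def ket_ideal.zero algebra_simps; fail)+
end

instantiation dfock :: (field) ab_group_add
begin
lift_definition zero_dfock :: "'a dfock" is 0 .
lift_definition plus_dfock :: "'a dfock \<Rightarrow> 'a dfock \<Rightarrow> 'a dfock" is "(+)"
  unfolding bra_eq_def by (metis add_diff_add bra_ideal.add)
lift_definition uminus_dfock :: "'a dfock \<Rightarrow> 'a dfock" is uminus
  unfolding bra_eq_def by (metis bra_ideal_uminus minus_diff_minus)
lift_definition minus_dfock :: "'a dfock \<Rightarrow> 'a dfock \<Rightarrow> 'a dfock" is "(-)"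
  unfolding bra_eq_def by (subst diff_diff_swap) (rule bra_ideal_diff)
instance
  by standard (transfer; simp add: bra_eq_def bra_ideal.zero algebra_simps; fail)+
end

lift_definition vac :: "'k::field fock" is 1 .
lift_definition dvac :: "'k::field dfock" is 1 .

lift_definition lact :: "'k::field cliff \<Rightarrow> 'k fock \<Rightarrow> 'k fock" is "(*)"
  unfolding ket_eq_def by (metis ket_ideal_mult right_diff_distrib)
lift_definition ract :: "'k::field dfock \<Rightarrow> 'k cliff \<Rightarrow> 'k dfock" is "(*)"
  unfolding bra_eq_def by (metis bra_ideal_mult left_diff_distrib)

definition fscale :: "'k::field \<Rightarrow> 'k fock \<Rightarrow> 'k fock" where
  "fscale c v = lact (scal c) v"
definition dscale :: "'k::field \<Rightarrow> 'k dfock \<Rightarrow> 'k dfock" where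
  "dscale c w = ract w (scal c)"

lemma cstar_ket_ideal: "x \<in> ket_ideal \<Longrightarrow> cstar x \<in> bra_ideal"
  by (induction rule: ket_ideal.induct)
     (auto simp: cstar_zero cstar_add cstar_mult cstar_psi cstar_psi_st intro: bra_ideal.intros)

lift_definition fstar :: "'k::field fock \<Rightarrow> 'k dfock" is cstar
  unfolding ket_eq_def bra_eq_def by (metis cstar_diff cstar_ket_ideal)

definition is_pairing :: "('k::field dfock \<Rightarrow> 'k fock \<Rightarrow> 'k) \<Rightarrow> bool" where
  "is_pairing p \<longleftrightarrow>
     (\<forall>w w' v. p (w + w') v = p w v + p w' v) \<and>
     (\<forall>w v v'. p w (v + v') = p w v + p w v') \<and>
     (\<forall>c w v. p (dscale c w) v = c * p w v) \<and>
     (\<forall>c w v. p w (fscale c v) = c * p w v) \<and>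
     p dvac vac = 1 \<and>
     (\<forall>w X v. p (ract w X) v = p w (lact X v))"

definition pairing :: "'k::field dfock \<Rightarrow> 'k fock \<Rightarrow> 'k" where
  "pairing = (THE p. is_pairing p)"


subsection \<open>Existence and uniqueness of the pairing\<close>

definition ex_vac :: "nat set \<Rightarrow> 'k::field" where
  "ex_vac D = (if D = {} then 1 else 0)"

lemma ex_an_vac: "ex_an a ex_vac = (\<lambda>D. 0)"
  by (simp add: ex_an_def ex_vac_def fun_eq_iff)

lemma cact_ket_ideal: "x \<in> ket_ideal \<Longrightarrow> cact x ex_vac = (\<lambda>D. 0)"
  by (induction rule: ket_ideal.induct)
     (simp_all add: cact_zero cact_mult cact_add cact_psi cact_psi_st ex_an_vac cact_zero_vec)

lemma cact_bra_ideal: "x \<in> bra_ideal \<Longrightarrow> cact x v {} = 0"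
  by (induction rule: bra_ideal.induct)
     (simp_all add: cact_zero cact_mult cact_add cact_psi cact_psi_st ex_cr_def)

lift_definition ex_pairing :: "'k::field dfock \<Rightarrow> 'k fock \<Rightarrow> 'k" is
  "\<lambda>X Y. cact (X * Y) ex_vac {}"
proof -
  fix X X' Y Y' :: "'k cliff"
  assume "bra_eq X X'" "ket_eq Y Y'"
  then have "cact (X - X') (cact Y ex_vac) {} = 0" "cact (Y - Y') ex_vac = (\<lambda>D. 0)"
    by (simp_all add: bra_eq_def ket_eq_def cact_bra_ideal cact_ket_ideal)
  then have "cact X (cact Y ex_vac) {} = cact X' (cact Y ex_vac) {}" "cact Y ex_vac = cact Y' ex_vac"
    by (simp_all add: cact_diff fun_eq_iff)
  then show "cact (X * Y) ex_vac {} = cact (X' * Y') ex_vac {}"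
    by (simp add: cact_mult)
qed

lemma is_pairing_ex_pairing: "is_pairing ex_pairing"
  unfolding is_pairing_def fscale_def dscale_def
proof (intro conjI allI)
  fix w w' :: "'a dfock" and v v' :: "'a fock" and c :: 'a and X :: "'a cliff"
  show "ex_pairing (w + w') v = ex_pairing w v + ex_pairing w' v"
    by transfer (simp add: distrib_right cact_add)
  show "ex_pairing w (v + v') = ex_pairing w v + ex_pairing w v'"
    by transfer (simp add: distrib_left cact_add)
  show "ex_pairing (ract w (scal c)) v = c * ex_pairing w v"
    by transfer (simp add: cact_mult cact_scal cact_scale)
  show "ex_pairing w (lact (scal c) v) = c * ex_pairing w v"
    by transfer (simp add: cact_mult cact_scal cact_scale)
  show "ex_pairing dvac vac = (1 :: 'a)"
    by transfer (simp add: cact_one ex_vac_def)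
  show "ex_pairing (ract w X) v = ex_pairing w (lact X v)"
    by transfer (simp add: mult.assoc)
qed

fun cgen :: "gen \<Rightarrow> 'k::field cliff" where
  "cgen (Psi n) = psi n"
| "cgen (PsiS n) = psi_st n"

lemma cgen_anticomm: "\<exists>c. (cgen g * cgen h :: 'k::field cliff) = scal c - cgen h * cgen g"
proof (cases g; cases h)
  fix m n assume [simp]: "g = Psi m" "h = Psi n"
  show ?thesis using psi_psi[of m n, where 'a = 'k] by (intro exI[of _ 0]) (simp add: scal_zero eq_neg_iff_add_eq_0)
next
  fix m n assume [simp]: "g = PsiS m" "h = PsiS n"
  show ?thesis using psi_st_psi_st[of m n, where 'a = 'k] by (intro exI[of _ 0]) (simp add: scal_zero eq_neg_iff_add_eq_0)
next
  fix m n assume [simp]: "g = Psi m" "h = PsiS n"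
  show ?thesis using psi_psi_st[of m n, where 'k = 'k]
    by (intro exI[of _ "if m = n then 1 else 0"]) (simp add: scal_zero scal_one eq_diff_eq)
next
  fix m n assume [simp]: "g = PsiS m" "h = Psi n"
  show ?thesis using psi_psi_st[of n m, where 'k = 'k]
    by (intro exI[of _ "if m = n then 1 else 0"]) (auto simp: scal_zero scal_one eq_diff_eq add.commute)
qed

lemma abs_cliff_single_word:
  "abs_cliff (Poly_Mapping.single (Word gs) (c :: 'k::field)) = scal c * prod_list (map cgen gs)"
proof (induction gs)
  case Nil
  then show ?case by (simp add: scal.abs_eq zero_word_def)
next
  case (Cons g gs)
  have "abs_cliff (fgen g) = (cgen g :: 'k cliff)"
    by (cases g) (simp_all add: psi.abs_eq psi_st.abs_eq)
  moreover have "Poly_Mapping.single (Word (g # gs)) c = fgen g * Poly_Mapping.single (Word gs) c"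
    by (simp add: fgen_def mult_single)
  ultimately have "abs_cliff (Poly_Mapping.single (Word (g # gs)) c) = cgen g * abs_cliff (Poly_Mapping.single (Word gs) c)"
    by (simp flip: times_cliff.abs_eq)
  with Cons show ?case
    by (simp add: scal_commute mult.assoc)
qed

lemma is_pairing_unique:
  assumes p: "is_pairing p" and q: "is_pairing q"
  shows "(p :: 'a::field dfock \<Rightarrow> _) = q"
proof -
  define f where "f X = p dvac (lact X vac) - q dvac (lact X vac)" for X
  have lact_add: "lact (X + Y) v = lact X v + lact Y v" for X Y :: "'a cliff" and v
    by transfer (simp add: distrib_right ket_eq_def ket_ideal.zero)
  have lact_mult: "lact (X * Y) v = lact X (lact Y v)" for X Y :: "'a cliff" and v
    by transfer (simp add: mult.assoc ket_eq_def ket_ideal.zero)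
  have ract_mult: "ract w (X * Y) = ract (ract w X) Y" for X Y :: "'a cliff" and w
    by transfer (simp add: mult.assoc bra_eq_def bra_ideal.zero)
  have zero: "r 0 v = 0" "r w 0 = 0" if "is_pairing r" for r :: "'a dfock \<Rightarrow> _" and v w
    using that unfolding is_pairing_def by (metis add_cancel_right_right)+
  have f_add: "f (X + Y) = f X + f Y" for X Y
    using p q by (simp add: f_def is_pairing_def lact_add)
  have f_scal: "f (scal c * X) = c * f X" for c X
    using p q by (simp add: f_def is_pairing_def lact_mult right_diff_distrib flip: fscale_def)
  have f_uminus: "f (- X) = - f X" for X
    using f_add[of X "- X"] f_scal[of 0 0] by (simp add: scal_zero eq_neg_iff_add_eq_0 add.commute)
  have f_diff: "f (X - Y) = f X - f Y" for X Y
    using f_add[of X "- Y"] by (simp add: f_uminus)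
  have f_one: "f 1 = 0"
  proof -
    have "lact 1 vac = (vac :: 'a fock)" by transfer (simp add: ket_eq_def ket_ideal.zero)
    then show ?thesis using p q by (simp add: f_def is_pairing_def)
  qed
  define ann where "ann g = (case g of Psi n \<Rightarrow> n < 0 | PsiS n \<Rightarrow> 0 \<le> n)" for g
  have f_ann: "f (X * cgen g) = 0" if "ann g" for X g
  proof -
    have "X * cgen g \<in> ket_ideal"
      using that by (cases g) (auto simp: ann_def intro: ket_ideal.intros)
    then have "lact (X * cgen g) vac = 0"
      by transfer (simp add: ket_eq_def)
    then show ?thesis by (simp add: f_def zero p q)
  qed
  have f_cr: "f (cgen g * X) = 0" if "\<not> ann g" for X g
  proof -
    have "cgen g * X \<in> bra_ideal"
      using that by (cases g) (auto simp: ann_def intro: bra_ideal.intros)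
    then have "ract dvac (cgen g * X) = 0"
      by transfer (simp add: bra_eq_def)
    moreover have "f (cgen g * X) = p (ract dvac (cgen g * X)) vac - q (ract dvac (cgen g * X)) vac"
      using p q by (simp add: f_def is_pairing_def)
    ultimately show ?thesis by (simp add: zero p q)
  qed
  let ?W = "\<lambda>gs. prod_list (map cgen gs) :: 'a cliff"
  have f_word: "f (?W gs) = 0" for gs
  proof (induction gs rule: length_induct)
    case (1 gs)
    have move: "f (?W us * cgen g * ?W ws) = 0"
      if "ann g" "length us + length ws < length gs" for g us ws
      using that(2)
    proof (induction ws arbitrary: us)
      case Nil
      then show ?case using f_ann[OF that(1)] by simp
    next
      case (Cons h ws)
      obtain c where c: "cgen g * cgen h = (scal c - cgen h * cgen g :: 'a cliff)"
        using cgen_anticomm by blast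
      have "?W us * cgen g * ?W (h # ws) = ?W us * (cgen g * cgen h) * ?W ws"
        by (simp add: mult.assoc)
      also have "\<dots> = ?W us * scal c * ?W ws - ?W us * (cgen h * cgen g) * ?W ws"
        by (simp add: c left_diff_distrib right_diff_distrib)
      also have "\<dots> = scal c * ?W (us @ ws) - ?W (us @ [h]) * cgen g * ?W ws"
        by (simp add: scal_commute mult.assoc)
      finally have "f (?W us * cgen g * ?W (h # ws)) = c * f (?W (us @ ws)) - f (?W (us @ [h]) * cgen g * ?W ws)"
        by (simp add: f_diff f_scal)
      moreover have "length (us @ ws) < length gs" using Cons.prems by simp
      then have "f (?W (us @ ws)) = 0" using 1 by blast
      moreover have "f (?W (us @ [h]) * cgen g * ?W ws) = 0" using Cons.prems by (intro Cons.IH) simp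
      ultimately show ?case by simp
    qed
    show ?case
    proof (cases gs)
      case Nil
      then show ?thesis by (simp add: f_one)
    next
      case (Cons g gs')
      show ?thesis
      proof (cases "ann g")
        case True
        then show ?thesis using move[of g "[]" gs'] Cons by simp
      next
        case False
        then show ?thesis using f_cr Cons by simp
      qed
    qed
  qed
  have f_all: "f X = 0" for X
  proof (induction X rule: cliff_induct)
    case zero
    show ?case using f_scal[of 0 0] by simp
  next
    case (word w c)
    then show ?case by (cases w) (simp add: abs_cliff_single_word f_scal f_word)
  qed (simp add: f_add)
  show "p = q"
  proof (intro ext)
    fix w :: "'a dfock" and v :: "'a fock"
    obtain X where w: "w = ract dvac X"
    proof
      show "w = ract dvac (rep_dfock w)"
        by (simp add: dvac_def ract.abs_eq Quotient_abs_rep[OF Quotient_dfock])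
    qed
    obtain Y where v: "v = lact Y vac"
    proof
      show "v = lact (rep_fock v) vac"
        by (simp add: vac_def lact.abs_eq Quotient_abs_rep[OF Quotient_fock])
    qed
    have "r w v = r dvac (lact (X * Y) vac)" if "is_pairing r" for r :: "'a dfock \<Rightarrow> 'a fock \<Rightarrow> 'a"
      using that by (simp add: w v is_pairing_def lact_mult)
    from this[OF p] this[OF q] show "p w v = q w v"
      using f_all[of "X * Y"] by (simp add: f_def)
  qed
qed

theorem ex1_pairing: "\<exists>!p. is_pairing p"
  using is_pairing_ex_pairing is_pairing_unique by blast

lemma is_pairing_pairing: "is_pairing pairing"
  unfolding pairing_def by (rule theI'[OF ex1_pairing])


subsection \<open>Shifted vacua, currents and vertex operators\<close>

definition shift_ket :: "int \<Rightarrow> 'k::field fock" where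
  "shift_ket m =
     (if 0 \<le> m then lact (prod_list (map psi (rev [0..m - 1]))) vac
      else lact (prod_list (map psi_st [m..-1])) vac)"

definition shift_bra :: "int \<Rightarrow> 'k::field dfock" where
  "shift_bra m =
     (if 0 \<le> m then ract dvac (prod_list (map psi_st [0..m - 1]))
      else ract dvac (prod_list (map psi (rev [m..-1]))))"

definition normal_ord :: "int \<Rightarrow> int \<Rightarrow> 'k::field cliff" where
  "normal_ord i k = (if i \<le> 0 then psi i * psi_st (i + k) else - (psi_st (i + k) * psi i))"

text \<open>The action of \<open>a\<^sub>k\<close> on \<open>\<F>\<close> from the left and on \<open>\<F>\<^sup>*\<close> from the right. For \<open>k \<noteq> 0\<close>, the only
  case used below, all but finitely many summands vanish on any given vector.\<close>

definition current :: "int \<Rightarrow> 'k::field fock \<Rightarrow> 'k fock" where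
  "current k v = Sum_any (\<lambda>i. lact (normal_ord i k) v)"

definition dcurrent :: "int \<Rightarrow> 'k::field dfock \<Rightarrow> 'k dfock" where
  "dcurrent k w = Sum_any (\<lambda>i. ract w (normal_ord i k))"

text \<open>\<open>H(X)\<close> and \<open>H\<^sup>*(X)\<close> as operators on series with coefficients in \<open>\<F>\<close>, and the right action
  of \<open>H\<^sup>*(X)\<close> on series with coefficients in \<open>\<F>\<^sup>*\<close>.\<close>

definition H_op :: "'k::field_char_0 alphabet \<Rightarrow> 'k fock series \<Rightarrow> 'k fock series" where
  "H_op X v = series_sum (\<lambda>k. conv fscale (const_series (1 / of_nat k) * psum k X)
     (map_series (current (int k)) v)) {1..}"

definition Hst_op :: "'k::field_char_0 alphabet \<Rightarrow> 'k fock series \<Rightarrow> 'k fock series" where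
  "Hst_op X v = series_sum (\<lambda>k. conv fscale (const_series (1 / of_nat k) * psum k X)
     (map_series (current (- int k)) v)) {1..}"

definition dHst_op :: "'k::field_char_0 alphabet \<Rightarrow> 'k dfock series \<Rightarrow> 'k dfock series" where
  "dHst_op X w = series_sum (\<lambda>k. conv dscale (const_series (1 / of_nat k) * psum k X)
     (map_series (dcurrent (- int k)) w)) {1..}"

definition exp_ket ::
    "('k::field_char_0 fock series \<Rightarrow> 'k fock series) \<Rightarrow> 'k fock series \<Rightarrow> 'k fock series" where
  "exp_ket T v = series_sum (\<lambda>n. map_series (fscale (1 / fact n)) ((T ^^ n) v)) UNIV"

definition exp_bra ::
    "('k::field_char_0 dfock series \<Rightarrow> 'k dfock series) \<Rightarrow> 'k dfock series \<Rightarrow> 'k dfock series" where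
  "exp_bra T w = series_sum (\<lambda>n. map_series (dscale (1 / fact n)) ((T ^^ n) w)) UNIV"

text \<open>\<open>\<langle>w| e\<^sup>H\<^sup>(\<^sup>X\<^sup>) |v\<rangle>\<close>\<close>

definition matrix_elem ::
    "'k::field_char_0 dfock series \<Rightarrow> 'k alphabet \<Rightarrow> 'k fock series \<Rightarrow> 'k series" where
  "matrix_elem w X v = conv pairing w (exp_ket (H_op X) v)"


subsection \<open>The vectors\<close>

definition ket_lower :: "nat \<Rightarrow> nat list \<Rightarrow> 'k::field_char_0 fock series" where
  "ket_lower l lam =
     foldr (\<lambda>i. let Y = A_alph (ipart lam i - 1) in
         exp_ket (- H_op Y) \<circ> map_series (lact (psi (ipart lam i - int i)))
         \<circ> exp_ket (H_op (letter (bv i))) \<circ> exp_ket (H_op Y))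
       [1..<Suc l] (const_series (shift_ket (- int l)))"

text \<open>The displayed product does depend on \<open>l\<close> between \<open>l = length lam\<close>, where the last factor
  is not trivial, and \<open>l > length lam\<close>, where it is and where the product no longer changes.\<close>

definition ket_upper :: "nat \<Rightarrow> nat list \<Rightarrow> 'k::field_char_0 fock series" where
  "ket_upper l lam =
     foldr (\<lambda>i. let Y = A_alph (ipart lam i) in
         exp_ket (Hst_op Y) \<circ> map_series (lact (psi (ipart lam i - int i)))
         \<circ> exp_ket (- Hst_op (letter (bv i))) \<circ> exp_ket (- Hst_op Y))
       [1..<Suc l]
       (exp_ket (Hst_op (A_alph (ipart lam l))) (const_series (shift_ket (- int l))))"

definition bra_upper :: "nat \<Rightarrow> nat list \<Rightarrow> 'k::field_char_0 dfock series" where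
  "bra_upper l mu = map_series fstar (ket_lower l mu)"

definition bra_lower :: "nat \<Rightarrow> nat list \<Rightarrow> 'k::field_char_0 dfock series" where
  "bra_lower l mu = map_series fstar (ket_upper l mu)"

text \<open>Operators act on bras from the right, so the leftmost factor is applied first.\<close>

definition bra_dbl :: "nat \<Rightarrow> nat list \<Rightarrow> 'k::field_char_0 dfock series" where
  "bra_dbl l mu =
     foldr (\<lambda>i. let Y = B_alph (int i) - A_alph (ipart mu i) in
         exp_bra (dHst_op Y) \<circ> map_series (\<lambda>w. ract w (psi_st (ipart mu i - int i)))
         \<circ> exp_bra (- dHst_op Y))
       [1..<Suc l] (const_series (shift_bra (- int l)))"


section \<open>Determinants and prefactors\<close>

definition det_from1 :: "nat \<Rightarrow> (nat \<Rightarrow> nat \<Rightarrow> 'a::comm_ring_1) \<Rightarrow> 'a" where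
  "det_from1 l f = det (mat l l (\<lambda>(i, j). f (Suc i) (Suc j)))"

definition C_fac :: "nat \<Rightarrow> nat \<Rightarrow> 'k::comm_ring_1 series" where
  "C_fac l n = (\<Prod>i=1..l. \<Prod>j=1..n. 1 - bv i * xv j)"

definition C'_fac :: "nat \<Rightarrow> nat \<Rightarrow> 'k::comm_ring_1 series" where
  "C'_fac l' n = (\<Prod>i=1..l'. \<Prod>j=1..n. unit_inv (1 + av i * xv j))"

end

theory Submission
  imports Defs
begin

text \<open>
  Conjugating by the vertex operators turns every vector into a product of fields
  \<open>\<Sum> w\<^sub>k \<psi>\<^sub>k\<close> applied to a shifted vacuum, so Wick's theorem evaluates each matrix element as a
  determinant of complete functions; moving \<open>e\<^sup>H\<close> past the factors \<open>e\<^sup>-\<^sup>H\<^sup>*\<^sup>(\<^sup>\<beta>\<^sup>)\<close> produces \<open>C\<close>.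

  For the passage from \<open>h\<close> to \<open>e\<close>, walk along the boundaries of \<open>\<lambda>\<close> and \<open>\<mu>\<close> in an \<open>l \<times> l'\<close> rectangle
  and attach to the lattice point in row \<open>r\<close> and column \<open>c\<close> the alphabet \<open>B\<^sub>r - A\<^sub>c\<close> (or a shift of it). The functions
  \<open>h\<^sub>p\<^sub>-\<^sub>q(x \<ominus> (\<kappa>\<^sub>q - \<rho>\<^sub>p\<^sub>+\<^sub>1))\<close> of the alphabets along two such walks form the matrix of the multiplication by
  \<open>\<Prod> (1 - x\<^sub>j t)\<^sup>-\<^sup>1\<close> with respect to two Newton bases of the polynomials modulo a fixed one. Its inverse is
  therefore given by the same formula with \<open>-x\<close>, its determinant is \<open>C'/C\<close>, and Jacobi's theorem on
  complementary minors exchanges the vertical steps of the walks (the \<open>h\<close>-determinant) for the horizontal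
  ones (the \<open>e\<close>-determinant). In the third identity the matrix is unitriangular and its inverse is found
  by factoring it. Since the \<open>e\<close>-determinant does not depend on \<open>l\<close>, the bra and the ket may be
  extended to a common length first.
\<close>

section \<open>Formal power series: convolution, Euler equations, operators determined by
  constants\<close>

subsection \<open>Series and the total degree\<close>

text \<open>Exponentials of infinite sums of currents are awkward to reorder directly. As all
  letters have degree one, the Euler derivation turns each identity between vertex operators into a
  first-order linear equation whose solution is fixed by its constant term. The modes of a field are
  collected in a Laurent series: conjugation by a vertex operator multiplies this series by a
  generating function, and a contraction is the constant term of a product of two such series.
  Wick's theorem needs adjoint fields that annihilate the vacuum |-l>. In the first two identities
  this is achieved by carrying exp(-H^*(B_l)) to the bra, provided that the alphabet K_j of row j
  minus B_l has a generating polynomial of degree at most l + \<mu>_j - j. For the second identity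
  and \<mu>_j = 0, the alphabet B_(j-1) read off from the bra has degree one too many. Such a row
  can be removed and restored with any homogeneous alphabet, so B_j takes its place; hence the case
  distinctions in the determinants.\<close>

lemma scoeff_add [simp]: "scoeff (f + g) m = scoeff f m + scoeff g m"
  and scoeff_zero [simp]: "scoeff 0 m = 0"
  and scoeff_minus [simp]: "scoeff (f - g) m = scoeff f m - scoeff g m"
  and scoeff_uminus [simp]: "scoeff (- f) m = - scoeff f m"
  by (simp_all add: plus_series_def zero_series_def minus_series_def uminus_series_def)

lemma scoeff_sum [simp]: "scoeff (\<Sum>i\<in>I. f i) m = (\<Sum>i\<in>I. scoeff (f i) m)"
  by (induction I rule: infinite_finite_induct) auto

lemma scoeff_const [simp]: "scoeff (const_series c) m = (if m = 0 then c else 0)"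
  and scoeff_map [simp]: "scoeff (map_series g s) m = g (scoeff s m)"
  by (simp_all add: const_series_def map_series_def)

lemma scoeff_conv: "scoeff (conv f s t) m = (\<Sum>(a, b)\<in>splits m. f (scoeff s a) (scoeff t b))"
  by (simp add: conv_def)

lemma scoeff_times: "scoeff (s * t) m = (\<Sum>(a, b)\<in>splits m. scoeff s a * scoeff t b)"
  by (simp add: times_series_def scoeff_conv)

lemma scoeff_one: "scoeff 1 m = (if m = 0 then 1 else 0)"
  by (simp add: one_series_def)

lemma in_splits [simp]: "(a, b) \<in> splits m \<longleftrightarrow> a + b = m"
  by (simp add: splits_def)

definition mdeg :: "monom \<Rightarrow> nat" where
  "mdeg m = (\<Sum>v\<in>Poly_Mapping.keys m. Poly_Mapping.lookup m v)"

lemma mdeg_superset: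
  "finite K \<Longrightarrow> Poly_Mapping.keys m \<subseteq> K \<Longrightarrow> mdeg m = (\<Sum>v\<in>K. Poly_Mapping.lookup m v)"
  unfolding mdeg_def by (rule sum.mono_neutral_left) (auto simp: in_keys_iff)

lemma mdeg_add [simp]: "mdeg (a + b) = mdeg a + mdeg b"
proof -
  let ?K = "Poly_Mapping.keys a \<union> Poly_Mapping.keys b"
  have "mdeg (a + b) = (\<Sum>v\<in>?K. Poly_Mapping.lookup (a + b) v)"
    by (rule mdeg_superset) (simp_all add: Poly_Mapping.keys_add)
  then show ?thesis
    by (simp add: lookup_add sum.distrib mdeg_superset[of ?K])
qed

lemma mdeg_zero [simp]: "mdeg 0 = 0"
  by (simp add: mdeg_def)

lemma mdeg_single [simp]: "mdeg (Poly_Mapping.single v k) = k"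
  by (cases "k = 0") (simp_all add: mdeg_def)

lemma mdeg_eq_0_iff [simp]: "mdeg m = 0 \<longleftrightarrow> m = 0"
proof
  assume "mdeg m = 0"
  then have "Poly_Mapping.lookup m v = 0" if "v \<in> Poly_Mapping.keys m" for v
    using that by (simp add: mdeg_def)
  then show "m = 0"
    by (metis in_keys_iff lookup_zero poly_mapping_eqI)
qed simp

lemma splits_0 [simp]: "splits 0 = {(0, 0)}"
proof -
  have *: "a = 0 \<and> b = 0" if "a + b = 0" for a b :: monom
  proof -
    have "mdeg a + mdeg b = 0" by (subst mdeg_add[symmetric]) (simp only: that mdeg_zero)
    then show ?thesis by simp
  qed
  show ?thesis by (auto simp: splits_def dest: *)
qed

lemma sum_splits_left:
  assumes "\<And>a b. a \<noteq> 0 \<Longrightarrow> f a b = 0"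
  shows "(\<Sum>(a, b)\<in>splits m. f a b) = (f 0 m :: 'a::comm_monoid_add)"
proof -
  have "(\<Sum>(a, b)\<in>splits m. f a b) = (\<Sum>(a, b)\<in>splits m. if a = 0 then f a b else 0)"
    by (intro sum.cong) (auto simp: assms)
  then show ?thesis by (simp add: splits_zero_left)
qed

lemma sum_splits_right:
  assumes "\<And>a b. b \<noteq> 0 \<Longrightarrow> f a b = 0"
  shows "(\<Sum>(a, b)\<in>splits m. f a b) = (f m 0 :: 'a::comm_monoid_add)"
  by (subst splits_swap, rule sum_splits_left) (rule assms)

lemma series_sum_coeff:
  assumes "finite J" "J \<subseteq> I" "\<And>i. i \<in> I \<Longrightarrow> i \<notin> J \<Longrightarrow> scoeff (f i) m = 0"
  shows "scoeff (series_sum f I) m = (\<Sum>i\<in>J. scoeff (f i) m)"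
proof -
  have "(\<Sum>i | i \<in> I \<and> scoeff (f i) m \<noteq> 0. scoeff (f i) m) = (\<Sum>i\<in>J. scoeff (f i) m)"
    using assms by (intro sum.mono_neutral_left) auto
  then show ?thesis by (simp add: series_sum_def)
qed

subsection \<open>Convolution of biadditive maps\<close>

text \<open>Additivity in both arguments is asked for instead of bilinearity because the maps that
  are convolved mix scalars, vectors, dual vectors and Laurent polynomials.\<close>

definition biadd :: "('a::ab_group_add \<Rightarrow> 'b::ab_group_add \<Rightarrow> 'c::ab_group_add) \<Rightarrow> bool" where
  "biadd f \<longleftrightarrow> (\<forall>y. additive (\<lambda>x. f x y)) \<and> (\<forall>x. additive (f x))"

lemma biaddI:
  assumes "\<And>x x' y. f (x + x') y = f x y + f x' y" "\<And>x y y'. f x (y + y') = f x y + f x y'"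
  shows "biadd f"
  using assms by (simp add: biadd_def additive_def)

lemma biadd_add: "biadd f \<Longrightarrow> f (x + x') y = f x y + f x' y" "biadd f \<Longrightarrow> f x (y + y') = f x y + f x y'"
  by (auto simp: biadd_def additive_def)
lemma biadd_zero: "biadd f \<Longrightarrow> f 0 y = 0" "biadd f \<Longrightarrow> f x 0 = 0"
  using additive.zero[of "\<lambda>x. f x y"] additive.zero[of "f x"] by (simp_all add: biadd_def)

lemma biadd_minus: "biadd f \<Longrightarrow> f (- x) y = - f x y" "biadd f \<Longrightarrow> f x (- y) = - f x y"
  using additive.minus[of "\<lambda>x. f x y" x] additive.minus[of "f x" y] by (simp_all add: biadd_def)

lemma biadd_diff: "biadd f \<Longrightarrow> f (x - x') y = f x y - f x' y" "biadd f \<Longrightarrow> f x (y - y') = f x y - f x y'"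
  using additive.diff[of "\<lambda>x. f x y" x x'] additive.diff[of "f x" y y'] by (simp_all add: biadd_def)

lemma biadd_sum: "biadd f \<Longrightarrow> f (\<Sum>i\<in>I. g i) y = (\<Sum>i\<in>I. f (g i) y)"
    "biadd f \<Longrightarrow> f x (\<Sum>i\<in>J. h i) = (\<Sum>i\<in>J. f x (h i))"
  using additive.sum[of "\<lambda>x. f x y" g I] additive.sum[of "f x" h J] by (simp_all add: biadd_def)

lemma biadd_times: "biadd ((*) :: 'a::ring \<Rightarrow> _)"
  by (rule biaddI) (simp_all add: distrib_left distrib_right)

lemma biadd_conv: "biadd f \<Longrightarrow> biadd (conv f)"
  by (intro biaddI series_eqI) (simp_all add: scoeff_conv biadd_add sum.distrib case_prod_beta)

lemma conv_const_left: "biadd f \<Longrightarrow> scoeff (conv f (const_series x) v) m = f x (scoeff v m)"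
  by (simp add: scoeff_conv, subst sum_splits_left) (auto simp: biadd_zero)

lemma conv_const_right: "biadd f \<Longrightarrow> scoeff (conv f u (const_series y)) m = f (scoeff u m) y"
  by (simp add: scoeff_conv, subst sum_splits_right) (auto simp: biadd_zero)

text \<open>Common normal form of both bracketings of a threefold convolution. An identity between
  coefficient maps thereby lifts to an identity between operators on series.\<close>

definition conv3 :: "('a \<Rightarrow> 'b \<Rightarrow> 'c \<Rightarrow> 'd::comm_monoid_add) \<Rightarrow> 'a series \<Rightarrow> 'b series \<Rightarrow> 'c series \<Rightarrow> 'd series" where
  "conv3 F u v w = Series (\<lambda>m. \<Sum>(a, q)\<in>splits m. \<Sum>(b, c)\<in>splits q. F (scoeff u a) (scoeff v b) (scoeff w c))"

lemma conv3_cong: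
  "(\<And>a b c. F (scoeff u a) (scoeff v b) (scoeff w c) = G (scoeff u a) (scoeff v b) (scoeff w c))
    \<Longrightarrow> conv3 F u v w = conv3 G u v w"
  by (simp add: conv3_def)

lemma conv3_add: "conv3 (\<lambda>x y z. F x y z + G x y z) u v w = conv3 F u v w + conv3 G u v w"
  for F :: "_ \<Rightarrow> _ \<Rightarrow> _ \<Rightarrow> 'd::ab_group_add"
  by (rule series_eqI) (simp add: conv3_def sum.distrib case_prod_beta)

lemma conv3_diff: "conv3 (\<lambda>x y z. F x y z - G x y z) u v w = conv3 F u v w - conv3 G u v w"
  for F :: "_ \<Rightarrow> _ \<Rightarrow> _ \<Rightarrow> 'd::ab_group_add"
  by (rule series_eqI) (simp add: conv3_def sum_subtractf case_prod_beta)

lemma conv_conv_right: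
  assumes "biadd f" shows "conv f u (conv g v w) = conv3 (\<lambda>x y z. f x (g y z)) u v w"
  by (rule series_eqI) (simp add: scoeff_conv conv3_def biadd_sum[OF assms] case_prod_beta)

lemma conv_conv_left:
  assumes "biadd f" shows "conv f (conv g u v) w = conv3 (\<lambda>x y z. f (g x y) z) u v w"
proof (rule series_eqI)
  fix m
  have "scoeff (conv f (conv g u v) w) m =
      (\<Sum>(p, c)\<in>splits m. \<Sum>(a, b)\<in>splits p. f (g (scoeff u a) (scoeff v b)) (scoeff w c))"
    by (simp add: scoeff_conv biadd_sum[OF assms] case_prod_beta)
  then show "scoeff (conv f (conv g u v) w) m = scoeff (conv3 (\<lambda>x y z. f (g x y) z) u v w) m"
    by (simp add: splits_assoc conv3_def)
qed

lemma conv3_swap: "conv3 F u v w = conv3 (\<lambda>y x z. F x y z) v u w"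
proof (rule series_eqI)
  fix m
  have "scoeff (conv3 F u v w) m =
    (\<Sum>(p, c)\<in>splits m. \<Sum>(a, b)\<in>splits p. F (scoeff u a) (scoeff v b) (scoeff w c))"
    by (simp add: conv3_def splits_assoc)
  also have "\<dots> = (\<Sum>(p, c)\<in>splits m. \<Sum>(b, a)\<in>splits p. F (scoeff u a) (scoeff v b) (scoeff w c))"
    by (intro sum.cong refl) (auto intro: splits_swap)
  also have "\<dots> = scoeff (conv3 (\<lambda>y x z. F x y z) v u w) m"
    by (simp add: conv3_def splits_assoc)
  finally show "scoeff (conv3 F u v w) m = scoeff (conv3 (\<lambda>y x z. F x y z) v u w) m" .
qed

text \<open>The arguments come out as \<open>u\<close>, \<open>v\<close>, \<open>w\<close> although
  \<open>v\<close> acts last, so both sides of a commutation relation become \<open>conv3\<close> of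
  the same series.\<close>

lemma conv_conv_right_swap:
  assumes "biadd f" shows "conv f v (conv g u w) = conv3 (\<lambda>x y z. f y (g x z)) u v w"
  by (simp add: conv_conv_right[OF assms] conv3_swap[of _ v u])

subsection \<open>The Euler derivation\<close>

text \<open>Multiplication by the degree, written as a repeated sum because the coefficients only form
  an abelian group.\<close>

definition euler :: "'a::ab_group_add series \<Rightarrow> 'a series" where
  "euler v = Series (\<lambda>m. \<Sum>i<mdeg m. scoeff v m)"

lemma scoeff_euler [simp]: "scoeff (euler v) m = (\<Sum>i<mdeg m. scoeff v m)"
  by (simp add: euler_def)

lemma euler_add: "euler (u + v) = euler u + euler v"
  and euler_diff: "euler (u - v) = euler u - euler v"
  and euler_uminus: "euler (- u) = - euler u"
  and euler_zero [simp]: "euler 0 = 0"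
  by (auto intro!: series_eqI simp del: sum_constant simp: sum.distrib sum_subtractf sum_negf)

lemma euler_const [simp]: "euler (const_series c) = 0"
  by (rule series_eqI) (simp del: sum_constant)

lemma sum_lessThan_add_const: "(\<Sum>i<(k + l :: nat). x) = (\<Sum>i<k. x) + (\<Sum>i<l. x)"
  for x :: "'a::comm_monoid_add"
  by (induction l) (simp_all add: add_ac del: sum_constant)

lemma euler_conv:
  assumes "biadd f" shows "euler (conv f u v) = conv f (euler u) v + conv f u (euler v)"
proof (rule series_eqI)
  fix m
  have "scoeff (euler (conv f u v)) m = (\<Sum>(a, b)\<in>splits m. \<Sum>i<mdeg m. f (scoeff u a) (scoeff v b))"
    by (simp add: scoeff_conv case_prod_beta del: sum_constant) (rule sum.swap)
  also have "\<dots> = (\<Sum>(a, b)\<in>splits m. (\<Sum>i<mdeg a. f (scoeff u a) (scoeff v b)) +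
       (\<Sum>i<mdeg b. f (scoeff u a) (scoeff v b)))"
    by (intro sum.cong refl) (auto simp: sum_lessThan_add_const simp del: sum_constant)
  also have "\<dots> = scoeff (conv f (euler u) v + conv f u (euler v)) m"
    by (simp add: scoeff_conv biadd_sum[OF assms] sum.distrib case_prod_beta del: sum_constant)
  finally show "scoeff (euler (conv f u v)) m = scoeff (conv f (euler u) v + conv f u (euler v)) m" .
qed

lemma euler_mult: "euler (u * v) = euler u * v + u * euler (v :: 'a::comm_ring_1 series)"
  unfolding times_series_def by (rule euler_conv[OF biadd_times])

lemma euler_one [simp]: "euler (1 :: 'a::comm_ring_1 series) = 0"
  by (simp add: one_series_def)

text \<open>Stands in for characteristic zero when the coefficients are merely an abelian group: a
  positive degree can be cancelled.\<close>

definition torsion_free :: "'a::ab_group_add itself \<Rightarrow> bool" where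
  "torsion_free _ \<longleftrightarrow> (\<forall>n (x::'a). 0 < n \<longrightarrow> (\<Sum>i<(n::nat). x) = 0 \<longrightarrow> x = 0)"

definition vanish :: "nat \<Rightarrow> 'a::zero series \<Rightarrow> bool" where
  "vanish d v \<longleftrightarrow> (\<forall>m. mdeg m < d \<longrightarrow> scoeff v m = 0)"

lemma vanish_conv:
  assumes "biadd f" "vanish c u" "vanish d v" shows "vanish (c + d) (conv f u v)"
  unfolding vanish_def
proof (intro allI impI)
  fix m assume m: "mdeg m < c + d"
  have "f (scoeff u a) (scoeff v b) = 0" if "a + b = m" for a b
    using that m assms mdeg_add[of a b]
    by (cases "mdeg a < c") (auto simp: vanish_def biadd_zero[OF assms(1)])
  then show "scoeff (conv f u v) m = 0"
    by (auto simp: scoeff_conv intro!: sum.neutral)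
qed

lemma vanish_1_iff: "vanish (Suc 0) u \<longleftrightarrow> scoeff u 0 = 0"
  by (simp add: vanish_def)

lemma vanish_euler: "vanish d u \<Longrightarrow> vanish d (euler u)"
  by (simp add: vanish_def del: sum_constant)

text \<open>On the part of degree d > 0 the Euler derivation multiplies by d, which is injective,
  while \<open>S\<close> raises the lowest degree by one; so \<open>w\<close> cannot have a lowest
  nonzero part. This is the uniqueness principle behind the identities between vertex
  operators.\<close>

lemma euler_ode_zero:
  fixes w :: "'a::ab_group_add series"
  assumes tf: "torsion_free TYPE('a)" and eq: "euler w = S w"
    and S: "\<And>d. vanish d w \<Longrightarrow> vanish (Suc d) (S w)" and w0: "scoeff w 0 = 0"
  shows "w = 0"
proof -
  have "vanish d w" for d
  proof (induction d)
    case (Suc d)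
    have "scoeff w m = 0" if "mdeg m = d" for m
    proof (cases "d = 0")
      case True
      with that w0 show ?thesis by simp
    next
      case False
      have "scoeff (euler w) m = 0"
        using S[OF Suc] that unfolding eq by (simp add: vanish_def)
      with False that tf show ?thesis
        unfolding torsion_free_def by (simp del: sum_constant)
    qed
    with Suc show ?case by (auto simp: vanish_def less_Suc_eq)
  qed (simp add: vanish_def)
  then show ?thesis
    by (intro series_eqI) (auto simp: vanish_def)
qed

subsection \<open>Operators determined by their values on constants\<close>

text \<open>Linearity over monomials together with compatibility with infinite coefficientwise sums.
  Such maps agree as soon as they agree on constant series.\<close>

definition loc :: "('a::ab_group_add series \<Rightarrow> 'b::ab_group_add series) \<Rightarrow> bool" where
  "loc T \<longleftrightarrow> additive (\<lambda>x. T (const_series x)) \<and>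
     (\<forall>v m. scoeff (T v) m = (\<Sum>(a, b)\<in>splits m. scoeff (T (const_series (scoeff v b))) a))"

lemma locD: "loc T \<Longrightarrow> scoeff (T v) m = (\<Sum>(a, b)\<in>splits m. scoeff (T (const_series (scoeff v b))) a)"
  and loc_additive: "loc T \<Longrightarrow> additive (\<lambda>x. T (const_series x))"
  unfolding loc_def by blast+

lemma loc_eqI:
  assumes "loc S" "loc T" "\<And>x. S (const_series x) = T (const_series x)"
  shows "S v = T v"
  by (rule series_eqI) (simp add: locD[OF assms(1)] locD[OF assms(2), of v] assms(3))

lemma additive_coeff: "loc T \<Longrightarrow> additive (\<lambda>x. scoeff (T (const_series x)) a)"
  using loc_additive[of T] by (simp add: additive_def)

lemma loc_add: assumes "loc T" shows "T (u + v) = T u + T v"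
  by (rule series_eqI)
     (simp add: locD[OF assms, of "u + v"] locD[OF assms, of u] locD[OF assms, of v]
        additive.add[OF additive_coeff[OF assms]] sum.distrib case_prod_beta)

lemma loc_imp_additive: "loc T \<Longrightarrow> additive T"
  by (simp add: additive_def loc_add)

lemma loc_comp:
  assumes S: "loc S" and T: "loc T" shows "loc (\<lambda>v. S (T v))"
proof -
  have "scoeff (S (T v)) m = (\<Sum>(a, b)\<in>splits m. scoeff (S (T (const_series (scoeff v b)))) a)" for v m
  proof -
    have "scoeff (S (T v)) m = (\<Sum>(a, q)\<in>splits m. \<Sum>(b, c)\<in>splits q.
       scoeff (S (const_series (scoeff (T (const_series (scoeff v c))) b))) a)"
      unfolding locD[OF S, of "T v"] locD[OF T, of v]
      by (simp add: additive.sum[OF additive_coeff[OF S]] case_prod_beta)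
    also have "\<dots> = (\<Sum>(p, c)\<in>splits m. \<Sum>(a, b)\<in>splits p.
       scoeff (S (const_series (scoeff (T (const_series (scoeff v c))) b))) a)"
      by (rule splits_assoc[symmetric])
    also have "\<dots> = (\<Sum>(p, c)\<in>splits m. scoeff (S (T (const_series (scoeff v c)))) p)"
      unfolding locD[OF S, of "T (const_series _)"] ..
    finally show ?thesis .
  qed
  moreover have "additive (\<lambda>x. S (T (const_series x)))"
    using loc_additive[OF T] by (simp add: additive_def loc_add[OF S])
  ultimately show ?thesis unfolding loc_def by blast
qed

lemma loc_conv_right: assumes "biadd f" shows "loc (conv f u)"
  unfolding loc_def
proof (intro conjI allI)
  show "additive (\<lambda>x. conv f u (const_series x))"
    unfolding additive_def
    by (intro allI series_eqI) (simp only: conv_const_right[OF assms] scoeff_add biadd_add[OF assms])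
  show "scoeff (conv f u v) m = (\<Sum>(a, b)\<in>splits m. scoeff (conv f u (const_series (scoeff v b))) a)" for v m
    by (simp only: conv_const_right[OF assms]) (simp add: scoeff_conv)
qed

lemma loc_conv_left: assumes "biadd f" shows "loc (\<lambda>u. conv f u v)"
  unfolding loc_def
proof (intro conjI allI)
  show "additive (\<lambda>x. conv f (const_series x) v)"
    unfolding additive_def
    by (intro allI series_eqI) (simp only: conv_const_left[OF assms] scoeff_add biadd_add[OF assms])
  fix u m
  show "scoeff (conv f u v) m = (\<Sum>(a, b)\<in>splits m. scoeff (conv f (const_series (scoeff u b)) v) a)"
    by (simp only: conv_const_left[OF assms], subst splits_swap) (simp add: scoeff_conv)
qed

lemma loc_map: assumes "additive f" shows "loc (map_series f)"
  unfolding loc_def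
proof (intro conjI allI)
  show "additive (\<lambda>x. map_series f (const_series x))"
    by (auto simp: additive_def additive.add[OF assms] additive.zero[OF assms] intro!: series_eqI)
  fix v m
  show "scoeff (map_series f v) m = (\<Sum>(a, b)\<in>splits m. scoeff (map_series f (const_series (scoeff v b))) a)"
    by (subst sum_splits_left) (auto simp: additive.zero[OF assms])
qed

lemma loc_id: "loc (\<lambda>v. v)"
proof -
  have "map_series (\<lambda>x. x) = (\<lambda>v. v :: 'a series)"
    by (intro ext series_eqI) simp
  with loc_map[of "\<lambda>x::'a. x"] show ?thesis by (simp add: additive_def)
qed

lemma loc_funpow: "loc T \<Longrightarrow> loc (T ^^ n)" for T :: "'a::ab_group_add series \<Rightarrow> 'a series"
proof (induction n)
  case 0
  have "T ^^ 0 = (\<lambda>v. v)" by (rule ext) simp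
  then show ?case using loc_id by (simp only:)
next
  case (Suc n) then show ?case using loc_comp[of T "T ^^ n"] by (simp add: comp_def)
qed

section \<open>Generating functions of alphabets and their logarithms\<close>

subsection \<open>Alphabets of linear letters\<close>

lemma unit_inv_right: "u dvd 1 \<Longrightarrow> u * unit_inv u = (1 :: 'a::comm_ring_1)"
  by (metis dvd_def unit_inv_eqI)

text \<open>Every representation of the exponent as a difference gives the same value, which keeps
  \<open>unit_powi_add\<close> free of sign cases.\<close>

lemma unit_powi_diff:
  assumes "u dvd (1 :: 'a::comm_ring_1)"
  shows "unit_powi u (int p - int q) = u ^ p * unit_inv u ^ q"
proof (cases "q \<le> p")
  case True
  have "u ^ p * unit_inv u ^ q = u ^ (p - q) * (u * unit_inv u) ^ q"
    using power_add[of u "p - q" q] True by (simp add: power_mult_distrib mult.assoc)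
  with True show ?thesis
    by (simp add: unit_powi_def unit_inv_right[OF assms] nat_diff_distrib)
next
  case False
  have "u ^ p * unit_inv u ^ q = unit_inv u ^ (q - p) * (u * unit_inv u) ^ p"
    using power_add[of "unit_inv u" "q - p" p] False by (simp add: power_mult_distrib mult_ac)
  with False show ?thesis
    by (simp add: unit_powi_def unit_inv_right[OF assms] nat_diff_distrib)
qed

lemma unit_powi_add:
  assumes "u dvd (1 :: 'a::comm_ring_1)"
  shows "unit_powi u (a + b) = unit_powi u a * unit_powi u b"
proof -
  obtain p q r s where ab: "a = int p - int q" "b = int r - int s"
    by (metis int_diff_cases)
  then have "a + b = int (p + r) - int (q + s)" by simp
  then show ?thesis
    by (simp only: ab unit_powi_diff[OF assms] power_add mult_ac)
qed

lemma unit_powi_0 [simp]: "unit_powi u 0 = (1 :: 'a::comm_ring_1)"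
  and unit_powi_1 [simp]: "unit_powi u 1 = u"
  by (simp_all add: unit_powi_def)

text \<open>Multiplicative extension of \<open>\<phi>\<close> from letters to alphabets. Up to the
  sign of the alphabet, \<open>hgen\<close>, \<open>egen\<close>, \<open>hR\<close> and
  \<open>xprod\<close> are all of this shape.\<close>

definition alph_prod :: "('z \<Rightarrow> 'a::comm_ring_1) \<Rightarrow> ('z \<Rightarrow>\<^sub>0 int) \<Rightarrow> 'a" where
  "alph_prod \<phi> X = (\<Prod>z\<in>Poly_Mapping.keys X. unit_powi (\<phi> z) (Poly_Mapping.lookup X z))"

lemma alph_prod_superset:
  "finite K \<Longrightarrow> Poly_Mapping.keys X \<subseteq> K \<Longrightarrow>
    alph_prod \<phi> X = (\<Prod>z\<in>K. unit_powi (\<phi> z) (Poly_Mapping.lookup X z))"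
  unfolding alph_prod_def by (rule prod.mono_neutral_left) (auto simp: in_keys_iff)

lemma alph_prod_add:
  assumes "\<And>z. z \<in> Poly_Mapping.keys X \<union> Poly_Mapping.keys Y \<Longrightarrow> \<phi> z dvd 1"
  shows "alph_prod \<phi> (X + Y) = alph_prod \<phi> X * alph_prod \<phi> Y"
proof -
  let ?K = "Poly_Mapping.keys X \<union> Poly_Mapping.keys Y"
  have "alph_prod \<phi> (X + Y) = (\<Prod>z\<in>?K. unit_powi (\<phi> z) (Poly_Mapping.lookup (X + Y) z))"
    by (rule alph_prod_superset) (simp_all add: Poly_Mapping.keys_add)
  also have "\<dots> = (\<Prod>z\<in>?K. unit_powi (\<phi> z) (Poly_Mapping.lookup X z) * unit_powi (\<phi> z) (Poly_Mapping.lookup Y z))"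
    by (intro prod.cong refl) (simp add: lookup_add unit_powi_add assms)
  also have "\<dots> = alph_prod \<phi> X * alph_prod \<phi> Y"
    by (simp add: prod.distrib alph_prod_superset[of ?K])
  finally show ?thesis .
qed

lemma alph_prod_zero [simp]: "alph_prod \<phi> 0 = 1"
  by (simp add: alph_prod_def)

lemma alph_prod_single [simp]: "alph_prod \<phi> (Poly_Mapping.single z c) = unit_powi (\<phi> z) c"
  by (cases "c = 0") (simp_all add: alph_prod_def)

lemma alph_prod_hom:
  fixes h :: "'a::comm_ring_1 \<Rightarrow> 'b::comm_ring_1"
  assumes mult: "\<And>x y. h (x * y) = h x * h y" and one: "h 1 = 1"
    and unit: "\<And>z. z \<in> Poly_Mapping.keys X \<Longrightarrow> \<phi> z dvd 1"
  shows "h (alph_prod \<phi> X) = alph_prod (\<lambda>z. h (\<phi> z)) X"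
proof -
  have pow: "h (x ^ n) = h x ^ n" for x n
    by (induction n) (simp_all add: mult one)
  have "h (unit_inv u) = unit_inv (h u)" if "u dvd 1" for u
    by (metis mult one that unit_inv_eqI unit_inv_right)
  then have powi: "h (unit_powi u c) = unit_powi (h u) c" if "u dvd 1" for u c
    using that by (simp add: unit_powi_def pow)
  have prod: "h (\<Prod>z\<in>S. f z) = (\<Prod>z\<in>S. h (f z))" for S and f :: "_ \<Rightarrow> 'a"
    by (induction S rule: infinite_finite_induct) (simp_all add: mult one)
  show ?thesis
    unfolding alph_prod_def prod by (intro prod.cong refl powi unit)
qed

lemma one_minus_unit:
  fixes y :: "'a::comm_ring_1 series"
  assumes y: "scoeff y 0 = 0"
  shows "(1 - y) dvd 1"
proof
  have van: "vanish k (y ^ k)" for k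
  proof (induction k)
    case (Suc k)
    then show ?case
      using vanish_conv[OF biadd_times, of 1 y k "y ^ k"] y
      by (simp add: times_series_def vanish_1_iff)
  qed (simp add: vanish_def)
  \<comment> \<open>The geometric series, truncated separately for every monomial:
    \<open>y ^ k\<close> has no terms of degree below k, so a larger bound gives the same
    coefficient.\<close>
  define g where "g = Series (\<lambda>m. \<Sum>k\<le>mdeg m. scoeff (y ^ k) m)"
  have g: "scoeff g m = (\<Sum>k\<le>N. scoeff (y ^ k) m)" if "mdeg m \<le> N" for m N
    unfolding g_def scoeff_Series using that van
    by (intro sum.mono_neutral_left) (auto simp: vanish_def)
  show "1 = (1 - y) * g"
  proof (rule series_eqI)
    fix m
    let ?N = "mdeg m"
    have "scoeff (y * g) m = (\<Sum>(a, b)\<in>splits m. \<Sum>k\<le>?N. scoeff y a * scoeff (y ^ k) b)"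
      unfolding scoeff_times
    proof (intro sum.cong refl, clarify)
      fix a b assume "(a, b) \<in> splits m"
      then have "mdeg b \<le> ?N" by auto
      then show "scoeff y a * scoeff g b = (\<Sum>k\<le>?N. scoeff y a * scoeff (y ^ k) b)"
        by (simp add: g sum_distrib_left)
    qed
    also have "\<dots> = (\<Sum>k\<le>?N. scoeff (y ^ Suc k) m)"
      by (simp add: scoeff_times case_prod_beta) (rule sum.swap)
    also have "\<dots> = (\<Sum>k=1..Suc ?N. scoeff (y ^ k) m)"
      by (simp only: One_nat_def sum.shift_bounds_cl_Suc_ivl atMost_atLeast0)
    finally have "scoeff (y * g) m = (\<Sum>k=1..Suc ?N. scoeff (y ^ k) m)" .
    moreover have "scoeff g m = (\<Sum>k=0..Suc ?N. scoeff (y ^ k) m)"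
      by (subst g[of m "Suc ?N"]) (simp_all add: atMost_atLeast0)
    ultimately have "scoeff g m - scoeff (y * g) m = scoeff (y ^ 0) m"
      by (simp add: sum.atLeast_Suc_atMost[of 0] del: power_Suc power_0)
    then show "scoeff 1 m = scoeff ((1 - y) * g) m"
      by (simp add: left_diff_distrib)
  qed
qed

text \<open>Homogeneous of degree one, so that \<beta>_i and -\<alpha>_i are both admissible
  letters.\<close>

definition lin1 :: "'k::comm_ring_1 series \<Rightarrow> bool" where
  "lin1 z \<longleftrightarrow> (\<forall>m. mdeg m \<noteq> 1 \<longrightarrow> scoeff z m = 0)"

lemma lin1_var [simp]: "lin1 (var_series v)"
  and lin1_uminus [simp]: "lin1 z \<Longrightarrow> lin1 (- z)"
  by (auto simp: lin1_def var_series_def)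

lemma lin1_0: "lin1 z \<Longrightarrow> scoeff z 0 = 0"
  by (simp add: lin1_def)

lemma lin1_unit: "lin1 z \<Longrightarrow> 1 - z dvd 1" "lin1 z \<Longrightarrow> 1 + z dvd 1"
  using one_minus_unit[of z] one_minus_unit[of "- z"] by (simp_all add: lin1_0)

lemma euler_lin1: "lin1 z \<Longrightarrow> euler z = z"
proof (rule series_eqI)
  fix m assume "lin1 z"
  then show "scoeff (euler z) m = scoeff z m"
    by (cases "mdeg m = 1") (auto simp: lin1_def)
qed

definition homog :: "'k::comm_ring_1 alphabet \<Rightarrow> bool" where
  "homog X \<longleftrightarrow> (\<forall>z\<in>Poly_Mapping.keys X. lin1 z)"

lemma homogD: "homog X \<Longrightarrow> z \<in> Poly_Mapping.keys X \<Longrightarrow> lin1 z"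
  by (simp add: homog_def)

lemma homog_zero [simp]: "homog 0"
  by (simp add: homog_def)

lemma homog_add [simp]: "homog X \<Longrightarrow> homog Y \<Longrightarrow> homog (X + Y)"
  unfolding homog_def using Poly_Mapping.keys_add[of X Y] by blast

lemma homog_uminus [simp]: "homog (- X) \<longleftrightarrow> homog X"
  by (simp add: homog_def)

lemma homog_diff [simp]: "homog X \<Longrightarrow> homog Y \<Longrightarrow> homog (X - Y)"
  using homog_add[of X "- Y"] by simp

lemma homog_single [simp]: "lin1 z \<Longrightarrow> homog (Poly_Mapping.single z c)"
  by (simp add: homog_def)

lemma homog_sum: "(\<And>i. i \<in> I \<Longrightarrow> homog (f i)) \<Longrightarrow> homog (\<Sum>i\<in>I. f i)"
  by (induction I rule: infinite_finite_induct) auto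

lemma homog_xs [simp]: "homog (xs_alph n)"
  and homog_A [simp]: "homog (A_alph k)"
  and homog_B [simp]: "homog (B_alph k)"
  by (auto simp: xs_alph_def A_alph_def B_alph_def intro!: homog_sum)

lemma alph_induct [consumes 1, case_names zero single add]:
  assumes "homog X" "P 0" "\<And>z c. lin1 z \<Longrightarrow> P (Poly_Mapping.single z c)"
    "\<And>X Y. homog X \<Longrightarrow> homog Y \<Longrightarrow> P X \<Longrightarrow> P Y \<Longrightarrow> P (X + Y)"
  shows "P X"
proof -
  have "P (\<Sum>z\<in>S. Poly_Mapping.single z (Poly_Mapping.lookup X z)) \<and>
      homog (\<Sum>z\<in>S. Poly_Mapping.single z (Poly_Mapping.lookup X z))"
    if "finite S" "S \<subseteq> Poly_Mapping.keys X" for S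
    using that
  proof (induction S)
    case (insert z S)
    then have "lin1 z" using assms(1) by (auto simp: homog_def)
    with insert show ?case by (simp add: assms(3,4))
  qed (simp add: assms(2))
  from this[of "Poly_Mapping.keys X"] show ?thesis
    by (simp flip: poly_mapping_sum_single)
qed

text \<open>All letters have degree one, so the total degree can play the role of the variable \<open>t\<close> of the
  generating function of the \<open>h\<^sub>m\<close>, which is evaluated at \<open>t = 1\<close>.\<close>

definition hR :: "'k::comm_ring_1 alphabet \<Rightarrow> 'k series" where
  "hR X = alph_prod (\<lambda>z. 1 - z) (- X)"

lemma hR_zero [simp]: "hR 0 = 1"
  by (simp add: hR_def)

lemma hR_add: "homog X \<Longrightarrow> homog Y \<Longrightarrow> hR (X + Y) = hR X * hR Y"
  unfolding hR_def minus_add_distrib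
  by (rule alph_prod_add) (auto dest: homogD lin1_unit)

lemma hR_uminus_right: "homog X \<Longrightarrow> hR X * hR (- X) = 1"
  using hR_add[of X "- X"] by simp

lemma hR_uminus_letter: "hR (- letter z) = 1 - z"
  by (simp add: hR_def)

lemma hR_single: "hR (Poly_Mapping.single z c) = unit_powi (1 - z) (- c)"
  by (simp add: hR_def flip: single_uminus)

lemma hR_0: assumes "homog X" shows "scoeff (hR X) 0 = 1"
  using assms
proof (induction rule: alph_induct)
  case (single z c)
  have h: "scoeff (x * y) 0 = scoeff x 0 * scoeff y 0" for x y :: "'a series"
    by (simp add: scoeff_times)
  have "scoeff (unit_inv (1 - z)) 0 = 1"
  proof -
    have "scoeff ((1 - z) * unit_inv (1 - z)) 0 = 1"
      unfolding unit_inv_right[OF lin1_unit(1)[OF single]] by (simp add: scoeff_one)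
    then show ?thesis by (simp add: h lin1_0[OF single] scoeff_one)
  qed
  moreover have "scoeff (x ^ n) 0 = 1" if "scoeff x 0 = 1" for x :: "'a series" and n
    using that by (induction n) (simp_all add: h scoeff_one)
  ultimately show ?case
    unfolding hR_single unit_powi_def using single by (simp add: scoeff_one lin1_0)
next
  case (add X Y)
  then show ?case by (simp add: hR_add scoeff_times)
qed (simp add: scoeff_one)

subsection \<open>Homogeneous parts\<close>

definition dpart :: "int \<Rightarrow> 'a::zero series \<Rightarrow> 'a series" where
  "dpart k c = Series (\<lambda>m. if int (mdeg m) = k then scoeff c m else 0)"

lemma scoeff_dpart [simp]: "scoeff (dpart k c) m = (if int (mdeg m) = k then scoeff c m else 0)"
  by (simp add: dpart_def)

text \<open>Writes the total degree into the exponent of a formal variable. This is multiplicative,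
  and it recovers \<open>hgen\<close> from \<open>hR\<close>.\<close>

definition dfps :: "'a::comm_ring_1 series \<Rightarrow> 'a series fps" where
  "dfps c = Abs_fps (\<lambda>k. dpart (int k) c)"

lemma dpart_mult: "dpart (int k) (c * d) = (\<Sum>i=0..k. dpart (int i) c * dpart (int (k - i)) d)"
proof (rule series_eqI)
  fix m
  have "scoeff (\<Sum>i=0..k. dpart (int i) c * dpart (int (k - i)) d) m =
    (\<Sum>(a, b)\<in>splits m. \<Sum>i=0..k. if mdeg a = i \<and> mdeg b = k - i then scoeff c a * scoeff d b else 0)"
    unfolding scoeff_sum scoeff_times
    by (subst sum.swap, intro sum.cong refl, clarify, intro sum.cong refl) auto
  also have "\<dots> = (\<Sum>(a, b)\<in>splits m. if mdeg m = k then scoeff c a * scoeff d b else 0)"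
  proof (intro sum.cong refl, clarify)
    fix a b assume "(a, b) \<in> splits m"
    then have m: "mdeg m = mdeg a + mdeg b" by auto
    have "(\<Sum>i=0..k. if mdeg a = i \<and> mdeg b = k - i then scoeff c a * scoeff d b else 0) =
      (\<Sum>i=0..k. if i = mdeg a then (if mdeg m = k then scoeff c a * scoeff d b else 0) else 0)"
      by (intro sum.cong refl) (auto simp: m)
    then show "(\<Sum>i=0..k. if mdeg a = i \<and> mdeg b = k - i then scoeff c a * scoeff d b else 0) =
      (if mdeg m = k then scoeff c a * scoeff d b else 0)"
      by (auto simp: m)
  qed
  finally show "scoeff (dpart (int k) (c * d)) m =
      scoeff (\<Sum>i=0..k. dpart (int i) c * dpart (int (k - i)) d) m"
    by (simp add: scoeff_times)
qed

lemma dfps_mult: "dfps (c * d) = dfps c * dfps d"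
  by (rule fps_ext) (simp add: dfps_def fps_mult_nth dpart_mult)

lemma dfps_one: "dfps 1 = 1"
  by (rule fps_ext, rule series_eqI) (auto simp: dfps_def scoeff_one fps_one_nth)

lemma dfps_add: "dfps (c + d) = dfps c + dfps d"
  and dfps_diff: "dfps (c - d) = dfps c - dfps d"
  by (rule fps_ext, rule series_eqI, simp add: dfps_def)+

lemma dfps_lin1:
  assumes "lin1 z" shows "dfps z = fps_const z * fps_X"
proof (rule fps_ext, rule series_eqI)
  fix n m
  show "scoeff (fps_nth (dfps z) n) m = scoeff (fps_nth (fps_const z * fps_X) n) m"
    using assms by (cases "n = 1") (auto simp: dfps_def lin1_def fps_X_def)
qed

lemma hgen_eq: assumes "homog X" shows "hgen X = dfps (hR X)"
proof -
  have "dfps (hR X) = alph_prod (\<lambda>z. dfps (1 - z)) (- X)"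
    unfolding hR_def
    by (rule alph_prod_hom) (use assms in \<open>auto simp: dfps_mult dfps_one dest: homogD lin1_unit\<close>)
  also have "\<dots> = hgen X"
    unfolding alph_prod_def hgen_def
    by (intro prod.cong) (use assms in \<open>auto simp: dfps_diff dfps_one dfps_lin1 dest: homogD\<close>)
  finally show ?thesis by simp
qed

lemma hfun_eq: "homog X \<Longrightarrow> hfun k X = dpart k (hR X)"
  by (auto simp: hfun_def hgen_eq dfps_def intro!: series_eqI)

definition sgn_pow :: "int \<Rightarrow> 'a::comm_ring_1" where
  "sgn_pow k = (if even k then 1 else - 1)"

lemma sgn_pow_add: "sgn_pow (i + j) = sgn_pow i * sgn_pow j"
  and sgn_pow_diff: "sgn_pow (i - j) = sgn_pow i * sgn_pow j"
  and sgn_pow_nat: "sgn_pow (int n) = (-1) ^ n"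
  by (auto simp: sgn_pow_def)

text \<open>Substitutes -v for every variable v, which exchanges the factors 1 - z and 1 + z of the
  two kinds of generating functions.\<close>

definition twist :: "'a::comm_ring_1 series \<Rightarrow> 'a series" where
  "twist c = Series (\<lambda>m. sgn_pow (int (mdeg m)) * scoeff c m)"

lemma twist_mult: "twist (c * d) = twist c * twist d"
  by (rule series_eqI)
     (auto simp: twist_def scoeff_times sum_distrib_left sgn_pow_add case_prod_beta mult_ac intro!: sum.cong)

lemma twist_one_minus: "lin1 z \<Longrightarrow> twist (1 - z) = 1 + z"
  by (rule series_eqI) (auto simp: twist_def scoeff_one lin1_def sgn_pow_def)

lemma efun_eq: assumes "homog X" shows "efun k X = dpart k (twist (hR (- X)))"
proof -
  have "dfps (twist (hR (- X))) = alph_prod (\<lambda>z. dfps (twist (1 - z))) X"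
    unfolding hR_def minus_minus
    by (rule alph_prod_hom[where h = "\<lambda>c. dfps (twist c)"])
       (use assms in \<open>auto simp: dfps_mult twist_mult dest: homogD lin1_unit\<close>,
        simp add: dfps_one[symmetric], rule arg_cong[of _ _ dfps],
        rule series_eqI, simp add: twist_def scoeff_one sgn_pow_def)
  also have "\<dots> = egen X"
    unfolding alph_prod_def egen_def
    by (intro prod.cong) (use assms in \<open>auto simp: twist_one_minus dfps_add dfps_one dfps_lin1 dest: homogD\<close>)
  finally have "egen X = dfps (twist (hR (- X)))" by simp
  then show ?thesis
    by (auto simp: efun_def dfps_def intro!: series_eqI)
qed

lemma efun_hfun: "homog X \<Longrightarrow> efun k X = sgn_pow k * hfun k (- X)"
proof -
  assume X: "homog X"
  have "scoeff (sgn_pow k * c) m = sgn_pow k * scoeff c m" for c :: "'a series" and m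
    by (simp add: sgn_pow_def)
  with X show ?thesis
    by (intro series_eqI) (auto simp: efun_eq hfun_eq twist_def)
qed

subsection \<open>Laurent series\<close>

type_synonym 'k laurent = "(int \<Rightarrow>\<^sub>0 'k) series"

text \<open>\<open>tau s\<close> restores the variable: it substitutes \<open>t\<^sup>s v\<close> for every variable \<open>v\<close>.\<close>

definition tau :: "int \<Rightarrow> 'k::comm_ring_1 series \<Rightarrow> 'k laurent" where
  "tau s c = Series (\<lambda>m. Poly_Mapping.single (s * int (mdeg m)) (scoeff c m))"

lemma scoeff_tau [simp]: "scoeff (tau s c) m = Poly_Mapping.single (s * int (mdeg m)) (scoeff c m)"
  by (simp add: tau_def)

definition coef :: "int \<Rightarrow> 'k::comm_ring_1 laurent \<Rightarrow> 'k series" where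
  "coef n u = map_series (\<lambda>p. Poly_Mapping.lookup p n) u"

lemma scoeff_coef [simp]: "scoeff (coef n u) m = Poly_Mapping.lookup (scoeff u m) n"
  by (simp add: coef_def)

definition tpow :: "int \<Rightarrow> 'k::comm_ring_1 laurent" where
  "tpow k = const_series (Poly_Mapping.single k 1)"

lemma laurent_eqI: "(\<And>n. coef n u = coef n v) \<Longrightarrow> u = v"
  by (intro series_eqI poly_mapping_eqI) (metis scoeff_coef)

lemma coef_add: "coef n (u + v) = coef n u + coef n v"
  and coef_diff: "coef n (u - v) = coef n u - coef n v"
  and coef_zero [simp]: "coef n 0 = 0"
  by (auto intro!: series_eqI simp: lookup_add lookup_minus)

lemma coef_sum: "coef n (\<Sum>i\<in>I. f i) = (\<Sum>i\<in>I. coef n (f i))"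
  by (induction I rule: infinite_finite_induct) (auto simp: coef_add)

lemma single_sum: "Poly_Mapping.single n (\<Sum>i\<in>I. f i) = (\<Sum>i\<in>I. Poly_Mapping.single n (f i))"
  by (induction I rule: infinite_finite_induct) (simp_all add: single_add)

lemma tau_mult: "tau s (c * d) = tau s c * tau s d"
proof (rule series_eqI)
  fix m
  have "scoeff (tau s (c * d)) m = (\<Sum>(a, b)\<in>splits m. Poly_Mapping.single (s * int (mdeg m)) (scoeff c a * scoeff d b))"
    by (simp add: scoeff_times case_prod_beta single_sum)
  also have "\<dots> = scoeff (tau s c * tau s d) m"
    unfolding scoeff_times by (intro sum.cong refl) (auto simp: mult_single distrib_left)
  finally show "scoeff (tau s (c * d)) m = scoeff (tau s c * tau s d) m" .
qed

lemma tau_one [simp]: "tau s 1 = 1"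
  by (rule series_eqI) (auto simp: scoeff_one)

lemma tau_add: "tau s (c + d) = tau s c + tau s d"
  and tau_uminus: "tau s (- c) = - tau s c"
  and tau_diff: "tau s (c - d) = tau s c - tau s d"
  and tau_zero [simp]: "tau s 0 = 0"
  by (auto intro!: series_eqI simp: single_add single_diff single_uminus)

lemma euler_tau: "euler (tau s c) = tau s (euler c)"
proof (rule series_eqI)
  fix m
  show "scoeff (euler (tau s c)) m = scoeff (tau s (euler c)) m"
    by (simp add: single_sum del: sum_constant)
qed

lemma tau_lin1: "lin1 z \<Longrightarrow> tau s z = tau 0 z * tpow s"
proof (rule series_eqI)
  fix m assume z: "lin1 z"
  have "scoeff (tau 0 z * tpow s) m = Poly_Mapping.single 0 (scoeff z m) * Poly_Mapping.single s 1"
    unfolding scoeff_times tpow_def by (subst sum_splits_right) auto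
  then show "scoeff (tau s z) m = scoeff (tau 0 z * tpow s) m"
    using z by (cases "mdeg m = 1") (auto simp: mult_single lin1_def)
qed

lemma tpow_add: "tpow (i + j) = tpow i * tpow j"
  by (rule series_eqI) (auto simp: tpow_def scoeff_times mult_single sum_splits_left)

lemma tpow_0 [simp]: "tpow 0 = 1"
  by (rule series_eqI) (auto simp: tpow_def scoeff_one)

lemma coef_tpow: "coef n (tpow k * u) = coef (n - k) u"
proof (rule series_eqI)
  fix m
  have 1: "Poly_Mapping.lookup (Poly_Mapping.single k 1 * p) n = Poly_Mapping.lookup p (n - k)"
    for p :: "int \<Rightarrow>\<^sub>0 'a"
  proof (induction p rule: free_alg_induct)
    case (single w c)
    show ?case by (auto simp: mult_single lookup_single when_def)
  qed (simp_all add: distrib_left lookup_add)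
  have "scoeff (tpow k * u) m = Poly_Mapping.single k 1 * scoeff u m"
    unfolding scoeff_times tpow_def by (subst sum_splits_left) auto
  then show "scoeff (coef n (tpow k * u)) m = scoeff (coef (n - k) u) m"
    by (simp add: 1)
qed

lemma coef_tau_0_mult: "coef n (tau 0 c * u) = c * coef n u"
proof (rule series_eqI)
  fix m
  have 1: "Poly_Mapping.lookup (Poly_Mapping.single 0 x * p) n = x * Poly_Mapping.lookup p n"
    for x :: 'a and p :: "int \<Rightarrow>\<^sub>0 'a"
  proof (induction p rule: free_alg_induct)
    case (single w c)
    show ?case by (auto simp: mult_single lookup_single when_def)
  qed (simp_all add: distrib_left lookup_add)
  show "scoeff (coef n (tau 0 c * u)) m = scoeff (c * coef n u) m"
    by (simp add: scoeff_times lookup_sum case_prod_beta 1)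
qed

lemma coef_tau: "s * s = 1 \<Longrightarrow> coef n (tau s c) = dpart (s * n) c"
  by (rule series_eqI) (auto simp: lookup_single when_def zmult_eq_1_iff)

lemma coef_tau_mult:
  "scoeff (coef n (tau s c * tau s' d)) m =
    (\<Sum>(a, b)\<in>splits m. if s * int (mdeg a) + s' * int (mdeg b) = n then scoeff c a * scoeff d b else 0)"
  unfolding scoeff_coef scoeff_times lookup_sum
  by (intro sum.cong refl) (auto simp: mult_single lookup_single when_def)

text \<open>The two factors carry opposite powers of t, so the exponent measures the difference of
  the degrees. Both signs of \<open>s\<close> occur: the fields produce the x-part in negative
  powers of t, the Newton bases in positive ones.\<close>

lemma ominus_eq:
  assumes s: "s * s = 1"
  shows "series_sum (\<lambda>(i, j). dpart (int i) c * dpart (int j) d) {(i, j). int i - int j = k} =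
    coef (s * k) (tau s c * tau (- s) d)"
proof (rule series_eqI)
  fix m
  define J where "J = {(i, j). i \<le> mdeg m \<and> j \<le> mdeg m \<and> int i - int j = k}"
  have fin: "finite J"
    by (rule finite_subset[of _ "{..mdeg m} \<times> {..mdeg m}"]) (auto simp: J_def)
  have zero: "scoeff (dpart (int i) c * dpart (int j) d) m = 0" if "i > mdeg m \<or> j > mdeg m" for i j
    unfolding scoeff_times by (rule sum.neutral) (use that in auto)
  have "scoeff (series_sum (\<lambda>(i, j). dpart (int i) c * dpart (int j) d) {(i, j). int i - int j = k}) m
    = (\<Sum>p\<in>J. scoeff ((\<lambda>(i, j). dpart (int i) c * dpart (int j) d) p) m)"
    by (rule series_sum_coeff[OF fin]) (auto simp: J_def intro!: zero)
  also have "\<dots> = (\<Sum>(a, b)\<in>splits m. \<Sum>(i, j)\<in>J. if (i, j) = (mdeg a, mdeg b) then scoeff c a * scoeff d b else 0)"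
    unfolding case_prod_beta scoeff_times
    by (subst sum.swap) (intro sum.cong refl, auto)
  also have "\<dots> = (\<Sum>(a, b)\<in>splits m. if int (mdeg a) - int (mdeg b) = k then scoeff c a * scoeff d b else 0)"
  proof (intro sum.cong refl, clarify)
    fix a b assume "(a, b) \<in> splits m"
    then have "(mdeg a, mdeg b) \<in> J \<longleftrightarrow> int (mdeg a) - int (mdeg b) = k"
      by (auto simp: J_def)
    moreover have "(\<Sum>(i, j)\<in>J. if (i, j) = (mdeg a, mdeg b) then scoeff c a * scoeff d b else 0)
       = (\<Sum>p\<in>J. if p = (mdeg a, mdeg b) then scoeff c a * scoeff d b else 0)"
      by (simp add: case_prod_beta prod_eq_iff)
    ultimately show "(\<Sum>(i, j)\<in>J. if (i, j) = (mdeg a, mdeg b) then scoeff c a * scoeff d b else 0) =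
      (if int (mdeg a) - int (mdeg b) = k then scoeff c a * scoeff d b else 0)"
      using fin by (simp add: sum.delta)
  qed
  also have "\<dots> = scoeff (coef (s * k) (tau s c * tau (- s) d)) m"
    unfolding coef_tau_mult by (intro sum.cong refl) (use s in \<open>auto simp: zmult_eq_1_iff\<close>)
  finally show "scoeff (series_sum (\<lambda>(i, j). dpart (int i) c * dpart (int j) d) {(i, j). int i - int j = k}) m
    = scoeff (coef (s * k) (tau s c * tau (- s) d)) m" .
qed

lemma h_ominus_eq:
  assumes "homog X" "homog Y" "s * s = 1"
  shows "h_ominus k X Y = coef (s * k) (tau s (hR X) * tau (- s) (hR Y))"
  unfolding h_ominus_def using assms by (simp add: hfun_eq ominus_eq)

lemma e_ominus_eq:
  assumes "homog X" "homog Y" shows "e_ominus k X Y = sgn_pow k * h_ominus k (- X) (- Y)"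
proof -
  have "e_ominus k X Y = coef (1 * k) (tau 1 (twist (hR (- X))) * tau (- 1) (twist (hR (- Y))))"
    unfolding e_ominus_def using assms by (simp add: efun_eq ominus_eq[of 1, simplified])
  also have "\<dots> = sgn_pow k * coef (1 * k) (tau 1 (hR (- X)) * tau (- 1) (hR (- Y)))"
  proof (rule series_eqI)
    fix m
    have s: "scoeff (sgn_pow k * c) m = sgn_pow k * scoeff c m" for c :: "'a series"
      by (simp add: sgn_pow_def)
    show "scoeff (coef (1 * k) (tau 1 (twist (hR (- X))) * tau (- 1) (twist (hR (- Y))))) m =
      scoeff (sgn_pow k * coef (1 * k) (tau 1 (hR (- X)) * tau (- 1) (hR (- Y)))) m"
      unfolding s coef_tau_mult sum_distrib_left
      by (intro sum.cong refl) (auto simp: twist_def sgn_pow_diff mult_ac)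
  qed
  also have "\<dots> = sgn_pow k * h_ominus k (- X) (- Y)"
    using assms by (simp add: h_ominus_eq[of _ _ 1, simplified])
  finally show ?thesis .
qed

subsection \<open>Power sums\<close>

text \<open>\<open>\<Sum>\<^sub>k p\<^sub>k(X)/k\<close>, the logarithm of \<open>hR X\<close>.\<close>

definition pR :: "'k::field_char_0 alphabet \<Rightarrow> 'k series" where
  "pR X = Series (\<lambda>m. scoeff (psum (mdeg m) X) m / of_nat (mdeg m))"

lemma psum_add: "psum k (X + Y) = psum k X + psum k Y"
  unfolding psum_def by (rule sum_keys_add) (simp add: distrib_right)

lemma psum_zero [simp]: "psum k 0 = 0"
  by (simp add: psum_def)

lemma psum_uminus: "psum k (- X) = - psum k X"
  using psum_add[of k X "- X"] by (simp add: eq_neg_iff_add_eq_0 add.commute)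

lemma psum_single [simp]: "psum k (Poly_Mapping.single z c) = of_int c * z ^ k"
  by (cases "c = 0") (simp_all add: psum_def)

lemma pR_add: "pR (X + Y) = pR X + pR Y"
  and pR_uminus: "pR (- X) = - pR X"
  and pR_zero [simp]: "pR 0 = 0"
  by (auto intro!: series_eqI simp: pR_def psum_add psum_uminus add_divide_distrib)

lemma pR_0 [simp]: "scoeff (pR X) 0 = 0"
  by (simp add: pR_def)

lemma lin1_power: "lin1 z \<Longrightarrow> mdeg m \<noteq> k \<Longrightarrow> scoeff (z ^ k) m = 0"
proof (induction k arbitrary: m)
  case (Suc k)
  have "scoeff z a * scoeff (z ^ k) b = 0" if "a + b = m" for a b
    using Suc.prems Suc.IH[of b] that by (cases "mdeg a = 1") (auto simp: lin1_def)
  then show ?case by (auto simp: scoeff_times intro!: sum.neutral)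
qed (auto simp: scoeff_one)

lemma scoeff_of_int: "scoeff (of_int c * u) m = of_int c * scoeff u m"
  for u :: "'a::comm_ring_1 series"
proof -
  have "scoeff (of_nat n * u) m = of_nat n * scoeff u m" for n
    by (induction n) (simp_all add: distrib_right)
  moreover obtain p q where "c = int p - int q" by (metis int_diff_cases)
  ultimately show ?thesis by (simp add: left_diff_distrib)
qed

lemma psum_homog: "homog X \<Longrightarrow> mdeg m \<noteq> k \<Longrightarrow> scoeff (psum k X) m = 0"
  by (induction rule: alph_induct) (simp_all add: psum_add scoeff_of_int lin1_power)

lemma euler_pR: "scoeff (euler (pR X)) m = (if m = 0 then 0 else scoeff (psum (mdeg m) X) m)"
  by (simp add: pR_def)

text \<open>Differentiating \<Sum> z^k / k gives \<Sum> z^k over k \<ge> 1, that is z / (1 -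
  z).\<close>

lemma euler_hR_aux:
  fixes z :: "'k::field_char_0 series"
  assumes z: "lin1 z"
  shows "(1 - z) * euler (pR (letter z)) = z"
proof (rule series_eqI)
  fix m
  let ?q = "euler (pR (letter z))"
  have q: "scoeff ?q b = (if b = 0 then 0 else scoeff (z ^ mdeg b) b)" for b
    by (simp only: euler_pR psum_single) simp
  have "scoeff z a * scoeff ?q b =
      (if mdeg m \<le> 1 then 0 else scoeff z a * scoeff (z ^ (mdeg m - 1)) b)" if "a + b = m" for a b
    using that z by (cases "mdeg a = 1") (auto simp: q lin1_def simp del: scoeff_euler)
  then have "scoeff (z * ?q) m = (\<Sum>(a, b)\<in>splits m. if mdeg m \<le> 1 then 0 else scoeff z a * scoeff (z ^ (mdeg m - 1)) b)"
    unfolding scoeff_times by (intro sum.cong) auto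
  also have "\<dots> = (if mdeg m \<le> 1 then 0 else scoeff (z * z ^ (mdeg m - 1)) m)"
    by (simp add: scoeff_times)
  also have "\<dots> = (if mdeg m \<le> 1 then 0 else scoeff (z ^ mdeg m) m)"
    by (cases "mdeg m") auto
  finally have "scoeff ?q m - scoeff (z * ?q) m = scoeff z m"
    using z by (auto simp: q lin1_def le_Suc_eq simp del: scoeff_euler)
  then show "scoeff ((1 - z) * ?q) m = scoeff z m"
    by (simp add: left_diff_distrib)
qed

lemma euler_power:
  fixes u :: "'a::comm_ring_1 series"
  assumes "u * v = 1"
  shows "euler (u ^ n) = of_nat n * (euler u * v) * u ^ n"
proof (induction n)
  case (Suc n)
  have "euler u * u ^ n = euler u * (u * v) * u ^ n" by (simp add: assms)
  then have 1: "euler u * u ^ n = (euler u * v) * u ^ Suc n" by (simp add: mult_ac)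
  have "euler (u ^ Suc n) = euler u * u ^ n + u * euler (u ^ n)" by (simp add: euler_mult)
  also have "\<dots> = (euler u * v) * u ^ Suc n + of_nat n * (euler u * v) * u ^ Suc n"
    unfolding 1 Suc by (simp add: mult_ac)
  finally show ?case by (simp add: distrib_right)
qed simp

text \<open>The differential form of hR X = exp (pR X). The commutation rules for vertex operators
  ask for exactly this equation, so the exponential of \<open>pR X\<close> never has to be formed as
  a series.\<close>

lemma euler_hR:
  fixes X :: "'k::field_char_0 alphabet"
  assumes "homog X" shows "euler (hR X) = euler (pR X) * hR X"
  using assms
proof (induction rule: alph_induct)
  case (single z c)
  let ?u = "1 - z" and ?v = "unit_inv (1 - z)"
  have uv: "?u * ?v = 1" by (rule unit_inv_right[OF lin1_unit(1)[OF single]])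
  then have vu: "?v * ?u = 1" by (simp add: mult.commute)
  have eu: "euler ?u = - z" by (simp add: euler_diff euler_lin1 single)
  have "euler ?u * ?v + ?u * euler ?v = 0"
    using arg_cong[OF uv, of euler] by (simp add: euler_mult)
  have ev: "euler ?v * ?u = z * ?v"
    using \<open>euler ?u * ?v + ?u * euler ?v = 0\<close> by (simp add: eu mult.commute)
  have q: "euler (pR (letter z)) = z * ?v"
  proof -
    have "euler (pR (letter z)) = ?v * (?u * euler (pR (letter z)))"
      by (simp only: mult.assoc[symmetric] vu mult_1_left)
    then show ?thesis by (simp only: euler_hR_aux[OF single] mult.commute)
  qed
  have qc: "euler (pR (Poly_Mapping.single z c)) = of_int c * (z * ?v)"
    unfolding q[symmetric] by (rule series_eqI) (simp only: scoeff_of_int euler_pR psum_single, simp)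
  show ?case
  proof (cases "c \<le> 0")
    case True
    have "euler (hR (Poly_Mapping.single z c)) = of_nat (nat (- c)) * (- z * ?v) * ?u ^ nat (- c)"
      unfolding hR_single unit_powi_def using True euler_power[OF uv, of "nat (- c)"] by (simp add: eu)
    moreover have "(of_nat (nat (- c)) :: 'k series) = - of_int c"
      using True by (metis neg_0_le_iff_le of_int_minus of_int_of_nat_eq nat_0_le)
    ultimately show ?thesis
      unfolding qc hR_single unit_powi_def using True by simp
  next
    case False
    have "euler (hR (Poly_Mapping.single z c)) = of_nat (nat c) * (z * ?v) * ?v ^ nat c"
      unfolding hR_single unit_powi_def using False euler_power[OF vu, of "nat c"] by (simp add: ev)
    moreover have "(of_nat (nat c) :: 'k series) = of_int c"
      using False by (metis linear of_int_of_nat_eq nat_0_le)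
    ultimately show ?thesis
      unfolding qc hR_single unit_powi_def using False by simp
  qed
next
  case (add X Y)
  then show ?case by (simp add: hR_add euler_mult pR_add euler_add algebra_simps)
qed simp

section \<open>Currents and the vacuum form on single vectors\<close>

subsection \<open>Fock space\<close>

lemma lact_add_left: "lact (X + Y) v = lact X v + lact Y v"
  by transfer (simp add: distrib_right ket_eq_def ket_ideal.zero)
lemma lact_add_right: "lact X (u + v) = lact X u + lact X v"
  by transfer (simp add: distrib_left ket_eq_def ket_ideal.zero)
lemma lact_mult: "lact (X * Y) v = lact X (lact Y v)"
  by transfer (simp add: mult.assoc ket_eq_def ket_ideal.zero)
lemma lact_one [simp]: "lact 1 v = v"
  by transfer (simp add: ket_eq_def ket_ideal.zero)
lemma ract_mult: "ract w (X * Y) = ract (ract w X) Y"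
  by transfer (simp add: mult.assoc bra_eq_def bra_ideal.zero)
lemma ract_one [simp]: "ract w 1 = w"
  by transfer (simp add: bra_eq_def bra_ideal.zero)
lemma biadd_lact: "biadd lact"
  by (rule biaddI) (simp_all add: lact_add_left lact_add_right)

lemmas lact_zero [simp] = biadd_zero[OF biadd_lact]
  and lact_uminus = biadd_minus[OF biadd_lact]
  and lact_diff = biadd_diff[OF biadd_lact]
  and lact_sum = biadd_sum[OF biadd_lact]

lemma scal_add: "scal (c + d) = scal c + scal d"
  by (simp add: scal.abs_eq single_add plus_cliff.abs_eq)
lemma scal_mult: "scal (c * d) = scal c * scal d"
  by (simp add: scal.abs_eq times_cliff.abs_eq mult_single)

lemma fscale_lact: "fscale c (lact X v) = lact X (fscale c v)"
  unfolding fscale_def by (simp add: scal_commute flip: lact_mult)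

lemma biadd_fscale: "biadd fscale"
  unfolding fscale_def by (rule biaddI) (simp_all add: scal_add lact_add_left lact_add_right)

lemma fscale_fscale: "fscale c (fscale d v) = fscale (c * d) v"
  by (simp add: fscale_def scal_mult lact_mult)
lemma fscale_one [simp]: "fscale 1 v = v"
  by (simp add: fscale_def scal_one)
lemma fscale_left_commute: "fscale c (fscale d v) = fscale d (fscale c v)"
  by (simp add: fscale_fscale mult.commute)

lemmas fscale_zero [simp] = biadd_zero[OF biadd_fscale]
  and fscale_add = biadd_add[OF biadd_fscale]
  and fscale_minus = biadd_minus[OF biadd_fscale]
  and fscale_diff = biadd_diff[OF biadd_fscale]
  and fscale_sum = biadd_sum[OF biadd_fscale]

lemma sum_const_fock: "(\<Sum>i<n. x) = fscale (of_nat n) x"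
  by (induction n) (simp_all add: fscale_add add.commute)

lemma torsion_free_fock: "torsion_free TYPE('k::field_char_0 fock)"
  unfolding torsion_free_def sum_const_fock
proof (intro allI impI)
  fix n :: nat and x :: "'k fock"
  assume "0 < n" "fscale (of_nat n) x = 0"
  then have "fscale (1 / of_nat n) (fscale (of_nat n) x) = 0" by simp
  with \<open>0 < n\<close> show "x = 0" by (simp add: fscale_fscale)
qed

text \<open>Disposes of squares of generators and of sums that an involution maps to their
  negatives.\<close>

lemma fock_double_zero: "x = - x \<Longrightarrow> x = (0 :: 'k::field_char_0 fock)"
proof -
  assume "x = - x"
  then have "(\<Sum>i<2::nat. x) = 0" by (simp add: numeral_2_eq_2 eq_neg_iff_add_eq_0)
  then show ?thesis using torsion_free_fock unfolding torsion_free_def by (metis zero_less_numeral)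
qed

lemma fock_induct [case_names vac gen add scale]:
  fixes P :: "'k::field fock \<Rightarrow> bool"
  assumes "P vac" "\<And>g v. P v \<Longrightarrow> P (lact (cgen g) v)" "\<And>u v. P u \<Longrightarrow> P v \<Longrightarrow> P (u + v)"
    "\<And>c v. P v \<Longrightarrow> P (fscale c v)"
  shows "P v"
proof -
  have "P (lact X vac)" for X
  proof (induction X rule: cliff_induct)
    case zero
    show ?case using assms(4)[of vac 0] assms(1) by simp
  next
    case (word w c)
    obtain gs where w: "w = Word gs" by (cases w)
    have "P (lact (prod_list (map cgen gs)) vac)"
      by (induction gs) (simp_all add: lact_mult assms)
    then show ?case
      using assms(4) by (simp add: w abs_cliff_single_word lact_mult fscale_def)
  qed (simp add: lact_add_left assms)
  moreover have "v = lact (rep_fock v) vac"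
    by (simp add: vac_def lact.abs_eq Quotient_abs_rep[OF Quotient_fock])
  ultimately show ?thesis by metis
qed

lemma vac_ann: "n < 0 \<Longrightarrow> lact (psi n) vac = 0" "0 \<le> n \<Longrightarrow> lact (psi_st n) vac = 0"
proof -
  show "n < 0 \<Longrightarrow> lact (psi n) vac = 0"
    by transfer (use ket_ideal.psi[of _ 1] in \<open>simp add: ket_eq_def\<close>)
  show "0 \<le> n \<Longrightarrow> lact (psi_st n) vac = 0"
    by transfer (use ket_ideal.psi_st[of _ 1] in \<open>simp add: ket_eq_def\<close>)
qed

lemma psi_anticomm: "lact (psi m) (lact (psi n) v) = - lact (psi n) (lact (psi m) v)"
  by (simp add: eq_neg_iff_add_eq_0 psi_psi flip: lact_mult lact_add_left)

lemma psi_st_anticomm: "lact (psi_st m) (lact (psi_st n) v) = - lact (psi_st n) (lact (psi_st m) v)"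
  by (simp add: eq_neg_iff_add_eq_0 psi_st_psi_st flip: lact_mult lact_add_left)

lemma psi_st_psi_anticomm:
  "lact (psi_st m) (lact (psi n) v) = (if m = n then v else 0) - lact (psi n) (lact (psi_st m) v)"
proof -
  have "psi_st m * psi n + psi n * psi_st m = (if m = n then 1 else 0 :: 'a cliff)"
    using psi_psi_st[of n m] by (auto simp: add.commute)
  then have "lact (psi_st m * psi n + psi n * psi_st m) v = (if m = n then v else 0)"
    by simp
  then show ?thesis by (simp add: lact_add_left lact_mult eq_diff_eq)
qed

text \<open>A vector involves finitely many generators, so far out modes act on it as on the vacuum.
  This makes the infinite sums in the currents locally finite.\<close>

lemma ann_large: "\<exists>M::int. \<forall>n>M. lact (psi_st n) v = 0 \<and> lact (psi (- n)) v = 0"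
proof (induction v rule: fock_induct)
  case vac
  show ?case by (intro exI[of _ 0]) (simp add: vac_ann)
next
  case (gen g v)
  then obtain M where M: "\<forall>n>M. lact (psi_st n) v = 0 \<and> lact (psi (- n)) v = 0" by blast
  show ?case
  proof (cases g)
    case (Psi m)
    with M show ?thesis
      by (intro exI[of _ "max M \<bar>m\<bar>"]) (auto simp: psi_st_psi_anticomm psi_anticomm[of _ m])
  next
    case (PsiS m)
    have "lact (psi (- n)) (lact (psi_st m) v) = (if m = - n then v else 0) - lact (psi_st m) (lact (psi (- n)) v)" for n
      using psi_st_psi_anticomm[of m "- n" v] by (simp add: algebra_simps)
    with PsiS M show ?thesis
      by (intro exI[of _ "max M \<bar>m\<bar>"]) (auto simp: psi_st_anticomm[of _ m])
  qed
next
  case (add u v)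
  then obtain M N where "\<forall>n>M. lact (psi_st n) u = 0 \<and> lact (psi (- n)) u = 0"
    "\<forall>n>N. lact (psi_st n) v = 0 \<and> lact (psi (- n)) v = 0" by blast
  then show ?case by (intro exI[of _ "max M N"]) (simp add: lact_add_right)
next
  case (scale c v)
  then show ?case by (metis fscale_lact fscale_zero(2))
qed

abbreviation bilin :: "int \<Rightarrow> int \<Rightarrow> 'k::field fock \<Rightarrow> 'k fock" where
  "bilin i j v \<equiv> lact (psi i) (lact (psi_st j) v)"

lemma bilin_swap: "i \<noteq> j \<Longrightarrow> bilin i j v = - lact (psi_st j) (lact (psi i) v)"
  by (simp add: psi_st_psi_anticomm)

lemma normal_ord_lact: "k \<noteq> 0 \<Longrightarrow> lact (normal_ord i k) v = bilin i (i + k) v"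
  by (simp add: normal_ord_def lact_mult lact_uminus psi_st_psi_anticomm)

text \<open>Far to the left the diagonal terms act as the identity instead of vanishing, because
  those states are filled. This asymmetry is the source of the central term of the Heisenberg
  algebra.\<close>

lemma bilin_bound:
  "\<exists>M. (\<forall>i k. k \<noteq> 0 \<longrightarrow> \<bar>i\<bar> > M + \<bar>k\<bar> \<longrightarrow> bilin i (i + k) v = 0) \<and>
    (\<forall>i>M. bilin i i v = 0) \<and> (\<forall>i. i < - M \<longrightarrow> bilin i i v = v) \<and> 0 \<le> M"
proof -
  obtain M where M: "\<And>n. n > M \<Longrightarrow> lact (psi_st n) v = 0" "\<And>n. n > M \<Longrightarrow> lact (psi (- n)) v = 0"
    using ann_large[of v] by blast
  have M': "lact (psi n) v = 0" if "- n > M" for n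
    using M(2)[of "- n"] that by simp
  show ?thesis
  proof (intro exI[of _ "max M 0"] conjI allI impI)
    fix i k :: int assume k: "k \<noteq> 0" and i: "\<bar>i\<bar> > max M 0 + \<bar>k\<bar>"
    show "bilin i (i + k) v = 0"
    proof (cases "i > 0")
      case True
      with i have "i + k > M" by auto
      then show ?thesis by (simp add: M)
    next
      case False
      with i have "- i > M" by auto
      then show ?thesis using k by (simp add: bilin_swap M')
    qed
  next
    fix i :: int assume "i > max M 0"
    then show "bilin i i v = 0" by (simp add: M)
  next
    fix i :: int assume "i < - max M 0"
    then have "lact (psi_st i) (lact (psi i) v) = 0" by (simp add: M')
    then show "bilin i i v = v" by (simp add: psi_st_psi_anticomm)
  qed simp
qed

lemma current_sum:
  assumes "k \<noteq> 0" "finite S" "\<And>i. i \<notin> S \<Longrightarrow> bilin i (i + k) v = 0"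
  shows "current k v = (\<Sum>i\<in>S. bilin i (i + k) v)"
  unfolding current_def using assms
  by (subst Sum_any.expand_superset[of S]) (auto simp: normal_ord_lact)

text \<open>All larger windows work as well, so finitely many vectors can share one.\<close>

lemma current_window:
  assumes "k \<noteq> 0"
  obtains M where "\<And>K. K \<ge> M \<Longrightarrow> current k v = (\<Sum>i\<in>{-K..K}. bilin i (i + k) v)" "0 \<le> M"
proof -
  obtain M where M: "\<forall>i k. k \<noteq> 0 \<longrightarrow> \<bar>i\<bar> > M + \<bar>k\<bar> \<longrightarrow> bilin i (i + k) v = 0"
    "\<forall>i>M. bilin i i v = 0" "\<forall>i. i < - M \<longrightarrow> bilin i i v = v" "0 \<le> M"
    using bilin_bound[of v] by blast
  show ?thesis
  proof
    fix K assume "K \<ge> M + \<bar>k\<bar>"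
    with assms M show "current k v = (\<Sum>i\<in>{-K..K}. bilin i (i + k) v)"
      by (intro current_sum) auto
  qed (use M in auto)
qed

lemma current_add: "k \<noteq> 0 \<Longrightarrow> current k (u + v) = current k u + current k v"
proof -
  assume k: "k \<noteq> 0"
  obtain L where L: "\<And>K. K \<ge> L \<Longrightarrow> current k u = (\<Sum>i\<in>{-K..K}. bilin i (i + k) u)"
    using current_window[OF k] by metis
  obtain M where M: "\<And>K. K \<ge> M \<Longrightarrow> current k v = (\<Sum>i\<in>{-K..K}. bilin i (i + k) v)"
    using current_window[OF k] by metis
  obtain N where N: "\<And>K. K \<ge> N \<Longrightarrow> current k (u + v) = (\<Sum>i\<in>{-K..K}. bilin i (i + k) (u + v))"
    using current_window[OF k] by metis
  show ?thesis
    using L[of "max L (max M N)"] M[of "max L (max M N)"] N[of "max L (max M N)"]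
    by (simp add: lact_add_right sum.distrib)
qed

lemma current_fscale: "k \<noteq> 0 \<Longrightarrow> current k (fscale c v) = fscale c (current k v)"
proof -
  assume k: "k \<noteq> 0"
  obtain M where M: "\<And>K. K \<ge> M \<Longrightarrow> current k v = (\<Sum>i\<in>{-K..K}. bilin i (i + k) v)"
    using current_window[OF k] by metis
  obtain N where N: "\<And>K. K \<ge> N \<Longrightarrow> current k (fscale c v) = (\<Sum>i\<in>{-K..K}. bilin i (i + k) (fscale c v))"
    using current_window[OF k] by metis
  show ?thesis
    using M[of "max M N"] N[of "max M N"] by (simp add: fscale_sum fscale_lact)
qed

lemma additive_current: "k \<noteq> 0 \<Longrightarrow> additive (current k)"
  by (simp add: additive_def current_add)

lemma current_psi:
  assumes k: "k \<noteq> 0"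
  shows "current k (lact (psi n) v) = lact (psi n) (current k v) + lact (psi (n - k)) v"
proof -
  obtain M where M: "\<And>K. K \<ge> M \<Longrightarrow> current k v = (\<Sum>i\<in>{-K..K}. bilin i (i + k) v)"
    using current_window[OF k] by metis
  obtain N where N: "\<And>K. K \<ge> N \<Longrightarrow> current k (lact (psi n) v) = (\<Sum>i\<in>{-K..K}. bilin i (i + k) (lact (psi n) v))"
    using current_window[OF k] by metis
  define K where "K = max (max M N) \<bar>n - k\<bar>"
  have K: "M \<le> K" "n - k \<in> {-K..K}" by (auto simp: K_def)
  have "bilin i (i + k) (lact (psi n) v) =
      lact (psi n) (bilin i (i + k) v) + (if i = n - k then lact (psi (n - k)) v else 0)" for i
  proof -
    have "bilin i (i + k) (lact (psi n) v) =
        (if i + k = n then lact (psi i) v else 0) - lact (psi i) (lact (psi n) (lact (psi_st (i + k)) v))"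
      by (simp add: psi_st_psi_anticomm[of "i + k" n] lact_diff)
    then show ?thesis by (auto simp: psi_anticomm[of i n])
  qed
  then have "current k (lact (psi n) v) =
      (\<Sum>i\<in>{-K..K}. lact (psi n) (bilin i (i + k) v) + (if i = n - k then lact (psi (n - k)) v else 0))"
    using N[of K] by (simp add: K_def)
  also have "\<dots> = lact (psi n) (current k v) + lact (psi (n - k)) v"
    using M[OF K(1)] K(2) by (simp add: sum.distrib lact_sum del: atLeastAtMost_iff)
  finally show ?thesis .
qed

lemma current_psi_st:
  assumes k: "k \<noteq> 0"
  shows "current k (lact (psi_st n) v) = lact (psi_st n) (current k v) - lact (psi_st (n + k)) v"
proof -
  obtain M where M: "\<And>K. K \<ge> M \<Longrightarrow> current k v = (\<Sum>i\<in>{-K..K}. bilin i (i + k) v)"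
    using current_window[OF k] by metis
  obtain N where N: "\<And>K. K \<ge> N \<Longrightarrow> current k (lact (psi_st n) v) = (\<Sum>i\<in>{-K..K}. bilin i (i + k) (lact (psi_st n) v))"
    using current_window[OF k] by metis
  define K where "K = max (max M N) \<bar>n\<bar>"
  have K: "M \<le> K" "n \<in> {-K..K}" by (auto simp: K_def)
  have "bilin i (i + k) (lact (psi_st n) v) =
      lact (psi_st n) (bilin i (i + k) v) - (if i = n then lact (psi_st (n + k)) v else 0)" for i
    by (auto simp: psi_st_psi_anticomm[of n i] psi_st_anticomm[of "i + k" n] lact_uminus)
  then have "current k (lact (psi_st n) v) =
      (\<Sum>i\<in>{-K..K}. lact (psi_st n) (bilin i (i + k) v) - (if i = n then lact (psi_st (n + k)) v else 0))"
    using N[of K] by (simp add: K_def)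
  also have "\<dots> = lact (psi_st n) (current k v) - lact (psi_st (n + k)) v"
    using M[OF K(1)] K(2) by (simp add: sum_subtractf lact_sum del: atLeastAtMost_iff)
  finally show ?thesis .
qed

text \<open>Shifting a sequence that is \<open>v\<close> far to the left and 0 far to the right
  moves p copies of \<open>v\<close> into the window.\<close>

lemma sum_shift_aux:
  fixes g :: "int \<Rightarrow> 'k::field_char_0 fock"
  assumes 0: "\<And>i. i > M \<Longrightarrow> g i = 0" and v: "\<And>i. - i > M \<Longrightarrow> g i = v" and K: "K \<ge> M + int p" and M: "0 \<le> M"
  shows "(\<Sum>i\<in>{-K..K}. g (i - int p) - g i) = fscale (of_nat p) v"
proof -
  have "(\<Sum>i\<in>{-K..K}. g (i - int p)) = (\<Sum>i\<in>{-K - int p..K - int p}. g i)"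
    by (rule sum.reindex_bij_witness[of _ "\<lambda>i. i + int p" "\<lambda>i. i - int p"]) auto
  also have "\<dots> = (\<Sum>i\<in>{-K - int p..K}. g i)"
    using K by (intro sum.mono_neutral_left) (auto intro!: 0)
  also have "{-K - int p..K} = {-K - int p..< -K} \<union> {-K..K}"
    using K M by auto
  also have "(\<Sum>i\<in>\<dots>. g i) = (\<Sum>i\<in>{-K - int p..< -K}. g i) + (\<Sum>i\<in>{-K..K}. g i)"
    by (rule sum.union_disjoint) auto
  also have "(\<Sum>i\<in>{-K - int p..< -K}. g i) = (\<Sum>i<p. v)"
    by (rule sum.reindex_bij_witness[of _ "\<lambda>i. int i - K - int p" "\<lambda>i. nat (i + K + int p)"])
       (use K in \<open>auto intro!: v[symmetric]\<close>)
  finally show ?thesis by (simp add: sum_subtractf sum_const_fock)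
qed

lemma sum_shift:
  fixes g :: "int \<Rightarrow> 'k::field_char_0 fock"
  assumes 0: "\<And>i. i > M \<Longrightarrow> g i = 0" and v: "\<And>i. - i > M \<Longrightarrow> g i = v" and K: "K \<ge> M + 2 * \<bar>n\<bar>" and M: "0 \<le> M"
  shows "(\<Sum>i\<in>{-K..K}. g (i - n) - g i) = fscale (of_int n) v"
proof (cases "0 \<le> n")
  case True
  then show ?thesis using sum_shift_aux[of M g v "nat n" K, OF 0 v] K M by simp
next
  case False
  define p where "p = nat (- n)"
  have n: "n = - int p" using False by (simp add: p_def)
  \<comment> \<open>A negative shift of g is, up to the sign, a positive shift of the sequence with
    members g (i + p).\<close>
  have "(\<Sum>i\<in>{-K..K}. (\<lambda>i. g (i + int p)) (i - int p) - (\<lambda>i. g (i + int p)) i) = fscale (of_nat p) v"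
    by (rule sum_shift_aux[of "M + int p"]) (use K M in \<open>auto simp: n intro!: 0 v\<close>)
  then have "(\<Sum>i\<in>{-K..K}. - (g (i - n) - g i)) = fscale (of_nat p) v"
    by (simp add: n)
  then show ?thesis by (simp only: sum_negf) (simp add: n fscale_minus minus_equation_iff)
qed

lemma current_current:
  fixes v :: "'k::field_char_0 fock"
  assumes n: "n \<noteq> 0" and m: "m \<noteq> 0"
  shows "current n (current m v) = current m (current n v) + (if n + m = 0 then fscale (of_int n) v else 0)"
proof -
  obtain L where L: "\<And>K. K \<ge> L \<Longrightarrow> current m v = (\<Sum>i\<in>{-K..K}. bilin i (i + m) v)"
    using current_window[OF m] by metis
  obtain M where M: "\<And>K. K \<ge> M \<Longrightarrow> current m (current n v) = (\<Sum>i\<in>{-K..K}. bilin i (i + m) (current n v))"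
    using current_window[OF m] by metis
  obtain N where N: "\<forall>i k. k \<noteq> 0 \<longrightarrow> \<bar>i\<bar> > N + \<bar>k\<bar> \<longrightarrow> bilin i (i + k) v = 0"
    "\<forall>i>N. bilin i i v = 0" "\<forall>i. i < - N \<longrightarrow> bilin i i v = v" "0 \<le> N"
    using bilin_bound[of v] by blast
  define B where "B = N + \<bar>n + m\<bar>"
  define K where "K = max (max L M) (B + 2 * \<bar>n\<bar>)"
  define g where "g i = bilin i (i + (n + m)) v" for i
  \<comment> \<open>Commuting a_n through a bilinear leaves the difference of two shifted bilinears.
    Summed over i these cancel except for the terms that enter at the filled end.\<close>
  have step: "current n (bilin i (i + m) v) = bilin i (i + m) (current n v) + (g (i - n) - g i)" for i
    by (simp add: g_def current_psi[OF n] current_psi_st[OF n] lact_diff add_ac)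
  have "current n (current m v) = (\<Sum>i\<in>{-K..K}. current n (bilin i (i + m) v))"
    using L[of K] by (simp add: additive.sum[OF additive_current[OF n]] K_def)
  also have "\<dots> = current m (current n v) + (\<Sum>i\<in>{-K..K}. g (i - n) - g i)"
    using M[of K] by (simp only: step sum.distrib) (simp add: K_def)
  also have "(\<Sum>i\<in>{-K..K}. g (i - n) - g i) = fscale (of_int n) (if n + m = 0 then v else 0)"
  proof (rule sum_shift[of B])
    show "g i = 0" if "i > B" for i
      using that N by (cases "n + m = 0") (auto simp: g_def B_def)
    show "g i = (if n + m = 0 then v else 0)" if "- i > B" for i
      using that N by (cases "n + m = 0") (auto simp: g_def B_def)
  qed (use N in \<open>auto simp: K_def B_def\<close>)
  finally show ?thesis by auto
qed

subsection \<open>The pairing\<close>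

lemma pairing_add_left: "pairing (w + w') v = pairing w v + pairing w' v"
  and pairing_add_right: "pairing w (v + v') = pairing w v + pairing w v'"
  and pairing_dscale: "pairing (dscale c w) v = c * pairing w v"
  and pairing_fscale: "pairing w (fscale c v) = c * pairing w v"
  and pairing_vac: "pairing dvac vac = 1"
  and pairing_ract: "pairing (ract w X) v = pairing w (lact X v)"
  using is_pairing_pairing unfolding is_pairing_def by blast+

lemma biadd_pairing: "biadd pairing"
  by (rule biaddI) (simp_all add: pairing_add_left pairing_add_right)

lemma cstar_scal: "cstar (scal c) = scal c"
  by (simp add: scal.abs_eq cstar.abs_eq zero_word_def)

lemma cstar_one [simp]: "cstar 1 = 1"
  using cstar_scal[of 1] by (simp add: scal_one)

lemma cstar_cstar [simp]: "cstar (cstar X) = X"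
proof -
  have "word_star (word_star w) = w" for w
  proof (cases w)
    case (Word gs)
    have "gen_star (gen_star g) = g" for g by (cases g) auto
    then have "map (gen_star \<circ> gen_star) gs = gs" by (induction gs) auto
    with Word show ?thesis by (simp add: rev_map)
  qed
  then show ?thesis
    by (induction X rule: cliff_induct) (simp_all add: cstar_zero cstar.abs_eq cstar_add)
qed

lemma fstar_lact: "fstar (lact X v) = ract (fstar v) (cstar X)"
  by transfer (simp add: cstar_mult bra_eq_def bra_ideal.zero)
lemma fstar_add: "fstar (u + v) = fstar u + fstar v"
  by transfer (simp add: cstar_add bra_eq_def bra_ideal.zero)
lemma fstar_vac: "fstar vac = dvac"
  by transfer (simp add: bra_eq_def bra_ideal.zero)

lemma additive_fstar: "additive fstar"
  by (simp add: additive_def fstar_add)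

lemma fstar_surj: obtains u where "w = fstar u"
proof
  have "w = ract dvac (rep_dfock w)"
    by (simp add: dvac_def ract.abs_eq Quotient_abs_rep[OF Quotient_dfock])
  then show "w = fstar (lact (cstar (rep_dfock w)) vac)"
    by (simp add: fstar_lact fstar_vac)
qed

text \<open>The pairing transported to two kets. A right action on a bra thereby becomes the adjoint
  left action on the other argument, and one calculus of operators serves both sides.\<close>

definition form :: "'k::field fock \<Rightarrow> 'k fock \<Rightarrow> 'k" where
  "form u v = pairing (fstar u) v"

lemma form_lact: "form (lact X u) v = form u (lact (cstar X) v)"
  by (simp add: form_def fstar_lact pairing_ract)

lemma form_psi: "form (lact (psi n) u) v = form u (lact (psi_st n) v)"
  and form_psi_st: "form (lact (psi_st n) u) v = form u (lact (psi n) v)"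
  by (simp_all add: form_lact cstar_psi cstar_psi_st)

lemma form_fscale: "form (fscale c u) v = c * form u v" "form u (fscale c v) = c * form u v"
  by (simp_all add: form_def fscale_def fstar_lact cstar_scal flip: dscale_def)
     (simp_all add: pairing_dscale pairing_fscale flip: fscale_def)

lemma biadd_form: "biadd form"
  by (rule biaddI) (simp_all add: form_def fstar_add pairing_add_left pairing_add_right)

lemma form_current:
  assumes k: "k \<noteq> 0"
  shows "form (current k u) v = form u (current (- k) v)"
proof -
  obtain M where M: "\<And>K. K \<ge> M \<Longrightarrow> current k u = (\<Sum>i\<in>{-K..K}. bilin i (i + k) u)" "0 \<le> M"
    using current_window[OF k] by metis
  obtain N where N: "\<forall>i k. k \<noteq> 0 \<longrightarrow> \<bar>i\<bar> > N + \<bar>k\<bar> \<longrightarrow> bilin i (i + k) v = 0"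
    "\<forall>i>N. bilin i i v = 0" "\<forall>i. i < - N \<longrightarrow> bilin i i v = v" "0 \<le> N"
    using bilin_bound[of v] by blast
  define K where "K = max M (N + 2 * \<bar>k\<bar>)"
  have "form (current k u) v = (\<Sum>i\<in>{-K..K}. form u (bilin (i + k) i v))"
    using M(1)[of K] by (simp add: biadd_sum[OF biadd_form] form_psi form_psi_st K_def)
  also have "\<dots> = form u (\<Sum>i\<in>{-K..K}. bilin (i + k) i v)"
    by (simp add: biadd_sum[OF biadd_form])
  also have "(\<Sum>i\<in>{-K..K}. bilin (i + k) i v) = (\<Sum>i\<in>{-K + k..K + k}. bilin i (i + - k) v)"
    by (rule sum.reindex_bij_witness[of _ "\<lambda>i. i - k" "\<lambda>i. i + k"]) auto
  also have "\<dots> = current (- k) v"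
    by (rule current_sum[symmetric])
       (use k N(4) in \<open>auto simp: K_def intro!: N(1)[rule_format, of "- k", simplified]\<close>)
  finally show ?thesis .
qed

lemma dcurrent_fstar:
  assumes k: "k \<noteq> 0"
  shows "dcurrent k (fstar u) = fstar (current (- k) u)"
proof -
  have star: "ract (fstar u) (normal_ord i k) = fstar (bilin (i + k) i u)" for i
  proof -
    have "normal_ord i k = (psi i * psi_st (i + k) :: 'a cliff)"
    proof -
      have "psi i * psi_st (i + k) = - (psi_st (i + k) * psi i :: 'a cliff)"
        using k by (subst eq_neg_iff_add_eq_0) (simp add: psi_psi_st)
      then show ?thesis by (simp add: normal_ord_def)
    qed
    then show ?thesis
      by (simp add: fstar_lact cstar_psi cstar_psi_st ract_mult)
  qed
  obtain N where N: "\<forall>i k. k \<noteq> 0 \<longrightarrow> \<bar>i\<bar> > N + \<bar>k\<bar> \<longrightarrow> bilin i (i + k) u = 0"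
    "\<forall>i>N. bilin i i u = 0" "\<forall>i. i < - N \<longrightarrow> bilin i i u = u" "0 \<le> N"
    using bilin_bound[of u] by blast
  define K where "K = N + 2 * \<bar>k\<bar>"
  have 0: "bilin (i + k) i u = 0" if "i \<notin> {-K..K}" for i
    using N(1)[rule_format, of "- k" "i + k"] that k by (auto simp: K_def)
  have "dcurrent k (fstar u) = (\<Sum>i\<in>{-K..K}. fstar (bilin (i + k) i u))"
    unfolding dcurrent_def star
  proof (rule Sum_any.expand_superset)
    show "{i. fstar (bilin (i + k) i u) \<noteq> 0} \<subseteq> {-K..K}"
      using 0 additive.zero[OF additive_fstar] by force
  qed simp
  also have "\<dots> = fstar (\<Sum>i\<in>{-K..K}. bilin (i + k) i u)"
    by (simp add: additive.sum[OF additive_fstar])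
  also have "(\<Sum>i\<in>{-K..K}. bilin (i + k) i u) = (\<Sum>i\<in>{-K + k..K + k}. bilin i (i + - k) u)"
    by (rule sum.reindex_bij_witness[of _ "\<lambda>i. i - k" "\<lambda>i. i + k"]) auto
  also have "\<dots> = current (- k) u"
    by (rule current_sum[symmetric])
       (use k N(4) in \<open>auto simp: K_def intro!: N(1)[rule_format, of "- k", simplified]\<close>)
  finally show ?thesis .
qed

lemma pairing_dcurrent: "k \<noteq> 0 \<Longrightarrow> pairing (dcurrent k w) v = pairing w (current k v)"
  by (rule fstar_surj[of w]) (simp add: dcurrent_fstar form_current flip: form_def)

lemma dcurrent_add: "k \<noteq> 0 \<Longrightarrow> dcurrent k (w + w') = dcurrent k w + dcurrent k w'"
  by (rule fstar_surj[of w], rule fstar_surj[of w'])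
     (simp add: dcurrent_fstar current_add flip: fstar_add)

subsection \<open>Shifted vacua\<close>

definition sket :: "nat \<Rightarrow> 'k::field fock" where
  "sket l = shift_ket (- int l)"

lemma sket_eq: "sket l = lact (prod_list (map psi_st [- int l..-1])) vac"
  by (cases "l = 0") (simp_all add: sket_def shift_ket_def)

lemma sket_Suc: "sket (Suc l) = lact (psi_st (- int l - 1)) (sket l)"
proof -
  have "[- int (Suc l)..-1] = (- int l - 1) # [- int l..-1]"
    by (subst upto_rec1) auto
  then show ?thesis by (simp only: sket_eq) (simp add: lact_mult)
qed

lemma sket_0: "sket 0 = vac"
  by (simp add: sket_eq)

lemma psi_sket: "n < - int l \<Longrightarrow> lact (psi n) (sket l) = (0 :: 'k::field fock)"
proof (induction l)
  case 0 then show ?case by (simp add: sket_0 vac_ann)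
next
  case (Suc l)
  then have "lact (psi n) (sket (Suc l)) = - lact (psi_st (- int l - 1)) (lact (psi n) (sket l :: 'k fock))"
    unfolding sket_Suc by (intro bilin_swap) auto
  moreover have "lact (psi n) (sket l) = (0 :: 'k fock)" using Suc by simp
  ultimately show ?case by (simp only: lact_zero minus_zero)
qed

lemma psi_st_sket: "- int l \<le> n \<Longrightarrow> lact (psi_st n) (sket l) = (0 :: 'k::field_char_0 fock)"
proof (induction l)
  case 0 then show ?case by (simp add: sket_0 vac_ann)
next
  case (Suc l)
  show ?case
  proof (cases "n = - int l - 1")
    case True
    show ?thesis unfolding True sket_Suc
      by (rule fock_double_zero) (rule psi_st_anticomm)
  next
    case False
    with Suc show ?thesis by (simp only: sket_Suc psi_st_anticomm[of n]) simp
  qed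
qed

lemma psi_sket_Suc: "lact (psi (- int l - 1)) (sket (Suc l)) = (sket l :: 'k::field fock)"
  using psi_st_psi_anticomm[of "- int l - 1" "- int l - 1" "sket l :: 'k fock"]
  by (simp add: sket_Suc psi_sket)

lemma current_sket: "0 < k \<Longrightarrow> current k (sket l) = (0 :: 'k::field_char_0 fock)"
proof -
  assume k: "0 < k"
  have "bilin i (i + k) (sket l) = (0 :: 'k fock)" for i
    using k by (cases "- int l \<le> i + k") (simp_all add: psi_st_sket bilin_swap psi_sket)
  with k show ?thesis by (subst current_sum[of _ "{}"]) auto
qed

lemma fstar_sket: "fstar (sket l) = shift_bra (- int l)"
proof -
  have "cstar (prod_list (map psi_st ns)) = (prod_list (map psi (rev ns)) :: 'a cliff)" for ns
    by (induction ns) (simp_all add: cstar_mult cstar_psi_st)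
  then show ?thesis
    by (cases "l = 0") (simp_all add: sket_eq fstar_lact fstar_vac shift_bra_def)
qed

lemma form_sket_Suc: "form (sket (Suc l)) (lact (psi_st (- int l - 1)) v) = form (sket l) v"
  by (simp only: form_psi[symmetric] psi_sket_Suc)

lemma form_sket: "form (sket l) (sket l) = 1"
proof (induction l)
  case 0 show ?case by (simp only: sket_0 form_def fstar_vac pairing_vac)
next
  case (Suc l)
  then show ?case
    by (subst (2) sket_Suc) (simp only: form_sket_Suc)
qed

text \<open>On |-l> the states below -l are filled and the others are empty. The surviving bilinears
  create at a state from -l upwards and remove one below -l.\<close>

lemma current_minus_sket:
  assumes "0 < j"
  shows "current (- int j) (sket l) =
    (\<Sum>i<j. bilin (int i - int l) (int i - int l - int j) (sket l) :: 'k::field_char_0 fock)"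
proof -
  have "current (- int j) (sket l) = (\<Sum>i\<in>{- int l..<int j - int l}. bilin i (i + - int j) (sket l) :: 'k fock)"
  proof (rule current_sum)
    fix i assume "i \<notin> {- int l..<int j - int l}"
    then show "bilin i (i + - int j) (sket l) = (0 :: 'k fock)"
      using assms by (cases "i < - int l") (simp_all add: psi_st_sket bilin_swap psi_sket)
  qed (use assms in auto)
  also have "\<dots> = (\<Sum>i<j. bilin (int i - int l) (int i - int l - int j) (sket l))"
    by (rule sum.reindex_bij_witness[of _ "\<lambda>i. int i - int l" "\<lambda>i. nat (i + int l)"]) auto
  finally show ?thesis .
qed

text \<open>Expanded, the summands are \<psi>_(N-j-l) \<psi>_(i-l) times the adjoint mode of index
  i-l-j. Replacing (j, i) by (N-i, N-j) keeps that index and exchanges the two \<psi>, so the sum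
  equals its own negative.\<close>

lemma psi_current_sum_zero:
  "(\<Sum>j=1..N. lact (psi (int (N - j) - int l)) (current (- int j) (sket l))) = (0 :: 'k::field_char_0 fock)"
proof -
  define T where "T = (\<lambda>(j, i). lact (psi (int (N - j) - int l))
      (bilin (int i - int l) (int i - int l - int j) (sket l)) :: 'k fock)"
  define D where "D = Sigma {1..N} (\<lambda>j. {..<j})"
  have "(\<Sum>j=1..N. lact (psi (int (N - j) - int l)) (current (- int j) (sket l))) = (\<Sum>p\<in>D. T p)" (is "?S = _")
    unfolding D_def T_def
    by (subst sum.Sigma[symmetric]) (auto simp: current_minus_sket lact_sum intro!: sum.cong)
  have neg: "(\<Sum>p\<in>D. T p) = (\<Sum>p\<in>D. - T p)"
  proof (rule sum.reindex_bij_witness[of _ "\<lambda>(j, i). (N - i, N - j)" "\<lambda>(j, i). (N - i, N - j)"])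
    fix p assume "p \<in> D"
    then obtain j i where p: "p = (j, i)" "1 \<le> j" "j \<le> N" "i < j" by (auto simp: D_def)
    then have "int (N - j) - int l - int (N - i) = int i - int l - int j" "int (N - (N - i)) = int i"
      by auto
    then show "- T ((\<lambda>(j, i). (N - i, N - j)) p) = T p"
      unfolding T_def p(1) prod.case
      by (simp only: psi_anticomm[of "int (N - j) - int l" "int i - int l"])
  qed (auto simp: D_def)
  have "(\<Sum>p\<in>D. T p) = - (\<Sum>p\<in>D. T p)"
    using neg unfolding sum_negf .
  then have "(\<Sum>p\<in>D. T p) = 0" by (rule fock_double_zero)
  with \<open>?S = _\<close> show ?thesis by simp
qed

section \<open>Fields and vertex operators on series\<close>

subsection \<open>Linear extension of modes\<close>

text \<open>The operator with symbol p, that is \<Sum> p_n g_n. Passing from mode indices to Laurent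
  polynomials turns shifts of indices into multiplication.\<close>

definition lext :: "(int \<Rightarrow> 'k::field fock \<Rightarrow> 'k fock) \<Rightarrow> (int \<Rightarrow>\<^sub>0 'k) \<Rightarrow> 'k fock \<Rightarrow> 'k fock" where
  "lext g p w = (\<Sum>n\<in>Poly_Mapping.keys p. fscale (Poly_Mapping.lookup p n) (g n w))"

lemma lext_add_left: "lext g (p + q) w = lext g p w + lext g q w"
  unfolding lext_def by (rule sum_keys_add) (rule fscale_add)

lemma lext_zero [simp]: "lext g 0 w = 0"
  by (simp add: lext_def)

lemma lext_single [simp]: "lext g (Poly_Mapping.single n c) w = fscale c (g n w)"
  by (cases "c = 0") (simp_all add: lext_def)

definition lin_mode :: "('k::field fock \<Rightarrow> 'k fock) \<Rightarrow> bool" where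
  "lin_mode f \<longleftrightarrow> additive f \<and> (\<forall>c w. f (fscale c w) = fscale c (f w))"

lemma lin_modeD: "lin_mode f \<Longrightarrow> f (u + v) = f u + f v" "lin_mode f \<Longrightarrow> f (fscale c u) = fscale c (f u)"
    "lin_mode f \<Longrightarrow> f 0 = 0"
  by (auto simp: lin_mode_def additive.add additive.zero)

lemma biadd_lext: "(\<And>n. lin_mode (g n)) \<Longrightarrow> biadd (lext g)"
  by (rule biaddI, rule lext_add_left) (simp add: lext_def lin_modeD fscale_add sum.distrib)

lemma lext_fscale: "(\<And>n. lin_mode (g n)) \<Longrightarrow> lext g p (fscale c w) = fscale c (lext g p w)"
  by (simp add: lext_def lin_modeD fscale_sum fscale_left_commute[of c])

text \<open>The index is negated, as in \<open>smode\<close>, so that indices add in the commutators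
  with both kinds of fields. Mode 0 is set to 0 because H and its adjoint do not contain
  a_0.\<close>

definition cmode :: "int \<Rightarrow> 'k::field fock \<Rightarrow> 'k fock" where
  "cmode n = (if n = 0 then (\<lambda>_. 0) else current (- n))"

abbreviation "pmode n \<equiv> lact (psi n)"
abbreviation "smode n \<equiv> lact (psi_st (- n))"

lemma lin_mode_cmode: "lin_mode (cmode n)"
  by (simp add: lin_mode_def cmode_def additive_def current_add current_fscale)
lemma lin_mode_lact: "lin_mode (lact X)"
  by (simp add: lin_mode_def additive_def lact_add_right fscale_lact)

lemmas lin_modes = lin_mode_cmode lin_mode_lact

text \<open>\<open>e\<close> is the charge of the field, 1 for \<psi> and -1 for its adjoint. The
  constant term of \<open>p\<close> is subtracted because \<open>cmode 0\<close> vanishes.\<close>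

lemma curL_lext:
  assumes lin: "\<And>n. lin_mode (b n)"
    and comm: "\<And>n m w. n \<noteq> 0 \<Longrightarrow> cmode n (b m w) = b m (cmode n w) + fscale e (b (n + m) w)"
  shows "lext cmode p (lext b q w) = lext b q (lext cmode p w) +
    lext b (Poly_Mapping.single 0 e * (p - Poly_Mapping.single 0 (Poly_Mapping.lookup p 0)) * q) w"
proof (induction p rule: free_alg_induct)
  case zero
  then show ?case by (simp add: biadd_zero[OF biadd_lext[of b, OF lin]])
next
  case (single n c)
  show ?case
  proof (induction q rule: free_alg_induct)
    case (single m d)
    show ?case
      by (cases "n = 0")
         (simp_all add: cmode_def[of 0] lin_modeD[OF lin_mode_cmode] lin_modeD[OF lin] comm fscale_add
           fscale_fscale mult_single lookup_single mult_ac add.commute[of n m])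
  next
    case (add p q)
    then show ?case
      by (simp add: lext_add_left lin_modeD[OF lin_mode_cmode] fscale_add distrib_left)
  qed (simp add: lin_modeD[OF lin_mode_cmode])
next
  case (add p p')
  have eq: "p + p' - Poly_Mapping.single 0 (Poly_Mapping.lookup (p + p') 0) =
    (p - Poly_Mapping.single 0 (Poly_Mapping.lookup p 0)) + (p' - Poly_Mapping.single 0 (Poly_Mapping.lookup p' 0))"
    by (simp add: lookup_add single_add)
  show ?case
    by (simp only: eq add lext_add_left distrib_left distrib_right biadd_add[OF biadd_lext[of b, OF lin]]) (simp only: add_ac)
qed

lemma cmode_pmode: "n \<noteq> 0 \<Longrightarrow> cmode n (pmode m w) = pmode m (cmode n w) + fscale 1 (pmode (n + m) w)"
  by (simp add: cmode_def current_psi add.commute)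

lemma cmode_smode: "n \<noteq> 0 \<Longrightarrow> cmode n (smode m w) = smode m (cmode n w) + fscale (- 1) (smode (n + m) w)"
  by (simp add: cmode_def current_psi_st fscale_minus add.commute)

text \<open>\<open>smode n\<close> and \<open>pmode m\<close> contract exactly when n + m = 0, so
  the total contraction is the constant term of the product of the symbols.\<close>

lemma psisL_psiL:
  "lext smode p (lext pmode q w) = fscale (Poly_Mapping.lookup (p * q) 0) w - lext pmode q (lext smode p w)"
proof (induction p rule: free_alg_induct)
  case (single n c)
  show ?case
  proof (induction q rule: free_alg_induct)
    case (single m d)
    show ?case
      by (simp add: fscale_lact[symmetric] psi_st_psi_anticomm fscale_diff fscale_fscale mult_single
          lookup_single when_def mult_ac add.commute)
  next
    case (add p q)
    then show ?case
      by (simp add: lext_add_left lact_add_right fscale_add distrib_left lookup_add)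
  qed simp
next
  case (add p q)
  then show ?case
    by (simp add: lext_add_left distrib_right lookup_add fscale_add
        biadd_add[OF biadd_lext[of "\<lambda>n. lact (psi n)", OF lin_mode_lact]])
qed (simp add: biadd_zero[OF biadd_lext[of "\<lambda>n. lact (psi n)", OF lin_mode_lact]])

text \<open>The Heisenberg cocycle on symbols: minus the constant term of t p'(t) q(t).\<close>

definition heis :: "(int \<Rightarrow>\<^sub>0 'k::field) \<Rightarrow> (int \<Rightarrow>\<^sub>0 'k) \<Rightarrow> 'k" where
  "heis p q = (\<Sum>n\<in>Poly_Mapping.keys p. of_int (- n) * Poly_Mapping.lookup p n * Poly_Mapping.lookup q (- n))"

lemma biadd_heis: "biadd heis"
proof (rule biaddI)
  fix p p' q q' :: "int \<Rightarrow>\<^sub>0 'a"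
  show "heis (p + p') q = heis p q + heis p' q"
    unfolding heis_def by (rule sum_keys_add) (simp add: algebra_simps)
  show "heis p (q + q') = heis p q + heis p q'"
    unfolding heis_def sum.distrib[symmetric] by (intro sum.cong) (simp_all add: lookup_add algebra_simps)
qed

lemma heis_single:
  "heis (Poly_Mapping.single n c) (Poly_Mapping.single m d) = (if n + m = 0 then - of_int n * c * d else 0)"
  by (cases "c = 0") (auto simp: heis_def lookup_single when_def)

lemma curL_curL:
  fixes w :: "'k::field_char_0 fock"
  shows "lext cmode p (lext cmode q w) = lext cmode q (lext cmode p w) + fscale (heis p q) w"
proof (induction p rule: free_alg_induct)
  case (single n c)
  show ?case
  proof (induction q rule: free_alg_induct)
    case (single m d)
    show ?case
    proof (cases "n = 0 \<or> m = 0")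
      case True
      then show ?thesis by (auto simp: cmode_def[of 0] lin_modeD[OF lin_mode_cmode] heis_single)
    next
      case False
      then have "cmode n (cmode m w) = cmode m (cmode n w) + fscale (if n + m = 0 then - of_int n else 0) w"
        using current_current[of "- n" "- m" w] by (auto simp: cmode_def add_eq_0_iff)
      then show ?thesis
        by (simp add: lin_modeD[OF lin_mode_cmode] fscale_add fscale_fscale heis_single mult_ac)
    qed
  next
    case (add p q)
    then show ?case
      by (simp add: lext_add_left lin_modeD[OF lin_mode_cmode] fscale_add biadd_add[OF biadd_heis])
  qed (simp add: lin_modeD[OF lin_mode_cmode] biadd_zero[OF biadd_heis])
next
  case (add p q)
  then show ?case
    by (simp add: lext_add_left fscale_add biadd_add[OF biadd_heis]
        biadd_add[OF biadd_lext[of cmode, OF lin_mode_cmode]])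
qed (simp add: biadd_zero[OF biadd_heis] biadd_zero[OF biadd_lext[of cmode, OF lin_mode_cmode]])

subsection \<open>Operators on series\<close>

text \<open>The coefficient of the symbol at each monomial is a Laurent polynomial, so only finitely
  many modes enter each coefficient of the result.\<close>

definition lop :: "(int \<Rightarrow> 'k::field fock \<Rightarrow> 'k fock) \<Rightarrow> 'k laurent \<Rightarrow> 'k fock series \<Rightarrow> 'k fock series" where
  "lop g u v = conv (lext g) u v"

abbreviation "cur_op \<equiv> lop cmode"
abbreviation "psi_op \<equiv> lop pmode"
abbreviation "psis_op \<equiv> lop smode"

definition rscale :: "'k::field series \<Rightarrow> 'k fock series \<Rightarrow> 'k fock series" where
  "rscale c v = conv fscale c v"

lemma biadd_lop: "(\<And>n. lin_mode (g n)) \<Longrightarrow> biadd (lop g)"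
  using biadd_conv[OF biadd_lext[of g]] by (simp add: lop_def[abs_def])

lemma biadd_rscale: "biadd rscale"
  using biadd_conv[OF biadd_fscale] by (simp add: rscale_def[abs_def])

lemma loc_lop: "(\<And>n. lin_mode (g n)) \<Longrightarrow> loc (lop g u)" "(\<And>n. lin_mode (g n)) \<Longrightarrow> loc (\<lambda>u. lop g u v)"
  unfolding lop_def[abs_def] by (intro loc_conv_right loc_conv_left biadd_lext; assumption)+

lemma loc_rscale: "loc (rscale c)"
  unfolding rscale_def[abs_def] by (intro loc_conv_right biadd_fscale)

lemma euler_lop: "(\<And>n. lin_mode (g n)) \<Longrightarrow> euler (lop g u v) = lop g (euler u) v + lop g u (euler v)"
  unfolding lop_def by (rule euler_conv[OF biadd_lext])

lemma euler_rscale: "euler (rscale c v) = rscale (euler c) v + rscale c (euler v)"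
  unfolding rscale_def by (rule euler_conv[OF biadd_fscale])

lemma rscale_lop: "(\<And>n. lin_mode (g n)) \<Longrightarrow> lop g u (rscale c v) = rscale c (lop g u v)"
  unfolding lop_def rscale_def
  by (subst conv_conv_right[OF biadd_lext], assumption, subst conv_conv_right_swap[OF biadd_fscale])
     (simp add: lext_fscale)

lemma rscale_rscale: "rscale c (rscale d v) = rscale (c * d) v"
  unfolding rscale_def times_series_def
  by (simp add: conv_conv_right[OF biadd_fscale] conv_conv_left[OF biadd_fscale] fscale_fscale)

abbreviation sscale :: "'k::field \<Rightarrow> 'k fock series \<Rightarrow> 'k fock series" where
  "sscale c v \<equiv> map_series (fscale c) v"

lemma sscale_lop: "(\<And>n. lin_mode (g n)) \<Longrightarrow> lop g u (sscale c v) = sscale c (lop g u v)"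
  by (rule series_eqI) (simp add: lop_def scoeff_conv lext_fscale fscale_sum case_prod_beta)

lemma sscale_rscale: "rscale d (sscale c v) = sscale c (rscale d v)"
  by (rule series_eqI) (simp add: rscale_def scoeff_conv fscale_sum case_prod_beta fscale_fscale mult.commute)

lemma sscale_euler: "euler (sscale c v) = sscale c (euler v)"
  by (rule series_eqI) (simp add: fscale_sum del: sum_constant)

lemma cur_op_lop:
  assumes lin: "\<And>n. lin_mode (b n)"
    and comm: "\<And>n m w. n \<noteq> 0 \<Longrightarrow> cmode n (b m w) = b m (cmode n w) + fscale e (b (n + m) w)"
    and u: "\<And>m. Poly_Mapping.lookup (scoeff u m) 0 = 0"
  shows "cur_op u (lop b w v) = lop b w (cur_op u v) + lop b (const_series (Poly_Mapping.single 0 e) * u * w) v"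
proof -
  have c: "const_series (Poly_Mapping.single 0 e) * u * w = conv (\<lambda>x y. Poly_Mapping.single 0 e * x * y) u w"
  proof (rule series_eqI)
    fix m
    have "scoeff (const_series (Poly_Mapping.single 0 e) * u) a = Poly_Mapping.single 0 e * scoeff u a" for a
      unfolding scoeff_times by (subst sum_splits_left) auto
    then show "scoeff (const_series (Poly_Mapping.single 0 e) * u * w) m =
        scoeff (conv (\<lambda>x y. Poly_Mapping.single 0 e * x * y) u w) m"
      by (simp add: scoeff_times[of _ w] scoeff_conv)
  qed
  have "lext cmode (scoeff u a) (lext b q x) = lext b q (lext cmode (scoeff u a) x) +
      lext b (Poly_Mapping.single 0 e * scoeff u a * q) x" for a q x
    using curL_lext[of b e "scoeff u a" q x, OF lin comm] u[of a] by simp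
  then have "conv3 (\<lambda>x y z. lext cmode x (lext b y z)) u w v =
    conv3 (\<lambda>x y z. lext b y (lext cmode x z) + lext b (Poly_Mapping.single 0 e * x * y) z) u w v"
    by (intro conv3_cong)
  then show ?thesis
    unfolding lop_def c conv3_add
    by (simp add: conv_conv_right[OF biadd_lext[of cmode, OF lin_mode_cmode]]
        conv_conv_right_swap[OF biadd_lext[of b, OF lin]] conv_conv_left[OF biadd_lext[of b, OF lin]])
qed

lemma psis_op_psi_op: "psis_op w (psi_op u v) = rscale (coef 0 (w * u)) v - psi_op u (psis_op w v)"
proof -
  have "coef 0 (w * u) = conv (\<lambda>p q. Poly_Mapping.lookup (p * q) 0) w u"
    by (rule series_eqI) (simp add: scoeff_times scoeff_conv lookup_sum case_prod_beta)
  then show ?thesis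
    unfolding lop_def rscale_def
    by (simp add: conv_conv_right[OF biadd_lext[of "\<lambda>n. lact (psi_st (- n))", OF lin_mode_lact]]
        conv_conv_right_swap[OF biadd_lext[of "\<lambda>n. lact (psi n)", OF lin_mode_lact]]
        conv_conv_left[OF biadd_fscale] psisL_psiL conv3_diff)
qed

lemma cur_op_cur_op:
  fixes v :: "'k::field_char_0 fock series"
  shows "cur_op u (cur_op u' v) = cur_op u' (cur_op u v) + rscale (conv heis u u') v"
proof -
  note b = biadd_lext[of cmode, OF lin_mode_cmode]
  have "cur_op u (cur_op u' v) = conv3 (\<lambda>x y z. lext cmode y (lext cmode x z) + fscale (heis x y) z) u u' v"
    unfolding lop_def conv_conv_right[OF b] by (rule conv3_cong) (rule curL_curL)
  also have "\<dots> = cur_op u' (cur_op u v) + rscale (conv heis u u') v"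
    unfolding conv3_add lop_def rscale_def conv_conv_right_swap[OF b, of u'] conv_conv_left[OF biadd_fscale] ..
  finally show ?thesis .
qed

text \<open>When all nonzero exponents have the same sign, no two of them add up to 0, and the
  cocycle vanishes.\<close>

lemma cur_op_tau_commute:
  fixes v :: "'k::field_char_0 fock series"
  assumes "s \<noteq> 0"
  shows "cur_op (tau s c) (cur_op (tau s d) v) = cur_op (tau s d) (cur_op (tau s c) v)"
proof -
  have 1: "heis (Poly_Mapping.single (s * int i) x) (Poly_Mapping.single (s * int j) y) = 0" for i j and x y :: 'k
  proof (cases "i = 0")
    case False
    then have "s * int i + s * int j \<noteq> 0" using assms by (simp flip: distrib_left of_nat_add)
    then show ?thesis by (simp add: heis_single)
  qed (simp add: heis_single)
  have "conv heis (tau s c) (tau s d) = 0"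
    by (rule series_eqI) (simp add: scoeff_conv 1 case_prod_beta)
  then show ?thesis by (simp add: cur_op_cur_op[of "tau s c"] biadd_zero[OF biadd_rscale])
qed

subsection \<open>Exponentials\<close>

text \<open>What it takes to pass a map through the sum of an exponential. Unlike \<open>loc\<close>
  it also covers \<open>euler\<close>, which kills all constants without being 0.\<close>

definition fcont :: "('k::field fock series \<Rightarrow> 'k fock series) \<Rightarrow> bool" where
  "fcont S \<longleftrightarrow> additive S \<and> (\<forall>c v. S (sscale c v) = sscale c (S v)) \<and> (\<forall>d v. vanish d v \<longrightarrow> vanish d (S v))"

lemma loc_vanish: "loc T \<Longrightarrow> vanish d v \<Longrightarrow> vanish d (T v)"
  unfolding vanish_def
proof (intro allI impI)
  fix m assume T: "loc T" and v: "\<forall>m. mdeg m < d \<longrightarrow> scoeff v m = 0" and m: "mdeg m < d"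
  have "scoeff (T (const_series (scoeff v b))) a = 0" if "a + b = m" for a b
    using that m v additive.zero[OF additive_coeff[OF T]] by (metis add_lessD1 add.commute mdeg_add)
  then show "scoeff (T v) m = 0"
    by (subst locD[OF T]) (auto intro!: sum.neutral)
qed

lemma fcontI: "loc S \<Longrightarrow> (\<And>c v. S (sscale c v) = sscale c (S v)) \<Longrightarrow> fcont S"
  by (simp add: fcont_def loc_imp_additive loc_vanish)

lemma fcont_lop: "(\<And>n. lin_mode (g n)) \<Longrightarrow> fcont (lop g u)"
  by (intro fcontI loc_lop sscale_lop)

lemma fcont_rscale: "fcont (rscale c)"
  by (intro fcontI loc_rscale sscale_rscale)

lemma fcont_euler: "fcont euler"
  by (simp add: fcont_def additive_def euler_add sscale_euler vanish_euler)

lemma fcont_zero: "fcont (\<lambda>v. 0)"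
  by (auto simp: fcont_def additive_def vanish_def intro!: series_eqI)

lemma fcont_uminus: "fcont S \<Longrightarrow> fcont (\<lambda>v. - S v)"
  by (auto simp: fcont_def additive_def vanish_def fscale_minus intro!: series_eqI)

lemma fcontD: "fcont S \<Longrightarrow> S (u + v) = S u + S v" "fcont S \<Longrightarrow> S (sscale c v) = sscale c (S v)"
    "fcont S \<Longrightarrow> vanish d v \<Longrightarrow> vanish d (S v)" "fcont S \<Longrightarrow> S (\<Sum>i\<in>I. f i) = (\<Sum>i\<in>I. S (f i))"
    "fcont S \<Longrightarrow> S (u - v) = S u - S v" "fcont S \<Longrightarrow> S 0 = 0"
  by (auto simp: fcont_def additive.add additive.sum additive.diff additive.zero)

text \<open>Every application gains a degree, so the exponential is a finite sum in each
  coefficient.\<close>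

definition raising :: "('a::zero series \<Rightarrow> 'a series) \<Rightarrow> bool" where
  "raising T \<longleftrightarrow> (\<forall>d v. vanish d v \<longrightarrow> vanish (Suc d) (T v))"

lemma raising_funpow: "raising T \<Longrightarrow> vanish n ((T ^^ n) v)"
  by (induction n) (auto simp: raising_def, simp add: vanish_def)

lemma exp_sum_coeff:
  assumes T: "raising T" and s: "\<And>c. s c 0 = 0" and N: "mdeg m \<le> N"
  shows "scoeff (series_sum (\<lambda>n. map_series (s (1 / fact n)) ((T ^^ n) v)) UNIV) m =
    (\<Sum>n\<le>N. s (1 / fact n) (scoeff ((T ^^ n) v) m))"
proof -
  have "scoeff ((T ^^ n) v) m = 0" if "n > N" for n
    using raising_funpow[OF T, of n v] that N by (auto simp: vanish_def)
  then show ?thesis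
    by (subst series_sum_coeff[of "{..N}"]) (auto simp: s)
qed

lemma exp_ket_coeff:
  "raising T \<Longrightarrow> mdeg m \<le> N \<Longrightarrow>
    scoeff (exp_ket T v) m = (\<Sum>n\<le>N. fscale (1 / fact n) (scoeff ((T ^^ n) v) m))"
  unfolding exp_ket_def by (rule exp_sum_coeff) auto

lemma fcont_exp_coeff:
  assumes T: "raising T" and S: "fcont S" and N: "mdeg m \<le> N"
  shows "scoeff (S (exp_ket T v)) m = (\<Sum>n\<le>N. fscale (1 / fact n) (scoeff (S ((T ^^ n) v)) m))"
proof -
  let ?p = "\<Sum>n\<le>N. sscale (1 / fact n) ((T ^^ n) v)"
  have "vanish (Suc N) (exp_ket T v - ?p)"
    by (auto simp: vanish_def exp_ket_coeff[OF T])
  then have "vanish (Suc N) (S (exp_ket T v) - S ?p)"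
    using fcontD(3)[OF S] by (simp only: fcontD(5)[OF S, symmetric])
  then have "scoeff (S (exp_ket T v)) m = scoeff (S ?p) m"
    using N by (simp add: vanish_def)
  then show ?thesis by (simp add: fcontD(2,4)[OF S])
qed

text \<open>If \<open>[T, S] = S'\<close> commutes with \<open>T\<close>, then \<open>e\<^sup>T S = (S + S') e\<^sup>T\<close>. This also applies to the Euler
  derivation \<open>S\<close>.\<close>

lemma exp_ket_twist:
  fixes T :: "'k::field_char_0 fock series \<Rightarrow> 'k fock series"
  assumes T: "raising T" "fcont T" and S: "fcont S" "fcont S'"
    and TS: "\<And>v. T (S v) = S (T v) + S' v" and TS': "\<And>v. T (S' v) = S' (T v)"
  shows "exp_ket T (S v) = S (exp_ket T v) + S' (exp_ket T v)"
proof (rule series_eqI)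
  fix m
  let ?N = "mdeg m"
  have TS'n: "(T ^^ n) (S' v) = S' ((T ^^ n) v)" for n v
    by (induction n) (simp_all add: TS')
  \<comment> \<open>As \<open>S'\<close> commutes with \<open>T\<close>, the commutator of the power
    n + 1 with \<open>S\<close> is n + 1 times S' T^n; the factor n + 1 turns 1 / (n + 1)! into 1 /
    n! below.\<close>
  have pow: "(T ^^ Suc n) (S v) = S ((T ^^ Suc n) v) + sscale (of_nat (Suc n)) (S' ((T ^^ n) v))" for n
  proof (induction n)
    case 0
    show ?case by (rule series_eqI) (simp add: TS)
  next
    case (Suc n)
    have "(T ^^ Suc (Suc n)) (S v) = T ((T ^^ Suc n) (S v))" by simp
    also have "\<dots> = T (S ((T ^^ Suc n) v)) + sscale (of_nat (Suc n)) (S' ((T ^^ Suc n) v))"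
      unfolding Suc by (simp add: fcontD(1,2)[OF T(2)] TS')
    also have "\<dots> = S ((T ^^ Suc (Suc n)) v) + sscale (of_nat (Suc (Suc n))) (S' ((T ^^ Suc n) v))"
      by (rule series_eqI)
         (simp only: TS funpow.simps comp_apply scoeff_add scoeff_map of_nat_Suc fscale_add fscale_one add_ac)
    finally show ?case .
  qed
  have "scoeff (exp_ket T (S v)) m = (\<Sum>n\<le>Suc ?N. fscale (1 / fact n) (scoeff ((T ^^ n) (S v)) m))"
    by (rule exp_ket_coeff[OF T(1)]) simp
  also have "\<dots> = scoeff (S v) m + (\<Sum>n\<le>?N. fscale (1 / fact (Suc n)) (scoeff ((T ^^ Suc n) (S v)) m))"
    by (subst sum.atMost_Suc_shift) simp
  also have "(\<Sum>n\<le>?N. fscale (1 / fact (Suc n)) (scoeff ((T ^^ Suc n) (S v)) m)) =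
      (\<Sum>n\<le>?N. fscale (1 / fact (Suc n)) (scoeff (S ((T ^^ Suc n) v)) m)) +
      (\<Sum>n\<le>?N. fscale (1 / fact n) (scoeff (S' ((T ^^ n) v)) m))"
    unfolding sum.distrib[symmetric]
  proof (intro sum.cong refl)
    fix n
    have "1 / fact (Suc n) * of_nat (Suc n) = (1 / fact n :: 'k)"
      by (simp add: field_simps del: of_nat_Suc)
    then show "fscale (1 / fact (Suc n)) (scoeff ((T ^^ Suc n) (S v)) m) =
      fscale (1 / fact (Suc n)) (scoeff (S ((T ^^ Suc n) v)) m) + fscale (1 / fact n) (scoeff (S' ((T ^^ n) v)) m)"
      unfolding pow by (simp only: scoeff_add scoeff_map fscale_add fscale_fscale)
  qed
  also have "scoeff (S v) m + ((\<Sum>n\<le>?N. fscale (1 / fact (Suc n)) (scoeff (S ((T ^^ Suc n) v)) m)) +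
      (\<Sum>n\<le>?N. fscale (1 / fact n) (scoeff (S' ((T ^^ n) v)) m))) =
    (\<Sum>n\<le>Suc ?N. fscale (1 / fact n) (scoeff (S ((T ^^ n) v)) m)) +
      (\<Sum>n\<le>?N. fscale (1 / fact n) (scoeff (S' ((T ^^ n) v)) m))"
    by (subst sum.atMost_Suc_shift) (simp add: add.assoc)
  also have "\<dots> = scoeff (S (exp_ket T v) + S' (exp_ket T v)) m"
    by (simp add: fcont_exp_coeff[OF T(1) S(1), of m "Suc ?N"] fcont_exp_coeff[OF T(1) S(2), of m ?N])
  finally show "scoeff (exp_ket T (S v)) m = scoeff (S (exp_ket T v) + S' (exp_ket T v)) m" .
qed

lemma exp_ket_commute:
  fixes T :: "'k::field_char_0 fock series \<Rightarrow> 'k fock series"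
  assumes "raising T" "fcont T" "fcont S" "\<And>v. T (S v) = S (T v)"
  shows "exp_ket T (S v) = S (exp_ket T v)"
  using exp_ket_twist[of T S "\<lambda>v. 0" v] assms fcont_zero fcontD(6)[OF assms(2)] by simp

lemma exp_ket_fixed:
  assumes "raising T" "T v = 0" "T 0 = 0" shows "exp_ket T v = v"
proof (rule series_eqI)
  fix m
  have "(T ^^ Suc n) v = 0" for n
    by (induction n) (simp_all add: assms)
  then have "(T ^^ n) v = (if n = 0 then v else 0)" for n
    by (cases n) auto
  then have "scoeff (exp_ket T v) m = (\<Sum>n\<le>mdeg m. if n = 0 then scoeff v m else 0)"
    by (subst exp_ket_coeff[OF assms(1) order_refl]) (intro sum.cong, auto)
  then show "scoeff (exp_ket T v) m = scoeff v m" by simp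
qed

lemma loc_exp_ket:
  assumes T: "raising T" "loc T" shows "loc (exp_ket T)"
  unfolding loc_def
proof (intro conjI allI)
  have n: "loc (T ^^ n)" for n by (rule loc_funpow[OF T(2)])
  show "additive (\<lambda>x. exp_ket T (const_series x))"
    unfolding additive_def
  proof (intro allI series_eqI)
    fix x y m
    show "scoeff (exp_ket T (const_series (x + y))) m =
        scoeff (exp_ket T (const_series x) + exp_ket T (const_series y)) m"
      by (simp add: exp_ket_coeff[OF T(1) order_refl] additive.add[OF loc_additive[OF n]] fscale_add sum.distrib)
  qed
  fix v m
  have "scoeff (exp_ket T v) m = (\<Sum>n\<le>mdeg m. \<Sum>(a, b)\<in>splits m.
      fscale (1 / fact n) (scoeff ((T ^^ n) (const_series (scoeff v b))) a))"
    by (simp only: exp_ket_coeff[OF T(1) order_refl] locD[OF n, where v = v]) (simp add: fscale_sum case_prod_beta)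
  also have "\<dots> = (\<Sum>(a, b)\<in>splits m. \<Sum>n\<le>mdeg m.
      fscale (1 / fact n) (scoeff ((T ^^ n) (const_series (scoeff v b))) a))"
    unfolding case_prod_beta by (rule sum.swap)
  also have "\<dots> = (\<Sum>(a, b)\<in>splits m. scoeff (exp_ket T (const_series (scoeff v b))) a)"
  proof (intro sum.cong refl, clarify)
    fix a b assume "(a, b) \<in> splits m"
    then have "mdeg a \<le> mdeg m" by auto
    then show "(\<Sum>n\<le>mdeg m. fscale (1 / fact n) (scoeff ((T ^^ n) (const_series (scoeff v b))) a)) =
      scoeff (exp_ket T (const_series (scoeff v b))) a"
      by (simp add: exp_ket_coeff[OF T(1)])
  qed
  finally show "scoeff (exp_ket T v) m = (\<Sum>(a, b)\<in>splits m. scoeff (exp_ket T (const_series (scoeff v b))) a)" .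
qed

subsection \<open>Vertex operators\<close>

text \<open>For \<open>s = -1\<close> the exponential of H, for \<open>s = 1\<close> that of its
  adjoint; in the applications \<open>c\<close> is the logarithm \<open>pR X\<close>.\<close>

definition vert :: "int \<Rightarrow> 'k::field_char_0 series \<Rightarrow> 'k fock series \<Rightarrow> 'k fock series" where
  "vert s c = exp_ket (cur_op (tau s c))"

lemma raising_cur_op: "scoeff u 0 = 0 \<Longrightarrow> raising (cur_op u)"
  unfolding raising_def lop_def
  using vanish_conv[OF biadd_lext[of cmode, OF lin_mode_cmode], of 1 u] by (simp add: vanish_1_iff)

lemma raising_cur_tau: "scoeff c 0 = 0 \<Longrightarrow> raising (cur_op (tau s c))"
  by (rule raising_cur_op) simp

lemma loc_vert: "scoeff c 0 = 0 \<Longrightarrow> loc (vert s c)"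
  unfolding vert_def by (intro loc_exp_ket raising_cur_tau loc_lop lin_modes)

lemma vert_zero_right: "scoeff c 0 = 0 \<Longrightarrow> vert s c 0 = 0"
  by (rule additive.zero[OF loc_imp_additive[OF loc_vert]])

lemma vert_0: "scoeff c 0 = 0 \<Longrightarrow> scoeff (vert s c v) 0 = scoeff v 0"
  unfolding vert_def by (subst exp_ket_coeff[OF raising_cur_tau, of _ 0 0]) auto

text \<open>An instance of \<open>exp_ket_twist\<close>: the commutator of a current with the Euler
  derivation is, up to sign, a current in the same direction, and the two currents commute.\<close>

lemma euler_vert:
  assumes c: "scoeff c 0 = 0" and s: "s \<noteq> 0"
  shows "euler (vert s c v) = cur_op (tau s (euler c)) (vert s c v) + vert s c (euler v)"
proof -
  have "vert s c (euler v) = euler (vert s c v) + - cur_op (tau s (euler c)) (vert s c v)"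
    unfolding vert_def
  proof (rule exp_ket_twist)
    show "cur_op (tau s c) (euler v) = euler (cur_op (tau s c) v) + - cur_op (tau s (euler c)) v" for v
      by (simp add: euler_lop[of cmode, OF lin_mode_cmode] euler_tau)
    show "cur_op (tau s c) (- cur_op (tau s (euler c)) v) = - cur_op (tau s (euler c)) (cur_op (tau s c) v)" for v
      by (simp add: biadd_minus[OF biadd_lop[of cmode, OF lin_mode_cmode]] cur_op_tau_commute[OF s, of c])
  qed (intro raising_cur_tau c fcont_euler fcont_uminus fcont_lop lin_modes)+
  then show ?thesis by simp
qed

lemma vert_unique:
  assumes c: "scoeff c 0 = 0" and s: "s \<noteq> 0"
    and y: "euler y = cur_op (tau s (euler c)) y" "scoeff y 0 = x"
  shows "y = vert s c (const_series x)"
proof -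
  have "y - vert s c (const_series x) = 0"
  proof (rule euler_ode_zero[OF torsion_free_fock])
    show "euler (y - vert s c (const_series x)) = cur_op (tau s (euler c)) (y - vert s c (const_series x))"
      using biadd_zero[OF biadd_lop[of cmode, OF lin_mode_cmode]] loc_imp_additive[OF loc_vert[OF c, of s]]
      by (simp add: euler_diff y(1) euler_vert[OF c s] biadd_diff[OF biadd_lop[of cmode, OF lin_mode_cmode]] additive.zero)
    show "vanish (Suc d) (cur_op (tau s (euler c)) (y - vert s c (const_series x)))"
      if "vanish d (y - vert s c (const_series x))" for d
      using raising_cur_tau[of "euler c" s] that by (simp add: raising_def)
    show "scoeff (y - vert s c (const_series x)) 0 = 0"
      by (simp add: vert_0[OF c] y(2))
  qed
  then show ?thesis by simp
qed

text \<open>Conjugation multiplies the symbol of a field by \<open>h\<close>, the exponential of e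
  c, which is specified by its Euler equation. For a constant symbol and a constant vector both
  sides solve the same equation; \<open>loc\<close> then frees first the symbol and after that the
  vector.\<close>

lemma vert_lop:
  fixes c h :: "'k::field_char_0 series"
  assumes lin: "\<And>n. lin_mode (b n)"
    and comm: "\<And>n m w. n \<noteq> 0 \<Longrightarrow> cmode n (b m w) = b m (cmode n w) + fscale e (b (n + m) w)"
    and c: "scoeff c 0 = 0" and s: "s \<noteq> 0"
    and h: "tau s (euler h) = const_series (Poly_Mapping.single 0 e) * tau s (euler c) * tau s h" "scoeff h 0 = 1"
  shows "vert s c (lop b w v) = lop b (tau s h * w) (vert s c v)"
proof -
  note vz = vert_zero_right[OF c, of s]
  note lz = biadd_zero[OF biadd_lop[of b, OF lin]]
  have const: "vert s c (lop b (const_series p) (const_series x)) = lop b (tau s h * const_series p) (vert s c (const_series x))" for p x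
  proof -
    let ?y = "lop b (tau s h * const_series p) (vert s c (const_series x))"
    have "lop b (const_series p) (const_series x) = const_series (lext b p x)"
      unfolding lop_def
      by (rule series_eqI) (simp add: conv_const_left[OF biadd_lext[of b, OF lin]] biadd_zero[OF biadd_lext[of b, OF lin]])
    moreover have "?y = vert s c (const_series (lext b p x))"
    proof (rule vert_unique[OF c s])
      have "Poly_Mapping.lookup (scoeff (tau s (euler c)) m) 0 = 0" for m
        using s by (cases "m = 0") (auto simp: lookup_single when_def)
      then have "cur_op (tau s (euler c)) ?y =
         lop b (tau s h * const_series p) (cur_op (tau s (euler c)) (vert s c (const_series x))) +
         lop b (const_series (Poly_Mapping.single 0 e) * tau s (euler c) * (tau s h * const_series p)) (vert s c (const_series x))"
        by (intro cur_op_lop lin comm)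
      then show "euler ?y = cur_op (tau s (euler c)) ?y"
        by (simp add: euler_lop[of b, OF lin] euler_mult euler_tau h(1) euler_vert[OF c s] vz lz mult_ac)
      have "scoeff (tau s h * const_series p) 0 = p"
        by (simp add: scoeff_times h(2))
      then show "scoeff ?y 0 = lext b p x"
        by (simp add: lop_def scoeff_conv vert_0[OF c])
    qed
    ultimately show ?thesis by simp
  qed
  have const2: "vert s c (lop b w (const_series x)) = lop b (tau s h * w) (vert s c (const_series x))" for x
  proof (rule loc_eqI[where S = "\<lambda>w. vert s c (lop b w (const_series x))"
        and T = "\<lambda>w. lop b (tau s h * w) (vert s c (const_series x))"])
    show "loc (\<lambda>w. vert s c (lop b w (const_series x)))"
      by (intro loc_comp[OF loc_vert[OF c]] loc_lop lin)
    show "loc (\<lambda>w. lop b (tau s h * w) (vert s c (const_series x)))"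
      using loc_comp[OF loc_lop(2)[of b, OF lin] loc_conv_right[OF biadd_times, of "tau s h"]]
      by (simp add: times_series_def)
  qed (rule const)
  show ?thesis
  proof (rule loc_eqI[where S = "\<lambda>v. vert s c (lop b w v)" and T = "\<lambda>v. lop b (tau s h * w) (vert s c v)"])
    show "loc (\<lambda>v. vert s c (lop b w v))"
      by (intro loc_comp[OF loc_vert[OF c]] loc_lop lin)
    show "loc (\<lambda>v. lop b (tau s h * w) (vert s c v))"
      by (intro loc_comp[OF _ loc_vert[OF c]] loc_lop lin)
  qed (rule const2)
qed

lemma vert_psi_op:
  fixes c h :: "'k::field_char_0 series"
  assumes "scoeff c 0 = 0" "s \<noteq> 0" "euler h = euler c * h" "scoeff h 0 = 1"
  shows "vert s c (psi_op w v) = psi_op (tau s h * w) (vert s c v)"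
proof (rule vert_lop[where e = 1])
  have "const_series (Poly_Mapping.single 0 1) = (1 :: 'k laurent)"
    by (rule series_eqI) (simp add: scoeff_one)
  then show "tau s (euler h) = const_series (Poly_Mapping.single 0 1) * tau s (euler c) * tau s h"
    using assms(3) by (simp add: tau_mult)
qed (use assms lin_modes in \<open>auto simp: cmode_pmode\<close>)

lemma vert_psis_op:
  fixes c h :: "'k::field_char_0 series"
  assumes "scoeff c 0 = 0" "s \<noteq> 0" "euler h = - euler c * h" "scoeff h 0 = 1"
  shows "vert s c (psis_op w v) = psis_op (tau s h * w) (vert s c v)"
proof (rule vert_lop[where e = "- 1"])
  have "const_series (Poly_Mapping.single 0 (- 1)) = (- 1 :: 'k laurent)"
    by (rule series_eqI) (simp add: scoeff_one single_uminus)
  then show "tau s (euler h) = const_series (Poly_Mapping.single 0 (- 1)) * tau s (euler c) * tau s h"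
    using assms(3) by (simp add: tau_mult tau_uminus)
qed (use assms lin_modes in \<open>auto simp: cmode_smode\<close>)

lemma vert_add:
  assumes c: "scoeff c 0 = 0" and d: "scoeff d 0 = 0" and s: "s \<noteq> 0"
  shows "vert s (c + d) v = vert s c (vert s d v)"
proof (rule loc_eqI[where S = "vert s (c + d)"])
  show "loc (vert s (c + d))" by (rule loc_vert) (simp add: c d)
  show "loc (\<lambda>v. vert s c (vert s d v))" by (rule loc_comp[OF loc_vert loc_vert]) (rule c d)+
  fix x
  have vz: "vert s c 0 = 0" "vert s d 0 = 0"
    by (simp_all add: vert_zero_right c d)
  have "vert s c (vert s d (const_series x)) = vert s (c + d) (const_series x)"
  proof (rule vert_unique[OF _ s])
    have "vert s c (cur_op (tau s (euler d)) v) = cur_op (tau s (euler d)) (vert s c v)" for v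
      unfolding vert_def
      by (rule exp_ket_commute)
         (simp_all add: raising_cur_tau c fcont_lop lin_mode_cmode cur_op_tau_commute[OF s, of c "euler d"])
    then show "euler (vert s c (vert s d (const_series x))) =
        cur_op (tau s (euler (c + d))) (vert s c (vert s d (const_series x)))"
      by (simp add: euler_vert c d s vz loc_add[OF loc_vert[OF c]] euler_add tau_add
          biadd_add[OF biadd_lop[of cmode, OF lin_mode_cmode]])
  qed (simp_all add: c d vert_0)
  then show "vert s (c + d) (const_series x) = vert s c (vert s d (const_series x))" by simp
qed

lemma vert_zero [simp]: "vert s 0 v = v"
  unfolding vert_def tau_zero
  by (rule exp_ket_fixed) (use raising_cur_op[of 0] in \<open>auto simp: biadd_zero[OF biadd_lop[of cmode, OF lin_mode_cmode]]\<close>)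

lemma vert_uminus: "scoeff c 0 = 0 \<Longrightarrow> s \<noteq> 0 \<Longrightarrow> vert s (- c) (vert s c v) = v"
    "scoeff c 0 = 0 \<Longrightarrow> s \<noteq> 0 \<Longrightarrow> vert s c (vert s (- c) v) = v"
  using vert_add[of "- c" c s v] vert_add[of c "- c" s v] by simp_all

text \<open>\<open>K\<close> is the exponential of the cocycle of the two symbols, again specified
  by its Euler equation. On constants both sides solve the equation given by \<open>?S\<close> and
  start from the same value.\<close>

lemma vert_heis:
  fixes c d K :: "'k::field_char_0 series"
  assumes c: "scoeff c 0 = 0" and d: "scoeff d 0 = 0" and s: "s \<noteq> 0"
    and K: "euler K = euler (conv heis (tau s c) (tau (- s) d)) * K" "scoeff K 0 = 1"
  shows "vert s c (vert (- s) d v) = rscale K (vert (- s) d (vert s c v))"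
proof (rule loc_eqI[where S = "\<lambda>v. vert s c (vert (- s) d v)" and T = "\<lambda>v. rscale K (vert (- s) d (vert s c v))"])
  show "loc (\<lambda>v. vert s c (vert (- s) d v))" by (rule loc_comp[OF loc_vert loc_vert]) (rule c d)+
  show "loc (\<lambda>v. rscale K (vert (- s) d (vert s c v)))" by (rule loc_comp[OF loc_rscale loc_comp[OF loc_vert loc_vert]]) (rule c d)+
  fix x
  have s': "- s \<noteq> 0" using s by simp
  have vz: "vert s c 0 = 0" "vert (- s) d 0 = 0"
    by (simp_all add: vert_zero_right c d)
  \<comment> \<open>By the Leibniz rule the derivative of the exponent splits in two.
    \<open>c1\<close> arises when \<open>vert s c\<close> passes the current of
    \<open>euler d\<close>, and \<open>c2\<close> when \<open>vert (- s) d\<close> passes the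
    current of \<open>euler c\<close>.\<close>
  define c1 where "c1 = conv heis (tau s c) (tau (- s) (euler d))"
  define c2 where "c2 = conv heis (tau s (euler c)) (tau (- s) d)"
  have Kc: "euler K = (c1 + c2) * K"
    using K(1) by (simp add: euler_conv[OF biadd_heis] c1_def c2_def euler_tau add.commute)
  have tw1: "vert s c (cur_op (tau (- s) (euler d)) v) = cur_op (tau (- s) (euler d)) (vert s c v) + rscale c1 (vert s c v)" for v
    unfolding vert_def
    by (rule exp_ket_twist)
       (simp_all add: raising_cur_tau c fcont_lop lin_mode_cmode fcont_rscale rscale_lop c1_def
         cur_op_cur_op[of "tau s c" "tau (- s) (euler d)"])
  have tw2: "vert (- s) d (cur_op (tau s (euler c)) v) =
      cur_op (tau s (euler c)) (vert (- s) d v) + rscale (- c2) (vert (- s) d v)" for v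
    unfolding vert_def
    by (rule exp_ket_twist)
       (simp_all add: raising_cur_tau d fcont_lop lin_mode_cmode fcont_rscale rscale_lop c2_def
         cur_op_cur_op[of "tau s (euler c)" "tau (- s) d"] biadd_minus[OF biadd_rscale] fcont_uminus
         biadd_minus[OF biadd_lop[of cmode, OF lin_mode_cmode]])
  let ?A = "vert s c (vert (- s) d (const_series x))" and ?B = "vert (- s) d (vert s c (const_series x))"
  let ?D = "?A - rscale K ?B"
  let ?S = "\<lambda>w. cur_op (tau s (euler c)) w + cur_op (tau (- s) (euler d)) w + rscale c1 w"
  note simps = biadd_diff[OF biadd_lop[of cmode, OF lin_mode_cmode]] biadd_diff[OF biadd_rscale]
    biadd_add[OF biadd_rscale] biadd_minus[OF biadd_rscale]
    rscale_lop[of cmode, OF lin_mode_cmode] rscale_rscale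
  have "?D = 0"
  proof (rule euler_ode_zero[OF torsion_free_fock, where S = ?S])
    have "euler ?A = ?S ?A"
      by (simp add: euler_vert[OF c s] euler_vert[OF d s'] loc_add[OF loc_vert[OF c]] vz tw1)
    moreover have "euler (rscale K ?B) = ?S (rscale K ?B)"
      by (simp add: euler_rscale Kc euler_vert[OF c s] euler_vert[OF d s'] loc_add[OF loc_vert[OF d]] vz tw2 simps
          algebra_simps)
    ultimately show "euler ?D = ?S ?D"
      by (simp add: euler_diff simps algebra_simps)
    have "scoeff c1 0 = 0" by (simp add: c1_def scoeff_conv c biadd_zero[OF biadd_heis])
    then show "vanish (Suc e) (?S ?D)" if "vanish e ?D" for e
      using raising_cur_tau[of "euler c" s] raising_cur_tau[of "euler d" "- s"] that
        vanish_conv[OF biadd_fscale, of 1 c1 e ?D]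
      by (auto simp: raising_def vanish_1_iff rscale_def vanish_def)
    show "scoeff ?D 0 = 0"
      by (simp add: vert_0 c d rscale_def scoeff_conv K(2))
  qed
  then show "?A = rscale K ?B" by simp
qed

subsection \<open>The operators \<open>H(X)\<close> and their adjoints\<close>

text \<open>p_k(X) is homogeneous of degree k, so the summation index can be read off from the
  monomial and the sum over k collapses to one convolution with \<open>pR X\<close>.\<close>

lemma power_sum_series:
  assumes X: "homog X" and f: "\<And>y. f 0 y = 0"
  shows "scoeff (series_sum (\<lambda>k. conv f (const_series (1 / of_nat k) * psum k X) (map_series (g k) v)) {1..}) m =
    (\<Sum>(a, b)\<in>splits m. if a = 0 then 0 else f (scoeff (pR X) a) (g (mdeg a) (scoeff v b)))"
proof -
  have c: "scoeff (const_series (1 / of_nat k) * psum k X) a = (if mdeg a = k then scoeff (pR X) a else 0)" for k a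
    unfolding scoeff_times using psum_homog[OF X, of a k] by (subst sum_splits_left) (auto simp: pR_def)
  have t: "scoeff (conv f (const_series (1 / of_nat k) * psum k X) (map_series (g k) v)) m =
     (\<Sum>(a, b)\<in>splits m. if mdeg a = k then f (scoeff (pR X) a) (g (mdeg a) (scoeff v b)) else 0)" for k
    unfolding scoeff_conv c by (intro sum.cong refl) (auto simp: f)
  have "scoeff (series_sum (\<lambda>k. conv f (const_series (1 / of_nat k) * psum k X) (map_series (g k) v)) {1..}) m =
     (\<Sum>k=1..mdeg m. \<Sum>(a, b)\<in>splits m. if mdeg a = k then f (scoeff (pR X) a) (g (mdeg a) (scoeff v b)) else 0)"
    by (subst series_sum_coeff[of "{1..mdeg m}"]) (auto simp: t intro!: sum.neutral)
  also have "\<dots> = (\<Sum>(a, b)\<in>splits m. \<Sum>k=1..mdeg m. if mdeg a = k then f (scoeff (pR X) a) (g (mdeg a) (scoeff v b)) else 0)"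
    unfolding case_prod_beta by (rule sum.swap)
  also have "\<dots> = (\<Sum>(a, b)\<in>splits m. if a = 0 then 0 else f (scoeff (pR X) a) (g (mdeg a) (scoeff v b)))"
    by (intro sum.cong refl) (auto simp: Suc_le_eq simp flip: mdeg_eq_0_iff)
  finally show ?thesis .
qed

lemma H_op_eq: assumes "homog X" shows "H_op X = cur_op (tau (- 1) (pR X))"
proof (intro ext series_eqI)
  fix v m
  show "scoeff (H_op X v) m = scoeff (cur_op (tau (- 1) (pR X)) v) m"
    unfolding H_op_def lop_def scoeff_conv
    by (subst power_sum_series[OF assms, of fscale "\<lambda>k. current (int k)"], simp)
       (intro sum.cong refl, auto simp: cmode_def)
qed

lemma Hst_op_eq: assumes "homog X" shows "Hst_op X = cur_op (tau 1 (pR X))"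
proof (intro ext series_eqI)
  fix v m
  show "scoeff (Hst_op X v) m = scoeff (cur_op (tau 1 (pR X)) v) m"
    unfolding Hst_op_def lop_def scoeff_conv
    by (subst power_sum_series[OF assms, of fscale "\<lambda>k. current (- int k)"], simp)
       (intro sum.cong refl, auto simp: cmode_def)
qed

lemma exp_H_op: "homog X \<Longrightarrow> exp_ket (H_op X) = vert (- 1) (pR X)"
  and exp_Hst_op: "homog X \<Longrightarrow> exp_ket (Hst_op X) = vert 1 (pR X)"
  by (simp_all add: H_op_eq Hst_op_eq vert_def)

lemma uminus_cur_op: "- cur_op (tau s c) = cur_op (tau s (- c))"
  by (rule ext) (simp add: tau_uminus biadd_minus[OF biadd_lop[of cmode, OF lin_mode_cmode]] fun_Compl_def)

lemma exp_uminus_H_op: "homog X \<Longrightarrow> exp_ket (- H_op X) = vert (- 1) (pR (- X))"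
  and exp_uminus_Hst_op: "homog X \<Longrightarrow> exp_ket (- Hst_op X) = vert 1 (pR (- X))"
  by (simp_all add: H_op_eq Hst_op_eq vert_def uminus_cur_op pR_uminus)

abbreviation hv :: "int \<Rightarrow> 'k::field_char_0 alphabet \<Rightarrow> 'k fock series \<Rightarrow> 'k fock series" where
  "hv s X \<equiv> vert s (pR X)"

lemma hv_add: "s \<noteq> 0 \<Longrightarrow> hv s (X + Y) v = hv s X (hv s Y v)"
  by (simp add: pR_add vert_add)

lemma hv_psi_op: "homog X \<Longrightarrow> s \<noteq> 0 \<Longrightarrow> hv s X (psi_op w v) = psi_op (tau s (hR X) * w) (hv s X v)"
  by (intro vert_psi_op) (simp_all add: euler_hR hR_0)

lemma hv_psis_op: "homog X \<Longrightarrow> s \<noteq> 0 \<Longrightarrow> hv s X (psis_op w v) = psis_op (tau s (hR (- X)) * w) (hv s X v)"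
  by (intro vert_psis_op) (simp_all add: euler_hR hR_0 pR_uminus euler_uminus)

subsection \<open>Adjoints\<close>

lemma mdeg_pos_iff [simp]: "0 < mdeg m \<longleftrightarrow> m \<noteq> 0"
  using mdeg_eq_0_iff[of m] by linarith

text \<open>Stated for a general pairing \<open>g\<close> and scaling \<open>s\<close>, as it serves
  operators on kets through \<open>form\<close> as well as the right action on bras through
  \<open>pairing\<close>.\<close>

lemma exp_adjoint:
  fixes g :: "'a::ab_group_add \<Rightarrow> 'k::field_char_0 fock \<Rightarrow> 'k"
  assumes g: "biadd g" "\<And>c x y. g (s c x) y = c * g x y" "\<And>c x y. g x (fscale c y) = c * g x y"
    and s: "\<And>c. s c 0 = 0" and T: "raising T'" "raising T"
    and adj: "\<And>w v. conv g (T' w) v = conv g w (T v)"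
  shows "conv g (series_sum (\<lambda>n. map_series (s (1 / fact n)) ((T' ^^ n) w)) UNIV) v = conv g w (exp_ket T v)"
proof (rule series_eqI)
  fix m
  let ?N = "mdeg m"
  have pow: "conv g ((T' ^^ n) w) v = conv g w ((T ^^ n) v)" for n
  proof (induction n arbitrary: v)
    case (Suc n)
    from Suc[of "T v"] show ?case by (simp add: adj) (simp add: funpow_swap1)
  qed simp
  have "scoeff (conv g (series_sum (\<lambda>n. map_series (s (1 / fact n)) ((T' ^^ n) w)) UNIV) v) m =
    (\<Sum>(a, b)\<in>splits m. \<Sum>n\<le>?N. 1 / fact n * g (scoeff ((T' ^^ n) w) a) (scoeff v b))"
    unfolding scoeff_conv
  proof (intro sum.cong refl, clarify)
    fix a b assume "(a, b) \<in> splits m"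
    then have "mdeg a \<le> ?N" by auto
    from exp_sum_coeff[where s = s, OF T(1) s this, of w]
    show "g (scoeff (series_sum (\<lambda>n. map_series (s (1 / fact n)) ((T' ^^ n) w)) UNIV) a) (scoeff v b) =
      (\<Sum>n\<le>?N. 1 / fact n * g (scoeff ((T' ^^ n) w) a) (scoeff v b))"
      by (simp add: biadd_sum[OF g(1)] g(2))
  qed
  also have "\<dots> = (\<Sum>n\<le>?N. 1 / fact n * scoeff (conv g ((T' ^^ n) w) v) m)"
    unfolding case_prod_beta scoeff_conv sum_distrib_left by (rule sum.swap)
  also have "\<dots> = (\<Sum>n\<le>?N. 1 / fact n * scoeff (conv g w ((T ^^ n) v)) m)"
    unfolding pow ..
  also have "\<dots> = (\<Sum>(a, b)\<in>splits m. \<Sum>n\<le>?N. 1 / fact n * g (scoeff w a) (scoeff ((T ^^ n) v) b))"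
    unfolding case_prod_beta scoeff_conv sum_distrib_left by (rule sum.swap)
  also have "\<dots> = scoeff (conv g w (exp_ket T v)) m"
    unfolding scoeff_conv
  proof (intro sum.cong refl, clarify)
    fix a b assume "(a, b) \<in> splits m"
    then have "mdeg b \<le> ?N" by auto
    from exp_ket_coeff[OF T(2) this, of v]
    show "(\<Sum>n\<le>?N. 1 / fact n * g (scoeff w a) (scoeff ((T ^^ n) v) b)) = g (scoeff w a) (scoeff (exp_ket T v) b)"
      by (simp add: biadd_sum[OF g(1)] g(3))
  qed
  finally show "scoeff (conv g (series_sum (\<lambda>n. map_series (s (1 / fact n)) ((T' ^^ n) w)) UNIV) v) m =
    scoeff (conv g w (exp_ket T v)) m" .
qed

text \<open>The degree travels along with the coefficient, so that adjointness can be checked on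
  single modes.\<close>

lemma cur_op_tau: "cur_op (tau s c) v =
    conv (\<lambda>(k, c) v. fscale c (cmode (s * int k) v)) (Series (\<lambda>a. (mdeg a, scoeff c a))) v"
  by (rule series_eqI) (simp add: lop_def scoeff_conv)

lemma form_cmode: "form (cmode n u) v = form u (cmode (- n) v)"
  by (simp add: cmode_def form_current biadd_zero[OF biadd_form])

lemma sform_cur_op: "conv form (cur_op (tau s c) u) v = conv form u (cur_op (tau (- s) c) v)"
  unfolding cur_op_tau conv_conv_left[OF biadd_form] conv_conv_right_swap[OF biadd_form]
  by (rule conv3_cong) (simp add: form_fscale form_cmode)

lemma sform_vert:
  assumes "scoeff c 0 = 0"
  shows "conv form (vert s c u) v = conv form u (vert (- s) c v)"
  unfolding vert_def exp_ket_def[of _ u]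
  by (rule exp_adjoint[of form fscale])
     (auto simp: biadd_form form_fscale sform_cur_op raising_cur_tau assms)

lemma sform_psi: "conv form (map_series (lact (psi n)) u) v = conv form u (map_series (lact (psi_st n)) v)"
  by (rule series_eqI) (simp add: scoeff_conv form_psi)

lemma pairing_fstar: "conv pairing (map_series fstar u) v = conv form u v"
  by (rule series_eqI) (simp add: scoeff_conv form_def)

lemma pairing_ract_series:
  "conv pairing (map_series (\<lambda>w. ract w X) w) v = conv pairing w (map_series (lact X) v)"
  by (rule series_eqI) (simp add: scoeff_conv pairing_ract)

lemma dscale_0 [simp]: "dscale c 0 = 0"
  unfolding dscale_def by transfer (simp add: bra_eq_def bra_ideal.zero)
lemma dscale_zero_left: "dscale 0 w = 0"
  unfolding dscale_def scal_zero by transfer (simp add: bra_eq_def bra_ideal.zero)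

lemma dHst_op_eq:
  assumes "homog X"
  shows "dHst_op X w = conv (\<lambda>(k, c) w. if k = 0 then 0 else dscale c (dcurrent (- int k) w))
    (Series (\<lambda>a. (mdeg a, scoeff (pR X) a))) w"
proof (rule series_eqI)
  fix m
  show "scoeff (dHst_op X w) m = scoeff (conv (\<lambda>(k, c) w. if k = 0 then 0 else dscale c (dcurrent (- int k) w))
      (Series (\<lambda>a. (mdeg a, scoeff (pR X) a))) w) m"
    unfolding dHst_op_def scoeff_conv
    by (subst power_sum_series[OF assms, of dscale "\<lambda>k. dcurrent (- int k)"]) (simp_all add: dscale_zero_left)
qed

lemma dcurrent_zero: "k \<noteq> 0 \<Longrightarrow> dcurrent k 0 = 0"
  using dcurrent_add[of k 0 0] by simp

lemma raising_dHst_op: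
  assumes X: "homog X" shows "raising (dHst_op X)"
  unfolding raising_def
proof (intro allI impI)
  fix d and w :: "'a dfock series" assume w: "vanish d w"
  have "dscale (scoeff (pR X) a) (dcurrent (- int (mdeg a)) (scoeff w b)) = 0"
    if "mdeg a + mdeg b < Suc d" "a \<noteq> 0" for a b
  proof -
    have "mdeg b < d" using that mdeg_pos_iff[of a] by linarith
    with w have "scoeff w b = 0" by (simp add: vanish_def)
    with \<open>a \<noteq> 0\<close> show ?thesis by (simp add: dcurrent_zero)
  qed
  then show "vanish (Suc d) (dHst_op X w)"
    by (auto simp: vanish_def dHst_op_eq[OF X] scoeff_conv intro!: sum.neutral)
qed

lemma pairing_dHst_op:
  assumes "homog X"
  shows "conv pairing (dHst_op X w) v = conv pairing w (cur_op (tau 1 (pR X)) v)"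
  unfolding cur_op_tau dHst_op_eq[OF assms] conv_conv_left[OF biadd_pairing] conv_conv_right_swap[OF biadd_pairing]
  by (rule conv3_cong)
     (auto simp: pairing_dscale pairing_fscale cmode_def pairing_dcurrent biadd_zero[OF biadd_pairing] split: prod.splits)

lemma pairing_exp_bra:
  assumes X: "homog X"
  shows "conv pairing (exp_bra (dHst_op X) w) v = conv pairing w (hv 1 X v)"
    "conv pairing (exp_bra (- dHst_op X) w) v = conv pairing w (hv 1 (- X) v)"
proof -
  show "conv pairing (exp_bra (dHst_op X) w) v = conv pairing w (hv 1 X v)"
    unfolding exp_bra_def vert_def
    by (rule exp_adjoint[of pairing dscale])
       (simp_all add: biadd_pairing pairing_dscale pairing_fscale raising_dHst_op X raising_cur_tau pairing_dHst_op)
  have "raising (- dHst_op X)"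
    using raising_dHst_op[OF X] by (simp add: raising_def vanish_def fun_Compl_def)
  then show "conv pairing (exp_bra (- dHst_op X) w) v = conv pairing w (hv 1 (- X) v)"
    unfolding exp_bra_def vert_def
    by (intro exp_adjoint[of pairing dscale])
       (simp_all add: raising_cur_op biadd_pairing pairing_dscale pairing_fscale X raising_cur_tau pairing_dHst_op fun_Compl_def
         pR_uminus tau_uminus biadd_minus[OF biadd_lop[of cmode, OF lin_mode_cmode]]
         biadd_minus[OF biadd_conv[OF biadd_pairing]])
qed

section \<open>From vacuum expectation values to determinants of complete functions\<close>

subsection \<open>Vertex operators on the shifted vacua\<close>

abbreviation cket :: "nat \<Rightarrow> 'k::field fock series" where
  "cket l \<equiv> const_series (sket l)"

definition bra :: "nat \<Rightarrow> 'k::field_char_0 fock series \<Rightarrow> 'k series" where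
  "bra l v = conv form (cket l) v"

lemma scoeff_bra: "scoeff (bra l v) m = form (sket l) (scoeff v m)"
  by (simp add: bra_def conv_const_left[OF biadd_form])

lemma bra_pairing: "conv pairing (const_series (shift_bra (- int l))) v = bra l v"
  by (rule series_eqI) (simp add: scoeff_bra conv_const_left[OF biadd_pairing] form_def fstar_sket)

lemma additive_bra: "additive (bra l)"
  by (auto simp: additive_def scoeff_bra biadd_add[OF biadd_form] intro!: series_eqI)

lemma bra_rscale: "bra l (rscale c v) = c * bra l v"
  by (rule series_eqI)
     (simp add: scoeff_bra rscale_def scoeff_conv scoeff_times biadd_sum[OF biadd_form] form_fscale case_prod_beta)

lemma bra_cket: "bra l (cket l) = 1"
  by (rule series_eqI) (simp add: scoeff_bra scoeff_one form_sket biadd_zero[OF biadd_form])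

text \<open>Currents of positive index kill every shifted vacuum, so the exponential of H fixes
  it.\<close>

lemma vert_cket:
  assumes c: "scoeff c 0 = 0" shows "vert (- 1) c (cket l) = cket l"
  unfolding vert_def
proof (rule exp_ket_fixed)
  show "cur_op (tau (- 1) c) (cket l) = 0"
    unfolding lop_def
    by (rule series_eqI)
       (auto simp: conv_const_right[OF biadd_lext[of cmode, OF lin_mode_cmode]] cmode_def current_sket)
qed (auto simp: raising_cur_tau c biadd_zero[OF biadd_lop[of cmode, OF lin_mode_cmode]])

lemma bra_hv: "bra l (hv 1 X v) = bra l v"
  unfolding bra_def using sform_vert[of "pR X" "- 1" "cket l" v] by (simp add: vert_cket)

lemma psi_op_tpow: "psi_op (tpow n) v = map_series (lact (psi n)) v"
  and psis_op_tpow: "psis_op (tpow (- n)) v = map_series (lact (psi_st n)) v"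
  unfolding lop_def tpow_def
  by (rule series_eqI; simp add: conv_const_left[OF biadd_lext] lin_mode_lact)+

text \<open>\<open>smode n\<close> is the adjoint mode of index -n, which kills |-l> for n \<le> l.
  A symbol without powers above t^l therefore annihilates this vacuum.\<close>

lemma psis_op_cket:
  assumes "\<And>n. n > int l \<Longrightarrow> coef n w = 0"
  shows "psis_op w (cket l) = (0 :: 'k::field_char_0 fock series)"
proof (rule series_eqI)
  fix m
  have "fscale (Poly_Mapping.lookup (scoeff w m) n) (smode n (sket l)) = (0 :: 'k fock)" for n
  proof (cases "n > int l")
    case True
    then have "scoeff (coef n w) m = 0" using assms by simp
    then show ?thesis by simp
  qed (simp add: psi_st_sket)
  then show "scoeff (psis_op w (cket l)) m = scoeff (0 :: 'k fock series) m"
    by (simp add: lop_def conv_const_right[OF biadd_lext[of smode, OF lin_mode_lact]] lext_def)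
qed

text \<open>Against <-l-1| all modes above l + 1 vanish, and the lowest coefficient of the symbol is
  the constant term 1 of \<open>hR X\<close>. The value is the same for all \<open>X\<close>: a
  final row with \<mu>_j = 0 may be added with an arbitrary homogeneous alphabet.\<close>

lemma bra_Suc:
  assumes X: "homog X"
  shows "bra (Suc l) (psis_op (tau 1 (hR X) * tpow (int l + 1)) v) = bra l v"
proof -
  let ?w = "tau 1 (hR X) * tpow (int l + 1)"
  have coef: "coef n ?w = dpart (n - (int l + 1)) (hR X)" for n
    by (subst mult.commute) (simp add: coef_tpow coef_tau)
  have 1: "form (sket (Suc l)) (smode n y) = (if n = int l + 1 then form (sket l) y else 0)"
    if "n \<ge> int l + 1" for n and y :: "'a fock"
  proof (cases "n = int l + 1")
    case True
    have "- n = - int l - 1" using True by simp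
    then show ?thesis using form_sket_Suc[of l y] True by (simp only: if_True simp_thms)
  next
    case False
    with that have "lact (psi (- n)) (sket (Suc l)) = (0 :: 'a fock)" by (intro psi_sket) auto
    with False show ?thesis by (simp add: form_psi[symmetric] biadd_zero[OF biadd_form])
  qed
  have 2: "form (sket (Suc l)) (lext smode (scoeff ?w a) y) = (if a = 0 then form (sket l) y else 0)"
    for a and y :: "'a fock"
  proof -
    have lk: "Poly_Mapping.lookup (scoeff ?w a) n = (if int (mdeg a) = n - (int l + 1) then scoeff (hR X) a else 0)" for n
      using arg_cong[OF coef[of n], of "\<lambda>c. scoeff c a"] by simp
    have "form (sket (Suc l)) (lext smode (scoeff ?w a) y) =
      (\<Sum>n\<in>Poly_Mapping.keys (scoeff ?w a). if n = int l + 1 then Poly_Mapping.lookup (scoeff ?w a) n * form (sket l) y else 0)"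
      unfolding lext_def biadd_sum(2)[OF biadd_form]
    proof (intro sum.cong refl)
      fix n assume "n \<in> Poly_Mapping.keys (scoeff ?w a)"
      then have "n \<ge> int l + 1" by (simp add: in_keys_iff lk split: if_splits)
      then show "form (sket (Suc l)) (fscale (Poly_Mapping.lookup (scoeff ?w a) n) (smode n y)) =
        (if n = int l + 1 then Poly_Mapping.lookup (scoeff ?w a) n * form (sket l) y else 0)"
        by (simp add: form_fscale 1)
    qed
    also have "\<dots> = Poly_Mapping.lookup (scoeff ?w a) (int l + 1) * form (sket l) y"
      by (auto simp: sum.delta in_keys_iff)
    also have "\<dots> = (if a = 0 then form (sket l) y else 0)"
      by (simp add: lk hR_0[OF X])
    finally show ?thesis .
  qed
  show ?thesis
  proof (rule series_eqI)
    fix m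
    have "scoeff (bra (Suc l) (psis_op ?w v)) m = (\<Sum>(a, b)\<in>splits m. if a = 0 then form (sket l) (scoeff v b) else 0)"
      unfolding scoeff_bra lop_def scoeff_conv biadd_sum(2)[OF biadd_form] by (simp add: case_prod_beta 2)
    then show "scoeff (bra (Suc l) (psis_op ?w v)) m = scoeff (bra l v) m"
      by (simp add: splits_zero_left scoeff_bra)
  qed
qed

lemma scoeff_var: "scoeff (var_series v) a = (if a = Poly_Mapping.single v 1 then 1 else 0)"
  by (simp add: var_series_def)

lemma var_power: "scoeff (var_series v ^ k :: 'k::comm_ring_1 series) a = (if a = Poly_Mapping.single v k then 1 else 0)"
proof (induction k arbitrary: a)
  case (Suc k)
  have "scoeff (var_series v ^ Suc k :: 'k series) a =
    (\<Sum>(x, y)\<in>splits a. if (x, y) = (Poly_Mapping.single v 1, Poly_Mapping.single v k) then 1 else 0)"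
    unfolding power_Suc scoeff_times by (intro sum.cong refl) (auto simp: Suc scoeff_var)
  also have "\<dots> = (\<Sum>p\<in>splits a. if p = (Poly_Mapping.single v 1, Poly_Mapping.single v k) then 1 else 0)"
    by (simp add: case_prod_beta prod_eq_iff)
  also have "\<dots> = (if Poly_Mapping.single v 1 + Poly_Mapping.single v k = a then 1 else 0)"
    by (simp add: sum.delta)
  also have "Poly_Mapping.single v 1 + Poly_Mapping.single v k = Poly_Mapping.single v (Suc k)"
    by (simp flip: single_add)
  finally show ?case by auto
qed (auto simp: scoeff_one)

text \<open>\<open>e\<^sup>H\<^sup>*\<^sup>(\<^sup>\<beta>\<^sup>)|m\<rangle> = \<Sum> \<beta>\<^sup>k \<psi>\<^sub>m\<^sub>-\<^sub>1\<^sub>+\<^sub>k |m-1\<rangle>\<close> with \<open>m = -l\<close>: both sides solve the same Euler equation, because the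
  sum over \<open>\<psi>\<^sub>k \<psi>\<^sub>i\<close> with fixed \<open>k + i\<close> vanishes.\<close>

lemma hv_letter_cket:
  "hv 1 (letter (var_series \<beta>)) (cket l) =
    psi_op (tau 1 (hR (letter (var_series \<beta>))) * tpow (- int l - 1)) (cket (Suc l) :: 'k::field_char_0 fock series)"
proof -
  let ?z = "var_series \<beta> :: 'k series"
  let ?p = "pR (letter ?z)" and ?g = "hR (letter ?z)" and ?L = "Suc l"
  let ?w = "tau 1 ?g * tpow (- int ?L)"
  let ?y = "psi_op ?w (cket ?L :: 'k fock series)"
  note lz = biadd_zero[OF biadd_lop[of pmode, OF lin_mode_lact]]
  \<comment> \<open>For a single letter 1 / (1 - z) equals 1 plus its logarithmic derivative, so
    both factors of the sum below have powers of \<beta> as their only monomials.\<close>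
  have g: "?g = 1 + euler ?p"
  proof -
    have "unit_inv (1 - ?z) = 1 + euler ?p"
      by (rule unit_inv_eqI) (simp add: distrib_left euler_hR_aux)
    then show ?thesis by (simp add: hR_single unit_powi_def)
  qed
  have ep: "scoeff (euler ?p) b = (if b \<noteq> 0 \<and> b = Poly_Mapping.single \<beta> (mdeg b) then 1 else 0)" for b
    unfolding euler_pR by (simp add: var_power)
  have gb: "scoeff ?g b = (if b = Poly_Mapping.single \<beta> (mdeg b) then 1 else 0)" for b
    unfolding g scoeff_add ep by (auto simp: scoeff_one)
  have w: "scoeff ?w a = Poly_Mapping.single (int (mdeg a) - int ?L) (scoeff ?g a)" for a
    unfolding scoeff_times tpow_def by (subst sum_splits_right) (auto simp: mult_single simp del: of_nat_Suc)
  have zero: "psi_op ?w (cur_op (tau 1 (euler ?p)) (cket ?L)) = (0 :: 'k fock series)"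
  proof (rule series_eqI)
    fix m
    let ?N = "mdeg m"
    let ?f = "\<lambda>a b. fscale (scoeff ?g a * scoeff (euler ?p) b)
         (lact (psi (int (mdeg a) - int ?L)) (cmode (int (mdeg b)) (sket ?L))) :: 'k fock"
    have c: "scoeff (psi_op ?w (cur_op (tau 1 (euler ?p)) (cket ?L))) m = (\<Sum>(a, b)\<in>splits m. ?f a b)"
      unfolding lop_def scoeff_conv[of _ ?w] w conv_const_right[OF biadd_lext[of cmode, OF lin_mode_cmode]]
      by (simp add: fscale_lact[symmetric] fscale_fscale)
    show "scoeff (psi_op ?w (cur_op (tau 1 (euler ?p)) (cket ?L))) m = scoeff (0 :: 'k fock series) m"
    proof (cases "m = Poly_Mapping.single \<beta> ?N")
      case False
      have "?f a b = 0" if "a + b = m" for a b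
      proof -
        have "scoeff ?g a * scoeff (euler ?p) b = 0"
        proof (rule ccontr)
          assume "scoeff ?g a * scoeff (euler ?p) b \<noteq> 0"
          then have "a = Poly_Mapping.single \<beta> (mdeg a)" "b = Poly_Mapping.single \<beta> (mdeg b)"
            by (auto simp: gb ep simp del: scoeff_euler split: if_splits)
          then have "m = Poly_Mapping.single \<beta> ?N"
            using that by (metis mdeg_add single_add)
          with False show False by simp
        qed
        then show ?thesis by (simp only: fscale_zero)
      qed
      then show ?thesis unfolding c by (auto intro!: sum.neutral)
    next
      case True
      \<comment> \<open>Here \<open>m\<close> is the power \<beta>^N. The factorizations that
        contribute are \<beta>^(N-j) \<beta>^j with j \<ge> 1, as \<open>euler ?p\<close> has no
        constant term.\<close>
      let ?S = "(\<lambda>j. (Poly_Mapping.single \<beta> (?N - j), Poly_Mapping.single \<beta> j)) ` {1..?N}"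
      have inj: "inj_on (\<lambda>j. (Poly_Mapping.single \<beta> (?N - j), Poly_Mapping.single \<beta> j)) {1..?N}"
        by (rule inj_onI) (metis mdeg_single prod.inject)
      have "(\<Sum>(a, b)\<in>splits m. ?f a b) = (\<Sum>(a, b)\<in>?S. ?f a b)"
      proof (rule sum.mono_neutral_right)
        show "?S \<subseteq> splits m"
          by (auto simp flip: single_add) (subst (2) True, simp)
        show "\<forall>p\<in>splits m - ?S. (case p of (a, b) \<Rightarrow> ?f a b) = 0"
        proof
          fix p assume p: "p \<in> splits m - ?S"
          obtain a b where ab: "p = (a, b)" by fastforce
          have "scoeff ?g a * scoeff (euler ?p) b = 0"
          proof (rule ccontr)
            assume "scoeff ?g a * scoeff (euler ?p) b \<noteq> 0"
            then have "a = Poly_Mapping.single \<beta> (mdeg a)" "b = Poly_Mapping.single \<beta> (mdeg b)" "b \<noteq> 0"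
              by (auto simp: gb ep simp del: scoeff_euler split: if_splits)
            moreover have "mdeg a = ?N - mdeg b" "mdeg b \<le> ?N" using p ab by auto
            moreover have "1 \<le> mdeg b" using \<open>b \<noteq> 0\<close> by (metis mdeg_eq_0_iff less_one not_le)
            ultimately have "(a, b) \<in> ?S" by (metis (mono_tags, lifting) atLeastAtMost_iff image_eqI)
            with p ab show False by simp
          qed
          then show "(case p of (a, b) \<Rightarrow> ?f a b) = 0" by (simp only: ab prod.case fscale_zero)
        qed
      qed simp
      also have "\<dots> = (\<Sum>j=1..?N. ?f (Poly_Mapping.single \<beta> (?N - j)) (Poly_Mapping.single \<beta> j))"
        by (subst sum.reindex[OF inj]) simp
      also have "\<dots> = (\<Sum>j=1..?N. lact (psi (int (?N - j) - int ?L)) (current (- int j) (sket ?L)))"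
      proof (intro sum.cong refl)
        fix j assume "j \<in> {1..?N}"
        then have "Poly_Mapping.single \<beta> j \<noteq> 0" "j \<noteq> 0" by (auto simp flip: mdeg_eq_0_iff)
        then show "?f (Poly_Mapping.single \<beta> (?N - j)) (Poly_Mapping.single \<beta> j) =
            lact (psi (int (?N - j) - int ?L)) (current (- int j) (sket ?L))"
          by (simp add: gb ep cmode_def del: scoeff_euler of_nat_Suc)
      qed
      also have "\<dots> = 0" by (rule psi_current_sum_zero)
      finally show ?thesis unfolding c by simp
    qed
  qed
  have "?y = vert 1 ?p (cket l)"
  proof (rule vert_unique)
    have "Poly_Mapping.lookup (scoeff (tau 1 (euler ?p)) m) 0 = 0" for m
      by (cases "m = 0") (auto simp: lookup_single when_def)
    then have "cur_op (tau 1 (euler ?p)) ?y = psi_op ?w (cur_op (tau 1 (euler ?p)) (cket ?L)) +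
        psi_op (const_series (Poly_Mapping.single 0 1) * tau 1 (euler ?p) * ?w) (cket ?L)"
      by (intro cur_op_lop lin_mode_lact cmode_pmode)
    moreover have "const_series (Poly_Mapping.single 0 1) = (1 :: 'k laurent)"
      by (rule series_eqI) (simp add: scoeff_one)
    moreover have "euler ?y = psi_op (tau 1 (euler ?p) * ?w) (cket ?L)"
      by (simp add: euler_lop[of pmode, OF lin_mode_lact] lz euler_mult euler_tau euler_hR tau_mult tpow_def mult_ac
          del: of_nat_Suc)
    ultimately show "euler ?y = cur_op (tau 1 (euler ?p)) ?y"
      by (simp add: zero del: of_nat_Suc)
    have "scoeff ?w 0 = Poly_Mapping.single (- int ?L) 1"
      unfolding w by (simp add: hR_0)
    then have "scoeff ?y 0 = lact (psi (- int ?L)) (sket ?L)"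
      by (simp add: lop_def scoeff_conv del: of_nat_Suc)
    moreover have "- int ?L = - int l - 1" by simp
    ultimately show "scoeff ?y 0 = sket l" by (simp only: psi_sket_Suc)
  qed simp_all
  moreover have "- int ?L = - int l - 1" by simp
  ultimately show ?thesis by (simp only:)
qed

text \<open>Conjugation by the vertex operator of \<beta> reduces this to
  \<open>hv_letter_cket\<close>. It is the reason why further rows of length 0 do not change
  \<open>ket_upper\<close>: exp(-H^*(\<beta>)) moves the vacuum |-l-1>, but the mode applied
  afterwards yields the plain vacuum |-l>.\<close>

lemma psi_hv_cket:
  "map_series (lact (psi (- int l - 1))) (hv 1 (- letter (var_series \<beta>)) (cket (Suc l))) =
     (cket l :: 'k::field_char_0 fock series)"
proof -
  let ?b = "letter (var_series \<beta>) :: 'k alphabet"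
  let ?y = "psi_op (tpow (- int l - 1)) (hv 1 (- ?b) (cket (Suc l)))"
  have "hv 1 ?b ?y = psi_op (tau 1 (hR ?b) * tpow (- int l - 1)) (cket (Suc l))"
    by (subst hv_psi_op) (simp_all add: pR_uminus vert_uminus)
  also have "\<dots> = hv 1 ?b (cket l)" by (rule hv_letter_cket[symmetric])
  finally have "hv 1 (- ?b) (hv 1 ?b ?y) = hv 1 (- ?b) (hv 1 ?b (cket l))" by simp
  then show ?thesis by (simp add: pR_uminus vert_uminus psi_op_tpow)
qed

subsection \<open>Wick's theorem\<close>

definition rlinear :: "('k::field fock series \<Rightarrow> 'k fock series) \<Rightarrow> bool" where
  "rlinear T \<longleftrightarrow> additive T \<and> (\<forall>c v. T (rscale c v) = rscale c (T v))"

lemma rlinearD: "rlinear T \<Longrightarrow> T (u + v) = T u + T v" "rlinear T \<Longrightarrow> T (rscale c v) = rscale c (T v)"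
    "rlinear T \<Longrightarrow> T (\<Sum>i\<in>I. f i) = (\<Sum>i\<in>I. T (f i))" "rlinear T \<Longrightarrow> T (u - v) = T u - T v" "rlinear T \<Longrightarrow> T 0 = 0"
  by (auto simp: rlinear_def additive.add additive.sum additive.diff additive.zero)

lemma rlinear_lop: "(\<And>n. lin_mode (g n)) \<Longrightarrow> rlinear (lop g u)"
  by (simp add: rlinear_def rscale_lop loc_imp_additive loc_lop)

lemma rlinear_fold: "(\<And>j. rlinear (P j)) \<Longrightarrow> rlinear (fold P js)"
proof (induction js)
  case (Cons j js)
  then have "rlinear (fold P js)" "rlinear (P j)" by auto
  then show ?case by (auto simp: rlinear_def additive_def)
qed (simp add: rlinear_def additive_def)

text \<open>Each field that \<open>P\<close> passes contributes its contraction and a sign, and at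
  the end \<open>P\<close> kills \<open>\<Omega>\<close>.\<close>

lemma wick_step:
  assumes P: "rlinear P" "P \<Omega> = 0" and Q: "\<And>i. rlinear (Q i)"
    and anti: "\<And>i v. P (Q i v) = rscale (c i) v - Q i (P v)"
  shows "P (foldr Q is \<Omega>) =
    (\<Sum>a<length is. rscale ((-1) ^ a * c (is ! a)) (foldr Q (take a is @ drop (Suc a) is) \<Omega>))"
proof (induction "is")
  case Nil
  then show ?case by (simp add: P)
next
  case (Cons i "is")
  let ?t = "\<lambda>is a. rscale ((-1) ^ a * c (is ! a)) (foldr Q (take a is @ drop (Suc a) is) \<Omega>)"
  have "P (foldr Q (i # is) \<Omega>) = rscale (c i) (foldr Q is \<Omega>) - Q i (P (foldr Q is \<Omega>))"
    by (simp add: anti)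
  also have "\<dots> = ?t (i # is) 0 + (\<Sum>a<length is. ?t (i # is) (Suc a))"
    unfolding Cons by (simp add: rlinearD[OF Q] biadd_minus[OF biadd_rscale] sum_negf)
  also have "\<dots> = (\<Sum>a<length (i # is). ?t (i # is) a)"
    by (simp only: list.size(4) add_Suc_right add_0_right sum.lessThan_Suc_shift)
  finally show ?case .
qed

text \<open>\<open>fold\<close> lets the first adjoint field act first. Its contractions with signs
  (-1)^a are the Laplace expansion along column 0, and deleting the contracted field from
  \<open>is\<close> deletes row a.\<close>

lemma wick:
  fixes \<omega> :: "'k::field fock series \<Rightarrow> 'k series"
  assumes \<omega>: "additive \<omega>" "\<And>c v. \<omega> (rscale c v) = c * \<omega> v" "\<omega> \<Omega> = 1"
    and P: "\<And>j. rlinear (P j)" and Q: "\<And>i. rlinear (Q i)"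
    and anti: "\<And>i j v. P j (Q i v) = rscale (c i j) v - Q i (P j v)"
    and "length is = length js" "\<And>j. j \<in> set js \<Longrightarrow> P j \<Omega> = 0"
  shows "\<omega> (fold P js (foldr Q is \<Omega>)) = det (mat (length js) (length js) (\<lambda>(a, b). c (is ! a) (js ! b)))"
  using assms(7,8)
proof (induction js arbitrary: "is")
  case Nil
  then show ?case by (simp add: \<omega> det_dim_zero)
next
  case (Cons j js)
  let ?n = "length js"
  let ?A = "mat (Suc ?n) (Suc ?n) (\<lambda>(a, b). c (is ! a) ((j # js) ! b))"
  let ?del = "\<lambda>a. take a is @ drop (Suc a) is"
  have len: "length is = Suc ?n" using Cons.prems by simp
  have IH: "\<omega> (fold P js (foldr Q (?del a) \<Omega>)) = det (mat_delete ?A a 0)" if "a < Suc ?n" for a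
  proof -
    have "\<omega> (fold P js (foldr Q (?del a) \<Omega>)) = det (mat ?n ?n (\<lambda>(x, y). c (?del a ! x) (js ! y)))"
      by (rule Cons.IH) (use len that Cons.prems in auto)
    also have "mat ?n ?n (\<lambda>(x, y). c (?del a ! x) (js ! y)) = mat_delete ?A a 0"
      by (rule eq_matI) (use len that in \<open>auto simp: mat_delete_def nth_append min_def\<close>)
    finally show ?thesis .
  qed
  have "\<omega> (fold P (j # js) (foldr Q is \<Omega>)) =
    \<omega> (fold P js (\<Sum>a<Suc ?n. rscale ((-1) ^ a * c (is ! a) j) (foldr Q (?del a) \<Omega>)))"
    using wick_step[of "P j" \<Omega> Q "\<lambda>i. c i j" "is"] Cons.prems P Q anti len by simp
  also have "\<dots> = (\<Sum>a<Suc ?n. (-1) ^ a * c (is ! a) j * \<omega> (fold P js (foldr Q (?del a) \<Omega>)))"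
    by (simp only: rlinearD(2,3)[OF rlinear_fold[of P, OF P]] additive.sum[OF \<omega>(1)] \<omega>(2))
  also have "\<dots> = (\<Sum>a<Suc ?n. ?A $$ (a, 0) * cofactor ?A a 0)"
    by (intro sum.cong refl) (simp add: IH cofactor_def mult_ac del: foldr_append)
  also have "\<dots> = det ?A"
    by (rule laplace_expansion_column[symmetric]) auto
  finally show ?case by simp
qed

lemma psi_wick:
  fixes w u :: "nat \<Rightarrow> 'k::field_char_0 laurent"
  assumes "\<And>j n. j \<in> {1..l} \<Longrightarrow> n > int l \<Longrightarrow> coef n (w j) = 0"
  shows "bra l (fold (\<lambda>j. psis_op (w j)) [1..<Suc l] (foldr (\<lambda>i. psi_op (u i)) [1..<Suc l] (cket l))) =
    det_from1 l (\<lambda>i j. coef 0 (w j * u i))"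
proof -
  have "bra l (fold (\<lambda>j. psis_op (w j)) [1..<Suc l] (foldr (\<lambda>i. psi_op (u i)) [1..<Suc l] (cket l))) =
    det (mat (length [1..<Suc l]) (length [1..<Suc l]) (\<lambda>(a, b). (\<lambda>i j. coef 0 (w j * u i)) ([1..<Suc l] ! a) ([1..<Suc l] ! b)))"
  proof (rule wick)
    show "psis_op (w j) (cket l) = 0" if "j \<in> set [1..<Suc l]" for j
      using that by (intro psis_op_cket assms) auto
  qed (rule additive_bra bra_rscale bra_cket psis_op_psi_op refl | intro rlinear_lop lin_mode_lact)+
  also have "\<dots> = det_from1 l (\<lambda>i j. coef 0 (w j * u i))"
    unfolding det_from1_def by (rule arg_cong[of _ _ det], rule eq_matI) (auto simp del: upt_Suc)
  finally show ?thesis .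
qed

lemma hv_foldr:
  "homog X \<Longrightarrow> s \<noteq> 0 \<Longrightarrow> hv s X (foldr (\<lambda>i. psi_op (u i)) is v) = foldr (\<lambda>i. psi_op (tau s (hR X) * u i)) is (hv s X v)"
  by (induction "is") (simp_all add: hv_psi_op)

lemma hv_fold:
  "homog X \<Longrightarrow> s \<noteq> 0 \<Longrightarrow> hv s X (fold (\<lambda>j. psis_op (w j)) js v) = fold (\<lambda>j. psis_op (tau s (hR (- X)) * w j)) js (hv s X v)"
  by (induction js arbitrary: v) (simp_all add: hv_psis_op)

lemma tau_hR_inverse:
  assumes "homog X"
  shows "tau s (hR X) * (tau s (hR (- X)) * u) = u" "tau s (hR (- X)) * (tau s (hR X) * u) = u"
proof -
  from assms have "tau s (hR X) * tau s (hR (- X)) = 1"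
    by (simp add: hR_uminus_right flip: tau_mult)
  then show "tau s (hR X) * (tau s (hR (- X)) * u) = u" "tau s (hR (- X)) * (tau s (hR X) * u) = u"
    by (metis mult.assoc mult.commute mult_1_left)+
qed

lemma fold_hv:
  assumes "homog X" "s \<noteq> 0"
  shows "fold (\<lambda>j. psis_op (w j)) js (hv s X v) = hv s X (fold (\<lambda>j. psis_op (tau s (hR X) * w j)) js v)"
  using assms by (simp add: hv_fold tau_hR_inverse)

lemma foldr_hv:
  assumes "homog X" "s \<noteq> 0"
  shows "foldr (\<lambda>i. psi_op (u i)) is (hv s X v) = hv s X (foldr (\<lambda>i. psi_op (tau s (hR (- X)) * u i)) is v)"
  using assms by (simp add: hv_foldr tau_hR_inverse)

subsection \<open>The factor \<open>C\<close>\<close>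

text \<open>The cocycle of two letters is \<Sum> (x y)^k / k, which is minus the logarithm of 1 - x
  y. This is the Euler equation expressing that.\<close>

lemma heis_letters:
  fixes x y :: "'k::field_char_0 series"
  assumes x: "lin1 x" and y: "lin1 y"
  defines "q \<equiv> euler (conv heis (tau (- 1) (pR (letter x))) (tau 1 (pR (letter y))))"
  shows "euler (1 - y * x) = - q * (1 - y * x)"
proof -
  let ?z = "y * x"
  \<comment> \<open>In degree 2 k only (x y)^k / k occurs, and the derivation multiplies it by 2
    k.\<close>
  have q: "scoeff q m = (if m \<noteq> 0 \<and> even (mdeg m) then 2 * scoeff (?z ^ (mdeg m div 2)) m else 0)" for m
  proof -
    have tm: "of_nat (mdeg m) * heis (scoeff (tau (- 1) (pR (letter x))) a) (scoeff (tau 1 (pR (letter y))) b) =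
      (if m \<noteq> 0 \<and> even (mdeg m) then 2 * (scoeff (x ^ (mdeg m div 2)) a * scoeff (y ^ (mdeg m div 2)) b) else 0)"
      if "a + b = m" for a b
    proof (cases "mdeg a = mdeg b \<and> m \<noteq> 0")
      case True
      define k where "k = mdeg a"
      have k: "mdeg a = k" "mdeg b = k" "mdeg m = 2 * k" using True that by (auto simp: k_def)
      with True have "k \<noteq> 0" using mdeg_eq_0_iff[of m] by auto
      have "heis (scoeff (tau (- 1) (pR (letter x))) a) (scoeff (tau 1 (pR (letter y))) b) =
          of_nat k * (scoeff (x ^ k) a / of_nat k) * (scoeff (y ^ k) b / of_nat k)"
        by (simp add: heis_single pR_def k)
      then have "of_nat (mdeg m) * heis (scoeff (tau (- 1) (pR (letter x))) a) (scoeff (tau 1 (pR (letter y))) b) =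
          2 * (scoeff (x ^ k) a * scoeff (y ^ k) b)"
        using \<open>k \<noteq> 0\<close> by (simp only: k) (simp add: field_simps)
      with k True show ?thesis by simp
    next
      case False
      have "scoeff (x ^ (mdeg m div 2)) a * scoeff (y ^ (mdeg m div 2)) b = 0" if "m \<noteq> 0" "even (mdeg m)"
      proof -
        have "mdeg a \<noteq> mdeg m div 2 \<or> mdeg b \<noteq> mdeg m div 2" using False that by auto
        then show ?thesis using lin1_power[OF x] lin1_power[OF y] by auto
      qed
      moreover have "heis (scoeff (tau (- 1) (pR (letter x))) a) (scoeff (tau 1 (pR (letter y))) b) = 0 \<or> m = 0"
        using False by (auto simp: heis_single)
      ultimately show ?thesis by auto
    qed
    have "scoeff q m = (\<Sum>(a, b)\<in>splits m. of_nat (mdeg m) * heis (scoeff (tau (- 1) (pR (letter x))) a) (scoeff (tau 1 (pR (letter y))) b))"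
      by (simp add: q_def scoeff_conv sum_distrib_left case_prod_beta del: scoeff_tau)
    also have "\<dots> = (\<Sum>(a, b)\<in>splits m. if m \<noteq> 0 \<and> even (mdeg m) then 2 * (scoeff (x ^ (mdeg m div 2)) a * scoeff (y ^ (mdeg m div 2)) b) else 0)"
      by (intro sum.cong refl) (auto simp: tm simp del: scoeff_tau)
    also have "\<dots> = (if m \<noteq> 0 \<and> even (mdeg m) then 2 * scoeff (x ^ (mdeg m div 2) * y ^ (mdeg m div 2)) m else 0)"
      by (simp add: scoeff_times sum_distrib_left case_prod_beta)
    finally show ?thesis by (simp add: power_mult_distrib mult.commute)
  qed
  have z: "scoeff ?z m = 0" if "mdeg m \<noteq> 2" for m
  proof -
    have "scoeff y a * scoeff x b = 0" if "a + b = m" for a b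
      using \<open>mdeg m \<noteq> 2\<close> that x y by (cases "mdeg a = 1"; cases "mdeg b = 1") (auto simp: lin1_def)
    then show ?thesis by (auto simp: scoeff_times intro!: sum.neutral)
  qed
  have "(1 - ?z) * q = 2 * ?z"
  proof (rule series_eqI)
    fix m
    have "scoeff ?z a * scoeff q b =
        (if mdeg m > 2 \<and> even (mdeg m) then 2 * (scoeff ?z a * scoeff (?z ^ (mdeg m div 2 - 1)) b) else 0)"
      if "a + b = m" for a b
    proof (cases "mdeg a = 2")
      case True
      then have "mdeg m = 2 + mdeg b" using that by auto
      then show ?thesis by (auto simp: q)
    qed (simp add: z)
    then have "scoeff (?z * q) m = (\<Sum>(a, b)\<in>splits m.
        if mdeg m > 2 \<and> even (mdeg m) then 2 * (scoeff ?z a * scoeff (?z ^ (mdeg m div 2 - 1)) b) else 0)"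
      unfolding scoeff_times[of ?z q] by (intro sum.cong) auto
    also have "\<dots> = (if mdeg m > 2 \<and> even (mdeg m) then 2 * scoeff (?z * ?z ^ (mdeg m div 2 - 1)) m else 0)"
    proof (cases "mdeg m > 2 \<and> even (mdeg m)")
      case True
      then show ?thesis unfolding scoeff_times[of ?z "?z ^ _"] by (simp add: sum_distrib_left case_prod_beta)
    next
      case False
      then show ?thesis by (simp only: False if_False) (simp add: case_prod_beta)
    qed
    also have "\<dots> = (if mdeg m > 2 \<and> even (mdeg m) then 2 * scoeff (?z ^ (mdeg m div 2)) m else 0)"
    proof -
      have "?z * ?z ^ (mdeg m div 2 - 1) = ?z ^ (mdeg m div 2)" if "mdeg m > 2"
      proof -
        have "mdeg m div 2 = Suc (mdeg m div 2 - 1)" using that by linarith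
        then show ?thesis by (metis power_Suc)
      qed
      then show ?thesis by simp
    qed
    finally have zq: "scoeff (?z * q) m = (if mdeg m > 2 \<and> even (mdeg m) then 2 * scoeff (?z ^ (mdeg m div 2)) m else 0)" .
    have two: "scoeff (2 * c) m = 2 * scoeff c m" for c :: "'k series"
      using scoeff_of_int[of 2 c m] by simp
    have "scoeff q m - scoeff (?z * q) m = 2 * scoeff ?z m"
    proof (cases "mdeg m = 2")
      case True
      then show ?thesis by (auto simp: zq q)
    next
      case False
      then have "mdeg m > 2 \<or> mdeg m = 0 \<or> odd (mdeg m)" by presburger
      with False show ?thesis by (auto simp: zq q z)
    qed
    then show "scoeff ((1 - ?z) * q) m = scoeff (2 * ?z) m"
      by (simp add: left_diff_distrib two)
  qed
  moreover have "euler ?z = 2 * ?z"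
    by (simp add: euler_mult euler_lin1 x y)
  ultimately show ?thesis by (simp add: euler_diff mult.commute)
qed

lemma euler_prod:
  fixes f :: "'i \<Rightarrow> 'a::comm_ring_1 series"
  assumes "\<And>i. i \<in> I \<Longrightarrow> euler (f i) = g i * f i"
  shows "euler (\<Prod>i\<in>I. f i) = (\<Sum>i\<in>I. g i) * (\<Prod>i\<in>I. f i)"
  using assms
  by (induction I rule: infinite_finite_induct) (simp_all add: euler_mult algebra_simps)

lemma pR_sum: "pR (\<Sum>i\<in>I. f i) = (\<Sum>i\<in>I. pR (f i))"
  by (induction I rule: infinite_finite_induct) (simp_all add: pR_add)

lemma tau_sum: "tau s (\<Sum>i\<in>I. f i) = (\<Sum>i\<in>I. tau s (f i))"
  by (induction I rule: infinite_finite_induct) (simp_all add: tau_add)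

lemma euler_sum: "euler (\<Sum>i\<in>I. f i) = (\<Sum>i\<in>I. euler (f i))"
  by (induction I rule: infinite_finite_induct) (simp_all add: euler_add)

text \<open>Because B_l enters with a minus sign, the scalar is the product of all 1 - \<beta>_i x_j
  and not its inverse.\<close>

lemma hv_xs_B:
  "hv (- 1) (xs_alph n) (hv 1 (- B_alph (int l)) v) =
    rscale (C_fac l n) (hv 1 (- B_alph (int l)) (hv (- 1) (xs_alph n) (v :: 'k::field_char_0 fock series)))"
proof -
  let ?b = "\<lambda>j i. conv heis (tau (- 1) (pR (letter (xv j)))) (tau 1 (pR (letter (bv i)))) :: 'k series"
  note bi = biadd_conv[OF biadd_heis]
  have "conv heis (tau (- 1) (pR (xs_alph n))) (tau 1 (pR (- B_alph (int l)))) = - (\<Sum>i=1..l. \<Sum>j=1..n. ?b j i)"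
    unfolding xs_alph_def B_alph_def nat_int
    by (simp add: pR_uminus pR_sum tau_sum tau_uminus biadd_minus[OF bi] biadd_sum[OF bi])
  moreover have "euler (C_fac l n :: 'k series) = (\<Sum>i=1..l. \<Sum>j=1..n. - euler (?b j i)) * C_fac l n"
    unfolding C_fac_def by (intro euler_prod heis_letters) simp_all
  ultimately have "euler (C_fac l n :: 'k series) =
      euler (conv heis (tau (- 1) (pR (xs_alph n))) (tau 1 (pR (- B_alph (int l))))) * C_fac l n"
    by (simp add: euler_uminus euler_sum sum_negf)
  moreover have "scoeff (C_fac l n :: 'k series) 0 = 1"
  proof -
    have prod: "scoeff (\<Prod>i\<in>I. f i) 0 = 1" if "\<And>i. i \<in> I \<Longrightarrow> scoeff (f i) 0 = 1" for I and f :: "nat \<Rightarrow> 'k series"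
      using that by (induction I rule: infinite_finite_induct) (simp_all add: scoeff_one scoeff_times)
    show ?thesis unfolding C_fac_def by (intro prod) (simp add: scoeff_one scoeff_times lin1_0)
  qed
  ultimately show ?thesis
    using vert_heis[of "pR (xs_alph n)" "pR (- B_alph (int l))" "- 1" "C_fac l n" v] by simp
qed

subsection \<open>The vectors as products of fields\<close>

lemma B_alph_step: "B_alph (int (Suc i)) = B_alph (int i) + letter (bv (Suc i))"
  and A_alph_step: "A_alph (int (Suc i)) = A_alph (int i) + letter (- av (Suc i))"
  by (simp_all only: A_alph_def B_alph_def nat_int sum.nat_ivl_Suc' le_SucI[OF le0] One_nat_def add.commute)

lemma A_alph_nonpos [simp]: "k \<le> 0 \<Longrightarrow> A_alph k = 0"
  and B_alph_nonpos [simp]: "k \<le> 0 \<Longrightarrow> B_alph k = 0"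
  by (simp_all add: A_alph_def B_alph_def)

lemma part_zero: "length lam < i \<Longrightarrow> part lam i = 0"
  by (simp add: part_def)

text \<open>The vertex operators between the fields are pushed to the right into the vacuum. On the
  way they accumulate to the partial sums \<open>C\<close>, and field i is conjugated by
  \<open>C (i - 1)\<close>. The initial value \<open>C k\<close> stays general for the
  induction.\<close>

lemma foldr_shift:
  assumes s: "s \<noteq> 0" and F: "\<And>i v. F i v = psi_op (tau s (hR (a i)) * t i) (hv s (b i) v)"
    and C: "\<And>i. C (Suc i) = C i + b (Suc i)" and hom: "\<And>i. homog (a i)" "\<And>i. homog (C i)"
  shows "hv s (C k) (foldr F [Suc k..<Suc (k + d)] x) =
    foldr (\<lambda>i. psi_op (tau s (hR (a i + C (i - 1))) * t i)) [Suc k..<Suc (k + d)] (hv s (C (k + d)) x)"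
proof (induction d arbitrary: k)
  case (Suc d)
  have upt: "[Suc k..<Suc (k + Suc d)] = Suc k # [Suc (Suc k)..<Suc (Suc k + d)]"
    by (subst upt_conv_Cons) auto
  have "hv s (C k) (F (Suc k) y) = psi_op (tau s (hR (a (Suc k) + C k)) * t (Suc k)) (hv s (C (Suc k)) y)" for y
    by (simp add: F hv_psi_op hom s C hv_add hR_add tau_mult mult_ac)
  then show ?case
    unfolding upt using Suc[of "Suc k"] by simp
qed simp

text \<open>The mirror image of \<open>foldr_shift\<close> for adjoint fields: the accumulated
  operator ends up at the left, next to the bra.\<close>

lemma fold_shift:
  assumes s: "s \<noteq> 0" and F: "\<And>i v. F i v = hv s (b i) (psis_op (tau s (hR (a i)) * t i) v)"
    and C: "\<And>i. C (Suc i) = C i + b (Suc i)" and hom: "\<And>i. homog (a i)" "\<And>i. homog (C i)"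
  shows "fold F [Suc k..<Suc (k + d)] (hv s (C k) x) =
    hv s (C (k + d)) (fold (\<lambda>i. psis_op (tau s (hR (a i + C (i - 1))) * t i)) [Suc k..<Suc (k + d)] x)"
proof (induction d arbitrary: k x)
  case (Suc d)
  have upt: "[Suc k..<Suc (k + Suc d)] = Suc k # [Suc (Suc k)..<Suc (Suc k + d)]"
    by (subst upt_conv_Cons) auto
  have "F (Suc k) (hv s (C k) x) = hv s (C (Suc k)) (psis_op (tau s (hR (a (Suc k) + C k)) * t (Suc k)) x)"
    using fold_hv[OF hom(2) s, of "\<lambda>_. tau s (hR (a (Suc k))) * t (Suc k)" "[0]" k x]
    by (simp add: F C add.commute[of "C k"] hv_add s hR_add hom tau_mult mult_ac)
  then show ?case
    unfolding upt using Suc[of "Suc k"] by simp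
qed simp

lemma hv_commute: "s \<noteq> 0 \<Longrightarrow> hv s X (hv s Y v) = hv s Y (hv s X v)"
  by (metis add.commute hv_add)

lemma hv_cancel: "s \<noteq> 0 \<Longrightarrow> hv s X (hv s (- X) v) = v" "s \<noteq> 0 \<Longrightarrow> hv s (- X) (hv s X v) = v"
  by (simp_all add: pR_uminus vert_uminus)

lemma hv_zero [simp]: "hv s 0 v = v"
  by simp

text \<open>The exponentials involved commute with each other, so those of A conjugate the mode
  alone and only the factor of \<beta>_i stays behind.\<close>

lemma ket_upper_alt:
  "ket_upper r lam = foldr (\<lambda>i v. psi_op (tau 1 (hR (A_alph (ipart lam i))) * tpow (ipart lam i - int i)) (hv 1 (- letter (bv i)) v))
     [1..<Suc r] (hv 1 (A_alph (ipart lam r)) (cket r))"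
proof -
  have F: "exp_ket (Hst_op Y) (map_series (lact (psi k)) (exp_ket (- Hst_op (letter (bv i))) (exp_ket (- Hst_op Y) v))) =
      psi_op (tau 1 (hR Y) * tpow k) (hv 1 (- letter (bv i)) v)" if "homog Y" for Y k i and v :: "'a fock series"
    using that by (simp add: exp_Hst_op exp_uminus_Hst_op hv_psi_op hv_commute[of 1 Y] hv_cancel flip: psi_op_tpow)
  show ?thesis
    unfolding ket_upper_def Let_def
    by (simp only: comp_def F[OF homog_A] sket_def) (simp only: exp_Hst_op[OF homog_A])
qed

text \<open>For \<lambda>_r = 0 the last factor in the definition of the ket is trivial. What
  remains in front of the vacuum is exp(-H^*(B_r)), the origin of the prefactor C.\<close>

lemma ket_upper_form:
  assumes "part lam r = 0"
  shows "ket_upper r lam = foldr (\<lambda>i. psi_op (tau 1 (hR (A_alph (ipart lam i) + - B_alph (int (i - 1)))) * tpow (ipart lam i - int i)))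
     [1..<Suc r] (hv 1 (- B_alph (int r)) (cket r))"
proof -
  have eq: "ket_upper r lam = foldr (\<lambda>i v. psi_op (tau 1 (hR (A_alph (ipart lam i))) * tpow (ipart lam i - int i)) (hv 1 (- letter (bv i)) v))
     [Suc 0..<Suc (0 + r)] (cket r)"
    by (simp add: ket_upper_alt assms del: upt_Suc)
  have "hv 1 (- B_alph (int 0)) (ket_upper r lam) =
    foldr (\<lambda>i. psi_op (tau 1 (hR (A_alph (ipart lam i) + - B_alph (int (i - 1)))) * tpow (ipart lam i - int i)))
     [Suc 0..<Suc (0 + r)] (hv 1 (- B_alph (int (0 + r))) (cket r))"
    unfolding eq
    by (rule foldr_shift[where b = "\<lambda>i. - letter (bv i)" and C = "\<lambda>i. - B_alph (int i)"])
       (simp_all add: B_alph_step del: of_nat_Suc)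
  then show ?thesis by (simp del: upt_Suc)
qed

lemma upt_1_Suc: "[1..<Suc (Suc r)] = [1..<Suc r] @ [Suc r]"
  by simp

lemma ket_upper_Suc:
  assumes "part lam r = 0" "part lam (Suc r) = 0"
  shows "ket_upper (Suc r) lam = ket_upper r lam"
proof -
  have e: "ipart lam (Suc r) - int (Suc r) = - int r - 1" by (simp add: assms)
  have A: "A_alph (ipart lam (Suc r)) = 0" "A_alph (ipart lam r) = 0" by (simp_all add: assms)
  show ?thesis
    unfolding ket_upper_alt upt_1_Suc
    by (simp only: foldr_append foldr.simps comp_apply id_apply e A hR_zero tau_one mult_1_left hv_zero psi_op_tpow psi_hv_cket)
qed

lemma ket_lower_alt:
  "ket_lower r lam = foldr (\<lambda>i v. psi_op (tau (- 1) (hR (- A_alph (ipart lam i - 1))) * tpow (ipart lam i - int i)) (hv (- 1) (letter (bv i)) v))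
     [1..<Suc r] (cket r)"
proof -
  have F: "exp_ket (- H_op Y) (map_series (lact (psi k)) (exp_ket (H_op (letter (bv i))) (exp_ket (H_op Y) v))) =
      psi_op (tau (- 1) (hR (- Y)) * tpow k) (hv (- 1) (letter (bv i)) v)" if "homog Y" for Y k i and v :: "'a fock series"
    using that by (simp add: exp_H_op exp_uminus_H_op hv_psi_op hv_commute[of "- 1" "- Y"] hv_cancel flip: psi_op_tpow)
  show ?thesis
    unfolding ket_lower_def Let_def
    by (simp only: comp_def F[OF homog_A] sket_def)
qed

lemma ket_lower_form:
  "ket_lower r lam = foldr (\<lambda>i. psi_op (tau (- 1) (hR (- A_alph (ipart lam i - 1) + B_alph (int (i - 1)))) * tpow (ipart lam i - int i)))
     [1..<Suc r] (cket r)"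
proof -
  have eq: "ket_lower r lam = foldr (\<lambda>i v. psi_op (tau (- 1) (hR (- A_alph (ipart lam i - 1))) * tpow (ipart lam i - int i)) (hv (- 1) (letter (bv i)) v))
     [Suc 0..<Suc (0 + r)] (cket r)"
    by (simp add: ket_lower_alt del: upt_Suc)
  have "hv (- 1) (B_alph (int 0)) (ket_lower r lam) =
    foldr (\<lambda>i. psi_op (tau (- 1) (hR (- A_alph (ipart lam i - 1) + B_alph (int (i - 1)))) * tpow (ipart lam i - int i)))
     [Suc 0..<Suc (0 + r)] (hv (- 1) (B_alph (int (0 + r))) (cket r))"
    unfolding eq
    by (rule foldr_shift[where b = "\<lambda>i. letter (bv i)" and C = "\<lambda>i. B_alph (int i)"])
       (simp_all add: B_alph_step del: of_nat_Suc)
  then show ?thesis by (simp add: vert_cket del: upt_Suc)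
qed

lemma ket_lower_Suc:
  assumes "part lam (Suc r) = 0"
  shows "ket_lower (Suc r) lam = ket_lower r lam"
proof -
  have p: "map_series (lact (psi (- int r - 1))) (cket (Suc r)) = (cket r :: 'a fock series)"
    by (rule series_eqI) (simp add: psi_sket_Suc)
  have e: "ipart lam (Suc r) - int (Suc r) = - int r - 1" by (simp add: assms)
  have A: "A_alph (ipart lam (Suc r) - 1) = 0" by (simp add: assms)
  show ?thesis
    unfolding ket_lower_alt upt_1_Suc
    by (simp only: foldr_append foldr.simps comp_apply id_apply e A minus_zero hR_zero tau_one mult_1_left psi_op_tpow vert_cket[OF pR_0] p)
qed

text \<open>Common form of the double-bracket bra and of the bra dual to \<open>ket_lower\<close>,
  which differ in the alphabets \<open>K\<close> only.\<close>

definition bra_prod :: "nat \<Rightarrow> (nat \<Rightarrow> 'k::field_char_0 alphabet) \<Rightarrow> nat list \<Rightarrow> 'k fock series \<Rightarrow> 'k series" where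
  "bra_prod l K mu v = bra l (fold (\<lambda>j. psis_op (tau 1 (hR (K j)) * tpow (- (ipart mu j - int j)))) [1..<Suc l] v)"

lemma bra_prod_Suc:
  assumes "part mu (Suc l) = 0" "homog (K (Suc l))"
  shows "bra_prod (Suc l) K mu v = bra_prod l K mu v"
proof -
  have "- (ipart mu (Suc l) - int (Suc l)) = int l + 1" by (simp add: assms)
  then show ?thesis
    unfolding bra_prod_def upt_1_Suc
    by (simp only: fold_append comp_apply fold.simps id_apply bra_Suc[OF assms(2)])
qed

lemma bra_prod_extend:
  assumes "length mu \<le> l" "\<And>j. homog (K j)"
  shows "bra_prod (l + d) K mu v = bra_prod l K mu v"
  by (induction d) (use assms in \<open>simp_all add: bra_prod_Suc part_zero\<close>)

lemma ket_upper_extend: "length lam < r \<Longrightarrow> ket_upper (r + d) lam = ket_upper r lam"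
  by (induction d) (simp_all add: ket_upper_Suc part_zero)

lemma ket_lower_extend: "length lam \<le> r \<Longrightarrow> ket_lower (r + d) lam = ket_lower r lam"
  by (induction d) (simp_all add: ket_lower_Suc part_zero)

lemma foldr_adjoint:
  assumes "\<And>i w v. conv g (G i w) v = conv g w (F i v)"
  shows "conv g (foldr G is w) v = conv g w (fold F is v)"
  by (induction "is" arbitrary: v) (simp_all add: assms)

lemma bra_dbl_form:
  "conv pairing (bra_dbl l mu) v = bra_prod l (\<lambda>i. B_alph (int i) - A_alph (ipart mu i)) mu v"
proof -
  have F: "conv pairing (exp_bra (dHst_op Y) (map_series (\<lambda>w. ract w (psi_st k)) (exp_bra (- dHst_op Y) w))) v =
     conv pairing w (psis_op (tau 1 (hR Y) * tpow (- k)) v)" if "homog Y" for Y k w and v :: "'a fock series"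
    using that
    by (simp add: pairing_exp_bra pairing_ract_series hv_psis_op hv_cancel flip: psis_op_tpow)
  show ?thesis
    unfolding bra_dbl_def bra_prod_def Let_def comp_def bra_pairing[symmetric]
    by (rule foldr_adjoint) (rule F, simp)
qed

text \<open>The factors of the \<beta>_i accumulate to exp(H^*(B_l)) at the left, where the bra
  absorbs it.\<close>

lemma bra_upper_form:
  "conv pairing (bra_upper l mu) v = bra_prod l (\<lambda>i. - A_alph (ipart mu i - 1) + B_alph (int (i - 1))) mu v"
proof -
  define F where "F i v = hv 1 (letter (bv i)) (psis_op (tau 1 (hR (- A_alph (ipart mu i - 1))) * tpow (- (ipart mu i - int i))) v)"
    for i and v :: "'a fock series"
  have F': "conv form (exp_ket (- H_op Y) (map_series (lact (psi k)) (exp_ket (H_op (letter (bv i))) (exp_ket (H_op Y) w)))) v =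
     conv form w (hv 1 (letter (bv i)) (psis_op (tau 1 (hR (- Y)) * tpow (- k)) v))" if "homog Y" for Y k i w and v :: "'a fock series"
    using that
    by (simp add: exp_H_op exp_uminus_H_op sform_vert sform_psi hv_commute[of 1 Y] hv_psis_op hv_cancel mult.left_commute flip: psis_op_tpow)
  have "conv pairing (bra_upper l mu) v = conv form (ket_lower l mu) v"
    by (simp add: bra_upper_def pairing_fstar)
  also have "\<dots> = conv form (cket l) (fold F [1..<Suc l] v)"
    unfolding ket_lower_def Let_def comp_def sket_def F_def
    by (rule foldr_adjoint) (rule F', simp)
  also have "\<dots> = bra l (fold F [Suc 0..<Suc (0 + l)] (hv 1 (B_alph (int 0)) v))"
    by (simp add: bra_def del: upt_Suc)
  also have "\<dots> = bra l (hv 1 (B_alph (int (0 + l))) (fold (\<lambda>i. psis_op (tau 1 (hR (- A_alph (ipart mu i - 1) + B_alph (int (i - 1)))) *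
      tpow (- (ipart mu i - int i)))) [Suc 0..<Suc (0 + l)] v))"
    by (subst fold_shift[where b = "\<lambda>i. letter (bv i)" and a = "\<lambda>i. - A_alph (ipart mu i - 1)"
          and t = "\<lambda>i. tpow (- (ipart mu i - int i))" and C = "\<lambda>i. B_alph (int i)" and s = 1 and k = 0])
       (simp_all add: F_def B_alph_step del: upt_Suc of_nat_Suc)
  finally show ?thesis by (simp add: bra_hv bra_prod_def del: upt_Suc)
qed

text \<open>Here the accumulated operator is exp(-H(B_l)). The bra does not absorb it; it has to be
  carried to the vacuum on the right later.\<close>

lemma bra_lower_form:
  assumes "part mu l = 0"
  shows "conv pairing (bra_lower l mu) v = bra l (hv (- 1) (- B_alph (int l))
    (fold (\<lambda>i. psis_op (tau (- 1) (hR (A_alph (ipart mu i) + - B_alph (int (i - 1)))) * tpow (- (ipart mu i - int i)))) [1..<Suc l] v))"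
proof -
  define F where "F i v = hv (- 1) (- letter (bv i)) (psis_op (tau (- 1) (hR (A_alph (ipart mu i))) * tpow (- (ipart mu i - int i))) v)"
    for i and v :: "'a fock series"
  have F': "conv form (exp_ket (Hst_op Y) (map_series (lact (psi k)) (exp_ket (- Hst_op (letter (bv i))) (exp_ket (- Hst_op Y) w)))) v =
     conv form w (hv (- 1) (- letter (bv i)) (psis_op (tau (- 1) (hR Y) * tpow (- k)) v))" if "homog Y" for Y k i w and v :: "'a fock series"
    using that
    by (simp add: exp_Hst_op exp_uminus_Hst_op sform_vert sform_psi hv_commute[of "- 1" "- Y"] hv_psis_op hv_cancel mult.left_commute flip: psis_op_tpow)
  have "conv pairing (bra_lower l mu) v = conv form (ket_upper l mu) v"
    by (simp add: bra_lower_def pairing_fstar)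
  also have "\<dots> = conv form (exp_ket (Hst_op (A_alph (ipart mu l))) (cket l)) (fold F [1..<Suc l] v)"
    unfolding ket_upper_def Let_def comp_def sket_def F_def
    by (rule foldr_adjoint) (rule F', simp)
  also have "\<dots> = bra l (fold F [Suc 0..<Suc (0 + l)] (hv (- 1) (- B_alph (int 0)) v))"
    by (simp add: bra_def exp_Hst_op assms del: upt_Suc)
  also have "\<dots> = bra l (hv (- 1) (- B_alph (int (0 + l))) (fold (\<lambda>i. psis_op (tau (- 1) (hR (A_alph (ipart mu i) + - B_alph (int (i - 1)))) *
      tpow (- (ipart mu i - int i)))) [Suc 0..<Suc (0 + l)] v))"
    by (subst fold_shift[where b = "\<lambda>i. - letter (bv i)" and a = "\<lambda>i. A_alph (ipart mu i)"
          and t = "\<lambda>i. tpow (- (ipart mu i - int i))" and C = "\<lambda>i. - B_alph (int i)" and s = "- 1" and k = 0])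
       (simp_all add: F_def B_alph_step del: upt_Suc of_nat_Suc)
  finally show ?thesis by (simp del: upt_Suc)
qed

subsection \<open>Matrix elements as determinants of complete symmetric functions\<close>

definition deg_le :: "int \<Rightarrow> 'a::zero series \<Rightarrow> bool" where
  "deg_le d c \<longleftrightarrow> (\<forall>m. int (mdeg m) > d \<longrightarrow> scoeff c m = 0)"

lemma deg_le_mult: "deg_le d c \<Longrightarrow> deg_le e c' \<Longrightarrow> deg_le (d + e) (c * c' :: 'a::comm_ring_1 series)"
proof -
  assume c: "deg_le d c" "deg_le e c'"
  have "scoeff c a * scoeff c' b = 0" if "int (mdeg (a + b)) > d + e" for a b
    using c that by (cases "int (mdeg a) > d") (auto simp: deg_le_def)
  then show ?thesis by (auto simp: deg_le_def scoeff_times intro!: sum.neutral)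
qed

lemma deg_le_one: "deg_le 0 (1 :: 'a::comm_ring_1 series)"
  by (auto simp: deg_le_def scoeff_one)

lemma deg_le_lin1: "lin1 z \<Longrightarrow> deg_le 1 (1 - z)"
  by (auto simp: deg_le_def scoeff_one lin1_def)

lemma deg_le_B: "deg_le (int d) (hR (B_alph (int k) - B_alph (int (k + d))))"
proof (induction d)
  case (Suc d)
  have "hR (B_alph (int k) - B_alph (int (k + Suc d))) =
      hR (B_alph (int k) - B_alph (int (k + d)) + - letter (bv (Suc (k + d))))"
    unfolding add_Suc_right B_alph_step by (simp add: algebra_simps)
  also have "\<dots> = hR (B_alph (int k) - B_alph (int (k + d))) * (1 - bv (Suc (k + d)) :: 'a series)"
    by (subst hR_add) (simp_all add: hR_uminus_letter)
  finally show ?case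
    using deg_le_mult[OF Suc deg_le_lin1[of "bv (Suc (k + d))"]] by (simp add: add.commute)
qed (simp add: deg_le_one)

text \<open>Carrying exp(-H^*(B_l)) from the ket to the bra multiplies the symbols of the adjoint
  fields by \<open>hR (- B_alph (int l))\<close>. The degree condition on \<open>K\<close> says that
  these symbols then end at t^l, so that Wick's theorem applies.\<close>

lemma bra_prod_det:
  fixes K :: "nat \<Rightarrow> 'k::field_char_0 alphabet"
  assumes K: "\<And>j. homog (K j)" "\<And>j. j \<in> {1..l} \<Longrightarrow> deg_le (int l + ipart mu j - int j) (hR (K j - B_alph (int l)))"
    and lam: "part lam l = 0"
  shows "bra_prod l K mu (hv (- 1) (xs_alph n) (ket_upper l lam)) =
    C_fac l n * det_from1 l (\<lambda>i j. h_ominus (ipart lam i - ipart mu j - int i + int j) (xs_alph n)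
      (K j + A_alph (ipart lam i) - B_alph (int (i - 1))))"
proof -
  let ?B = "B_alph (int l) :: 'k alphabet"
  let ?u = "\<lambda>i. tau 1 (hR (A_alph (ipart lam i) - B_alph (int (i - 1)))) * tpow (ipart lam i - int i) :: 'k laurent"
  let ?w = "\<lambda>j. tau 1 (hR (K j)) * tpow (- (ipart mu j - int j))"
  let ?u' = "\<lambda>i. tau 1 (hR ?B) * (tau (- 1) (hR (xs_alph n)) * ?u i)"
  let ?w' = "\<lambda>j. tau 1 (hR (- ?B)) * ?w j"
  let ?fu = "\<lambda>u. foldr (\<lambda>i. psi_op (u i)) [1..<Suc l]"
  let ?fw = "\<lambda>w. fold (\<lambda>j. psis_op (w j)) [1..<Suc l]"
  have rl: "rlinear (?fw ?w)" by (intro rlinear_fold rlinear_lop lin_mode_lact)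
  have rl': "foldr (\<lambda>i. psi_op (u i)) is (rscale c v) = rscale c (foldr (\<lambda>i. psi_op (u i)) is v)"
    for u c and "is" :: "nat list" and v :: "'k fock series"
    by (induction "is") (simp_all add: rscale_lop lin_mode_lact)
  have "hv (- 1) (xs_alph n) (ket_upper l lam) =
      rscale (C_fac l n) (?fu (\<lambda>i. tau (- 1) (hR (xs_alph n)) * ?u i) (hv 1 (- ?B) (cket l)))"
    unfolding ket_upper_form[OF lam]
    by (subst hv_foldr) (simp_all add: hv_xs_B vert_cket rl' del: upt_Suc)
  also have "\<dots> = rscale (C_fac l n) (hv 1 (- ?B) (?fu ?u' (cket l)))"
    by (subst foldr_hv) (simp_all del: upt_Suc)
  finally have "bra_prod l K mu (hv (- 1) (xs_alph n) (ket_upper l lam)) =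
      C_fac l n * bra l (?fw ?w (hv 1 (- ?B) (?fu ?u' (cket l))))"
    unfolding bra_prod_def by (simp only: rlinearD(2)[OF rl] bra_rscale)
  also have "bra l (?fw ?w (hv 1 (- ?B) (?fu ?u' (cket l)))) = bra l (?fw ?w' (?fu ?u' (cket l)))"
    by (subst fold_hv) (simp_all add: bra_hv del: upt_Suc)
  also have "\<dots> = det_from1 l (\<lambda>i j. coef 0 (?w' j * ?u' i))"
  proof (rule psi_wick)
    fix j n assume j: "j \<in> {1..l}" and n: "n > int l"
    have "?w' j = tpow (- (ipart mu j - int j)) * tau 1 (hR (K j - ?B))"
      using hR_add[of "K j" "- ?B"] by (simp add: K tau_mult mult_ac)
    then have "coef n (?w' j) = dpart (n - (int j - ipart mu j)) (hR (K j - ?B))"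
      by (simp add: coef_tpow coef_tau)
    also have "\<dots> = 0"
      using K(2)[OF j] n by (intro series_eqI) (auto simp: deg_le_def)
    finally show "coef n (?w' j) = 0" .
  qed
  also have "\<dots> = det_from1 l (\<lambda>i j. h_ominus (ipart lam i - ipart mu j - int i + int j) (xs_alph n)
      (K j + A_alph (ipart lam i) - B_alph (int (i - 1))))"
  proof -
    have "coef 0 (?w' j * ?u' i) = h_ominus (ipart lam i - ipart mu j - int i + int j) (xs_alph n)
      (K j + A_alph (ipart lam i) - B_alph (int (i - 1)))" for i j
    proof -
      have hh: "hR (K j + A_alph (ipart lam i) - B_alph (int (i - 1))) = hR (K j) * hR (A_alph (ipart lam i) - B_alph (int (i - 1)))"
        using hR_add[of "K j" "A_alph (ipart lam i) - B_alph (int (i - 1))"] by (simp add: K algebra_simps)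
      have tt: "tpow (- (ipart mu j - int j)) * tpow (ipart lam i - int i) =
          (tpow (ipart lam i - ipart mu j - int i + int j) :: 'k laurent)"
        by (simp add: algebra_simps flip: tpow_add)
      \<comment> \<open>The factors of B_l acquired by the two kinds of fields cancel in every
        contraction.\<close>
      have "?w' j * ?u' i = tau 1 (hR ?B * hR (- ?B)) *
          ((tpow (- (ipart mu j - int j)) * tpow (ipart lam i - int i)) *
           (tau (- 1) (hR (xs_alph n)) * tau 1 (hR (K j + A_alph (ipart lam i) - B_alph (int (i - 1))))))"
        unfolding hh tau_mult by (simp only: mult_ac)
      also have "\<dots> = tpow (ipart lam i - ipart mu j - int i + int j) *
           (tau (- 1) (hR (xs_alph n)) * tau 1 (hR (K j + A_alph (ipart lam i) - B_alph (int (i - 1)))))"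
        unfolding tt by (simp add: hR_uminus_right)
      finally show ?thesis
        by (simp add: coef_tpow h_ominus_eq[of _ _ "- 1"] K)
    qed
    then show ?thesis by simp
  qed
  finally show ?thesis .
qed

text \<open>All vertex operators present are exponentials of H, which commute and fix the vacuum, so
  no prefactor arises. The symbols of the adjoint fields are t^(j - \<mu>_j) times series in 1 / t
  and hence end at t^l.\<close>

lemma lower_det:
  assumes lam: "length lam \<le> l" and mu: "length mu < l"
  shows "matrix_elem (bra_lower l mu) (xs_alph n) (ket_lower l lam :: 'k::field_char_0 fock series) =
    det_from1 l (\<lambda>i j. hfun (ipart lam i - ipart mu j - int i + int j)
         (xs_alph n + (A_alph (ipart mu j) - A_alph (ipart lam i - 1)) + (B_alph (int (i - 1)) - B_alph (int (j - 1)))))"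
proof -
  let ?B = "B_alph (int l) :: 'k alphabet" and ?X = "xs_alph n :: 'k alphabet"
  let ?Z = "- ?B + ?X"
  let ?u = "\<lambda>i. tau (- 1) (hR (- A_alph (ipart lam i - 1) + B_alph (int (i - 1)))) * tpow (ipart lam i - int i) :: 'k laurent"
  let ?w = "\<lambda>i. tau (- 1) (hR (A_alph (ipart mu i) + - B_alph (int (i - 1)))) * tpow (- (ipart mu i - int i)) :: 'k laurent"
  let ?fu = "\<lambda>u. foldr (\<lambda>i. psi_op (u i)) [1..<Suc l]"
  let ?fw = "\<lambda>w. fold (\<lambda>j. psis_op (w j)) [1..<Suc l]"
  let ?w' = "\<lambda>j. tau (- 1) (hR (- ?Z)) * (tau (- 1) (hR ?X) * ?w j)" and ?u' = "\<lambda>i. tau (- 1) (hR ?Z) * ?u i"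
  have "matrix_elem (bra_lower l mu) ?X (ket_lower l lam) =
    bra l (hv (- 1) (- ?B) (?fw ?w (hv (- 1) ?X (?fu ?u (cket l)))))"
    using mu by (simp add: matrix_elem_def exp_H_op bra_lower_form part_zero ket_lower_form del: upt_Suc)
  also have "hv (- 1) (- ?B) (?fw ?w (hv (- 1) ?X (?fu ?u (cket l)))) =
      hv (- 1) ?Z (?fw (\<lambda>j. tau (- 1) (hR ?X) * ?w j) (?fu ?u (cket l)))"
    by (subst fold_hv, simp, simp, subst hv_add, simp, rule refl)
  also have "\<dots> = ?fw ?w' (?fu ?u' (cket l))"
    by (subst hv_fold) (simp_all add: hv_foldr vert_cket del: upt_Suc)
  also have "bra l \<dots> = det_from1 l (\<lambda>i j. coef 0 (?w' j * ?u' i))"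
  proof (rule psi_wick)
    fix j n' assume j: "j \<in> {1..l}" and n': "n' > int l"
    have "?w' j = tpow (- (ipart mu j - int j)) * tau (- 1) (hR (- ?Z) * (hR ?X * hR (A_alph (ipart mu j) + - B_alph (int (j - 1)))))"
      by (simp add: tau_mult mult_ac)
    then have "coef n' (?w' j) = dpart (- (n' + (ipart mu j - int j))) (hR (- ?Z) * (hR ?X * hR (A_alph (ipart mu j) + - B_alph (int (j - 1)))))"
      by (simp add: coef_tpow coef_tau)
    also have "\<dots> = 0" using j n' by (intro series_eqI) auto
    finally show "coef n' (?w' j) = 0" .
  qed
  also have "\<dots> = det_from1 l (\<lambda>i j. hfun (ipart lam i - ipart mu j - int i + int j)
         (xs_alph n + (A_alph (ipart mu j) - A_alph (ipart lam i - 1)) + (B_alph (int (i - 1)) - B_alph (int (j - 1)))))"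
  proof -
    have "coef 0 (?w' j * ?u' i) = hfun (ipart lam i - ipart mu j - int i + int j)
         (xs_alph n + (A_alph (ipart mu j) - A_alph (ipart lam i - 1)) + (B_alph (int (i - 1)) - B_alph (int (j - 1))))" for i j
    proof -
      let ?Y = "xs_alph n + (A_alph (ipart mu j) - A_alph (ipart lam i - 1)) + (B_alph (int (i - 1)) - B_alph (int (j - 1))) :: 'k alphabet"
      have "?Y = ?X + ((A_alph (ipart mu j) + - B_alph (int (j - 1))) + (- A_alph (ipart lam i - 1) + B_alph (int (i - 1))))"
        by simp
      then have hh: "hR ?Y = hR ?X * (hR (A_alph (ipart mu j) + - B_alph (int (j - 1))) * hR (- A_alph (ipart lam i - 1) + B_alph (int (i - 1))))"
        by (simp only: hR_add homog_add homog_xs homog_A homog_B homog_uminus)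
      have tt: "tpow (- (ipart mu j - int j)) * tpow (ipart lam i - int i) =
          (tpow (ipart lam i - ipart mu j - int i + int j) :: 'k laurent)"
        by (simp add: algebra_simps flip: tpow_add)
      have "?w' j * ?u' i = tau (- 1) (hR ?Z * hR (- ?Z)) *
          ((tpow (- (ipart mu j - int j)) * tpow (ipart lam i - int i)) * tau (- 1) (hR ?Y))"
        unfolding hh tau_mult by (simp only: mult_ac)
      also have "\<dots> = tpow (ipart lam i - ipart mu j - int i + int j) * tau (- 1) (hR ?Y)"
        unfolding tt by (subst hR_uminus_right) simp_all
      finally have "coef 0 (?w' j * ?u' i) = coef 0 (tpow (ipart lam i - ipart mu j - int i + int j) * tau (- 1) (hR ?Y))"
        by (simp only:)
      also have "\<dots> = dpart (- (0 - (ipart lam i - ipart mu j - int i + int j))) (hR ?Y)"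
        by (simp only: coef_tpow) (subst coef_tau, simp, simp)
      also have "- (0 - (ipart lam i - ipart mu j - int i + int j)) = ipart lam i - ipart mu j - int i + int j"
        by simp
      finally show ?thesis by (simp only: hfun_eq homog_add homog_xs homog_diff homog_A homog_B)
    qed
    then show ?thesis by simp
  qed
  finally show ?thesis .
qed

section \<open>The full matrix: Newton bases, inverse and determinant\<close>

subsection \<open>Multiplication operators in Newton bases\<close>

text \<open>Power series in t, for which the residue, that is the coefficient of 1 / t,
  vanishes.\<close>

definition hol :: "'k::comm_ring_1 laurent \<Rightarrow> bool" where
  "hol u \<longleftrightarrow> (\<forall>n<0. coef n u = 0)"

definition top_le :: "int \<Rightarrow> 'k::comm_ring_1 laurent \<Rightarrow> bool" where
  "top_le d u \<longleftrightarrow> (\<forall>n>d. coef n u = 0)"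

lemma lookup_mult_zero:
  fixes p q :: "int \<Rightarrow>\<^sub>0 'k::comm_ring_1"
  assumes "\<And>i j. i + j = n \<Longrightarrow> Poly_Mapping.lookup p i = 0 \<or> Poly_Mapping.lookup q j = 0"
  shows "Poly_Mapping.lookup (p * q) n = 0"
proof (rule ccontr)
  assume "Poly_Mapping.lookup (p * q) n \<noteq> 0"
  then have "n \<in> Poly_Mapping.keys (p * q)" by (simp add: in_keys_iff)
  then obtain i j where "n = i + j" "i \<in> Poly_Mapping.keys p" "j \<in> Poly_Mapping.keys q"
    using keys_mult[of p q] by auto
  with assms[of i j] show False by (auto simp: in_keys_iff)
qed

lemma coef_mult_zero:
  assumes "\<And>i j. i + j = n \<Longrightarrow> coef i u = 0 \<or> coef j v = 0"
  shows "coef n (u * v) = 0"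
proof (rule series_eqI)
  fix m
  have "Poly_Mapping.lookup (scoeff u a * scoeff v b) n = 0" for a b
  proof (rule lookup_mult_zero)
    fix i j assume "i + j = n"
    with assms show "Poly_Mapping.lookup (scoeff u a) i = 0 \<or> Poly_Mapping.lookup (scoeff v b) j = 0"
      by (metis scoeff_coef scoeff_zero)
  qed
  then show "scoeff (coef n (u * v)) m = scoeff 0 m"
    by (simp add: scoeff_times lookup_sum case_prod_beta)
qed

lemma hol_mult: "hol u \<Longrightarrow> hol v \<Longrightarrow> hol (u * v)"
proof -
  assume uv: "hol u" "hol v"
  show ?thesis
    unfolding hol_def
  proof (intro allI impI)
    fix n :: int assume "n < 0"
    then show "coef n (u * v) = 0"
      using uv by (intro coef_mult_zero) (auto simp: hol_def, smt (verit))
  qed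
qed

lemma top_le_mult: "top_le d u \<Longrightarrow> top_le e v \<Longrightarrow> top_le (d + e) (u * v)"
proof -
  assume uv: "top_le d u" "top_le e v"
  show ?thesis
    unfolding top_le_def
  proof (intro allI impI)
    fix n :: int assume "n > d + e"
    then show "coef n (u * v) = 0"
      using uv by (intro coef_mult_zero) (auto simp: top_le_def, smt (verit))
  qed
qed

lemma coef_tau_0: "coef n (tau 0 c) = (if n = 0 then c else 0)"
  by (rule series_eqI) (simp add: lookup_single when_def)

lemma coef_one: "coef n 1 = (if n = 0 then 1 else 0)"
  using coef_tau_0[of n 1] by simp

lemma coef_tpow': "coef n (tpow k) = (if n = k then 1 else 0)"
  using coef_tpow[of n k 1] by (simp add: coef_one)

lemma hol_one: "hol 1"
  and hol_tau_0: "hol (tau 0 c)"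
  and hol_tpow: "0 \<le> k \<Longrightarrow> hol (tpow k)"
  and hol_tau_1: "hol (tau 1 c)"
  and top_le_tau_m1: "top_le 0 (tau (- 1) c)"
  and top_le_tpow: "top_le k (tpow k)"
  by (simp_all add: hol_def top_le_def coef_one coef_tau_0 coef_tpow' coef_tau) (auto intro!: series_eqI)

lemma hol_diff: "hol u \<Longrightarrow> hol v \<Longrightarrow> hol (u - v)"
  by (simp add: hol_def coef_diff)

lemma laurent_const: "hol r \<Longrightarrow> top_le 0 r \<Longrightarrow> r = tau 0 (coef 0 r)"
proof (rule laurent_eqI)
  fix n assume "hol r" "top_le 0 r"
  then show "coef n r = coef n (tau 0 (coef 0 r))"
    by (cases n "0 :: int" rule: linorder_cases) (simp_all add: coef_tau_0 hol_def top_le_def)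
qed

definition pos_part :: "'k::comm_ring_1 laurent \<Rightarrow> 'k laurent" where
  "pos_part u = map_series (\<lambda>p. \<Sum>n\<in>{n \<in> Poly_Mapping.keys p. 0 \<le> n}. Poly_Mapping.single n (Poly_Mapping.lookup p n)) u"

lemma coef_pos_part: "coef n (pos_part u) = (if 0 \<le> n then coef n u else 0)"
proof (rule series_eqI)
  fix m
  have "(\<Sum>i\<in>{i \<in> Poly_Mapping.keys p. 0 \<le> i}. Poly_Mapping.lookup (Poly_Mapping.single i (Poly_Mapping.lookup p i)) n) =
    (if 0 \<le> n then Poly_Mapping.lookup p n else 0)" for p :: "int \<Rightarrow>\<^sub>0 'a"
    by (auto simp: lookup_single when_def sum.delta in_keys_iff)
  then show "scoeff (coef n (pos_part u)) m = scoeff (if 0 \<le> n then coef n u else 0) m"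
    by (simp add: pos_part_def lookup_sum)
qed

text \<open>\<open>u\<close> is h / (t - z), expanded at infinity in the application. Subtracting (t
  - z) times the nonnegative part of \<open>u\<close> from h leaves neither negative nor positive
  powers of t, hence a constant, which is the residue of \<open>u\<close>.\<close>

lemma division:
  assumes "hol h" "(tpow 1 - tau 0 z) * u = h"
  shows "h = tau 0 (coef (- 1) u) + (tpow 1 - tau 0 z) * pos_part u"
proof -
  let ?d = "tpow 1 - tau 0 z"
  let ?v = "u - pos_part u"
  have v: "coef n ?v = (if n < 0 then coef n u else 0)" for n
    by (simp add: coef_diff coef_pos_part)
  have r: "h - ?d * pos_part u = ?d * ?v"
    using assms(2) by (simp add: right_diff_distrib)
  have "hol (pos_part u)" by (simp add: hol_def coef_pos_part)
  then have "hol (h - ?d * pos_part u)"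
    by (intro hol_diff hol_mult assms hol_tpow hol_tau_0) auto
  moreover have "top_le 0 (?d * ?v)"
  proof -
    have "top_le 1 ?d" by (simp add: top_le_def coef_diff coef_tpow' coef_tau_0)
    moreover have "top_le (- 1) ?v" by (simp add: top_le_def v)
    ultimately show ?thesis using top_le_mult by fastforce
  qed
  ultimately have "h - ?d * pos_part u = tau 0 (coef 0 (?d * ?v))"
    using laurent_const unfolding r by blast
  moreover have "coef 0 (?d * ?v) = coef (- 1) u"
    unfolding left_diff_distrib by (subst coef_diff, subst coef_tpow, subst coef_tau_0_mult) (simp add: v)
  ultimately show ?thesis by (simp add: algebra_simps)
qed

text \<open>If \<open>\<kappa>\<close> loses the letters z_0, z_1, ... one by one, this is the
  Newton polynomial (t - z_0) ... (t - z_(q-1)) times \<open>nn \<kappa> 0\<close>. As it depends on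
  q and \<open>\<kappa> q\<close> only, chains with the same ends share their first and last
  members.\<close>

definition nn :: "(nat \<Rightarrow> 'k::comm_ring_1 alphabet) \<Rightarrow> nat \<Rightarrow> 'k laurent" where
  "nn \<kappa> q = tpow (int q) * tau (- 1) (hR (\<kappa> q))"

definition ni :: "(nat \<Rightarrow> 'k::comm_ring_1 alphabet) \<Rightarrow> nat \<Rightarrow> 'k laurent" where
  "ni \<kappa> q = tpow (- int q) * tau (- 1) (hR (- \<kappa> q))"

definition chain :: "nat \<Rightarrow> (nat \<Rightarrow> 'k::comm_ring_1 alphabet) \<Rightarrow> bool" where
  "chain N \<kappa> \<longleftrightarrow> (\<forall>q. homog (\<kappa> q)) \<and> (\<forall>q<N. \<exists>z. lin1 z \<and> \<kappa> q = \<kappa> (Suc q) + letter z)"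

lemma chain_homog: "chain N \<kappa> \<Longrightarrow> homog (\<kappa> q)"
  by (simp add: chain_def)

lemma nn_ni:
  assumes "homog (\<kappa> q)" "homog (\<rho> p)"
  shows "nn \<kappa> q * ni \<rho> p = tpow (int q - int p) * tau (- 1) (hR (\<kappa> q - \<rho> p))"
proof -
  have h: "hR (\<kappa> q - \<rho> p) = hR (\<kappa> q) * hR (- \<rho> p)"
    using assms hR_add[of "\<kappa> q" "- \<rho> p"] by simp
  have t: "tpow (int q - int p) = (tpow (int q) * tpow (- int p) :: 'a laurent)"
    using tpow_add[of "int q" "- int p"] by simp
  show ?thesis by (simp only: h t nn_def ni_def tau_mult mult_ac)
qed

lemma nn_ni_same: "homog (\<kappa> q) \<Longrightarrow> nn \<kappa> q * ni \<kappa> q = 1"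
  by (simp add: nn_ni)

lemma nn_Suc:
  assumes "lin1 z" "\<kappa> q = \<kappa> (Suc q) + letter z" "homog (\<kappa> q)"
  shows "nn \<kappa> (Suc q) = nn \<kappa> q * (tpow 1 - tau 0 z)"
proof -
  have "\<kappa> (Suc q) = \<kappa> q + - letter z" using assms(2) by simp
  then have "hR (\<kappa> (Suc q)) = hR (\<kappa> q) * (1 - z)"
    using hR_add[of "\<kappa> q" "- letter z"] assms by (simp add: hR_uminus_letter)
  moreover have "tpow (int (Suc q)) * (1 - tau 0 z * tpow (- 1)) = (tpow (int q) * (tpow 1 - tau 0 z) :: 'a laurent)"
  proof -
    have "tpow (int (Suc q)) * (tau 0 z * tpow (- 1)) = tau 0 z * tpow (int (Suc q) + - 1)"
      unfolding tpow_add by (simp only: mult_ac)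
    moreover have "tpow (int (Suc q)) = (tpow (int q) * tpow 1 :: 'a laurent)"
      by (simp add: add.commute flip: tpow_add)
    ultimately show ?thesis by (simp add: algebra_simps)
  qed
  moreover have "tau (- 1) (1 - z) = 1 - tau 0 z * tpow (- 1)"
    by (simp add: tau_diff tau_lin1[OF assms(1), of "- 1"])
  ultimately show ?thesis
    by (simp only: nn_def tau_mult) (metis (no_types, opaque_lifting) mult.assoc mult.commute)
qed

text \<open>A later member of the Newton basis is an earlier one times factors t - z.\<close>

lemma hol_nn_ni:
  assumes \<kappa>: "chain N \<kappa>" and "p \<le> q" "q \<le> N"
  shows "hol (nn \<kappa> q * ni \<kappa> p)"
  using assms(2,3)
proof (induction q rule: dec_induct)
  case base
  then show ?case by (simp add: nn_ni_same chain_homog[OF \<kappa>] hol_one)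
next
  case (step q)
  then obtain z where z: "lin1 z" "\<kappa> q = \<kappa> (Suc q) + letter z"
    using \<kappa> unfolding chain_def by (meson Suc_le_lessD)
  have "nn \<kappa> (Suc q) * ni \<kappa> p = nn \<kappa> q * ni \<kappa> p * (tpow 1 - tau 0 z)"
    by (simp add: nn_Suc[OF z chain_homog[OF \<kappa>]] mult_ac)
  with step show ?case
    by (auto intro!: hol_mult hol_diff hol_tpow hol_tau_0)
qed

lemma top_le_nn_ni:
  assumes "homog (\<kappa> q)" "homog (\<rho> p)" shows "top_le (int q - int p) (nn \<kappa> q * ni \<rho> p)"
  unfolding nn_ni[of \<kappa> q \<rho> p, OF assms] using top_le_mult[OF top_le_tpow top_le_tau_m1] by simp

text \<open>Newton interpolation: the coefficients of a power series with respect to the Newton basis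
  are divided differences, that is residues.\<close>

lemma newton:
  assumes \<sigma>: "chain N \<sigma>" and h: "hol h" and "k \<le> N"
  shows "\<exists>g. hol g \<and> h * nn \<sigma> 0 =
    (\<Sum>p<k. tau 0 (coef (- 1) (h * nn \<sigma> 0 * ni \<sigma> (Suc p))) * nn \<sigma> p) + nn \<sigma> k * g"
  using assms(3)
proof (induction k)
  case 0
  show ?case by (rule exI[of _ h]) (simp add: h mult.commute)
next
  case (Suc k)
  note hom = chain_homog[OF \<sigma>]
  define c where "c p = coef (- 1) (h * nn \<sigma> 0 * ni \<sigma> (Suc p))" for p
  from Suc obtain g where g: "hol g" "h * nn \<sigma> 0 = (\<Sum>p<k. tau 0 (c p) * nn \<sigma> p) + nn \<sigma> k * g"
    by (auto simp: c_def)
  obtain z where z: "lin1 z" "\<sigma> k = \<sigma> (Suc k) + letter z"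
    using \<sigma> Suc.prems unfolding chain_def by (meson Suc_le_lessD)
  let ?d = "tpow 1 - tau 0 z" and ?u = "g * (nn \<sigma> k * ni \<sigma> (Suc k))"
  have S: "nn \<sigma> (Suc k) = nn \<sigma> k * ?d" by (rule nn_Suc[OF z hom])
  have "?d * ?u = g * (nn \<sigma> (Suc k) * ni \<sigma> (Suc k))" by (simp only: S mult_ac)
  then have "?d * ?u = g" by (simp add: nn_ni_same hom)
  from division[OF g(1) this]
  have div: "g = tau 0 (coef (- 1) ?u) + ?d * pos_part ?u" .
  have "h * nn \<sigma> 0 * ni \<sigma> (Suc k) = (\<Sum>p<k. tau 0 (c p) * (nn \<sigma> p * ni \<sigma> (Suc k))) + ?u"
    unfolding g(2) distrib_right sum_distrib_right by (simp only: mult_ac)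
  then have "c k = (\<Sum>p<k. c p * coef (- 1) (nn \<sigma> p * ni \<sigma> (Suc k))) + coef (- 1) ?u"
    unfolding c_def[of k] by (simp only: coef_add coef_sum coef_tau_0_mult)
  \<comment> \<open>The powers of t in these products are at most p - (k + 1) \<le> -2.\<close>
  also have "(\<Sum>p<k. c p * coef (- 1) (nn \<sigma> p * ni \<sigma> (Suc k))) = 0"
  proof (intro sum.neutral ballI)
    fix p assume "p \<in> {..<k}"
    then have "coef (- 1) (nn \<sigma> p * ni \<sigma> (Suc k)) = 0"
      using top_le_nn_ni[of \<sigma> p \<sigma> "Suc k", OF hom hom] by (auto simp: top_le_def)
    then show "c p * coef (- 1) (nn \<sigma> p * ni \<sigma> (Suc k)) = 0" by simp
  qed
  finally have ck: "coef (- 1) ?u = c k" by simp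
  have "nn \<sigma> k * g = nn \<sigma> k * (tau 0 (c k) + ?d * pos_part ?u)"
    using div unfolding ck by simp
  also have "\<dots> = tau 0 (c k) * nn \<sigma> k + nn \<sigma> (Suc k) * pos_part ?u"
    by (simp only: S distrib_left mult_ac)
  finally have "h * nn \<sigma> 0 = (\<Sum>p<Suc k. tau 0 (c p) * nn \<sigma> p) + nn \<sigma> (Suc k) * pos_part ?u"
    using g(2) by (simp add: add.assoc)
  then show ?case
    by (intro exI[of _ "pos_part ?u"]) (simp add: hol_def coef_pos_part c_def)
qed

text \<open>By \<open>newton\<close>, the matrix of the multiplication by \<open>f\<close>, from the Newton basis of \<open>\<kappa>\<close> to that of \<open>\<rho>\<close>.\<close>

definition mm :: "'k::comm_ring_1 laurent \<Rightarrow> (nat \<Rightarrow> 'k alphabet) \<Rightarrow> (nat \<Rightarrow> 'k alphabet) \<Rightarrow> nat \<Rightarrow> nat \<Rightarrow> 'k series" where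
  "mm f \<kappa> \<rho> p q = coef (- 1) (f * (nn \<kappa> q * ni \<rho> (Suc p)))"

text \<open>Expand g times the q-th element of the basis of \<open>\<kappa>\<close> in the basis of
  \<open>\<sigma>\<close>, multiply by f and take residues against \<open>\<rho>\<close>. Equality
  of \<open>\<kappa>\<close> and \<open>\<sigma>\<close> at 0 makes the series to be expanded
  holomorphic; equality of \<open>\<sigma>\<close> and \<open>\<rho>\<close> at N makes the
  remainder a multiple of \<open>nn \<rho> N\<close>, which has no residues.\<close>

lemma mm_mult:
  assumes ch: "chain N \<kappa>" "chain N \<sigma>" "chain N \<rho>" and ends: "\<kappa> 0 = \<sigma> 0" "\<sigma> N = \<rho> N"
    and fg: "hol f" "hol g" and pq: "p < N" "q \<le> N"
  shows "(\<Sum>k<N. mm f \<sigma> \<rho> p k * mm g \<kappa> \<sigma> k q) = mm (f * g) \<kappa> \<rho> p q"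
proof -
  note hom = ch[THEN chain_homog]
  let ?h = "g * (nn \<kappa> q * ni \<kappa> 0)"
  have "ni \<kappa> 0 * nn \<sigma> 0 = 1"
    using nn_ni_same[of \<kappa> 0] hom by (simp add: nn_def ni_def ends mult.commute)
  then have h: "?h * nn \<sigma> 0 = g * nn \<kappa> q"
    by (simp add: mult.assoc)
  have "hol ?h" by (intro hol_mult fg hol_nn_ni[OF ch(1)]) (use pq in auto)
  from newton[OF ch(2) this order_refl] obtain g' where g': "hol g'"
    "g * nn \<kappa> q = (\<Sum>k<N. tau 0 (coef (- 1) (g * nn \<kappa> q * ni \<sigma> (Suc k))) * nn \<sigma> k) + nn \<sigma> N * g'"
    unfolding h by blast
  have "f * g * (nn \<kappa> q * ni \<rho> (Suc p)) = (g * nn \<kappa> q) * (f * ni \<rho> (Suc p))" by (simp only: mult_ac)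
  also have "\<dots> = (\<Sum>k<N. tau 0 (coef (- 1) (g * nn \<kappa> q * ni \<sigma> (Suc k))) * (f * (nn \<sigma> k * ni \<rho> (Suc p)))) +
      f * (nn \<sigma> N * ni \<rho> (Suc p)) * g'"
    by (subst g'(2), subst distrib_right, subst sum_distrib_right) (simp only: mult_ac)
  also have "nn \<sigma> N * ni \<rho> (Suc p) = nn \<rho> N * ni \<rho> (Suc p)"
    by (simp add: nn_def ends)
  finally have e: "f * g * (nn \<kappa> q * ni \<rho> (Suc p)) =
    (\<Sum>k<N. tau 0 (coef (- 1) (g * nn \<kappa> q * ni \<sigma> (Suc k))) * (f * (nn \<sigma> k * ni \<rho> (Suc p)))) +
      f * (nn \<rho> N * ni \<rho> (Suc p)) * g'" .
  have "hol (f * (nn \<rho> N * ni \<rho> (Suc p)) * g')"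
    by (intro hol_mult fg g' hol_nn_ni[OF ch(3)]) (use pq in auto)
  then have "coef (- 1) (f * (nn \<rho> N * ni \<rho> (Suc p)) * g') = 0" by (simp add: hol_def)
  then have "mm (f * g) \<kappa> \<rho> p q = (\<Sum>k<N. coef (- 1) (g * nn \<kappa> q * ni \<sigma> (Suc k)) * mm f \<sigma> \<rho> p k)"
    unfolding mm_def by (subst e) (simp only: coef_add coef_sum coef_tau_0_mult add_0_right)
  also have "\<dots> = (\<Sum>k<N. mm f \<sigma> \<rho> p k * mm g \<kappa> \<sigma> k q)"
    by (simp only: mm_def mult.assoc mult.commute[of "coef _ (f * _)"])
  finally show ?thesis by simp
qed

lemma mm_h_ominus:
  assumes "homog (\<kappa> q)" "homog (\<rho> (Suc p))" "homog X"
  shows "mm (tau 1 (hR X)) \<kappa> \<rho> p q = h_ominus (int p - int q) X (\<kappa> q - \<rho> (Suc p))"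
proof -
  have "tau 1 (hR X) * (nn \<kappa> q * ni \<rho> (Suc p)) =
    tpow (int q - int (Suc p)) * (tau 1 (hR X) * tau (- 1) (hR (\<kappa> q - \<rho> (Suc p))))"
    unfolding nn_ni[of \<kappa> q \<rho> "Suc p", OF assms(1,2)] by (simp only: mult_ac)
  moreover have "- 1 - (int q - int (Suc p)) = int p - int q" by simp
  ultimately have "mm (tau 1 (hR X)) \<kappa> \<rho> p q =
      coef (int p - int q) (tau 1 (hR X) * tau (- 1) (hR (\<kappa> q - \<rho> (Suc p))))"
    by (simp only: mm_def coef_tpow)
  then show ?thesis
    using assms by (simp add: h_ominus_eq[of _ _ 1])
qed

lemma mm_upper: "chain N \<rho> \<Longrightarrow> hol f \<Longrightarrow> p < q \<Longrightarrow> q \<le> N \<Longrightarrow> mm f \<rho> \<rho> p q = 0"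
proof -
  assume a: "chain N \<rho>" "hol f" "p < q" "q \<le> N"
  then have "hol (f * (nn \<rho> q * ni \<rho> (Suc p)))"
    by (intro hol_mult hol_nn_ni) auto
  then show ?thesis by (simp add: mm_def hol_def)
qed

lemma dpart_0_hR: "homog X \<Longrightarrow> dpart 0 (hR X) = 1"
  by (rule series_eqI) (auto simp: scoeff_one hR_0)

text \<open>For q \<le> p the quotient of the two basis elements has leading term t^(q-p-1) at
  infinity. The change of basis is therefore unitriangular.\<close>

lemma mm_one:
  assumes "homog (\<kappa> q)" "homog (\<rho> (Suc p))" "q \<le> p"
  shows "mm 1 \<kappa> \<rho> p q = (if p = q then 1 else 0)"
proof -
  have "mm 1 \<kappa> \<rho> p q = dpart (int q - int p) (hR (\<kappa> q - \<rho> (Suc p)))"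
    unfolding mm_def nn_ni[of \<kappa> q \<rho> "Suc p", OF assms(1,2)] by (simp add: coef_tpow coef_tau algebra_simps)
  with assms show ?thesis
    by (auto simp: dpart_0_hR intro!: series_eqI)
qed

lemma mat_mult_fun:
  "mat n n f * mat n n g = mat n n (\<lambda>(i, j). \<Sum>k<n. f (i, k) * g (k, j) :: 'a::comm_ring_1)"
  by (rule eq_matI) (auto simp: scalar_prod_def atLeast0LessThan)

text \<open>Change to the basis of \<open>\<rho>\<close> first. The change is upper unitriangular,
  and multiplication by f in a single Newton basis is lower triangular because it preserves the
  multiples of each basis element.\<close>

lemma newton_det:
  assumes ch: "chain N \<kappa>" "chain N \<rho>" and ends: "\<kappa> 0 = \<rho> 0" "\<kappa> N = \<rho> N" and f: "hol f"
  shows "det (mat N N (\<lambda>(p, q). mm f \<kappa> \<rho> p q)) = (\<Prod>p<N. mm f \<rho> \<rho> p p)"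
proof -
  note hom = ch[THEN chain_homog]
  have "mat N N (\<lambda>(p, q). mm f \<kappa> \<rho> p q) = mat N N (\<lambda>(p, q). mm f \<rho> \<rho> p q) * mat N N (\<lambda>(p, q). mm 1 \<kappa> \<rho> p q)"
    unfolding mat_mult_fun
    by (rule eq_matI) (use mm_mult[OF ch(1,2,2) ends(1) refl f hol_one] in auto)
  then have "det (mat N N (\<lambda>(p, q). mm f \<kappa> \<rho> p q)) =
      det (mat N N (\<lambda>(p, q). mm f \<rho> \<rho> p q)) * det (mat N N (\<lambda>(p, q). mm 1 \<kappa> \<rho> p q))"
    by (simp add: det_mult[of _ N])
  also have "det (mat N N (\<lambda>(p, q). mm f \<rho> \<rho> p q)) = prod_list (diag_mat (mat N N (\<lambda>(p, q). mm f \<rho> \<rho> p q)))"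
    by (rule det_lower_triangular[of N]) (auto simp: mm_upper[OF ch(2) f])
  also have "det (mat N N (\<lambda>(p, q). mm 1 \<kappa> \<rho> p q)) = prod_list (diag_mat (mat N N (\<lambda>(p, q). mm 1 \<kappa> \<rho> p q)))"
    by (rule det_upper_triangular) (auto simp: upper_triangular_def mm_one hom)
  finally show ?thesis
    by (simp add: prod_list_diag_prod mm_one hom atLeast0LessThan)
qed

lemma newton_inverse:
  assumes ch: "chain N \<kappa>" "chain N \<rho>" and ends: "\<kappa> 0 = \<rho> 0" "\<kappa> N = \<rho> N" and X: "homog X" and "p < N" "s < N"
  shows "(\<Sum>q<N. h_ominus (int p - int q) X (\<kappa> q - \<rho> (Suc p)) * h_ominus (int q - int s) (- X) (\<rho> s - \<kappa> (Suc q))) =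
    (if p = s then 1 else 0)"
proof -
  note hom = ch[THEN chain_homog]
  have "(\<Sum>q<N. h_ominus (int p - int q) X (\<kappa> q - \<rho> (Suc p)) * h_ominus (int q - int s) (- X) (\<rho> s - \<kappa> (Suc q))) =
    (\<Sum>q<N. mm (tau 1 (hR X)) \<kappa> \<rho> p q * mm (tau 1 (hR (- X))) \<rho> \<kappa> q s)"
    using X hom by (simp add: mm_h_ominus)
  also have "\<dots> = mm (tau 1 (hR X) * tau 1 (hR (- X))) \<rho> \<rho> p s"
    using assms by (intro mm_mult hol_tau_1) auto
  also have "tau 1 (hR X) * tau 1 (hR (- X)) = 1"
    using X by (simp add: hR_uminus_right flip: tau_mult)
  also have "mm 1 \<rho> \<rho> p s = (if p = s then 1 else 0)"
    using assms hom by (cases "s \<le> p") (auto simp: mm_one mm_upper[OF ch(2) hol_one])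
  finally show ?thesis .
qed

text \<open>The case N = 1 of the multiplication matrices: multiplication modulo t - z is evaluation
  at t = z, and values are multiplicative.\<close>

lemma h_ominus_0_letter_add:
  assumes "homog X" "homog Y" "lin1 z"
  shows "h_ominus 0 (X + Y) (letter z) = h_ominus 0 X (letter z) * h_ominus 0 Y (letter z)"
proof -
  let ?\<kappa> = "\<lambda>i::nat. if i = 0 then letter z else 0"
  have ch: "chain 1 ?\<kappa>" using assms by (auto simp: chain_def)
  have e: "mm (tau 1 (hR Z)) ?\<kappa> ?\<kappa> 0 0 = h_ominus 0 Z (letter z)" if "homog Z" for Z
    using assms that by (subst mm_h_ominus) auto
  have "mm (tau 1 (hR X)) ?\<kappa> ?\<kappa> 0 0 * mm (tau 1 (hR Y)) ?\<kappa> ?\<kappa> 0 0 = mm (tau 1 (hR X) * tau 1 (hR Y)) ?\<kappa> ?\<kappa> 0 0"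
    using mm_mult[OF ch ch ch refl refl hol_tau_1 hol_tau_1, of 0 0 "hR X" "hR Y"] by simp
  also have "tau 1 (hR X) * tau 1 (hR Y) = tau 1 (hR (X + Y))"
    by (simp add: hR_add assms tau_mult)
  finally show ?thesis using assms by (simp only: e homog_add)
qed

text \<open>For the alphabet -x the value of 1 - x t at z is computed directly; multiplicativity
  then gives the inverse for x.\<close>

lemma h_ominus_0_letter:
  assumes x: "lin1 x" and z: "lin1 z"
  shows "h_ominus 0 (letter x) (letter z) * (1 - x * z) = 1"
proof -
  let ?g = "hR (letter z)"
  have "(1 - z) * ?g = 1"
    using hR_uminus_right[of "letter z"] z by (simp add: hR_uminus_letter mult.commute)
  then have "dpart (int 1) ((1 - z) * ?g) = dpart (int 1) 1" by simp
  moreover have "dpart 0 (1 - z) = 1" "dpart 1 (1 - z) = - z" "dpart 1 1 = (0 :: 'a series)"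
    using z by (auto intro!: series_eqI simp: scoeff_one lin1_def)
  ultimately have d1: "dpart 1 ?g = z"
    unfolding dpart_mult using z by (simp add: dpart_0_hR)
  have "h_ominus 0 (- letter x) (letter z) = coef 0 ((1 - tau 0 x * tpow 1) * tau (- 1) ?g)"
    using x z by (simp add: h_ominus_eq[of _ _ 1] hR_uminus_letter tau_diff tau_lin1[of x 1])
  also have "(1 - tau 0 x * tpow 1) * tau (- 1) ?g = tau (- 1) ?g - tau 0 x * (tpow 1 * tau (- 1) ?g)"
    by (simp add: left_diff_distrib mult.assoc)
  also have "coef 0 \<dots> = dpart 0 ?g - x * dpart 1 ?g"
    by (simp add: coef_diff coef_tau_0_mult coef_tpow coef_tau)
  also have "\<dots> = 1 - x * z" using z by (simp add: d1 dpart_0_hR)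
  finally have "h_ominus 0 (- letter x) (letter z) = 1 - x * z" .
  moreover have "h_ominus 0 0 (letter z) = 1"
    using z by (simp add: h_ominus_eq[of _ _ 1] coef_tau dpart_0_hR)
  ultimately show ?thesis
    using h_ominus_0_letter_add[of "letter x" "- letter x" z] x z by simp
qed

lemma h_ominus_0_xs:
  assumes "lin1 z"
  shows "h_ominus 0 (xs_alph n) (letter z) * (\<Prod>j=1..n. 1 - xv j * z) = 1"
proof (induction n)
  case 0
  show ?case using assms by (simp add: xs_alph_def h_ominus_eq[of _ _ 1] coef_tau dpart_0_hR)
next
  case (Suc n)
  have "xs_alph (Suc n) = xs_alph n + (letter (xv (Suc n)) :: 'a alphabet)" by (simp add: xs_alph_def)
  then have "h_ominus 0 (xs_alph (Suc n)) (letter z) = h_ominus 0 (xs_alph n) (letter z) * h_ominus 0 (letter (xv (Suc n))) (letter z)"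
    by (simp add: h_ominus_0_letter_add assms)
  then have "h_ominus 0 (xs_alph (Suc n)) (letter z) * (\<Prod>j=1..Suc n. 1 - xv j * z) =
    (h_ominus 0 (xs_alph n) (letter z) * (\<Prod>j=1..n. 1 - xv j * z)) * (h_ominus 0 (letter (xv (Suc n))) (letter z) * (1 - xv (Suc n) * z))"
    by (simp add: mult_ac)
  then show ?case by (simp only: Suc h_ominus_0_letter[OF lin1_var assms]) simp
qed

text \<open>The product of all 1 - x_j z over the letters z of the alphabet, with multiplicities.
  For B_l it is C, and for A_l' the inverse of C'.\<close>

definition xprod :: "nat \<Rightarrow> 'k::comm_ring_1 alphabet \<Rightarrow> 'k series" where
  "xprod n = alph_prod (\<lambda>z. \<Prod>j=1..n. 1 - xv j * z)"

lemma xprod_add: "homog X \<Longrightarrow> homog Y \<Longrightarrow> xprod n (X + Y) = xprod n X * xprod n Y"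
  unfolding xprod_def
proof (rule alph_prod_add)
  fix z :: "'a series" assume "homog X" "homog Y" "z \<in> Poly_Mapping.keys X \<union> Poly_Mapping.keys Y"
  then have "lin1 z" by (auto dest: homogD)
  from h_ominus_0_xs[OF this, of n] show "(\<Prod>j=1..n. 1 - xv j * z) dvd 1"
    by (metis dvd_triv_right)
qed

lemma xprod_zero [simp]: "xprod n 0 = 1"
  by (simp add: xprod_def)

lemma xprod_letter: "xprod n (letter z) = (\<Prod>j=1..n. 1 - xv j * z)"
  by (simp add: xprod_def)

text \<open>The diagonal entries are values at the letters that \<open>\<rho>\<close> loses along
  the chain, and these letters make up \<rho>_0 - \<rho>_N.\<close>

lemma newton_det_xs:
  assumes ch: "chain N \<kappa>" "chain N \<rho>" and ends: "\<kappa> 0 = \<rho> 0" "\<kappa> N = \<rho> N"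
  shows "det (mat N N (\<lambda>(p, q). h_ominus (int p - int q) (xs_alph n) (\<kappa> q - \<rho> (Suc p)))) * xprod n (\<rho> 0 - \<rho> N) = 1"
proof -
  note hom = ch[THEN chain_homog]
  have "mat N N (\<lambda>(p, q). h_ominus (int p - int q) (xs_alph n) (\<kappa> q - \<rho> (Suc p))) =
      mat N N (\<lambda>(p, q). mm (tau 1 (hR (xs_alph n))) \<kappa> \<rho> p q)"
    by (rule eq_matI) (auto simp: mm_h_ominus hom)
  then have "det (mat N N (\<lambda>(p, q). h_ominus (int p - int q) (xs_alph n) (\<kappa> q - \<rho> (Suc p)))) =
      (\<Prod>p<N. h_ominus 0 (xs_alph n) (\<rho> p - \<rho> (Suc p)))"
    by (simp only: newton_det[OF ch ends hol_tau_1]) (simp add: mm_h_ominus hom)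
  moreover have "(\<Prod>p<k. h_ominus 0 (xs_alph n) (\<rho> p - \<rho> (Suc p))) * xprod n (\<rho> 0 - \<rho> k) = 1" if "k \<le> N" for k
    using that
  proof (induction k)
    case (Suc k)
    then obtain z where z: "lin1 z" "\<rho> k = \<rho> (Suc k) + letter z"
      using ch(2) unfolding chain_def by (meson Suc_le_lessD)
    have d: "\<rho> 0 - \<rho> (Suc k) = (\<rho> 0 - \<rho> k) + letter z" "\<rho> k - \<rho> (Suc k) = letter z" using z by simp_all
    have h: "homog (\<rho> 0 - \<rho> k)" "homog (letter z)" using z(1) hom by simp_all
    have x: "xprod n (\<rho> 0 - \<rho> (Suc k)) = xprod n (\<rho> 0 - \<rho> k) * (\<Prod>j=1..n. 1 - xv j * z)"
      by (simp only: d(1) xprod_add[OF h] xprod_letter)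
    have "(\<Prod>p<Suc k. h_ominus 0 (xs_alph n) (\<rho> p - \<rho> (Suc p))) * xprod n (\<rho> 0 - \<rho> (Suc k)) =
      ((\<Prod>p<k. h_ominus 0 (xs_alph n) (\<rho> p - \<rho> (Suc p))) * xprod n (\<rho> 0 - \<rho> k)) *
      (h_ominus 0 (xs_alph n) (letter z) * (\<Prod>j=1..n. 1 - xv j * z))"
      by (simp add: x d(2) mult_ac)
    also have "\<dots> = 1"
      using Suc.IH Suc.prems by (simp only: h_ominus_0_xs[OF z(1)]) simp
    finally show ?case .
  qed simp
  ultimately show ?thesis by simp
qed

lemma xprod_B: "xprod n (B_alph (int l)) = C_fac l n"
proof (induction l)
  case (Suc l)
  have "xprod n (B_alph (int (Suc l))) = xprod n (B_alph (int l)) * (xprod n (letter (bv (Suc l))) :: 'a series)"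
    unfolding B_alph_step by (rule xprod_add) auto
  with Suc show ?case by (simp add: C_fac_def xprod_letter mult.commute)
qed (simp add: C_fac_def)

lemma xprod_A: "xprod n (A_alph (int l)) * C'_fac l n = 1"
proof (induction l)
  case (Suc l)
  let ?P = "\<Prod>j=1..n. unit_inv (1 + av (Suc l) * xv j) :: 'a series"
  have x: "xprod n (A_alph (int (Suc l))) = xprod n (A_alph (int l)) * (xprod n (letter (- av (Suc l))) :: 'a series)"
    unfolding A_alph_step by (rule xprod_add) auto
  have c: "C'_fac (Suc l) n = C'_fac l n * ?P"
    by (simp add: C'_fac_def)
  have "(1 + av (Suc l) * xv j) * unit_inv (1 + av (Suc l) * xv j) = (1 :: 'a series)" for j
    using one_minus_unit[of "- (av (Suc l) * xv j) :: 'a series"]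
    by (intro unit_inv_right) (simp add: scoeff_times lin1_0)
  then have "(\<Prod>j=1..n. (1 + av (Suc l) * xv j) * unit_inv (1 + av (Suc l) * xv j)) = (1 :: 'a series)"
    by simp
  then have p: "xprod n (letter (- av (Suc l))) * ?P = 1"
    by (simp add: xprod_letter prod.distrib mult.commute)
  have "xprod n (A_alph (int (Suc l))) * C'_fac (Suc l) n =
     (xprod n (A_alph (int l)) * C'_fac l n) * (xprod n (letter (- av (Suc l))) * ?P)"
    unfolding x c by (simp only: mult_ac)
  with Suc p show ?case by simp
qed (simp add: C'_fac_def)

section \<open>Exchanging vertical and horizontal steps\<close>

subsection \<open>Complementary minors\<close>

lemma det_identity_left_block:
  fixes f :: "nat \<times> nat \<Rightarrow> 'a::comm_ring_1"
  assumes "\<And>i j. i < l + n \<Longrightarrow> j < l \<Longrightarrow> f (i, j) = (if i = j then 1 else 0)"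
  shows "det (mat (l + n) (l + n) f) = det (mat n n (\<lambda>(i, j). f (l + i, l + j)))"
  using assms
proof (induction l arbitrary: f)
  case (Suc l)
  let ?A = "mat (Suc l + n) (Suc l + n) f"
  have "det ?A = (\<Sum>i<Suc l + n. ?A $$ (i, 0) * cofactor ?A i 0)"
    by (rule laplace_expansion_column) auto
  also have "\<dots> = (\<Sum>i<Suc l + n. if i = 0 then cofactor ?A 0 0 else 0)"
    by (intro sum.cong refl) (auto simp: Suc.prems)
  also have "\<dots> = det (mat_delete ?A 0 0)" by (simp add: cofactor_def)
  also have "mat_delete ?A 0 0 = mat (l + n) (l + n) (\<lambda>(i, j). f (Suc i, Suc j))"
    by (rule eq_matI) (auto simp: mat_delete_def)
  also have "det \<dots> = det (mat n n (\<lambda>(i, j). f (Suc l + i, Suc l + j)))"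
    using Suc.IH[of "\<lambda>(i, j). f (Suc i, Suc j)"] Suc.prems by simp
  finally show ?case .
qed simp

lemma det_identity_right_block:
  fixes f :: "nat \<times> nat \<Rightarrow> 'a::comm_ring_1"
  assumes "\<And>i j. i < l + n \<Longrightarrow> l \<le> j \<Longrightarrow> j < l + n \<Longrightarrow> f (i, j) = (if i = j then 1 else 0)"
  shows "det (mat (l + n) (l + n) f) = det (mat l l f)"
  using assms
proof (induction n)
  case (Suc n)
  let ?k = "l + n"
  let ?A = "mat (Suc ?k) (Suc ?k) f"
  have "det ?A = (\<Sum>i<Suc ?k. ?A $$ (i, ?k) * cofactor ?A i ?k)"
    by (rule laplace_expansion_column) auto
  also have "\<dots> = (\<Sum>i<Suc ?k. if i = ?k then cofactor ?A ?k ?k else 0)"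
    by (intro sum.cong refl) (auto simp: Suc.prems)
  also have "\<dots> = det (mat_delete ?A ?k ?k)" by (simp add: cofactor_def)
  also have "mat_delete ?A ?k ?k = mat ?k ?k f"
    by (rule eq_matI) (auto simp: mat_delete_def)
  also have "det \<dots> = det (mat l l f)"
    by (rule Suc.IH) (use Suc.prems in auto)
  finally show ?case by simp
qed simp

definition perm_mat :: "nat \<Rightarrow> (nat \<Rightarrow> nat) \<Rightarrow> 'a::comm_ring_1 mat" where
  "perm_mat N \<pi> = mat N N (\<lambda>(i, k). if k = \<pi> i then 1 else 0)"

text \<open>Multiplying the permuted matrix by \<open>?U\<close> keeps its first l columns and turns
  the others into unit vectors, so the determinants of the product and of \<open>?U\<close> reduce
  to one block each. Writing the permutations as matrices makes their signs accessible to Laplace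
  expansion.\<close>

lemma complementary_minor:
  fixes M Q :: "nat \<Rightarrow> nat \<Rightarrow> 'a::comm_ring_1"
  assumes inv: "\<And>p s. p < l + l' \<Longrightarrow> s < l + l' \<Longrightarrow> (\<Sum>q<l + l'. M p q * Q q s) = (if p = s then 1 else 0)"
    and \<pi>: "bij_betw \<pi> {..<l + l'} {..<l + l'}" and \<pi>': "bij_betw \<pi>' {..<l + l'} {..<l + l'}"
  shows "det (mat l l (\<lambda>(i, j). M (\<pi> i) (\<pi>' j))) =
    det (perm_mat (l + l') \<pi>) * det (mat (l + l') (l + l') (\<lambda>(p, q). M p q)) * det (perm_mat (l + l') \<pi>') *
    det (mat l' l' (\<lambda>(i, j). Q (\<pi>' (l + i)) (\<pi> (l + j))))"
proof -
  let ?N = "l + l'"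
  have r: "\<pi> i < ?N" "\<pi>' i < ?N" if "i < ?N" for i
    using \<pi> \<pi>' that by (auto dest: bij_betwE)
  let ?M' = "mat ?N ?N (\<lambda>(i, j). M (\<pi> i) (\<pi>' j))"
  let ?M = "mat ?N ?N (\<lambda>(p, q). M p q)"
  let ?U = "mat ?N ?N (\<lambda>(i, j). if j < l then (if i = j then 1 else 0) else Q (\<pi>' i) (\<pi> j))"
  have M': "?M' = perm_mat ?N \<pi> * ?M * transpose_mat (perm_mat ?N \<pi>')"
  proof (rule eq_matI)
    fix i j assume "i < dim_row (perm_mat ?N \<pi> * ?M * transpose_mat (perm_mat ?N \<pi>'))"
      and "j < dim_col (perm_mat ?N \<pi> * ?M * transpose_mat (perm_mat ?N \<pi>'))"
    then have ij: "i < ?N" "j < ?N" by (auto simp: perm_mat_def)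
    have 1: "perm_mat ?N \<pi> * ?M = mat ?N ?N (\<lambda>(i, q). M (\<pi> i) q)"
      unfolding perm_mat_def mat_mult_fun
      by (rule eq_matI) (use r in \<open>auto simp: if_distrib[of "\<lambda>x. x * _"] sum.delta cong: if_cong\<close>)
    have 2: "transpose_mat (perm_mat ?N \<pi>') = (mat ?N ?N (\<lambda>(q, j). if q = \<pi>' j then 1 else 0) :: 'a mat)"
      by (rule eq_matI) (auto simp: perm_mat_def)
    show "?M' $$ (i, j) = (perm_mat ?N \<pi> * ?M * transpose_mat (perm_mat ?N \<pi>')) $$ (i, j)"
      unfolding 1 2 mat_mult_fun using ij r
      by (auto simp: if_distrib[of "\<lambda>x. _ * x"] sum.delta cong: if_cong)
  qed (auto simp: perm_mat_def)
  have dM': "det ?M' = det (perm_mat ?N \<pi>) * det ?M * det (perm_mat ?N \<pi>')"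
    unfolding M' by (simp add: det_mult[of _ ?N] mult_carrier_mat[of _ ?N ?N _ ?N] det_transpose[of _ ?N] perm_mat_def)
  have prod: "(\<Sum>k<?N. M (\<pi> i) (\<pi>' k) * Q (\<pi>' k) (\<pi> j)) = (if i = j then 1 else 0)" if "i < ?N" "j < ?N" for i j
  proof -
    have "(\<Sum>k<?N. M (\<pi> i) (\<pi>' k) * Q (\<pi>' k) (\<pi> j)) = (\<Sum>q<?N. M (\<pi> i) q * Q q (\<pi> j))"
      by (rule sum.reindex_bij_betw[OF \<pi>'])
    also have "\<dots> = (if \<pi> i = \<pi> j then 1 else 0)" using that r by (intro inv)
    also have "\<pi> i = \<pi> j \<longleftrightarrow> i = j" using \<pi> that by (auto simp: bij_betw_def inj_on_def)
    finally show ?thesis .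
  qed
  have "det ?M' * det ?U = det (?M' * ?U)" by (simp add: det_mult[of _ ?N])
  also have "?M' * ?U = mat ?N ?N (\<lambda>(i, j). if j < l then M (\<pi> i) (\<pi>' j) else (if i = j then 1 else 0))"
    unfolding mat_mult_fun
    by (rule eq_matI) (auto simp: prod if_distrib[of "\<lambda>x. _ * x"] sum.delta cong: if_cong)
  also have "det \<dots> = det (mat l l (\<lambda>(i, j). if j < l then M (\<pi> i) (\<pi>' j) else (if i = j then 1 else 0)))"
    by (rule det_identity_right_block) auto
  also have "mat l l (\<lambda>(i, j). if j < l then M (\<pi> i) (\<pi>' j) else (if i = j then 1 else 0)) = mat l l (\<lambda>(i, j). M (\<pi> i) (\<pi>' j))"
    by (rule eq_matI) auto
  finally have "det (mat l l (\<lambda>(i, j). M (\<pi> i) (\<pi>' j))) = det ?M' * det ?U" by simp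
  also have "det ?U = det (mat l' l' (\<lambda>(i, j). Q (\<pi>' (l + i)) (\<pi> (l + j))))"
    by (subst det_identity_left_block) (auto intro!: arg_cong[of _ _ det] eq_matI)
  finally show ?thesis by (simp add: dM')
qed

text \<open>Over a commutative ring A B = 1 makes det A a unit with inverse det B, and the adjugate
  of A is det A times B.\<close>

lemma mat_right_inverse:
  fixes A B :: "'a::comm_ring_1 mat"
  assumes A: "A \<in> carrier_mat n n" and B: "B \<in> carrier_mat n n" and AB: "A * B = 1\<^sub>m n"
  shows "B * A = 1\<^sub>m n"
proof -
  have d: "det A * det B = 1"
    using det_mult[OF A B] AB by simp
  note adj = adj_mat[OF A]
  have "adj_mat A * (A * B) = (adj_mat A * A) * B"
    using adj(1) A B by simp
  then have "adj_mat A = det A \<cdot>\<^sub>m B"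
    using adj A B by (simp add: AB mult_smult_assoc_mat[of "1\<^sub>m n" n n])
  then have "det A \<cdot>\<^sub>m (B * A) = det A \<cdot>\<^sub>m 1\<^sub>m n"
    using adj(3) by (simp add: mult_smult_assoc_mat[OF B A])
  then have "det B \<cdot>\<^sub>m (det A \<cdot>\<^sub>m (B * A)) = det B \<cdot>\<^sub>m (det A \<cdot>\<^sub>m 1\<^sub>m n)" by simp
  moreover have "det B \<cdot>\<^sub>m (det A \<cdot>\<^sub>m C) = C" if "C \<in> carrier_mat n n" for C
  proof (rule eq_matI)
    fix i j assume "i < dim_row C" "j < dim_col C"
    then show "(det B \<cdot>\<^sub>m (det A \<cdot>\<^sub>m C)) $$ (i, j) = C $$ (i, j)"
      using d by (simp add: mult.assoc[symmetric] mult.commute[of "det B"])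
  qed auto
  ultimately show ?thesis using A B by simp
qed

lemma det_scale:
  fixes g :: "nat \<Rightarrow> nat \<Rightarrow> 'a::comm_ring_1"
  shows "det (mat n n (\<lambda>(i, j). a i * b j * g i j)) = (\<Prod>i<n. a i) * (\<Prod>j<n. b j) * det (mat n n (\<lambda>(i, j). g i j))"
proof -
  have d: "det (mat n n (\<lambda>(i, j). if i = j then c i else 0)) = (\<Prod>i<n. c i)" for c :: "nat \<Rightarrow> 'a"
    by (subst det_upper_triangular[of _ n]) (auto simp: upper_triangular_def prod_list_diag_prod atLeast0LessThan)
  have "mat n n (\<lambda>(i, j). a i * b j * g i j) =
    mat n n (\<lambda>(i, j). if i = j then a i else 0) * mat n n (\<lambda>(i, j). g i j) * mat n n (\<lambda>(i, j). if i = j then b i else 0)"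
    unfolding mat_mult_fun
    by (rule eq_matI) (auto simp: if_distrib[of "\<lambda>x. x * _"] if_distrib[of "\<lambda>x. _ * x"] sum.delta sum.delta' mult_ac cong: if_cong)
  then show ?thesis
    by (simp only: det_mult[of _ n] mult_carrier_mat[of _ n n _ n] mat_carrier d) (simp add: mult_ac)
qed

subsection \<open>Conjugate partitions and lattice paths\<close>

text \<open>Conjugate shapes inside a fixed box, with zero rows and columns allowed: the box
  determines the sizes of the determinants. Functions instead of partitions allow the first row to
  be removed by a shift of the argument.\<close>

definition conjug :: "nat \<Rightarrow> nat \<Rightarrow> (nat \<Rightarrow> nat) \<Rightarrow> (nat \<Rightarrow> nat) \<Rightarrow> bool" where
  "conjug l l' f c \<longleftrightarrow> (\<forall>i\<in>{1..l}. f i \<le> l') \<and> (\<forall>j\<in>{1..l'}. c j \<le> l) \<and>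
     (\<forall>i\<in>{1..l}. \<forall>j\<in>{1..l'}. j \<le> f i \<longleftrightarrow> i \<le> c j)"

lemma conjugD:
  assumes "conjug l l' f c"
  shows "1 \<le> i \<Longrightarrow> i \<le> l \<Longrightarrow> f i \<le> l'" "1 \<le> j \<Longrightarrow> j \<le> l' \<Longrightarrow> c j \<le> l"
    "1 \<le> i \<Longrightarrow> i \<le> l \<Longrightarrow> 1 \<le> j \<Longrightarrow> j \<le> l' \<Longrightarrow> j \<le> f i \<longleftrightarrow> i \<le> c j"
  using assms by (auto simp: conjug_def)

lemma conjug_antimono:
  assumes c: "conjug l l' f c"
  shows "1 \<le> i \<Longrightarrow> i \<le> i' \<Longrightarrow> i' \<le> l \<Longrightarrow> f i' \<le> f i" "1 \<le> j \<Longrightarrow> j \<le> j' \<Longrightarrow> j' \<le> l' \<Longrightarrow> c j' \<le> c j"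
proof -
  assume i: "1 \<le> i" "i \<le> i'" "i' \<le> l"
  show "f i' \<le> f i"
  proof (cases "f i' = 0")
    case False
    then have "i' \<le> c (f i')" using conjugD(1)[OF c, of i'] conjugD(3)[OF c, of i' "f i'"] i by simp
    then show ?thesis using conjugD(3)[OF c, of i "f i'"] conjugD(1)[OF c, of i'] i False by auto
  qed simp
next
  assume j: "1 \<le> j" "j \<le> j'" "j' \<le> l'"
  show "c j' \<le> c j"
  proof (cases "c j' = 0")
    case False
    then have "j' \<le> f (c j')" using conjugD(2)[OF c, of j'] conjugD(3)[OF c, of "c j'" j'] j by simp
    then show ?thesis using conjugD(3)[OF c, of "c j'" j] conjugD(2)[OF c, of j'] j False by auto
  qed simp
qed

text \<open>Number the steps of the boundary of \<open>f\<close> from the lower left to the upper right corner of the \<open>l \<times> l'\<close>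
  rectangle, starting with \<open>0\<close>. Then \<open>posn\<close> lists the vertical steps (for \<open>i < l\<close>) and the horizontal ones, and
  \<open>(prow l f p, pcol l f p)\<close> is the point before step \<open>p\<close>.\<close>

definition posn :: "nat \<Rightarrow> (nat \<Rightarrow> nat) \<Rightarrow> (nat \<Rightarrow> nat) \<Rightarrow> nat \<Rightarrow> nat" where
  "posn l f c i = (if i < l then f (Suc i) + l - Suc i else i - c (Suc (i - l)))"

lemma posn_left: "i < l \<Longrightarrow> int (posn l f c i) = int (f (Suc i)) + int l - int (Suc i)"
  by (simp add: posn_def of_nat_diff)

lemma posn_right: "conjug l l' f c \<Longrightarrow> j < l' \<Longrightarrow> int (posn l f c (l + j)) = int l + int j - int (c (Suc j))"
  using conjugD(2)[of l l' f c "Suc j"] by (simp add: posn_def of_nat_diff)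

text \<open>The numbers f_i + l - i and l + j - 1 - c_j, for i in 1..l and j in 1..l', are
  complementary. A coincidence would mean f_i + c_j = i + j - 1, against j \<le> f_i
  \<longleftrightarrow> i \<le> c_j.\<close>

lemma posn_bij:
  assumes c: "conjug l l' f c"
  shows "bij_betw (posn l f c) {..<l + l'} {..<l + l'}"
proof -
  have range: "posn l f c i < l + l'" if "i < l + l'" for i
    using that conjugD(1)[OF c, of "Suc i"] by (auto simp: posn_def)
  have ne: "posn l f c i \<noteq> posn l f c (l + j)" if "i < l" "j < l'" for i j
  proof -
    have "int (f (Suc i)) + int l - int (Suc i) \<noteq> int l + int j - int (c (Suc j))"
      using conjugD(3)[OF c, of "Suc i" "Suc j"] that by (cases "Suc j \<le> f (Suc i)") auto
    then show ?thesis using posn_left[of i l f c] posn_right[OF c that(2)] that by linarith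
  qed
  have lt: "posn l f c i' < posn l f c i" if "i < i'" "i' < l" for i i'
    using conjug_antimono(1)[OF c, of "Suc i" "Suc i'"] that posn_left[of i l f c] posn_left[of i' l f c] by simp
  have rt: "posn l f c (l + j) < posn l f c (l + j')" if "j < j'" "j' < l'" for j j'
    using conjug_antimono(2)[OF c, of "Suc j" "Suc j'"] that posn_right[OF c, of j] posn_right[OF c, of j'] by simp
  have "inj_on (posn l f c) {..<l + l'}"
  proof (rule inj_onI)
    fix x y assume xy: "x \<in> {..<l + l'}" "y \<in> {..<l + l'}" and eq: "posn l f c x = posn l f c y"
    consider "x < l" "y < l" | "x < l" "l \<le> y" | "l \<le> x" "y < l" | "l \<le> x" "l \<le> y" by linarith
    then show "x = y"
    proof cases
      case 1 then show ?thesis using lt[of x y] lt[of y x] eq by (metis less_irrefl linorder_neqE_nat)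
    next
      case 2 then show ?thesis using ne[of x "y - l"] eq xy by (auto simp: less_diff_conv2)
    next
      case 3 then show ?thesis using ne[of y "x - l"] eq xy by (auto simp: less_diff_conv2)
    next
      case 4
      then show ?thesis using rt[of "x - l" "y - l"] rt[of "y - l" "x - l"] eq xy
        by (cases x y rule: linorder_cases) (auto simp: less_diff_conv2)
    qed
  qed
  then show ?thesis
    unfolding bij_betw_def
    by (metis range endo_inj_surj finite_lessThan image_subsetI lessThan_iff)
qed

text \<open>Expansion along row 0 removes the first row of the shape. The truncated subtraction in
  \<open>?c\<close> leaves empty columns empty; these are the columns whose step numbers exceed
  \<open>?k\<close> and drop by one when column \<open>?k\<close> of the matrix is deleted.\<close>

lemma posn_sign:
  "conjug l l' f c \<Longrightarrow> det (perm_mat (l + l') (posn l f c)) = ((-1) ^ (\<Sum>i=1..l. f i + l - i) :: 'a::comm_ring_1)"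
proof (induction l arbitrary: f c)
  case 0
  then have "posn 0 f c i = i" if "i < l'" for i
    using that conjugD(2)[OF 0, of "Suc i"] by (simp add: posn_def)
  then have "perm_mat l' (posn 0 f c) = (1\<^sub>m l' :: 'a mat)"
    by (intro eq_matI) (auto simp: perm_mat_def)
  then show ?case by simp
next
  case (Suc l)
  let ?N = "l + l'" and ?f = "\<lambda>i. f (Suc i)" and ?c = "\<lambda>j. c j - 1"
  let ?k = "f 1 + l"
  let ?A = "perm_mat (Suc ?N) (posn (Suc l) f c) :: 'a mat"
  have c': "conjug l l' ?f ?c"
    using Suc.prems unfolding conjug_def by (auto simp: le_diff_conv)
  have k: "?k < Suc ?N" using conjugD(1)[OF Suc.prems, of 1] by simp
  have p0: "posn (Suc l) f c 0 = ?k" by (simp add: posn_def)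
  have del: "mat_delete ?A 0 ?k = perm_mat ?N (posn l ?f ?c)"
  proof (rule eq_matI)
    fix i j assume "i < dim_row (perm_mat ?N (posn l ?f ?c) :: 'a mat)" "j < dim_col (perm_mat ?N (posn l ?f ?c) :: 'a mat)"
    then have ij: "i < ?N" "j < ?N" by (auto simp: perm_mat_def)
    have "(if j < ?k then j else Suc j) = posn (Suc l) f c (Suc i) \<longleftrightarrow> j = posn l ?f ?c i"
    proof (cases "i < l")
      case True
      have "f (Suc (Suc i)) \<le> f 1" using conjug_antimono(1)[OF Suc.prems, of 1 "Suc (Suc i)"] True by simp
      then show ?thesis using True by (auto simp: posn_def)
    next
      case False
      define j' where "j' = Suc (i - l)"
      have j': "1 \<le> j'" "j' \<le> l'" "i = l + j' - 1" using False ij by (auto simp: j'_def)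
      have p1: "posn (Suc l) f c (Suc i) = Suc i - c j'" "posn l ?f ?c i = i - (c j' - 1)"
        using False by (auto simp: posn_def j'_def)
      have cj: "c j' \<le> Suc l" using conjugD(2)[OF Suc.prems] j' by simp
      have iff: "j' \<le> f 1 \<longleftrightarrow> 1 \<le> c j'" using conjugD(3)[OF Suc.prems, of 1 j'] j' by simp
      show ?thesis unfolding p1 using iff cj j' by (cases "1 \<le> c j'") auto
    qed
    then show "mat_delete ?A 0 ?k $$ (i, j) = perm_mat ?N (posn l ?f ?c) $$ (i, j)"
      using ij by (simp add: mat_delete_def perm_mat_def)
  qed (auto simp: perm_mat_def mat_delete_def)
  have "det ?A = (\<Sum>j<Suc ?N. ?A $$ (0, j) * cofactor ?A 0 j)"
    by (rule laplace_expansion_row) (auto simp: perm_mat_def)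
  also have "\<dots> = (\<Sum>j<Suc ?N. if j = ?k then cofactor ?A 0 ?k else 0)"
    by (intro sum.cong refl) (auto simp: perm_mat_def p0)
  also have "\<dots> = (-1) ^ ?k * det (mat_delete ?A 0 ?k)"
    using k by (simp add: cofactor_def)
  also have "\<dots> = (-1) ^ (?k + (\<Sum>i=1..l. ?f i + l - i))"
    unfolding del Suc.IH[OF c'] by (simp add: power_add)
  also have "?k + (\<Sum>i=1..l. ?f i + l - i) = (\<Sum>i=1..Suc l. f i + Suc l - i)"
  proof -
    have "(\<Sum>i=1..Suc l. f i + Suc l - i) = f 1 + l + (\<Sum>i=Suc 1..Suc l. f i + Suc l - i)"
      by (subst sum.atLeast_Suc_atMost) auto
    also have "(\<Sum>i=Suc 1..Suc l. f i + Suc l - i) = (\<Sum>i=1..l. ?f i + l - i)"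
      unfolding sum.shift_bounds_cl_Suc_ivl by simp
    finally show ?thesis by simp
  qed
  finally show ?case by simp
qed

lemma conjug_sum:
  assumes c: "conjug l l' f c" shows "(\<Sum>i=1..l. f i) = (\<Sum>j=1..l'. c j)"
proof -
  have "(\<Sum>i=1..l. f i) = (\<Sum>i=1..l. \<Sum>j=1..l'. if j \<le> f i then 1 else 0)"
  proof (intro sum.cong refl)
    fix i assume "i \<in> {1..l}"
    then have "f i \<le> l'" using conjugD(1)[OF c] by simp
    then have "{1..l'} \<inter> {j. j \<le> f i} = {1..f i}" by auto
    then show "f i = (\<Sum>j=1..l'. if j \<le> f i then 1 else 0)" by (simp add: sum.If_cases)
  qed
  also have "\<dots> = (\<Sum>j=1..l'. \<Sum>i=1..l. if i \<le> c j then 1 else 0)"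
    by (subst sum.swap) (intro sum.cong refl, use conjugD(3)[OF c] in auto)
  also have "\<dots> = (\<Sum>j=1..l'. c j)"
  proof (intro sum.cong refl)
    fix j assume "j \<in> {1..l'}"
    then have "c j \<le> l" using conjugD(2)[OF c] by simp
    then have "{1..l} \<inter> {i. i \<le> c j} = {1..c j}" by auto
    then show "(\<Sum>i=1..l. if i \<le> c j then 1 else 0) = c j" by (simp add: sum.If_cases)
  qed
  finally show ?thesis .
qed

text \<open>Row i is crossed by the vertical step of number f_i + l - i. Counted are the rows still
  to be crossed before step p is made.\<close>

definition prow :: "nat \<Rightarrow> (nat \<Rightarrow> nat) \<Rightarrow> nat \<Rightarrow> nat" where
  "prow l f p = card {i \<in> {1..l}. p + i \<le> f i + l}"

definition pcol :: "nat \<Rightarrow> (nat \<Rightarrow> nat) \<Rightarrow> nat \<Rightarrow> int" where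
  "pcol l f p = int p + int (prow l f p) - int l"

text \<open>As \<open>f\<close> decreases, the set counted by \<open>prow\<close> is an initial
  segment of the rows.\<close>

lemma path_left:
  assumes c: "conjug l l' f c" and i: "i < l"
  defines "p \<equiv> posn l f c i"
  shows "prow l f p = Suc i" "prow l f (Suc p) = i" "pcol l f p = int (f (Suc i))" "pcol l f (Suc p) = int (f (Suc i))"
proof -
  have p: "p + Suc i = f (Suc i) + l" using i by (simp add: p_def posn_def)
  have f: "k \<le> Suc i \<Longrightarrow> f (Suc i) \<le> f k" "Suc i \<le> k \<Longrightarrow> f k \<le> f (Suc i)" if "1 \<le> k" "k \<le> l" for k
    using conjug_antimono(1)[OF c, of k "Suc i"] conjug_antimono(1)[OF c, of "Suc i" k] that i by auto
  have "{k \<in> {1..l}. p + k \<le> f k + l} = {1..Suc i}"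
  proof (intro subset_antisym subsetI)
    fix k assume "k \<in> {k \<in> {1..l}. p + k \<le> f k + l}"
    then have k: "1 \<le> k" "k \<le> l" "p + k \<le> f k + l" by auto
    have "k \<le> Suc i" using k p f(2)[OF k(1,2)] by (cases "k \<le> Suc i") auto
    with k show "k \<in> {1..Suc i}" by simp
  next
    fix k assume "k \<in> {1..Suc i}"
    then have k: "1 \<le> k" "k \<le> l" "k \<le> Suc i" using i by auto
    with f(1)[OF k(1,2)] p show "k \<in> {k \<in> {1..l}. p + k \<le> f k + l}" by simp
  qed
  then show 1: "prow l f p = Suc i" by (simp add: prow_def)
  have "{k \<in> {1..l}. Suc p + k \<le> f k + l} = {1..i}"
  proof (intro subset_antisym subsetI)
    fix k assume "k \<in> {k \<in> {1..l}. Suc p + k \<le> f k + l}"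
    then have k: "1 \<le> k" "k \<le> l" "Suc p + k \<le> f k + l" by auto
    have "k \<le> i" using k p f(2)[OF k(1,2)] by (cases "k \<le> i") auto
    with k show "k \<in> {1..i}" by simp
  next
    fix k assume "k \<in> {1..i}"
    then have k: "1 \<le> k" "k \<le> l" "k \<le> i" using i by auto
    with f(1)[OF k(1,2)] p show "k \<in> {k \<in> {1..l}. Suc p + k \<le> f k + l}" by simp
  qed
  then show 2: "prow l f (Suc p) = i" by (simp add: prow_def)
  show "pcol l f p = int (f (Suc i))" "pcol l f (Suc p) = int (f (Suc i))"
    using p by (simp_all add: pcol_def 1 2)
qed

lemma path_right:
  assumes c: "conjug l l' f c" and j: "j < l'"
  defines "p \<equiv> posn l f c (l + j)"
  shows "prow l f p = c (Suc j)" "prow l f (Suc p) = c (Suc j)" "pcol l f p = int j" "pcol l f (Suc p) = int (Suc j)"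
proof -
  have cl: "c (Suc j) \<le> l" using conjugD(2)[OF c] j by simp
  have p: "p + c (Suc j) = l + j" using cl by (simp add: p_def posn_def)
  have f: "k \<le> c (Suc j) \<longleftrightarrow> Suc j \<le> f k" if "1 \<le> k" "k \<le> l" for k
    using conjugD(3)[OF c, of k "Suc j"] that j by auto
  have "{k \<in> {1..l}. p + k \<le> f k + l} = {1..c (Suc j)}"
  proof (intro subset_antisym subsetI)
    fix k assume "k \<in> {k \<in> {1..l}. p + k \<le> f k + l}"
    then have k: "1 \<le> k" "k \<le> l" "p + k \<le> f k + l" by auto
    have "k \<le> c (Suc j)" using k p f[OF k(1,2)] by (cases "k \<le> c (Suc j)") auto
    with k show "k \<in> {1..c (Suc j)}" by simp
  next
    fix k assume "k \<in> {1..c (Suc j)}"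
    then have k: "1 \<le> k" "k \<le> l" "k \<le> c (Suc j)" using cl by auto
    with f[OF k(1,2)] p show "k \<in> {k \<in> {1..l}. p + k \<le> f k + l}" by simp
  qed
  then show 1: "prow l f p = c (Suc j)" by (simp add: prow_def)
  have "{k \<in> {1..l}. Suc p + k \<le> f k + l} = {1..c (Suc j)}"
  proof (intro subset_antisym subsetI)
    fix k assume "k \<in> {k \<in> {1..l}. Suc p + k \<le> f k + l}"
    then have k: "1 \<le> k" "k \<le> l" "Suc p + k \<le> f k + l" by auto
    have "k \<le> c (Suc j)" using k p f[OF k(1,2)] by (cases "k \<le> c (Suc j)") auto
    with k show "k \<in> {1..c (Suc j)}" by simp
  next
    fix k assume "k \<in> {1..c (Suc j)}"
    then have k: "1 \<le> k" "k \<le> l" "k \<le> c (Suc j)" using cl by auto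
    with f[OF k(1,2)] p show "k \<in> {k \<in> {1..l}. Suc p + k \<le> f k + l}" by simp
  qed
  then show 2: "prow l f (Suc p) = c (Suc j)" by (simp add: prow_def)
  show "pcol l f p = int j" "pcol l f (Suc p) = int (Suc j)"
    using p by (simp_all add: pcol_def 1 2)
qed

lemma path_step:
  assumes c: "conjug l l' f c" and p: "p < l + l'"
  shows "(\<exists>i. prow l f p = Suc i \<and> prow l f (Suc p) = i \<and> pcol l f (Suc p) = pcol l f p \<and> 0 \<le> pcol l f p) \<or>
    (\<exists>j. prow l f (Suc p) = prow l f p \<and> pcol l f p = int j \<and> pcol l f (Suc p) = int (Suc j))"
proof -
  obtain i where i: "i < l + l'" "p = posn l f c i"
    using posn_bij[OF c] p by (auto simp: bij_betw_def)
  show ?thesis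
  proof (cases "i < l")
    case True
    then show ?thesis using path_left[OF c True] i by auto
  next
    case False
    then obtain j where j: "i = l + j" "j < l'" using i by (metis add_less_cancel_left le_add_diff_inverse not_less)
    then show ?thesis using path_right[OF c j(2)] i by auto
  qed
qed

lemma path_ends:
  assumes c: "conjug l l' f c"
  shows "prow l f 0 = l" "pcol l f 0 = 0" "prow l f (l + l') = 0" "pcol l f (l + l') = int l'"
proof -
  have "{i \<in> {1..l}. 0 + i \<le> f i + l} = {1..l}" by auto
  then show 1: "prow l f 0 = l" by (simp add: prow_def)
  have "{i \<in> {1..l}. l + l' + i \<le> f i + l} = {}" using conjugD(1)[OF c] by fastforce
  then show 2: "prow l f (l + l') = 0" by (simp add: prow_def)
  show "pcol l f 0 = 0" "pcol l f (l + l') = int l'" by (simp_all add: pcol_def 1 2)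
qed

lemma conjug_part:
  assumes lam: "is_partition lam" and len: "length lam \<le> l" and l': "part lam 1 \<le> l'"
  shows "conjug l l' (part lam) (conj_part lam)"
proof -
  have anti: "part lam k \<le> part lam i" if "1 \<le> i" "i \<le> k" for i k
  proof (cases "i = k \<or> length lam < k")
    case False
    with that have "i - 1 < k - 1" "k - 1 < length lam" by auto
    moreover have "sorted_wrt (\<ge>) lam" using lam by (simp add: is_partition_def)
    ultimately have "lam ! (k - 1) \<le> lam ! (i - 1)" by (metis sorted_wrt_nth_less)
    then show ?thesis using that False by (simp add: part_def)
  qed (auto simp: part_zero)
  let ?S = "\<lambda>j. {i. 1 \<le> i \<and> i \<le> length lam \<and> j \<le> part lam i}"
  have fin: "finite (?S j)" for j by (rule finite_subset[of _ "{1..length lam}"]) auto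
  have "part lam i \<le> l'" if "1 \<le> i" for i
    using anti[of 1 i] that l' by simp
  moreover have "conj_part lam j \<le> l" for j
  proof -
    have "card (?S j) \<le> card {1..length lam}" by (rule card_mono) auto
    then show ?thesis using len by (simp add: conj_part_def)
  qed
  moreover have "j \<le> part lam i \<longleftrightarrow> i \<le> conj_part lam j" if "1 \<le> i" "1 \<le> j" for i j
  proof
    assume j: "j \<le> part lam i"
    with that have "i \<le> length lam" using part_zero[of lam i] by (cases "length lam < i") auto
    then have "{1..i} \<subseteq> ?S j" using anti[of _ i] j by (auto intro: order.trans)
    from card_mono[OF fin this] show "i \<le> conj_part lam j" by (simp add: conj_part_def)
  next
    assume i: "i \<le> conj_part lam j"
    show "j \<le> part lam i"
    proof (rule ccontr)
      assume "\<not> j \<le> part lam i"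
      then have "?S j \<subseteq> {1..<i}" using anti[OF that(1)] by (fastforce simp: not_le)
      from card_mono[OF _ this] show False using i that by (simp add: conj_part_def)
    qed
  qed
  ultimately show ?thesis by (simp add: conjug_def)
qed

subsection \<open>Duality of the determinants\<close>

text \<open>The contribution of l is the same in both permutation signs, and that of l' in both
  products, so they cancel. What remains is the number of boxes of either shape, and each occurs
  twice.\<close>

lemma conjug_sign:
  assumes "conjug l l' f c" "conjug l l' g d"
  shows "det (perm_mat (l + l') (posn l f c)) * det (perm_mat (l + l') (posn l g d)) *
    ((\<Prod>i<l'. sgn_pow (int (c (Suc i)) - int (Suc i))) * (\<Prod>i<l'. sgn_pow (int (d (Suc i)) - int (Suc i)))) = (1 :: 'a::comm_ring_1)"
proof -
  have 1: "det (perm_mat (l + l') (posn l f c)) = ((-1) ^ ((\<Sum>j=1..l'. c j) + (\<Sum>i=1..l. l - i)) :: 'a)" if c: "conjug l l' f c" for f c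
  proof -
    have "(\<Sum>i=1..l. f i + l - i) = (\<Sum>i=1..l. f i + (l - i))" by (intro sum.cong) auto
    then show ?thesis by (simp only: posn_sign[OF c] sum.distrib conjug_sum[OF c])
  qed
  have 2: "(\<Prod>i<k. sgn_pow (int (c (Suc i)) - int (Suc i))) = ((-1) ^ ((\<Sum>j=1..k. c j) + (\<Sum>j=1..k. j)) :: 'a)" for c k
    by (induction k) (simp_all add: sgn_pow_diff sgn_pow_nat power_add mult_ac del: of_nat_Suc)
  have 3: "(-1) ^ (a + b) * (-1) ^ (a' + b) * ((-1) ^ (a + e) * (-1) ^ (a' + e)) = (1 :: 'a)" for a b a' e :: nat
    by (auto simp: minus_one_power_iff)
  show ?thesis unfolding 1[OF assms(1)] 1[OF assms(2)] 2 by (rule 3)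
qed

text \<open>The complementary minor of the inverse comes with rows and columns exchanged, hence the
  transposition. The two permutation signs are spread over the entries as row and column
  factors.\<close>

lemma det_dual:
  fixes M Q :: "nat \<Rightarrow> nat \<Rightarrow> 'a::comm_ring_1"
  assumes inv: "\<And>p s. p < l + l' \<Longrightarrow> s < l + l' \<Longrightarrow> (\<Sum>q<l + l'. M p q * Q q s) = (if p = s then 1 else 0)"
    and c: "conjug l l' f c" and d: "conjug l l' g d"
  shows "det_from1 l (\<lambda>i j. M (posn l f c (i - 1)) (posn l g d (j - 1))) =
    det (mat (l + l') (l + l') (\<lambda>(p, q). M p q)) *
    det_from1 l' (\<lambda>i j. sgn_pow (int (c i) - int (d j) - int i + int j) * Q (posn l g d (l + (j - 1))) (posn l f c (l + (i - 1))))"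
proof -
  let ?Q = "\<lambda>i j. Q (posn l g d (l + j)) (posn l f c (l + i))"
  let ?a = "\<lambda>c i. sgn_pow (int (c (Suc i)) - int (Suc i)) :: 'a"
  have t: "det (mat l' l' (\<lambda>(i, j). ?Q j i)) = det (mat l' l' (\<lambda>(i, j). ?Q i j))"
  proof -
    have "mat l' l' (\<lambda>(i, j). ?Q j i) = transpose_mat (mat l' l' (\<lambda>(i, j). ?Q i j))"
      by (rule eq_matI) auto
    then show ?thesis by (simp add: det_transpose[of _ l'])
  qed
  have "sgn_pow (int (c (Suc i)) - int (d (Suc j)) - int (Suc i) + int (Suc j)) = ?a c i * ?a d j" for i j
    by (simp only: sgn_pow_add sgn_pow_diff mult_ac)
  then have e: "det_from1 l' (\<lambda>i j. sgn_pow (int (c i) - int (d j) - int i + int j) * ?Q (i - 1) (j - 1)) =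
      (\<Prod>i<l'. ?a c i) * (\<Prod>i<l'. ?a d i) * det (mat l' l' (\<lambda>(i, j). ?Q i j))"
    unfolding det_from1_def by (simp only: det_scale diff_Suc_1)
  have "det_from1 l (\<lambda>i j. M (posn l f c (i - 1)) (posn l g d (j - 1))) =
     det (perm_mat (l + l') (posn l f c)) * det (mat (l + l') (l + l') (\<lambda>(p, q). M p q)) * det (perm_mat (l + l') (posn l g d)) *
     det (mat l' l' (\<lambda>(i, j). ?Q i j))"
    unfolding det_from1_def diff_Suc_1
    by (simp only: complementary_minor[OF inv posn_bij[OF c] posn_bij[OF d]] t)
  also have "\<dots> = det (mat (l + l') (l + l') (\<lambda>(p, q). M p q)) * det (mat l' l' (\<lambda>(i, j). ?Q i j)) *
     (det (perm_mat (l + l') (posn l f c)) * det (perm_mat (l + l') (posn l g d)))"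
    by (simp only: mult_ac)
  also have "\<dots> = det (mat (l + l') (l + l') (\<lambda>(p, q). M p q)) * det (mat l' l' (\<lambda>(i, j). ?Q i j)) *
     ((\<Prod>i<l'. ?a c i) * (\<Prod>i<l'. ?a d i))"
  proof -
    let ?s = "det (perm_mat (l + l') (posn l f c)) * det (perm_mat (l + l') (posn l g d)) :: 'a"
    let ?t = "(\<Prod>i<l'. ?a c i) * (\<Prod>i<l'. ?a d i)"
    have "?t * ?t = 1"
    proof -
      have "(\<Prod>i<l'. ?a c i) * (\<Prod>i<l'. ?a c i) = 1" for c :: "nat \<Rightarrow> nat"
        by (simp add: sgn_pow_def flip: prod.distrib) (rule prod.neutral, simp)
      note this[of c] this[of d]
      moreover have "(x * y) * (x * y) = (x * x) * (y * y)" for x y :: 'a by (simp only: mult_ac)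
      ultimately show ?thesis by (simp only:) simp
    qed
    moreover have "?s * ?t = 1" by (rule conjug_sign[OF c d])
    moreover have "x = y" if "y * y = 1" "x * y = 1" for x y :: 'a
      using that by (metis mult.assoc mult_1_left mult_1_right)
    ultimately have "?s = ?t" by blast
    then show ?thesis by simp
  qed
  finally show ?thesis unfolding e by (simp only: mult_ac)
qed

lemma path_chain:
  fixes F :: "nat \<Rightarrow> int \<Rightarrow> 'k::comm_ring_1 alphabet"
  assumes c: "conjug l l' f c" and "\<And>r k. homog (F r k)"
    and "\<And>i k. \<exists>z. lin1 z \<and> F (Suc i) (int k) = F i (int k) + letter z"
    and "\<And>i k. \<exists>z. lin1 z \<and> F i (int k) = F i (int (Suc k)) + letter z"
  shows "chain (l + l') (\<lambda>p. F (prow l f p) (pcol l f p))"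
  unfolding chain_def
proof (intro conjI allI impI)
  fix p assume p: "p < l + l'"
  show "\<exists>z. lin1 z \<and> F (prow l f p) (pcol l f p) = F (prow l f (Suc p)) (pcol l f (Suc p)) + letter z"
    using path_step[OF c p]
  proof (elim disjE exE conjE)
    fix i assume i: "prow l f p = Suc i" "prow l f (Suc p) = i" "pcol l f (Suc p) = pcol l f p" "0 \<le> pcol l f p"
    then obtain k where "pcol l f p = int k" by (metis nonneg_int_cases)
    then show ?thesis using i assms(3) by simp
  next
    fix j assume "prow l f (Suc p) = prow l f p" "pcol l f p = int j" "pcol l f (Suc p) = int (Suc j)"
    then show ?thesis using assms(4)[of _ j] by (simp only:)
  qed
qed (rule assms(2))

lemma h_e_ominus_dual:
  fixes \<kappa> \<rho> :: "nat \<Rightarrow> 'k::field_char_0 alphabet"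
  assumes c: "conjug l l' f c" and d: "conjug l l' g d"
    and ch: "chain (l + l') \<kappa>" "chain (l + l') \<rho>" and beg: "\<kappa> 0 = B_alph (int l)" "\<rho> 0 = B_alph (int l)"
    and fin: "\<kappa> (l + l') = - A_alph (int l')" "\<rho> (l + l') = - A_alph (int l')"
  shows "C_fac l n * det_from1 l (\<lambda>i j. h_ominus (int (f i) - int (g j) - int i + int j) (xs_alph n)
        (\<kappa> (posn l g d (j - 1)) - \<rho> (Suc (posn l f c (i - 1))))) =
    C'_fac l' n * det_from1 l' (\<lambda>i j. e_ominus (int (c i) - int (d j) - int i + int j) (xs_alph n)
        (\<kappa> (Suc (posn l g d (l + (j - 1)))) - \<rho> (posn l f c (l + (i - 1)))))"
proof -
  let ?M = "\<lambda>p q. h_ominus (int p - int q) (xs_alph n) (\<kappa> q - \<rho> (Suc p))"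
  let ?Q = "\<lambda>q s. h_ominus (int q - int s) (- xs_alph n) (\<rho> s - \<kappa> (Suc q))"
  let ?D = "det (mat (l + l') (l + l') (\<lambda>(p, q). ?M p q))"
  have ends: "\<kappa> 0 = \<rho> 0" "\<kappa> (l + l') = \<rho> (l + l')" using beg fin by simp_all
  note hom = ch[THEN chain_homog]
  \<comment> \<open>The letters lost along the walk are those of B_l and A_l', and
    \<open>xprod\<close> of them is C / C'.\<close>
  have "?D * xprod n (B_alph (int l) + A_alph (int l')) = 1"
    using newton_det_xs[OF ch ends, of n] by (simp add: beg fin)
  then have D0: "?D * (C_fac l n * xprod n (A_alph (int l'))) = 1"
    by (simp only: xprod_add homog_A homog_B xprod_B)
  have D: "C_fac l n * ?D = C'_fac l' n"
  proof -
    have "C_fac l n * ?D = C_fac l n * ?D * (xprod n (A_alph (int l')) * C'_fac l' n)" by (simp only: xprod_A mult_1_right)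
    also have "\<dots> = (?D * (C_fac l n * xprod n (A_alph (int l')))) * C'_fac l' n" by (simp only: mult_ac)
    also have "\<dots> = C'_fac l' n" by (simp only: D0 mult_1_left)
    finally show ?thesis .
  qed
  have h: "det_from1 l (\<lambda>i j. h_ominus (int (f i) - int (g j) - int i + int j) (xs_alph n)
        (\<kappa> (posn l g d (j - 1)) - \<rho> (Suc (posn l f c (i - 1))))) =
      det_from1 l (\<lambda>i j. ?M (posn l f c (i - 1)) (posn l g d (j - 1)))"
    unfolding det_from1_def
    by (intro arg_cong[of _ _ det] eq_matI) (auto simp: posn_left algebra_simps)
  have idx: "int (posn l g d (l + j)) - int (posn l f c (l + i)) = int (c (Suc i)) - int (d (Suc j)) - int (Suc i) + int (Suc j)"
    if "i < l'" "j < l'" for i j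
    using that by (simp add: posn_right[OF c] posn_right[OF d])
  have e: "det_from1 l' (\<lambda>i j. e_ominus (int (c i) - int (d j) - int i + int j) (xs_alph n)
        (\<kappa> (Suc (posn l g d (l + (j - 1)))) - \<rho> (posn l f c (l + (i - 1))))) =
      det_from1 l' (\<lambda>i j. sgn_pow (int (c i) - int (d j) - int i + int j) *
        ?Q (posn l g d (l + (j - 1))) (posn l f c (l + (i - 1))))"
    unfolding det_from1_def
    by (intro arg_cong[of _ _ det] eq_matI)
       (simp_all add: e_ominus_eq hom idx)
  show ?thesis
    unfolding h e D[symmetric] mult.assoc
    by (subst det_dual[OF newton_inverse[OF ch ends homog_xs] c d]) simp_all
qed

section \<open>Duality for the unitriangular matrix of the third identity\<close>

lemma hfun_0: "homog X \<Longrightarrow> hfun 0 X = 1"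
  by (simp add: hfun_eq dpart_0_hR)

lemma hfun_convolution:
  assumes "homog U" "homog V" "p < N"
  shows "(\<Sum>q<N. hfun (int p - int q) U * hfun (int q - int s) V) = hfun (int p - int s) (U + V)"
proof (cases "s \<le> p")
  case True
  have "(\<Sum>q<N. hfun (int p - int q) U * hfun (int q - int s) V) = (\<Sum>q=s..p. hfun (int p - int q) U * hfun (int q - int s) V)"
    using assms(3) by (intro sum.mono_neutral_right) (auto simp: hfun_def)
  also have "\<dots> = (\<Sum>i=0..p - s. hfun (int i) U * hfun (int (p - s - i)) V)"
    by (rule sum.reindex_bij_witness[of _ "\<lambda>i. p - i" "\<lambda>q. p - q"])
       (use True in \<open>auto simp: of_nat_diff algebra_simps\<close>)
  also have "\<dots> = hfun (int (p - s)) (U + V)"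
    using assms by (simp add: hfun_eq hR_add dpart_mult)
  finally show ?thesis using True by (simp add: of_nat_diff)
next
  case False
  then show ?thesis by (auto simp: hfun_def intro!: sum.neutral)
qed

definition weak_chain :: "nat \<Rightarrow> (nat \<Rightarrow> 'k::comm_ring_1 alphabet) \<Rightarrow> bool" where
  "weak_chain N a \<longleftrightarrow> (\<forall>q. homog (a q)) \<and> (\<forall>q<N. a q = a (Suc q) \<or> (\<exists>z. lin1 z \<and> a q = a (Suc q) + letter z))"

lemma chain_imp_weak_chain: "chain N a \<Longrightarrow> weak_chain N a"
  by (auto simp: chain_def weak_chain_def)

lemma weak_chain_deg_le:
  assumes a: "weak_chain N a" and "s + k \<le> N"
  shows "deg_le (int k) (hR (a (s + k) - a s))"
  using assms(2)
proof (induction k)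
  case (Suc k)
  have hom: "homog (a q)" for q using a by (simp add: weak_chain_def)
  have IH: "deg_le (int k) (hR (a (s + k) - a s))" using Suc by simp
  have "a (s + k) = a (Suc (s + k)) \<or> (\<exists>z. lin1 z \<and> a (s + k) = a (Suc (s + k)) + letter z)"
    using a Suc.prems by (simp add: weak_chain_def)
  then show ?case
  proof (elim disjE exE conjE)
    assume "a (s + k) = a (Suc (s + k))"
    with IH show ?thesis by (simp add: deg_le_def)
  next
    fix z assume z: "lin1 z" "a (s + k) = a (Suc (s + k)) + letter z"
    have d: "a (s + Suc k) - a s = (a (s + k) - a s) + - letter z" using z(2) by simp
    have "homog (a (s + k) - a s)" "homog (- letter z)" using hom z(1) by simp_all
    then have "hR (a (s + Suc k) - a s) = hR (a (s + k) - a s) * (1 - z)"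
      by (simp only: d hR_add hR_uminus_letter)
    then show ?thesis using deg_le_mult[OF IH deg_le_lin1[OF z(1)]] by (simp add: add.commute)
  qed
qed (simp add: deg_le_one)

text \<open>For p > s the alphabet consists of at most p - s - 1 letters with multiplicity -1, so
  its generating function is a polynomial of degree below p - s.\<close>

lemma weak_chain_hfun:
  assumes a: "weak_chain N a" and "p < N" "s < N"
  shows "hfun (int p - int s) (a p - a (Suc s)) = (if p = s then 1 else 0)"
proof -
  have hom: "homog (a q)" for q using a by (simp add: weak_chain_def)
  consider "p < s" | "p = s" | "s < p" by linarith
  then show ?thesis
  proof cases
    case 3
    then have "deg_le (int (p - Suc s)) (hR (a p - a (Suc s)))"
      using weak_chain_deg_le[OF a, of "Suc s" "p - Suc s"] assms by simp
    then show ?thesis using 3 hom by (auto simp: hfun_eq deg_le_def of_nat_diff intro!: series_eqI)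
  next
    case 2
    then show ?thesis using hom by (simp add: hfun_0)
  qed (simp add: hfun_def)
qed

text \<open>By convolution the matrix is U Z with U_pr = h_(p-r)(a_p) and Z_rq = h_(r-q)(X -
  b_(q+1)). For each factor, one of the two products with the candidate inverse is again a
  convolution and is evaluated by \<open>weak_chain_hfun\<close>. For Z this is the left inverse,
  and \<open>mat_right_inverse\<close> supplies the other side.\<close>

lemma weak_chain_inverse:
  fixes a b :: "nat \<Rightarrow> 'k::comm_ring_1 alphabet"
  assumes a: "weak_chain N a" and b: "weak_chain N b" and X: "homog X" and p: "p < N" and s: "s < N"
  shows "(\<Sum>q<N. hfun (int p - int q) (X + a p - b (Suc q)) * hfun (int q - int s) (- X + b q - a (Suc s))) =
    (if p = s then 1 else 0)"
proof -
  have hom: "homog (a q)" "homog (b q)" for q using a b by (simp_all add: weak_chain_def)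
  let ?U = "\<lambda>p r. hfun (int p - int r) (a p)"
  let ?Z = "\<lambda>r q. hfun (int r - int q) (X - b (Suc q))"
  let ?Zi = "\<lambda>q r. hfun (int q - int r) (- X + b q)"
  let ?Ui = "\<lambda>r s. hfun (int r - int s) (- a (Suc s))"
  have 1: "hfun (int p - int q) (X + a p - b (Suc q)) = (\<Sum>r<N. ?U p r * ?Z r q)" for q
    using hfun_convolution[of "a p" "X - b (Suc q)" p N q] hom X p by (simp add: algebra_simps)
  have 2: "hfun (int q - int s) (- X + b q - a (Suc s)) = (\<Sum>r<N. ?Zi q r * ?Ui r s)" if "q < N" for q
    using hfun_convolution[of "- X + b q" "- a (Suc s)" q N s] hom X that by (simp add: algebra_simps)
  have "(\<Sum>r<N. ?Zi q r * ?Z r q') = (if q = q' then 1 else 0)" if "q < N" "q' < N" for q q'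
    using hfun_convolution[of "- X + b q" "X - b (Suc q')" q N q'] hom X that weak_chain_hfun[OF b that] by simp
  then have "mat N N (\<lambda>(q, r). ?Zi q r) * mat N N (\<lambda>(r, q). ?Z r q) = 1\<^sub>m N"
    unfolding mat_mult_fun by (intro eq_matI) auto
  then have inv: "mat N N (\<lambda>(r, q). ?Z r q) * mat N N (\<lambda>(q, r). ?Zi q r) = 1\<^sub>m N"
    by (rule mat_right_inverse[OF mat_carrier mat_carrier])
  have Z: "(\<Sum>q<N. ?Z r q * ?Zi q r') = (if r = r' then 1 else 0)" if "r < N" "r' < N" for r r'
    using arg_cong[OF inv, of "\<lambda>A. A $$ (r, r')"] that unfolding mat_mult_fun by simp
  have "(\<Sum>q<N. hfun (int p - int q) (X + a p - b (Suc q)) * hfun (int q - int s) (- X + b q - a (Suc s))) =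
    (\<Sum>q<N. \<Sum>r<N. \<Sum>r'<N. ?U p r * (?Z r q * ?Zi q r') * ?Ui r' s)"
    by (intro sum.cong refl) (simp only: 1 2 lessThan_iff sum_product mult.assoc)
  also have "\<dots> = (\<Sum>r<N. \<Sum>r'<N. \<Sum>q<N. ?U p r * (?Z r q * ?Zi q r') * ?Ui r' s)"
    by (subst sum.swap) (intro sum.cong refl sum.swap)
  also have "\<dots> = (\<Sum>r<N. \<Sum>r'<N. ?U p r * (\<Sum>q<N. ?Z r q * ?Zi q r') * ?Ui r' s)"
    by (simp add: sum_distrib_left sum_distrib_right)
  also have "\<dots> = (\<Sum>r<N. \<Sum>r'<N. ?U p r * (if r = r' then 1 else 0) * ?Ui r' s)"
    by (intro sum.cong refl) (simp only: Z lessThan_iff)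
  also have "\<dots> = (\<Sum>r<N. ?U p r * ?Ui r s)"
    by (intro sum.cong refl) (simp add: if_distrib[of "\<lambda>x. _ * x"] if_distrib[of "\<lambda>x. x * _"] cong: if_cong)
  also have "\<dots> = (if p = s then 1 else 0)"
    using hfun_convolution[of "a p" "- a (Suc s)" p N s] hom p weak_chain_hfun[OF a p s] by simp
  finally show ?thesis .
qed

text \<open>The determinant of the full matrix is 1, so no prefactor appears.\<close>

lemma h_e_dual:
  fixes a b :: "nat \<Rightarrow> 'k::comm_ring_1 alphabet"
  assumes c: "conjug l l' f c" and d: "conjug l l' g d"
    and a: "weak_chain (l + l') a" and b: "weak_chain (l + l') b" and X: "homog X"
  shows "det_from1 l (\<lambda>i j. hfun (int (f i) - int (g j) - int i + int j) (X + a (posn l f c (i - 1)) - b (Suc (posn l g d (j - 1))))) =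
    det_from1 l' (\<lambda>i j. efun (int (c i) - int (d j) - int i + int j)
      (X + a (Suc (posn l f c (l + (i - 1)))) - b (posn l g d (l + (j - 1)))))"
proof -
  have hom: "homog (a q)" "homog (b q)" for q using a b by (simp_all add: weak_chain_def)
  let ?M = "\<lambda>p q. hfun (int p - int q) (X + a p - b (Suc q))"
  let ?Q = "\<lambda>q s. hfun (int q - int s) (- X + b q - a (Suc s))"
  have "det (mat (l + l') (l + l') (\<lambda>(p, q). ?M p q)) = prod_list (diag_mat (mat (l + l') (l + l') (\<lambda>(p, q). ?M p q)))"
    by (rule det_lower_triangular[of "l + l'"]) (auto simp: hfun_def)
  also have "\<dots> = 1"
    by (auto simp: prod_list_diag_prod hfun_0 hom X intro!: prod.neutral)
  finally have D: "det (mat (l + l') (l + l') (\<lambda>(p, q). ?M p q)) = 1" .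
  have h: "det_from1 l (\<lambda>i j. hfun (int (f i) - int (g j) - int i + int j) (X + a (posn l f c (i - 1)) - b (Suc (posn l g d (j - 1))))) =
      det_from1 l (\<lambda>i j. ?M (posn l f c (i - 1)) (posn l g d (j - 1)))"
    unfolding det_from1_def
    by (intro arg_cong[of _ _ det] eq_matI) (auto simp: posn_left algebra_simps)
  have idx: "int (posn l g d (l + j)) - int (posn l f c (l + i)) = int (c (Suc i)) - int (d (Suc j)) - int (Suc i) + int (Suc j)"
    if "i < l'" "j < l'" for i j
    using that by (simp add: posn_right[OF c] posn_right[OF d])
  have e: "det_from1 l' (\<lambda>i j. efun (int (c i) - int (d j) - int i + int j)
      (X + a (Suc (posn l f c (l + (i - 1)))) - b (posn l g d (l + (j - 1))))) =
      det_from1 l' (\<lambda>i j. sgn_pow (int (c i) - int (d j) - int i + int j) *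
        ?Q (posn l g d (l + (j - 1))) (posn l f c (l + (i - 1))))"
    unfolding det_from1_def
    by (intro arg_cong[of _ _ det] eq_matI)
       (simp_all add: efun_hfun hom X idx diff_diff_add)
  show ?thesis
    unfolding h e by (subst det_dual[OF weak_chain_inverse[OF a b X] c d]) (simp_all add: D)
qed

section \<open>Families of alphabets on the lattice points\<close>

lemma det_from1_cong:
  assumes "\<And>i j. i < l \<Longrightarrow> j < l \<Longrightarrow> f (Suc i) (Suc j) = g (Suc i) (Suc j)"
  shows "det_from1 l f = det_from1 l g"
  unfolding det_from1_def by (intro arg_cong[of _ _ det] eq_matI) (simp_all add: assms)

text \<open>Every step of a walk, up or to the right, loses one linear letter. The values on the two
  axes are those of B_r - A_k, so walks that carry different families share their end
  alphabets.\<close>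

definition rim :: "(nat \<Rightarrow> nat \<Rightarrow> 'k::comm_ring_1 alphabet) \<Rightarrow> bool" where
  "rim F \<longleftrightarrow> (\<forall>r k. homog (F r k)) \<and>
    (\<forall>r k. \<exists>z. lin1 z \<and> F (Suc r) k = F r k + letter z) \<and>
    (\<forall>r k. \<exists>z. lin1 z \<and> F r k = F r (Suc k) + letter z) \<and>
    (\<forall>r. F r 0 = B_alph (int r)) \<and> (\<forall>k. F 0 k = - A_alph (int k))"

lemma rim_homog: "rim F \<Longrightarrow> homog (F r k)"
  by (simp add: rim_def)

lemma rim_chain:
  assumes "rim F" "conjug l l' f c"
  shows "chain (l + l') (\<lambda>p. F (prow l f p) (nat (pcol l f p)))"
proof (rule path_chain[OF assms(2), of "\<lambda>r k. F r (nat k)"])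
  show "\<exists>z. lin1 z \<and> F i (nat (int k)) = F i (nat (int (Suc k))) + letter z" for i k
    using assms(1) by (simp only: nat_int rim_def)
qed (use assms(1) in \<open>simp_all add: rim_def\<close>)

text \<open>The alphabet at (j, k) arises from B_l by losing l - j + k letters, which is the degree
  that \<open>bra_prod_det\<close> allows.\<close>

lemma rim_deg_le:
  assumes F: "rim F" and j: "j \<le> l"
  shows "deg_le (int l + int k - int j) (hR (F j k - B_alph (int l)))"
proof (induction k)
  case 0
  show ?case using deg_le_B[of "l - j" j] j F by (simp add: rim_def of_nat_diff)
next
  case (Suc k)
  obtain z where z: "lin1 z" "F j k = F j (Suc k) + letter z" using F unfolding rim_def by blast
  have d: "F j (Suc k) - B_alph (int l) = (F j k - B_alph (int l)) + - letter z" using z(2) by simp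
  have "homog (F j k - B_alph (int l))" "homog (- letter z)" using rim_homog[OF F] z(1) by simp_all
  then have "hR (F j (Suc k) - B_alph (int l)) = hR (F j k - B_alph (int l)) * (1 - z)"
    by (simp only: d hR_add hR_uminus_letter)
  moreover have "int l + int (Suc k) - int j = (int l + int k - int j) + 1" by simp
  ultimately show ?case using deg_le_mult[OF Suc deg_le_lin1[OF z(1)]] by (simp only:)
qed

lemma rim_BA: "rim (\<lambda>r k. B_alph (int r) - A_alph (int k))"
  unfolding rim_def
proof (intro conjI allI)
  fix r k :: nat
  show "\<exists>z :: 'a series. lin1 z \<and> B_alph (int (Suc r)) - A_alph (int k) = B_alph (int r) - A_alph (int k) + letter z"
    by (rule exI[of _ "bv (Suc r)"]) (simp add: B_alph_step del: of_nat_Suc)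
  show "\<exists>z :: 'a series. lin1 z \<and> B_alph (int r) - A_alph (int k) = B_alph (int r) - A_alph (int (Suc k)) + letter z"
    by (rule exI[of _ "- av (Suc k)"]) (simp add: A_alph_step del: of_nat_Suc)
qed simp_all

text \<open>The shifted alphabets of the second identity, where a row or column of length \<open>0\<close> is not shifted.\<close>

definition hook :: "nat \<Rightarrow> nat \<Rightarrow> 'k::comm_ring_1 alphabet" where
  "hook r k = (if k = 0 then B_alph (int r) else if r = 0 then - A_alph (int k)
     else B_alph (int r - 1) - A_alph (int k - 1))"

lemma B_alph_pred: "B_alph (int (Suc (Suc i)) - 1) = B_alph (int (Suc i) - 1) + letter (bv (Suc i))"
  and A_alph_pred: "A_alph (int (Suc (Suc i)) - 1) = A_alph (int (Suc i) - 1) + letter (- av (Suc i))"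
  using B_alph_step[of i] A_alph_step[of i] by (simp_all only: of_nat_Suc add_diff_cancel_left' add_diff_cancel_right')

lemma rim_hook: "rim (hook :: nat \<Rightarrow> nat \<Rightarrow> 'k::comm_ring_1 alphabet)"
  unfolding rim_def
proof (intro conjI allI)
  fix r k :: nat
  show "homog (hook r k :: 'k alphabet)" by (simp add: hook_def)
  show "\<exists>z :: 'k series. lin1 z \<and> hook (Suc r) k = hook r k + letter z"
  proof (cases k)
    case 0
    then show ?thesis
      by (intro exI[of _ "bv (Suc r)"]) (simp add: hook_def B_alph_step del: of_nat_Suc)
  next
    case (Suc k')
    show ?thesis
    proof (cases r)
      case 0
      then show ?thesis using Suc A_alph_step[of k', where ?'b = 'k]
        by (intro exI[of _ "- av k"]) (simp add: hook_def)
    next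
      case (Suc r')
      then show ?thesis using \<open>k = Suc k'\<close> B_alph_pred[of r', where ?'a = 'k]
        by (intro exI[of _ "bv r"]) (simp add: hook_def)
    qed
  qed
  show "\<exists>z :: 'k series. lin1 z \<and> hook r k = hook r (Suc k) + letter z"
  proof (cases r)
    case 0
    then show ?thesis
      by (intro exI[of _ "- av (Suc k)"]) (cases "k = 0", simp_all add: hook_def A_alph_step del: of_nat_Suc)
  next
    case (Suc r')
    show ?thesis
    proof (cases k)
      case 0
      then show ?thesis using Suc B_alph_step[of r', where ?'a = 'k]
        by (intro exI[of _ "bv r"]) (simp add: hook_def)
    next
      case (Suc k')
      then show ?thesis using \<open>r = Suc r'\<close> A_alph_pred[of k', where ?'b = 'k]
        by (intro exI[of _ "- av k"]) (simp add: hook_def)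
    qed
  qed
qed (simp_all add: hook_def)

text \<open>The walk of \<mu> carries \<open>F\<close>, that of \<lambda> carries B_r - A_k. The
  entries read \<open>F\<close> before the vertical and after the horizontal steps, and B_r - A_k
  after the vertical and before the horizontal ones.\<close>

lemma rim_dual:
  fixes F :: "nat \<Rightarrow> nat \<Rightarrow> 'k::field_char_0 alphabet"
  assumes F: "rim F" and c: "conjug l l' f c" and d: "conjug l l' g d"
  shows "C_fac l n * det_from1 l (\<lambda>i j. h_ominus (int (f i) - int (g j) - int i + int j) (xs_alph n)
        (F j (g j) - (B_alph (int (i - 1)) - A_alph (int (f i))))) =
    C'_fac l' n * det_from1 l' (\<lambda>i j. e_ominus (int (c i) - int (d j) - int i + int j) (xs_alph n)
        (F (d j) j - (B_alph (int (c i)) - A_alph (int (i - 1)))))"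
proof -
  let ?\<kappa> = "\<lambda>p. F (prow l g p) (nat (pcol l g p))"
  let ?\<rho> = "\<lambda>p. B_alph (int (prow l f p)) - A_alph (int (nat (pcol l f p))) :: 'k alphabet"
  have "det_from1 l (\<lambda>i j. h_ominus (int (f i) - int (g j) - int i + int j) (xs_alph n)
        (F j (g j) - (B_alph (int (i - 1)) - A_alph (int (f i))))) =
     det_from1 l (\<lambda>i j. h_ominus (int (f i) - int (g j) - int i + int j) (xs_alph n)
        (?\<kappa> (posn l g d (j - 1)) - ?\<rho> (Suc (posn l f c (i - 1)))))"
    by (rule det_from1_cong) (simp add: path_left[OF c] path_left[OF d])
  moreover have "det_from1 l' (\<lambda>i j. e_ominus (int (c i) - int (d j) - int i + int j) (xs_alph n)
        (F (d j) j - (B_alph (int (c i)) - A_alph (int (i - 1))))) =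
     det_from1 l' (\<lambda>i j. e_ominus (int (c i) - int (d j) - int i + int j) (xs_alph n)
        (?\<kappa> (Suc (posn l g d (l + (j - 1)))) - ?\<rho> (posn l f c (l + (i - 1)))))"
    by (rule det_from1_cong) (simp add: path_right[OF c] path_right[OF d] del: of_nat_Suc)
  ultimately show ?thesis
    using h_e_ominus_dual[OF c d rim_chain[OF F d] rim_chain[OF rim_BA c], of n] F
    by (simp add: path_ends[OF c] path_ends[OF d] rim_def)
qed

text \<open>The lengths \<open>r\<close> and \<open>s\<close> of ket and bra are independent of the
  size \<open>l\<close>; both are raised to r + s. The bound on \<open>r\<close> is strict because
  the ket is stable only from its first row of length 0 on.\<close>

lemma upper_det:
  fixes F :: "nat \<Rightarrow> nat \<Rightarrow> 'k::field_char_0 alphabet"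
  assumes F: "rim F" and lam: "is_partition lam" "length lam \<le> l" "part lam 1 \<le> l'" "length lam < r"
    and mu: "is_partition mu" "length mu \<le> l" "part mu 1 \<le> l'" "length mu \<le> s"
  shows "bra_prod s (\<lambda>j. F j (part mu j)) mu (hv (- 1) (xs_alph n) (ket_upper r lam)) =
    C_fac l n * det_from1 l (\<lambda>i j. h_ominus (ipart lam i - ipart mu j - int i + int j) (xs_alph n)
      (F j (part mu j) - (B_alph (int (i - 1)) - A_alph (ipart lam i))))"
proof -
  let ?K = "\<lambda>j. F j (part mu j)"
  let ?det = "\<lambda>l. det_from1 l (\<lambda>i j. h_ominus (ipart lam i - ipart mu j - int i + int j) (xs_alph n)
      (?K j - (B_alph (int (i - 1)) - A_alph (ipart lam i))))"
  note hom = rim_homog[OF F]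
  have "bra_prod s ?K mu (hv (- 1) (xs_alph n) (ket_upper r lam)) =
      bra_prod (r + s) ?K mu (hv (- 1) (xs_alph n) (ket_upper (r + s) lam))"
    using bra_prod_extend[of mu s ?K r] mu(4) hom by (simp add: ket_upper_extend lam(4) add.commute)
  also have "\<dots> = C_fac (r + s) n * ?det (r + s)"
  proof -
    have deg: "deg_le (int (r + s) + ipart mu j - int j) (hR (?K j - B_alph (int (r + s))))" if "j \<in> {1..r + s}" for j
      using that by (intro rim_deg_le[OF F]) simp
    have "part lam (r + s) = 0" using lam(4) by (simp add: part_zero)
    from bra_prod_det[of ?K "r + s" mu lam n, OF hom deg this] show ?thesis by (simp only: diff_diff_eq2)
  qed
  also have "\<dots> = C_fac l n * ?det l"
    by (simp only: rim_dual[OF F conjug_part[OF lam(1,2,3)] conjug_part[OF mu(1,2,3)]]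
      rim_dual[OF F conjug_part[OF lam(1) _ lam(3), of "r + s"] conjug_part[OF mu(1) _ mu(3), of "r + s"]] lam(4) mu(4)
      trans_le_add1 trans_le_add2 less_imp_le)
  finally show ?thesis .
qed

lemma hook_weak_chain:
  assumes c: "conjug l l' f c"
  shows "weak_chain (l + l') (\<lambda>p. B_alph (int (prow l f p) - 1) - A_alph (pcol l f p - 1))"
  unfolding weak_chain_def
proof (intro conjI allI impI)
  fix p assume p: "p < l + l'"
  let ?a = "\<lambda>p. B_alph (int (prow l f p) - 1) - A_alph (pcol l f p - 1) :: 'a alphabet"
  show "?a p = ?a (Suc p) \<or> (\<exists>z. lin1 z \<and> ?a p = ?a (Suc p) + letter z)"
    using path_step[OF c p]
  proof (elim disjE exE conjE)
    fix i assume i: "prow l f p = Suc i" "prow l f (Suc p) = i" "pcol l f (Suc p) = pcol l f p"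
    show ?thesis
    proof (cases i)
      case (Suc i')
      then show ?thesis using i B_alph_pred[of i', where ?'a = 'a]
        by (intro disjI2 exI[of _ "bv i"]) simp
    qed (use i in simp)
  next
    fix j assume j: "prow l f (Suc p) = prow l f p" "pcol l f p = int j" "pcol l f (Suc p) = int (Suc j)"
    show ?thesis
    proof (cases j)
      case (Suc j')
      then show ?thesis using j A_alph_pred[of j', where ?'b = 'a]
        by (intro disjI2 exI[of _ "- av j"]) simp
    qed (use j in simp)
  qed
qed simp

text \<open>\<open>?a\<close> belongs to the walk of \<lambda> and is shifted by one in both
  coordinates, \<open>?b\<close> belongs to the walk of \<mu> and is not shifted.\<close>

lemma lower_dual:
  assumes c: "conjug l l' f c" and d: "conjug l l' g d"
  shows "det_from1 l (\<lambda>i j. hfun (int (f i) - int (g j) - int i + int j)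
      (xs_alph n + (A_alph (int (g j)) - A_alph (int (f i) - 1)) + (B_alph (int (i - 1)) - B_alph (int (j - 1))))) =
    (det_from1 l' (\<lambda>i j. efun (int (c i) - int (d j) - int i + int j)
      (xs_alph n + (A_alph (int (j - 1)) - A_alph (int (i - 1))) + (B_alph (int (c i) - 1) - B_alph (int (d j))))) :: 'k::comm_ring_1 series)"
proof -
  let ?a = "\<lambda>p. B_alph (int (prow l f p) - 1) - A_alph (pcol l f p - 1) :: 'k alphabet"
  let ?b = "\<lambda>p. B_alph (int (prow l g p)) - A_alph (int (nat (pcol l g p))) :: 'k alphabet"
  have "det_from1 l (\<lambda>i j. hfun (int (f i) - int (g j) - int i + int j)
      (xs_alph n + (A_alph (int (g j)) - A_alph (int (f i) - 1)) + (B_alph (int (i - 1)) - B_alph (int (j - 1))))) =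
     det_from1 l (\<lambda>i j. hfun (int (f i) - int (g j) - int i + int j)
      (xs_alph n + ?a (posn l f c (i - 1)) - ?b (Suc (posn l g d (j - 1)))))"
    by (rule det_from1_cong) (simp add: path_left[OF c] path_left[OF d] of_nat_diff algebra_simps)
  moreover have "det_from1 l' (\<lambda>i j. efun (int (c i) - int (d j) - int i + int j)
      (xs_alph n + (A_alph (int (j - 1)) - A_alph (int (i - 1))) + (B_alph (int (c i) - 1) - B_alph (int (d j))))) =
     det_from1 l' (\<lambda>i j. efun (int (c i) - int (d j) - int i + int j)
      (xs_alph n + ?a (Suc (posn l f c (l + (i - 1)))) - ?b (posn l g d (l + (j - 1)))))"
    by (rule det_from1_cong) (simp add: path_right[OF c] path_right[OF d], simp add: algebra_simps)
  ultimately show ?thesis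
    using h_e_dual[OF c d hook_weak_chain[OF c] chain_imp_weak_chain[OF rim_chain[OF rim_BA d]] homog_xs, of n]
    by simp
qed

section \<open>Assembly of the identities\<close>

lemma bra_prod_cong:
  "(\<And>j. 1 \<le> j \<Longrightarrow> j \<le> l \<Longrightarrow> K j = K' j) \<Longrightarrow> bra_prod l K mu v = bra_prod l K' mu v"
  unfolding bra_prod_def by (intro arg_cong[of _ _ "bra l"] fold_cong) auto

theorem theorem4p1:
  fixes lam mu :: "nat list" and n l l' r r' s s' :: nat
  assumes "is_partition lam" and "is_partition mu" and "n \<ge> 1"
    and "length lam \<le> l" and "length mu \<le> l"
    and "part lam 1 \<le> l'" and "part mu 1 \<le> l'"
    and "length lam < r" and "length mu < s"
    and "length lam \<le> r'" and "length mu \<le> s'"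
  shows
   "(matrix_elem (bra_dbl s' mu) (xs_alph n) (ket_upper r lam :: 'k::field_char_0 fock series)
     = C_fac l n * det_from1 l (\<lambda>i j. h_ominus (ipart lam i - ipart mu j - int i + int j) (xs_alph n)
         (seg_oc A_alph (ipart mu j) (ipart lam i) + seg_cc B_alph (int i) (int j)))) \<and>
    (C_fac l n * det_from1 l (\<lambda>i j. h_ominus (ipart lam i - ipart mu j - int i + int j) (xs_alph n)
         (seg_oc A_alph (ipart mu j) (ipart lam i) + seg_cc B_alph (int i) (int j)))
     = (C'_fac l' n :: 'k series) * det_from1 l' (\<lambda>i j. e_ominus (iconj lam i - iconj mu j - int i + int j) (xs_alph n)
         (seg_oo A_alph (int j) (int i) + seg_oc B_alph (iconj lam i) (iconj mu j)))) \<and>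
    (matrix_elem (bra_upper s' mu) (xs_alph n) (ket_upper r lam :: 'k fock series)
     = C_fac l n * det_from1 l (\<lambda>i j. h_ominus (ipart lam i - ipart mu j - int i + int j) (xs_alph n)
         (if part mu j = 0
          then seg_oc A_alph (ipart mu j) (ipart lam i) + seg_cc B_alph (int i) (int j)
          else seg_cc A_alph (ipart mu j) (ipart lam i) + seg_co B_alph (int i) (int j)))) \<and>
    (C_fac l n * det_from1 l (\<lambda>i j. h_ominus (ipart lam i - ipart mu j - int i + int j) (xs_alph n)
         (if part mu j = 0
          then seg_oc A_alph (ipart mu j) (ipart lam i) + seg_cc B_alph (int i) (int j)
          else seg_cc A_alph (ipart mu j) (ipart lam i) + seg_co B_alph (int i) (int j)))
     = (C'_fac l' n :: 'k series) * det_from1 l' (\<lambda>i j. e_ominus (iconj lam i - iconj mu j - int i + int j) (xs_alph n)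
         (if conj_part mu j = 0
          then seg_oo A_alph (int j) (int i) + seg_oc B_alph (iconj lam i) (iconj mu j)
          else seg_co A_alph (int j) (int i) + seg_oo B_alph (iconj lam i) (iconj mu j)))) \<and>
    (matrix_elem (bra_lower s mu) (xs_alph n) (ket_lower r' lam :: 'k fock series)
     = det_from1 l (\<lambda>i j. hfun (ipart lam i - ipart mu j - int i + int j)
         (xs_alph n + seg_cc A_alph (ipart lam i) (ipart mu j) + seg_co B_alph (int j) (int i)))) \<and>
    ((det_from1 l (\<lambda>i j. hfun (ipart lam i - ipart mu j - int i + int j)
         (xs_alph n + seg_cc A_alph (ipart lam i) (ipart mu j) + seg_co B_alph (int j) (int i))) :: 'k series)
     = det_from1 l' (\<lambda>i j. efun (iconj lam i - iconj mu j - int i + int j)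
         (xs_alph n + seg_co A_alph (int i) (int j) + seg_oo B_alph (iconj mu j) (iconj lam i))))"
proof (intro conjI)
  let ?h = "\<lambda>F :: nat \<Rightarrow> nat \<Rightarrow> 'k alphabet. det_from1 l (\<lambda>i j. h_ominus (ipart lam i - ipart mu j - int i + int j) (xs_alph n)
      (F j (part mu j) - (B_alph (int (i - 1)) - A_alph (ipart lam i))))"
  let ?e = "\<lambda>F :: nat \<Rightarrow> nat \<Rightarrow> 'k alphabet. det_from1 l' (\<lambda>i j. e_ominus (iconj lam i - iconj mu j - int i + int j) (xs_alph n)
      (F (conj_part mu j) j - (B_alph (iconj lam i) - A_alph (int (i - 1)))))"
  let ?BA = "\<lambda>r k. B_alph (int r) - A_alph (int k) :: 'k alphabet"
  let ?v = "hv (- 1) (xs_alph n) (ket_upper r lam :: 'k fock series)"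
  note seg = seg_cc_def seg_oc_def seg_co_def seg_oo_def
  note c = conjug_part[OF assms(1,4,6)] and d = conjug_part[OF assms(2,5,7)]
  have h1: "det_from1 l (\<lambda>i j. h_ominus (ipart lam i - ipart mu j - int i + int j) (xs_alph n)
         (seg_oc A_alph (ipart mu j) (ipart lam i) + seg_cc B_alph (int i) (int j))) = ?h ?BA"
    by (rule det_from1_cong) (simp add: seg algebra_simps)
  have e1: "det_from1 l' (\<lambda>i j. e_ominus (iconj lam i - iconj mu j - int i + int j) (xs_alph n)
         (seg_oo A_alph (int j) (int i) + seg_oc B_alph (iconj lam i) (iconj mu j))) = ?e ?BA"
    by (rule det_from1_cong) (simp add: seg algebra_simps)
  have h2: "det_from1 l (\<lambda>i j. h_ominus (ipart lam i - ipart mu j - int i + int j) (xs_alph n)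
         (if part mu j = 0
          then seg_oc A_alph (ipart mu j) (ipart lam i) + seg_cc B_alph (int i) (int j)
          else seg_cc A_alph (ipart mu j) (ipart lam i) + seg_co B_alph (int i) (int j))) = ?h hook"
    by (rule det_from1_cong) (simp add: seg hook_def algebra_simps)
  have e2: "det_from1 l' (\<lambda>i j. e_ominus (iconj lam i - iconj mu j - int i + int j) (xs_alph n)
         (if conj_part mu j = 0
          then seg_oo A_alph (int j) (int i) + seg_oc B_alph (iconj lam i) (iconj mu j)
          else seg_co A_alph (int j) (int i) + seg_oo B_alph (iconj lam i) (iconj mu j))) = ?e hook"
    by (rule det_from1_cong) (simp add: seg hook_def algebra_simps)
  show "C_fac l n * det_from1 l (\<lambda>i j. h_ominus (ipart lam i - ipart mu j - int i + int j) (xs_alph n)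
         (seg_oc A_alph (ipart mu j) (ipart lam i) + seg_cc B_alph (int i) (int j)))
     = (C'_fac l' n :: 'k series) * det_from1 l' (\<lambda>i j. e_ominus (iconj lam i - iconj mu j - int i + int j) (xs_alph n)
         (seg_oo A_alph (int j) (int i) + seg_oc B_alph (iconj lam i) (iconj mu j)))"
    unfolding h1 e1 by (rule rim_dual[OF rim_BA c d])
  show "C_fac l n * det_from1 l (\<lambda>i j. h_ominus (ipart lam i - ipart mu j - int i + int j) (xs_alph n)
         (if part mu j = 0
          then seg_oc A_alph (ipart mu j) (ipart lam i) + seg_cc B_alph (int i) (int j)
          else seg_cc A_alph (ipart mu j) (ipart lam i) + seg_co B_alph (int i) (int j)))
     = (C'_fac l' n :: 'k series) * det_from1 l' (\<lambda>i j. e_ominus (iconj lam i - iconj mu j - int i + int j) (xs_alph n)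
         (if conj_part mu j = 0
          then seg_oo A_alph (int j) (int i) + seg_oc B_alph (iconj lam i) (iconj mu j)
          else seg_co A_alph (int j) (int i) + seg_oo B_alph (iconj lam i) (iconj mu j)))"
    unfolding h2 e2 by (rule rim_dual[OF rim_hook c d])
  show "matrix_elem (bra_dbl s' mu) (xs_alph n) (ket_upper r lam :: 'k fock series)
     = C_fac l n * det_from1 l (\<lambda>i j. h_ominus (ipart lam i - ipart mu j - int i + int j) (xs_alph n)
         (seg_oc A_alph (ipart mu j) (ipart lam i) + seg_cc B_alph (int i) (int j)))"
    unfolding h1 matrix_elem_def exp_H_op[OF homog_xs] bra_dbl_form
    by (rule upper_det[OF rim_BA assms(1,4,6,8,2,5,7,11)])
  \<comment> \<open>The rows beyond \<open>length mu\<close> are dropped here and come back in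
    \<open>upper_det\<close> with the alphabets of \<open>hook\<close>. In the remaining rows
    \<mu>_j > 0, and there both alphabets agree.\<close>
  have "bra_prod s' (\<lambda>i. - A_alph (ipart mu i - 1) + B_alph (int (i - 1))) mu ?v =
      bra_prod (length mu) (\<lambda>i. - A_alph (ipart mu i - 1) + B_alph (int (i - 1))) mu ?v"
    using bra_prod_extend[of mu "length mu" "\<lambda>i. - A_alph (ipart mu i - 1) + B_alph (int (i - 1))" "s' - length mu"] assms(11)
    by simp
  also have "\<dots> = bra_prod (length mu) (\<lambda>j. hook j (part mu j)) mu ?v"
  proof (rule bra_prod_cong)
    fix j assume j: "1 \<le> j" "j \<le> length mu"
    then have "part mu j \<in> set mu" by (simp add: part_def)
    then have "part mu j \<noteq> 0" using assms(2) by (metis is_partition_def)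
    then show "- A_alph (ipart mu j - 1) + B_alph (int (j - 1)) = hook j (part mu j)"
      using j by (simp add: hook_def of_nat_diff)
  qed
  also have "\<dots> = C_fac l n * ?h hook"
    by (rule upper_det[OF rim_hook assms(1,4,6,8,2,5,7) order_refl])
  finally show "matrix_elem (bra_upper s' mu) (xs_alph n) (ket_upper r lam :: 'k fock series)
     = C_fac l n * det_from1 l (\<lambda>i j. h_ominus (ipart lam i - ipart mu j - int i + int j) (xs_alph n)
         (if part mu j = 0
          then seg_oc A_alph (ipart mu j) (ipart lam i) + seg_cc B_alph (int i) (int j)
          else seg_cc A_alph (ipart mu j) (ipart lam i) + seg_co B_alph (int i) (int j)))"
    unfolding h2 matrix_elem_def exp_H_op[OF homog_xs] bra_upper_form .
  let ?h3 = "\<lambda>l. det_from1 l (\<lambda>i j. hfun (ipart lam i - ipart mu j - int i + int j)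
      (xs_alph n + (A_alph (ipart mu j) - A_alph (ipart lam i - 1)) + (B_alph (int (i - 1)) - B_alph (int (j - 1))))) :: 'k series"
  have h3: "det_from1 l (\<lambda>i j. hfun (ipart lam i - ipart mu j - int i + int j)
         (xs_alph n + seg_cc A_alph (ipart lam i) (ipart mu j) + seg_co B_alph (int j) (int i))) = ?h3 l"
    by (rule det_from1_cong) (simp add: seg)
  show "det_from1 l (\<lambda>i j. hfun (ipart lam i - ipart mu j - int i + int j)
         (xs_alph n + seg_cc A_alph (ipart lam i) (ipart mu j) + seg_co B_alph (int j) (int i)))
     = (det_from1 l' (\<lambda>i j. efun (iconj lam i - iconj mu j - int i + int j)
         (xs_alph n + seg_co A_alph (int i) (int j) + seg_oo B_alph (iconj mu j) (iconj lam i))) :: 'k series)"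
    unfolding h3 lower_dual[OF c d] by (rule det_from1_cong) (simp add: seg)
  \<comment> \<open>r' + s bounds both lengths, strictly that of \<mu>, as \<open>lower_det\<close>
    requires.\<close>
  have "matrix_elem (bra_lower s mu) (xs_alph n) (ket_lower r' lam :: 'k fock series) =
      matrix_elem (bra_lower (s + r') mu) (xs_alph n) (ket_lower (r' + s) lam)"
    by (simp add: bra_lower_def ket_upper_extend ket_lower_extend assms)
  also have "\<dots> = ?h3 (r' + s)"
    using lower_det[of lam "r' + s" mu n, where ?'k = 'k] assms by (simp add: add.commute)
  also have "\<dots> = ?h3 l"
    using lower_dual[OF c d, of n, where ?'k = 'k] lower_dual[OF conjug_part[OF assms(1) _ assms(6)] conjug_part[OF assms(2) _ assms(7)], of "r' + s" n, where ?'k = 'k] assms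
    by simp
  finally show "matrix_elem (bra_lower s mu) (xs_alph n) (ket_lower r' lam :: 'k fock series)
     = det_from1 l (\<lambda>i j. hfun (ipart lam i - ipart mu j - int i + int j)
         (xs_alph n + seg_cc A_alph (ipart lam i) (ipart mu j) + seg_co B_alph (int j) (int i)))"
    unfolding h3 .
qed

end
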